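(* Let $n\ge 1$ be an integer. Any nilpotent orbit of $\mathfrak{sl}_n(\mathbb{C})$ associated with a non rectangular partition of $n$ verifies $\mathrm{RC}_2(m)$ for every integer $m\ge 1$.
   Context: Nilpotent orbits of $\mathfrak{sl}_n(\mathbb{C})$ are parametrized by partitions of $n$ (sizes of the Jordan blocks). A partition is rectangular if all of its (nonzero) parts are equal. For a scheme $X$ of finite type over $\mathbb{C}$ and $m\in\mathbb{N}$, $\mathcal{J}_m(X)$ denotes the $m$-th jet scheme of $X$, i.e. the scheme with $\mathrm{Hom}(Z,\mathcal{J}_m(X))=\mathrm{Hom}(Z\times \mathrm{Spec}\,\mathbb{C}[t]/(t^{m+1}),X)$ for every scheme $Z$ over $\mathbb{C}$, and $\pi_{X,m}:\mathcal{J}_m(X)\to X$ is the canonical projection. Closures $\overline{\mathcal{O}}$ of nilpotent orbits are regarded as reduced affine schemes. Definition of $\mathrm{RC}_2(m)$ ($m\ge1$): a nilpotent orbit $\mathcal{O}$ verifies $\mathrm{RC}_2(m)$ if for some nilpotent orbit $\mathcal{O}'$ contained in $\overline{\mathcal{O}}\setminus\mathcal{O}$, we have $\dim\pi_{\overline{\mathcal{O}},m}^{-1}(\mathcal{O}')\ge\dim\pi_{\overline{\mathcal{O}},m}^{-1}(\mathcal{O})$. *)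

theory Defs
  imports
    "HOL-Library.FuncSet"
    "HOL-Library.Extended_Real"
    "HOL-Library.Poly_Mapping"
    "HOL-Analysis.Abstract_Topology"
    "Jordan_Normal_Form.Jordan_Normal_Form"
begin

section \<open>Polynomials and points of affine schemes\<close>

type_synonym 'i cpoly = "('i \<Rightarrow>\<^sub>0 nat) \<Rightarrow>\<^sub>0 complex"

definition cpoly_ring :: "'i set \<Rightarrow> 'i cpoly set" where
  "cpoly_ring I = {f. \<forall>\<mu>\<in>Poly_Mapping.keys f. Poly_Mapping.keys \<mu> \<subseteq> I}"

definition eval_monom :: "('i \<Rightarrow> 'r::comm_ring_1) \<Rightarrow> ('i \<Rightarrow>\<^sub>0 nat) \<Rightarrow> 'r" where
  "eval_monom x \<mu> = (\<Prod>i\<in>Poly_Mapping.keys \<mu>. x i ^ Poly_Mapping.lookup \<mu> i)"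

text \<open>A commutative algebra over the complex numbers is a type \<^typ>\<open>'r::comm_ring_1\<close> together with a
  ring homomorphism \<open>h\<close> from \<^typ>\<open>complex\<close>; polynomials are evaluated in such an algebra.\<close>

definition eval_cpoly :: "(complex \<Rightarrow> 'r::comm_ring_1) \<Rightarrow> ('i \<Rightarrow> 'r) \<Rightarrow> 'i cpoly \<Rightarrow> 'r" where
  "eval_cpoly h x f =
    (\<Sum>\<mu>\<in>Poly_Mapping.keys f. h (Poly_Mapping.lookup f \<mu>) * eval_monom x \<mu>)"

text \<open>The points, with values in the algebra given by \<open>h\<close>, of the closed subscheme of the affine
  space with coordinates indexed by \<open>I\<close> that is cut out by the equations \<open>J\<close>.\<close>

definition affine_points :: "(complex \<Rightarrow> 'r::comm_ring_1) \<Rightarrow> 'i set \<Rightarrow> 'i cpoly set \<Rightarrow> ('i \<Rightarrow> 'r) set" where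
  "affine_points h I J = {x \<in> I \<rightarrow>\<^sub>E UNIV. \<forall>f\<in>J. eval_cpoly h x f = 0}"

definition vanishing_ideal :: "'i set \<Rightarrow> ('i \<Rightarrow> complex) set \<Rightarrow> 'i cpoly set" where
  "vanishing_ideal I Z = {f \<in> cpoly_ring I. \<forall>x\<in>Z. eval_cpoly id x f = 0}"

lemma eval_cpoly_superset:
  assumes "comm_ring_hom h" "finite K" "Poly_Mapping.keys f \<subseteq> K"
  shows "eval_cpoly h x f = (\<Sum>\<mu>\<in>K. h (Poly_Mapping.lookup f \<mu>) * eval_monom x \<mu>)"
proof -
  interpret comm_ring_hom h by fact
  show ?thesis unfolding eval_cpoly_def
    by (rule sum.mono_neutral_left) (use assms in \<open>auto simp: in_keys_iff\<close>)
qed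

lemma eval_cpoly_add:
  assumes "comm_ring_hom h"
  shows "eval_cpoly h x (f + g) = eval_cpoly h x f + eval_cpoly h x g"
proof -
  interpret comm_ring_hom h by fact
  let ?K = "Poly_Mapping.keys f \<union> Poly_Mapping.keys g"
  have "Poly_Mapping.keys (f + g) \<subseteq> ?K" by (rule Poly_Mapping.keys_add)
  then show ?thesis
    by (simp add: eval_cpoly_superset[OF assms, of ?K] lookup_add hom_add
        sum.distrib distrib_right)
qed

lemma eval_monom_superset:
  assumes "finite K" "Poly_Mapping.keys \<mu> \<subseteq> K"
  shows "eval_monom x \<mu> = (\<Prod>i\<in>K. x i ^ Poly_Mapping.lookup \<mu> i)"
  unfolding eval_monom_def
  by (rule prod.mono_neutral_left) (use assms in \<open>auto simp: in_keys_iff\<close>)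

lemma eval_monom_add: "eval_monom x (\<mu> + \<nu>) = eval_monom x \<mu> * eval_monom x \<nu>"
proof -
  let ?K = "Poly_Mapping.keys \<mu> \<union> Poly_Mapping.keys \<nu>"
  have "Poly_Mapping.keys (\<mu> + \<nu>) \<subseteq> ?K" by (rule Poly_Mapping.keys_add)
  then show ?thesis
    by (simp add: eval_monom_superset[of ?K] lookup_add power_add prod.distrib)
qed

lemma eval_cpoly_single:
  assumes "comm_ring_hom h"
  shows "eval_cpoly h x (Poly_Mapping.single \<mu> c) = h c * eval_monom x \<mu>"
proof -
  interpret comm_ring_hom h by fact
  show ?thesis by (simp add: eval_cpoly_superset[OF assms, of "{\<mu>}"])
qed

lemma eval_cpoly_0 [simp]: "eval_cpoly h x 0 = 0"
  by (simp add: eval_cpoly_def)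

lemma eval_cpoly_sum:
  assumes "comm_ring_hom h"
  shows "eval_cpoly h x (sum F A) = (\<Sum>a\<in>A. eval_cpoly h x (F a))"
  by (induction A rule: infinite_finite_induct) (simp_all add: eval_cpoly_add[OF assms])

lemma cpoly_eq_sum_single:
  fixes f :: "'i cpoly"
  shows "f = (\<Sum>\<mu>\<in>Poly_Mapping.keys f. Poly_Mapping.single \<mu> (Poly_Mapping.lookup f \<mu>))"
  by (rule poly_mapping_eqI) (simp add: lookup_sum lookup_single when_def in_keys_iff)

lemma eval_cpoly_mult:
  assumes "comm_ring_hom h"
  shows "eval_cpoly h x (f * g) = eval_cpoly h x f * eval_cpoly h x g"
proof -
  interpret comm_ring_hom h by fact
  let ?s = "\<lambda>f \<mu>. Poly_Mapping.single \<mu> (Poly_Mapping.lookup f \<mu>)"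
  have "f * g = (\<Sum>\<mu>\<in>Poly_Mapping.keys f. ?s f \<mu>) * (\<Sum>\<nu>\<in>Poly_Mapping.keys g. ?s g \<nu>)"
    using cpoly_eq_sum_single[of f] cpoly_eq_sum_single[of g] by simp
  also have "\<dots> = (\<Sum>\<mu>\<in>Poly_Mapping.keys f. \<Sum>\<nu>\<in>Poly_Mapping.keys g. ?s f \<mu> * ?s g \<nu>)"
    by (rule sum_product)
  finally have "eval_cpoly h x (f * g) =
      (\<Sum>\<mu>\<in>Poly_Mapping.keys f. \<Sum>\<nu>\<in>Poly_Mapping.keys g. eval_cpoly h x (?s f \<mu> * ?s g \<nu>))"
    by (simp add: eval_cpoly_sum[OF assms])
  also have "\<dots> = eval_cpoly h x f * eval_cpoly h x g"
    unfolding eval_cpoly_def[of h x f] eval_cpoly_def[of h x g] sum_product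
    by (simp add: mult_single eval_cpoly_single[OF assms] eval_monom_add hom_mult mult_ac)
  finally show ?thesis .
qed

lemma comm_ring_hom_eval_cpoly:
  assumes "comm_ring_hom h"
  shows "comm_ring_hom (eval_cpoly h x)"
proof -
  interpret comm_ring_hom h by fact
  have "eval_cpoly h x 1 = 1"
    using eval_cpoly_single[OF assms, of x 0 1] by (simp add: eval_monom_def)
  then show ?thesis
    by unfold_locales (simp_all add: eval_cpoly_add[OF assms] eval_cpoly_mult[OF assms])
qed


section \<open>Zariski topology and dimension\<close>

definition zariski :: "'i set \<Rightarrow> ('i \<Rightarrow> complex) topology" where
  "zariski I = topology_generated_by
    {{x \<in> I \<rightarrow>\<^sub>E UNIV. eval_cpoly id x f \<noteq> 0} | f. f \<in> cpoly_ring I}"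

lemma comm_ring_hom_id_complex: "comm_ring_hom (id :: complex \<Rightarrow> complex)"
  by unfold_locales auto

lemma cpoly_ring_mult:
  assumes "f \<in> cpoly_ring I" "g \<in> cpoly_ring I"
  shows "f * g \<in> cpoly_ring I"
  unfolding cpoly_ring_def
proof safe
  fix \<mu> i assume "\<mu> \<in> Poly_Mapping.keys (f * g)" and i: "i \<in> Poly_Mapping.keys \<mu>"
  then obtain a b where ab: "a \<in> Poly_Mapping.keys f" "b \<in> Poly_Mapping.keys g" "\<mu> = a + b"
    using keys_mult[of f g] by blast
  have "i \<in> Poly_Mapping.keys a \<union> Poly_Mapping.keys b"
    using i Poly_Mapping.keys_add[of a b] ab by auto
  then show "i \<in> I" using ab assms by (auto simp: cpoly_ring_def)
qed

lemma openin_zariski: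
  "openin (zariski I) U \<longleftrightarrow>
    (\<exists>J\<subseteq>cpoly_ring I. U = {x \<in> I \<rightarrow>\<^sub>E UNIV. \<exists>f\<in>J. eval_cpoly id x f \<noteq> 0})" (is "_ \<longleftrightarrow> ?Z U")
proof
  assume "openin (zariski I) U"
  then have "generate_topology_on
      {{x \<in> I \<rightarrow>\<^sub>E UNIV. eval_cpoly id x f \<noteq> 0} | f. f \<in> cpoly_ring I} U"
    by (simp add: zariski_def openin_topology_generated_by_iff)
  then show "?Z U"
  proof induction
    case Empty
    show ?case by (intro exI[of _ "{}"]) auto
  next
    case (Int A B)
    then obtain J K where J: "J \<subseteq> cpoly_ring I" "A = {x \<in> I \<rightarrow>\<^sub>E UNIV. \<exists>f\<in>J. eval_cpoly id x f \<noteq> 0}"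
      and K: "K \<subseteq> cpoly_ring I" "B = {x \<in> I \<rightarrow>\<^sub>E UNIV. \<exists>f\<in>K. eval_cpoly id x f \<noteq> 0}"
      by blast
    have "{f * g | f g. f \<in> J \<and> g \<in> K} \<subseteq> cpoly_ring I"
      using J(1) K(1) cpoly_ring_mult by blast
    moreover have "A \<inter> B =
        {x \<in> I \<rightarrow>\<^sub>E UNIV. \<exists>p\<in>{f * g | f g. f \<in> J \<and> g \<in> K}. eval_cpoly id x p \<noteq> 0}"
    proof (rule Set.set_eqI)
      fix x
      have "(\<exists>p\<in>{f * g | f g. f \<in> J \<and> g \<in> K}. eval_cpoly id x p \<noteq> 0) \<longleftrightarrow>
          (\<exists>f\<in>J. \<exists>g\<in>K. eval_cpoly id x f * eval_cpoly id x g \<noteq> 0)"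
        unfolding eval_cpoly_mult[OF comm_ring_hom_id_complex, symmetric] by blast
      then show "x \<in> A \<inter> B \<longleftrightarrow>
          x \<in> {x \<in> I \<rightarrow>\<^sub>E UNIV. \<exists>p\<in>{f * g | f g. f \<in> J \<and> g \<in> K}. eval_cpoly id x p \<noteq> 0}"
        unfolding J(2) K(2) by auto
    qed
    ultimately show ?case
      by (intro exI[of _ "{f * g | f g. f \<in> J \<and> g \<in> K}"] conjI)
  next
    case (UN \<A>)
    then have "\<exists>J. \<forall>A\<in>\<A>. J A \<subseteq> cpoly_ring I \<and>
        A = {x \<in> I \<rightarrow>\<^sub>E UNIV. \<exists>f\<in>J A. eval_cpoly id x f \<noteq> 0}"
      by (intro bchoice ballI)
    then obtain J where J': "\<forall>A\<in>\<A>. J A \<subseteq> cpoly_ring I \<and>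
        A = {x \<in> I \<rightarrow>\<^sub>E UNIV. \<exists>f\<in>J A. eval_cpoly id x f \<noteq> 0}" ..
    have J: "J A \<subseteq> cpoly_ring I"
      "A = {x \<in> I \<rightarrow>\<^sub>E UNIV. \<exists>f\<in>J A. eval_cpoly id x f \<noteq> 0}" if "A \<in> \<A>" for A
      using bspec[OF J' that] by (rule conjunct1, rule conjunct2)
    have mem: "x \<in> A \<longleftrightarrow> x \<in> I \<rightarrow>\<^sub>E UNIV \<and> (\<exists>f\<in>J A. eval_cpoly id x f \<noteq> 0)"
      if "A \<in> \<A>" for A x
      by (subst J(2)[OF that]) simp
    have "\<Union>\<A> = {x \<in> I \<rightarrow>\<^sub>E UNIV. \<exists>f\<in>(\<Union>A\<in>\<A>. J A). eval_cpoly id x f \<noteq> 0}"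
      by (rule Set.set_eqI) (simp only: Union_iff mem_Collect_eq UN_iff bex_simps, use mem in blast)
    moreover have "(\<Union>A\<in>\<A>. J A) \<subseteq> cpoly_ring I" using J(1) by (rule UN_least)
    ultimately show ?case by (intro exI[of _ "\<Union>A\<in>\<A>. J A"] conjI)
  next
    case (Basis A)
    then obtain f where "f \<in> cpoly_ring I" "A = {x \<in> I \<rightarrow>\<^sub>E UNIV. eval_cpoly id x f \<noteq> 0}"
      by blast
    then show ?case by (intro exI[of _ "{f}"]) blast
  qed
next
  assume "?Z U"
  then obtain J where J: "J \<subseteq> cpoly_ring I" "U = {x \<in> I \<rightarrow>\<^sub>E UNIV. \<exists>f\<in>J. eval_cpoly id x f \<noteq> 0}"
    by blast
  have "U = (\<Union>f\<in>J. {x \<in> I \<rightarrow>\<^sub>E UNIV. eval_cpoly id x f \<noteq> 0})"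
    using J(2) by auto
  moreover have "openin (zariski I) \<dots>"
    unfolding zariski_def
    by (intro openin_Union ballI) (use J(1) in \<open>auto intro!: topology_generated_by_Basis\<close>)
  ultimately show "openin (zariski I) U" by simp
qed

lemma topspace_zariski: "topspace (zariski I) = I \<rightarrow>\<^sub>E UNIV"
proof -
  have "1 \<in> cpoly_ring I" by (auto simp: cpoly_ring_def)
  moreover have "eval_cpoly id x 1 = 1" for x :: "'a \<Rightarrow> complex"
  proof -
    interpret comm_ring_hom "eval_cpoly id x"
      by (rule comm_ring_hom_eval_cpoly) (rule comm_ring_hom_id_complex)
    show ?thesis by (rule hom_one)
  qed
  ultimately have "openin (zariski I) (I \<rightarrow>\<^sub>E UNIV)"
    unfolding openin_zariski by (intro exI[of _ "{1}"]) auto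
  moreover have "topspace (zariski I) \<subseteq> I \<rightarrow>\<^sub>E UNIV"
    using openin_topspace[of "zariski I"] unfolding openin_zariski by blast
  ultimately show ?thesis by (simp add: openin_subset subset_antisym)
qed

lemma closedin_zariski:
  "closedin (zariski I) Z \<longleftrightarrow> (\<exists>J\<subseteq>cpoly_ring I. Z = affine_points id I J)"
proof -
  have D: "{x \<in> I \<rightarrow>\<^sub>E UNIV. \<exists>f\<in>J. eval_cpoly id x f \<noteq> 0} = (I \<rightarrow>\<^sub>E UNIV) - affine_points id I J"
    for J :: "'a cpoly set"
    unfolding affine_points_def by blast
  have S: "affine_points id I J \<subseteq> (I \<rightarrow>\<^sub>E UNIV)" for J :: "'a cpoly set"
    unfolding affine_points_def by blast
  have "Z \<subseteq> (I \<rightarrow>\<^sub>E UNIV) \<and> (I \<rightarrow>\<^sub>E UNIV) - Z = (I \<rightarrow>\<^sub>E UNIV) - affine_points id I J \<longleftrightarrow>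
      Z = affine_points id I J" for J
    using S[of J] by (metis double_diff order_refl)
  then show ?thesis
    unfolding closedin_def openin_zariski topspace_zariski D by metis
qed

definition irreducible_space :: "'a topology \<Rightarrow> bool" where
  "irreducible_space X \<longleftrightarrow> topspace X \<noteq> {} \<and>
    (\<forall>C D. closedin X C \<and> closedin X D \<and> C \<union> D = topspace X \<longrightarrow> C = topspace X \<or> D = topspace X)"

text \<open>The supremum is taken in \<^typ>\<open>ereal\<close>, so that the empty space has dimension \<open>- \<infinity>\<close>.\<close>

definition krull_dim :: "'a topology \<Rightarrow> ereal" where
  "krull_dim X = Sup {ereal (real k) | k. \<exists>Z :: nat \<Rightarrow> 'a set.
    (\<forall>i\<le>k. closedin X (Z i) \<and> irreducible_space (subtopology X (Z i))) \<and>
    (\<forall>i<k. Z i \<subset> Z (Suc i))}"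


section \<open>Jet schemes\<close>

text \<open>Let \<open>X\<close> be the closed subscheme of affine space with coordinates \<open>x i\<close>, \<open>i \<in> I\<close>, cut out by
  \<open>J\<close>. Substituting \<open>x i = (\<Sum>k\<le>m. x (i, k) * t ^ k)\<close> in an equation \<open>f\<close> gives a polynomial in
  \<open>t\<close> whose coefficients are polynomials in the variables \<open>x (i, k)\<close>. The \<open>m\<close>-th jet scheme of \<open>X\<close>
  is the closed subscheme of the affine space with coordinates indexed by \<open>I \<times> {..m}\<close> cut out by
  the coefficients of \<open>t ^ 0, \<dots>, t ^ m\<close> for all \<open>f \<in> J\<close>. The lemma \<open>jet_scheme_points\<close>
  below is its universal property.\<close>

definition jet_coord :: "nat \<Rightarrow> ('i \<times> nat \<Rightarrow> 'r::comm_ring_1) \<Rightarrow> 'i \<Rightarrow> 'r poly" where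
  "jet_coord m x i = (\<Sum>k\<le>m. monom (x (i, k)) k)"

definition cpoly_var :: "'i \<Rightarrow> 'i cpoly" where
  "cpoly_var i = Poly_Mapping.single (Poly_Mapping.single i 1) 1"

definition jet_coeff :: "nat \<Rightarrow> 'i cpoly \<Rightarrow> nat \<Rightarrow> ('i \<times> nat) cpoly" where
  "jet_coeff m f k =
    coeff (eval_cpoly (\<lambda>c. [:Poly_Mapping.single 0 c:]) (jet_coord m cpoly_var) f) k"

definition jet_equations :: "nat \<Rightarrow> 'i cpoly set \<Rightarrow> ('i \<times> nat) cpoly set" where
  "jet_equations m J = {jet_coeff m f k | f k. f \<in> J \<and> k \<le> m}"

definition jet_points :: "(complex \<Rightarrow> 'r::comm_ring_1) \<Rightarrow> 'i set \<Rightarrow> 'i cpoly set \<Rightarrow> nat \<Rightarrow> ('i \<times> nat \<Rightarrow> 'r) set" where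
  "jet_points h I J m = affine_points h (I \<times> {..m}) (jet_equations m J)"

definition jet_proj :: "'i set \<Rightarrow> ('i \<times> nat \<Rightarrow> 'r) \<Rightarrow> 'i \<Rightarrow> 'r" where
  "jet_proj I x = (\<lambda>i\<in>I. x (i, 0))"

lemma eval_cpoly_hom:
  assumes "comm_ring_hom \<phi>"
  shows "\<phi> (eval_cpoly h x f) = eval_cpoly (\<lambda>c. \<phi> (h c)) (\<lambda>i. \<phi> (x i)) f"
proof -
  interpret comm_ring_hom \<phi> by fact
  show ?thesis
    by (simp add: eval_cpoly_def eval_monom_def hom_sum hom_mult hom_prod hom_power)
qed

text \<open>Points of the jet scheme with values in an algebra \<open>R\<close> are the points of \<open>X\<close> with values in
  \<open>R[t] / (t ^ (m + 1))\<close>.\<close>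

lemma jet_scheme_points:
  fixes h :: "complex \<Rightarrow> 'r::comm_ring_1"
  assumes "comm_ring_hom h"
  shows "jet_points h I J m = {x \<in> (I \<times> {..m}) \<rightarrow>\<^sub>E UNIV.
    \<forall>f\<in>J. monom 1 (Suc m) dvd eval_cpoly (\<lambda>c. [:h c:]) (jet_coord m x) f}"
proof -
  have key: "eval_cpoly h x (jet_coeff m f k) =
      coeff (eval_cpoly (\<lambda>c. [:h c:]) (jet_coord m x) f) k" for x :: "'i \<times> nat \<Rightarrow> 'r" and f k
  proof -
    interpret comm_ring_hom h by fact
    interpret E: comm_ring_hom "eval_cpoly h x"
      by (rule comm_ring_hom_eval_cpoly) fact
    interpret M: map_poly_comm_ring_hom "eval_cpoly h x" ..
    have hom: "comm_ring_hom (map_poly (eval_cpoly h x))" ..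
    have v: "eval_cpoly h x (cpoly_var v) = x v" for v
      by (simp add: cpoly_var_def eval_cpoly_single[OF assms] eval_monom_def)
    have c: "eval_cpoly h x (Poly_Mapping.single 0 c) = h c" for c
      by (simp add: eval_cpoly_single[OF assms] eval_monom_def)
    have C: "map_poly (eval_cpoly h x) [:Poly_Mapping.single 0 c:] = [:h c:]" for c
      by (rule poly_eqI) (auto simp: coeff_map_poly coeff_pCons c split: nat.split)
    have X: "map_poly (eval_cpoly h x) (jet_coord m cpoly_var i) = jet_coord m x i" for i
      by (simp add: jet_coord_def M.hom_sum map_poly_monom v)
    have "map_poly (eval_cpoly h x)
        (eval_cpoly (\<lambda>c. [:Poly_Mapping.single 0 c:]) (jet_coord m cpoly_var) f) =
      eval_cpoly (\<lambda>c. [:h c:]) (jet_coord m x) f"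
      unfolding eval_cpoly_hom[OF hom] C X ..
    then show ?thesis
      by (metis E.coeff_map_poly_hom jet_coeff_def)
  qed
  have "(\<forall>p\<in>jet_equations m J. eval_cpoly h x p = 0) \<longleftrightarrow>
      (\<forall>f\<in>J. monom 1 (Suc m) dvd eval_cpoly (\<lambda>c. [:h c:]) (jet_coord m x) f)" for x
  proof -
    have "(\<forall>p\<in>jet_equations m J. eval_cpoly h x p = 0) \<longleftrightarrow>
        (\<forall>f\<in>J. \<forall>k\<le>m. eval_cpoly h x (jet_coeff m f k) = 0)"
      unfolding jet_equations_def by blast
    then show ?thesis
      unfolding key monom_1_dvd_iff' less_Suc_eq_le .
  qed
  then show ?thesis
    by (simp add: jet_points_def affine_points_def)
qed


section \<open>Nilpotent orbits\<close>

definition sl_mat :: "nat \<Rightarrow> complex mat set" where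
  "sl_mat n = {A \<in> carrier_mat n n. (\<Sum>i<n. A $$ (i, i)) = 0}"

text \<open>The orbits of the adjoint group are the conjugacy classes under the general linear group,
  as scalar matrices act trivially.\<close>

definition nilpotent_orbit :: "nat \<Rightarrow> complex mat set \<Rightarrow> bool" where
  "nilpotent_orbit n Ob \<longleftrightarrow>
    (\<exists>A\<in>sl_mat n. (\<exists>k. A ^\<^sub>m k = 0\<^sub>m n n) \<and> Ob = {B. similar_mat B A})"

definition partition_of :: "nat \<Rightarrow> nat multiset \<Rightarrow> bool" where
  "partition_of n p \<longleftrightarrow> 0 \<notin># p \<and> sum_mset p = n"

definition rectangular :: "nat multiset \<Rightarrow> bool" where
  "rectangular p \<longleftrightarrow> (\<forall>a\<in>#p. \<forall>b\<in>#p. a = b)"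

definition orbit_partition :: "complex mat set \<Rightarrow> nat multiset \<Rightarrow> bool" where
  "orbit_partition Ob p \<longleftrightarrow>
    (\<forall>A\<in>Ob. \<exists>ks. mset ks = p \<and> jordan_nf A (map (\<lambda>k. (k, 0)) ks))"

definition mat_coords :: "nat \<Rightarrow> (nat \<times> nat) set" where
  "mat_coords n = {..<n} \<times> {..<n}"

definition mat_point :: "nat \<Rightarrow> complex mat \<Rightarrow> nat \<times> nat \<Rightarrow> complex" where
  "mat_point n A = (\<lambda>ij\<in>mat_coords n. A $$ ij)"

definition orbit_closure :: "nat \<Rightarrow> complex mat set \<Rightarrow> complex mat set" where
  "orbit_closure n Ob =
    {A \<in> carrier_mat n n. mat_point n A \<in> zariski (mat_coords n) closure_of (mat_point n ` Ob)}"

text \<open>The dimension of the preimage of \<open>S\<close> in the \<open>m\<close>-th jet scheme of the reduced closure of \<open>Ob\<close>.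
  It is computed on complex points, which does not change the dimension as all schemes are of
  finite type.\<close>

definition jet_preimage ::
    "nat \<Rightarrow> nat \<Rightarrow> complex mat set \<Rightarrow> complex mat set \<Rightarrow> ((nat \<times> nat) \<times> nat \<Rightarrow> complex) set" where
  "jet_preimage n m Ob S =
    {x \<in> jet_points id (mat_coords n)
           (vanishing_ideal (mat_coords n) (mat_point n ` orbit_closure n Ob)) m.
      jet_proj (mat_coords n) x \<in> mat_point n ` S}"

definition jet_preimage_dim :: "nat \<Rightarrow> nat \<Rightarrow> complex mat set \<Rightarrow> complex mat set \<Rightarrow> ereal" where
  "jet_preimage_dim n m Ob S =
    krull_dim (subtopology (zariski (mat_coords n \<times> {..m})) (jet_preimage n m Ob S))"

definition RC2 :: "nat \<Rightarrow> nat \<Rightarrow> complex mat set \<Rightarrow> bool" where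
  "RC2 n m Ob \<longleftrightarrow>
    (\<exists>Ob'. nilpotent_orbit n Ob' \<and> Ob' \<subseteq> orbit_closure n Ob - Ob \<and>
      jet_preimage_dim n m Ob Ob' \<ge> jet_preimage_dim n m Ob Ob)"

end

theory Submission
  imports Defs
begin

text \<open>
  Let \<open>A\<close> be a Jordan matrix in the orbit \<open>O\<close> and let \<open>s\<close> be the first index of a Jordan block
  that is not the shortest one. The smaller orbit \<open>O'\<close> is that of the matrix \<open>y\<close> obtained by
  cutting the first link of this block, so that \<open>A = y + z\<close> for a matrix unit \<open>z\<close>.

  Every \<open>m\<close>-jet over \<open>O\<close> has the form \<open>\<rho> k A adj k\<close> with polynomials \<open>\<rho>\<close> and \<open>k\<close> in \<open>t\<close>, and
  the differential of this parametrization has rank at most \<open>m + 1\<close> times \<open>dim O\<close>, which is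
  \<open>n\<^sup>2\<close> minus the dimension of the centralizer of \<open>A\<close>. Over \<open>O'\<close> there are the jets
  \<open>g (y + t z + t ^ m Y) adj g\<close>, where \<open>Y\<close> is tangent to the closure of \<open>O\<close> at \<open>y\<close>: for
  \<open>t \<noteq> 0\<close> the matrix \<open>y + t z\<close> lies in \<open>O\<close>. The centralizer of \<open>y\<close> is larger than that of \<open>A\<close> by
  at most \<open>2 u + 2\<close>, where \<open>u\<close> counts the blocks shorter than the cut one, which costs \<open>2 u + 2\<close>
  dimensions in each of the \<open>m + 1\<close> coefficients. The commutators with \<open>t z\<close> give them back in the
  coefficients of \<open>t, \<dots>, t ^ m\<close>, and the loss in the constant coefficient is made up for by
  \<open>2 u + 2\<close> additional tangent vectors in the last one. The latter exist because \<open>u \<ge> 1\<close>, that is,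
  because the partition is not rectangular.

  Both dimension estimates are Jacobian criteria for the rank of a polynomial parametrization.
\<close>

section \<open>Polynomial functions\<close>

text \<open>The vanishing ideal of the orbit closure is never determined. For the upper bound only
  the equations \<open>complement_eq\<close> are used: they express that the ranks of powers are
  constant on O and bring a jet over O into Jordan form. For the lower bound only lines y + s Y with
  nonzero s in O, and conjugation, are used.

  The cokernel of the commutator with a chain matrix, dual to the centralizer, has the explicit
  index set \<open>reps\<close>. With r and R for its size at A and at y, jets over O have
  codimension at least r (m + 1) in matrix jets, and those over O' at most R + (m - 1) (R - 2 u - 2)
  + (R - 4 u - 4). So R \<le> r + 2 u + 2 is enough.

  The additional tangent vectors come from a second way to restore the cut block: the isolated index
  s is linked behind the end of the remainder instead of in front of it. Brackets with square-zero
  elements of the centralizer of y spread these two directions. A shorter block starting at c0 is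
  indispensable for one of them, the difference of the diagonal units at s + 1 and c0, which frees
  one more class.\<close>

lemma homogeneous_system_nontrivial:
  fixes a :: "'e \<Rightarrow> 'v \<Rightarrow> 'f::field"
  assumes "finite E" "finite V" "card E < card V"
  shows "\<exists>c. (\<exists>v\<in>V. c v \<noteq> 0) \<and> (\<forall>e\<in>E. (\<Sum>v\<in>V. a e v * c v) = 0)"
  using assms
proof (induction E arbitrary: V a rule: finite_induct)
  case empty
  then have "V \<noteq> {}" by auto
  then show ?case by (intro exI[of _ "\<lambda>_. 1"]) auto
next
  case (insert e E)
  show ?case
  proof (cases "\<forall>v\<in>V. a e v = 0")
    case True
    have "card E < card V" using insert by simp
    then obtain c where "\<exists>v\<in>V. c v \<noteq> 0" "\<forall>e\<in>E. (\<Sum>v\<in>V. a e v * c v) = 0"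
      using insert.IH[of V a] insert.prems by blast
    then show ?thesis using True by (intro exI[of _ c]) simp
  next
    case False
    then obtain w where w: "w \<in> V" "a e w \<noteq> 0" by blast
    let ?V = "V - {w}"
    have fin: "finite ?V" "card E < card ?V" using insert w by auto
    obtain c where c: "\<exists>v\<in>?V. c v \<noteq> 0"
      "\<forall>e'\<in>E. (\<Sum>v\<in>?V. (a e' v - a e' w * a e v / a e w) * c v) = 0"
      using insert.IH[OF fin, of "\<lambda>e' v. a e' v - a e' w * a e v / a e w"] by blast
    \<comment> \<open>The value at the eliminated unknown \<open>w\<close> is solved from equation
      \<open>e\<close>.\<close>
    define d where "d = c(w := - (\<Sum>v\<in>?V. a e v * c v) / a e w)"
    have split: "(\<Sum>v\<in>V. a e' v * d v) =
        (\<Sum>v\<in>?V. a e' v * c v) - a e' w * (\<Sum>v\<in>?V. a e v * c v) / a e w" for e'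
    proof -
      have "(\<Sum>v\<in>V. a e' v * d v) = a e' w * d w + (\<Sum>v\<in>?V. a e' v * d v)"
        using w insert.prems by (simp add: sum.remove)
      also have "(\<Sum>v\<in>?V. a e' v * d v) = (\<Sum>v\<in>?V. a e' v * c v)"
        by (rule sum.cong) (auto simp: d_def)
      finally show ?thesis by (simp add: d_def)
    qed
    have "(\<Sum>v\<in>V. a e' v * d v) = 0" if "e' \<in> E" for e'
    proof -
      have "(\<Sum>v\<in>?V. (a e' v - a e' w * a e v / a e w) * c v) =
          (\<Sum>v\<in>?V. a e' v * c v) - (\<Sum>v\<in>?V. a e' w * (a e v * c v) / a e w)"
        by (simp add: sum_subtractf left_diff_distrib mult.assoc)
      also have "(\<Sum>v\<in>?V. a e' w * (a e v * c v) / a e w) = a e' w * (\<Sum>v\<in>?V. a e v * c v) / a e w"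
        by (simp add: sum_divide_distrib sum_distrib_left)
      finally show ?thesis using c(2) that split[of e'] by simp
    qed
    moreover have "(\<Sum>v\<in>V. a e v * d v) = 0" using split[of e] w by simp
    moreover have "\<exists>v\<in>V. d v \<noteq> 0" using c(1) by (auto simp: d_def)
    ultimately show ?thesis by (intro exI[of _ d]) auto
  qed
qed

text \<open>Over the infinite field of complex numbers polynomials may be replaced by the functions
  that they define. This makes substitution and differentiation inductions on four rules, without
  monomials. The functions take total assignments but read only the coordinates in \<open>I\<close>,
  see \<open>polyfun_cong\<close>.\<close>

inductive_set polyfun :: "'i set \<Rightarrow> (('i \<Rightarrow> complex) \<Rightarrow> complex) set" for I :: "'i set" where
  const: "(\<lambda>x. c) \<in> polyfun I"
| coord: "i \<in> I \<Longrightarrow> (\<lambda>x. x i) \<in> polyfun I"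
| add: "\<lbrakk>F \<in> polyfun I; G \<in> polyfun I\<rbrakk> \<Longrightarrow> (\<lambda>x. F x + G x) \<in> polyfun I"
| mult: "\<lbrakk>F \<in> polyfun I; G \<in> polyfun I\<rbrakk> \<Longrightarrow> (\<lambda>x. F x * G x) \<in> polyfun I"

lemma polyfun_uminus: "F \<in> polyfun I \<Longrightarrow> (\<lambda>x. - F x) \<in> polyfun I"
  using polyfun.mult[OF polyfun.const[of "-1"], of F I] by simp

lemma polyfun_sum: "(\<And>a. a \<in> A \<Longrightarrow> F a \<in> polyfun I) \<Longrightarrow> (\<lambda>x. \<Sum>a\<in>A. F a x) \<in> polyfun I"
  by (induction A rule: infinite_finite_induct) (auto intro: polyfun.intros)

lemma polyfun_prod: "(\<And>a. a \<in> A \<Longrightarrow> F a \<in> polyfun I) \<Longrightarrow> (\<lambda>x. \<Prod>a\<in>A. F a x) \<in> polyfun I"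
  by (induction A rule: infinite_finite_induct) (auto intro: polyfun.intros)

lemma polyfun_power: "F \<in> polyfun I \<Longrightarrow> (\<lambda>x. F x ^ k) \<in> polyfun I"
  by (induction k) (auto intro: polyfun.intros)

lemma polyfun_cong: "F \<in> polyfun I \<Longrightarrow> (\<And>i. i \<in> I \<Longrightarrow> x i = y i) \<Longrightarrow> F x = F y"
  by (induction rule: polyfun.induct) auto

lemma polyfun_compose:
  "F \<in> polyfun I \<Longrightarrow> (\<And>i. i \<in> I \<Longrightarrow> H i \<in> polyfun J) \<Longrightarrow> (\<lambda>x. F (\<lambda>i. H i x)) \<in> polyfun J"
  by (induction rule: polyfun.induct) (auto intro: polyfun.intros)

lemma polyfun_along_ex:
  assumes "F \<in> polyfun I"
  shows "\<exists>p. \<forall>t. poly p t = F (\<lambda>i. poly (c i) t)"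
  using assms
proof induction
  case (const a) show ?case by (intro exI[of _ "[:a:]"]) simp
next
  case (coord i) show ?case by (intro exI[of _ "c i"]) simp
next
  case (add F G) then show ?case by (metis poly_add)
next
  case (mult F G) then show ?case by (metis poly_mult)
qed

lemma polyfun_line_ex:
  assumes "F \<in> polyfun I"
  shows "\<exists>p. \<forall>t. poly p t = F (\<lambda>i. x i + t * v i)"
  using polyfun_along_ex[OF assms, of "\<lambda>i. [:x i, v i:]"] by simp

text \<open>This is irreducibility of affine space: on the line through \<open>x\<close> and
  \<open>y\<close> both functions become nonzero polynomials in one variable, and their product has
  a nonzero value.\<close>

lemma polyfun_both_nonzero:
  assumes "F \<in> polyfun I" "G \<in> polyfun I" "F x \<noteq> 0" "G y \<noteq> 0"
  shows "\<exists>z. F z \<noteq> 0 \<and> G z \<noteq> 0"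
proof -
  obtain p where p: "\<forall>t. poly p t = F (\<lambda>i. x i + t * (y i - x i))"
    using polyfun_line_ex[OF assms(1), of x "\<lambda>i. y i - x i"] by blast
  obtain q where q: "\<forall>t. poly q t = G (\<lambda>i. x i + t * (y i - x i))"
    using polyfun_line_ex[OF assms(2), of x "\<lambda>i. y i - x i"] by blast
  have "poly p 0 \<noteq> 0" "poly q 1 \<noteq> 0" using assms p q by simp_all
  then have "p * q \<noteq> 0" by auto
  then have "\<exists>t. poly (p * q) t \<noteq> 0" by (metis poly_all_0_iff_0)
  then show ?thesis using p q by auto
qed

lemma polyfun_all_nonzero:
  assumes "finite A" "\<And>a. a \<in> A \<Longrightarrow> F a \<in> polyfun I" "\<And>a. a \<in> A \<Longrightarrow> \<exists>x. F a x \<noteq> 0"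
  shows "\<exists>z. \<forall>a\<in>A. F a z \<noteq> 0"
proof -
  have "\<exists>z. (\<Prod>a\<in>A. F a z) \<noteq> 0"
    using assms
  proof (induction A rule: finite_induct)
    case (insert a A)
    have "\<exists>z. F a z \<noteq> 0 \<and> (\<Prod>a\<in>A. F a z) \<noteq> 0"
    proof -
      obtain x y where "F a x \<noteq> 0" "(\<Prod>a\<in>A. F a y) \<noteq> 0" using insert by blast
      moreover have "(\<lambda>x. \<Prod>a\<in>A. F a x) \<in> polyfun I" using insert by (intro polyfun_prod) auto
      ultimately show ?thesis using insert polyfun_both_nonzero[of "F a" I "\<lambda>x. \<Prod>a\<in>A. F a x"] by blast
    qed
    then show ?case using insert by auto
  qed auto
  then show ?thesis using assms(1) by auto
qed

lemma polyfun_zero_dense: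
  assumes "F \<in> polyfun I" "h \<in> polyfun I" "h y \<noteq> 0" "\<And>x. h x \<noteq> 0 \<Longrightarrow> F x = 0"
  shows "F x = 0"
  using polyfun_both_nonzero[OF assms(1,2), of x y] assms(3,4) by blast

section \<open>Derivatives of polynomial functions\<close>

text \<open>Two properties are bundled so that one induction gives both: the chain rule along
  differentiable curves, and the expansion with remainder along polynomial curves perturbed in order
  \<open>m\<close>. The second one is exact in \<open>t\<close>, as needed for divisibility by
  powers of \<open>t\<close>.\<close>

definition gradient_of :: "'i set \<Rightarrow> (('i \<Rightarrow> complex) \<Rightarrow> complex) \<Rightarrow> ('i \<Rightarrow> ('i \<Rightarrow> complex) \<Rightarrow> complex) \<Rightarrow> bool" where
  "gradient_of I F G \<longleftrightarrow>
    (\<forall>(c :: 'i \<Rightarrow> complex \<Rightarrow> complex) c' s. (\<forall>i\<in>I. (c i has_field_derivative c' i) (at s)) \<longrightarrow>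
      ((\<lambda>s. F (\<lambda>i. c i s)) has_field_derivative (\<Sum>i\<in>I. G i (\<lambda>i. c i s) * c' i)) (at s)) \<and>
    (\<forall>a b m. m \<ge> 1 \<longrightarrow> (\<exists>q. (\<forall>t. F (\<lambda>i. poly (a i) t + t ^ m * poly (b i) t) =
        F (\<lambda>i. poly (a i) t) + t ^ m * poly q t) \<and>
      poly q 0 = (\<Sum>i\<in>I. G i (\<lambda>i. poly (a i) 0) * poly (b i) 0)))"

lemma gradient_of_const: "gradient_of I (\<lambda>x. a) (\<lambda>i x. 0)"
  by (auto simp: gradient_of_def intro: polyfun.intros intro!: exI[of _ 0])

lemma gradient_of_coord:
  assumes "finite I" "i \<in> I"
  shows "gradient_of I (\<lambda>x. x i) (\<lambda>j x. if j = i then 1 else 0)"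
proof -
  have e: "(\<Sum>j\<in>I. (if j = i then 1 else 0) * f j) = (f i :: complex)" for f
  proof -
    have "(\<Sum>j\<in>I. (if j = i then 1 else 0) * f j) = (\<Sum>j\<in>I. if j = i then f j else 0)"
      by (rule sum.cong) auto
    also have "\<dots> = f i" using assms by (simp add: sum.delta)
    finally show ?thesis .
  qed
  show ?thesis
    unfolding gradient_of_def e using assms
    by (auto intro: polyfun.intros intro!: exI[of _ "b i" for b])
qed

lemma gradient_of_add:
  assumes "gradient_of I F F'" "gradient_of I G G'"
  shows "gradient_of I (\<lambda>x. F x + G x) (\<lambda>i x. F' i x + G' i x)"
  unfolding gradient_of_def
proof (intro conjI allI impI ballI)
  fix c :: "'a \<Rightarrow> complex \<Rightarrow> complex" and c' s assume c: "\<forall>i\<in>I. (c i has_field_derivative c' i) (at s)"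
  show "((\<lambda>s. F (\<lambda>i. c i s) + G (\<lambda>i. c i s)) has_field_derivative
      (\<Sum>i\<in>I. (F' i (\<lambda>i. c i s) + G' i (\<lambda>i. c i s)) * c' i)) (at s)"
  proof -
    have "((\<lambda>s. F (\<lambda>i. c i s)) has_field_derivative (\<Sum>i\<in>I. F' i (\<lambda>i. c i s) * c' i)) (at s)"
      "((\<lambda>s. G (\<lambda>i. c i s)) has_field_derivative (\<Sum>i\<in>I. G' i (\<lambda>i. c i s) * c' i)) (at s)"
      using assms c unfolding gradient_of_def by blast+
    from DERIV_add[OF this] show ?thesis
      by (simp add: distrib_right sum.distrib)
  qed
next
  fix a b and m :: nat assume m: "m \<ge> 1"
  obtain p where p: "\<forall>t. F (\<lambda>i. poly (a i) t + t ^ m * poly (b i) t) = F (\<lambda>i. poly (a i) t) + t ^ m * poly p t"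
    "poly p 0 = (\<Sum>i\<in>I. F' i (\<lambda>i. poly (a i) 0) * poly (b i) 0)"
    using assms(1) m unfolding gradient_of_def by blast
  obtain q where q: "\<forall>t. G (\<lambda>i. poly (a i) t + t ^ m * poly (b i) t) = G (\<lambda>i. poly (a i) t) + t ^ m * poly q t"
    "poly q 0 = (\<Sum>i\<in>I. G' i (\<lambda>i. poly (a i) 0) * poly (b i) 0)"
    using assms(2) m unfolding gradient_of_def by blast
  show "\<exists>q. (\<forall>t. F (\<lambda>i. poly (a i) t + t ^ m * poly (b i) t) + G (\<lambda>i. poly (a i) t + t ^ m * poly (b i) t) =
        F (\<lambda>i. poly (a i) t) + G (\<lambda>i. poly (a i) t) + t ^ m * poly q t) \<and>
      poly q 0 = (\<Sum>i\<in>I. (F' i (\<lambda>i. poly (a i) 0) + G' i (\<lambda>i. poly (a i) 0)) * poly (b i) 0)"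
    by (intro exI[of _ "p + q"]) (simp add: p q algebra_simps sum.distrib)
qed

lemma gradient_of_mult:
  assumes "gradient_of I F F'" "gradient_of I G G'" "F \<in> polyfun I" "G \<in> polyfun I"
  shows "gradient_of I (\<lambda>x. F x * G x) (\<lambda>i x. F' i x * G x + F x * G' i x)"
  unfolding gradient_of_def
proof (intro conjI allI impI ballI)
  fix c :: "'a \<Rightarrow> complex \<Rightarrow> complex" and c' s assume c: "\<forall>i\<in>I. (c i has_field_derivative c' i) (at s)"
  have "((\<lambda>s. F (\<lambda>i. c i s)) has_field_derivative (\<Sum>i\<in>I. F' i (\<lambda>i. c i s) * c' i)) (at s)"
    "((\<lambda>s. G (\<lambda>i. c i s)) has_field_derivative (\<Sum>i\<in>I. G' i (\<lambda>i. c i s) * c' i)) (at s)"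
    using assms c unfolding gradient_of_def by blast+
  from DERIV_mult[OF this]
  show "((\<lambda>s. F (\<lambda>i. c i s) * G (\<lambda>i. c i s)) has_field_derivative
      (\<Sum>i\<in>I. (F' i (\<lambda>i. c i s) * G (\<lambda>i. c i s) + F (\<lambda>i. c i s) * G' i (\<lambda>i. c i s)) * c' i)) (at s)"
    by (rule DERIV_cong) (simp add: sum_distrib_left sum.distrib algebra_simps)
next
  fix a b and m :: nat assume m: "m \<ge> 1"
  obtain p where p: "\<forall>t. F (\<lambda>i. poly (a i) t + t ^ m * poly (b i) t) = F (\<lambda>i. poly (a i) t) + t ^ m * poly p t"
    "poly p 0 = (\<Sum>i\<in>I. F' i (\<lambda>i. poly (a i) 0) * poly (b i) 0)"
    using assms(1) m unfolding gradient_of_def by blast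
  obtain q where q: "\<forall>t. G (\<lambda>i. poly (a i) t + t ^ m * poly (b i) t) = G (\<lambda>i. poly (a i) t) + t ^ m * poly q t"
    "poly q 0 = (\<Sum>i\<in>I. G' i (\<lambda>i. poly (a i) 0) * poly (b i) 0)"
    using assms(2) m unfolding gradient_of_def by blast
  obtain f where f: "\<forall>t. poly f t = F (\<lambda>i. poly (a i) t)" using polyfun_along_ex[OF assms(3)] by blast
  obtain g where g: "\<forall>t. poly g t = G (\<lambda>i. poly (a i) t)" using polyfun_along_ex[OF assms(4)] by blast
  show "\<exists>q. (\<forall>t. F (\<lambda>i. poly (a i) t + t ^ m * poly (b i) t) * G (\<lambda>i. poly (a i) t + t ^ m * poly (b i) t) =
        F (\<lambda>i. poly (a i) t) * G (\<lambda>i. poly (a i) t) + t ^ m * poly q t) \<and>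
      poly q 0 = (\<Sum>i\<in>I. (F' i (\<lambda>i. poly (a i) 0) * G (\<lambda>i. poly (a i) 0) +
        F (\<lambda>i. poly (a i) 0) * G' i (\<lambda>i. poly (a i) 0)) * poly (b i) 0)"
  \<comment> \<open>The last summand is the second order term; it vanishes at 0 because
    \<open>m\<close> is positive, which leaves the product rule.\<close>
  proof (intro exI[of _ "p * g + f * q + monom 1 m * p * q"] conjI allI)
    show "poly (p * g + f * q + monom 1 m * p * q) 0 =
        (\<Sum>i\<in>I. (F' i (\<lambda>i. poly (a i) 0) * G (\<lambda>i. poly (a i) 0) +
        F (\<lambda>i. poly (a i) 0) * G' i (\<lambda>i. poly (a i) 0)) * poly (b i) 0)"
      using m by (simp add: poly_monom p(2) q(2) f g distrib_right sum.distrib sum_distrib_left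
          sum_distrib_right algebra_simps power_0_left)
  qed (simp add: p q f g poly_monom algebra_simps)
qed

lemma gradient_of_ex:
  assumes "finite I" "F \<in> polyfun I"
  shows "\<exists>G. gradient_of I F G"
  using assms(2)
proof induction
  case (const c) show ?case by (rule exI, rule gradient_of_const)
next
  case (coord i) show ?case by (rule exI, rule gradient_of_coord) (use assms coord in auto)
next
  case (add F G)
  then obtain F' G' where "gradient_of I F F'" "gradient_of I G G'" by auto
  then have "gradient_of I (\<lambda>x. F x + G x) (\<lambda>i x. F' i x + G' i x)"
    by (rule gradient_of_add)
  then show ?case by blast
next
  case (mult F G)
  then obtain F' G' where "gradient_of I F F'" "gradient_of I G G'" by auto
  then have "gradient_of I (\<lambda>x. F x * G x) (\<lambda>i x. F' i x * G x + F x * G' i x)"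
    using mult.hyps by (rule gradient_of_mult)
  then show ?case by blast
qed

definition gradient :: "'i set \<Rightarrow> (('i \<Rightarrow> complex) \<Rightarrow> complex) \<Rightarrow> 'i \<Rightarrow> ('i \<Rightarrow> complex) \<Rightarrow> complex" where
  "gradient I F = (SOME G. gradient_of I F G)"

definition dird :: "'i set \<Rightarrow> (('i \<Rightarrow> complex) \<Rightarrow> complex) \<Rightarrow> ('i \<Rightarrow> complex) \<Rightarrow> ('i \<Rightarrow> complex) \<Rightarrow> complex" where
  "dird I F x v = (\<Sum>i\<in>I. gradient I F i x * v i)"

lemma gradient_of_gradient: "finite I \<Longrightarrow> F \<in> polyfun I \<Longrightarrow> gradient_of I F (gradient I F)"
  unfolding gradient_def using gradient_of_ex by (rule someI_ex)

lemma has_field_derivative_polyfun: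
  assumes "finite I" "F \<in> polyfun I" "\<And>i. i \<in> I \<Longrightarrow> (c i has_field_derivative c' i) (at s)"
  shows "((\<lambda>s. F (\<lambda>i. c i s)) has_field_derivative dird I F (\<lambda>i. c i s) c') (at s)"
  using gradient_of_gradient[OF assms(1,2)] assms(3) unfolding gradient_of_def dird_def by blast

lemma has_field_derivative_dird:
  assumes "finite I" "F \<in> polyfun I"
  shows "((\<lambda>s. F (\<lambda>i. x i + s * v i)) has_field_derivative dird I F x v) (at 0)"
proof -
  have "((\<lambda>s. x i + s * v i) has_field_derivative v i) (at 0)" for i
    by (auto intro!: derivative_eq_intros)
  from has_field_derivative_polyfun[OF assms, of "\<lambda>i s. x i + s * v i" v 0, OF this]
  show ?thesis by simp
qed

lemma dird_eqI:
  assumes "finite I" "F \<in> polyfun I" "((\<lambda>s. F (\<lambda>i. x i + s * v i)) has_field_derivative D) (at 0)"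
  shows "dird I F x v = D"
  by (rule DERIV_unique[OF has_field_derivative_dird[OF assms(1,2)] assms(3)])

lemma polyfun_taylor:
  assumes "finite I" "F \<in> polyfun I" "m \<ge> 1"
  shows "\<exists>q. (\<forall>t. F (\<lambda>i. poly (a i) t + t ^ m * poly (b i) t) = F (\<lambda>i. poly (a i) t) + t ^ m * poly q t) \<and>
      poly q 0 = dird I F (\<lambda>i. poly (a i) 0) (\<lambda>i. poly (b i) 0)"
  using gradient_of_gradient[OF assms(1,2)] assms(3) unfolding gradient_of_def dird_def by blast

lemma dird_sum: "dird I F x (\<lambda>i. \<Sum>a\<in>A. c a * v a i) = (\<Sum>a\<in>A. c a * dird I F x (v a))"
  unfolding dird_def by (simp add: sum_distrib_left mult_ac, subst sum.swap, simp)

lemma dird_add: "dird I F x (\<lambda>i. v i + w i) = dird I F x v + dird I F x w"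
  by (simp add: dird_def algebra_simps sum.distrib)

lemma dird_scale: "dird I F x (\<lambda>i. c * v i) = c * dird I F x v"
  by (simp add: dird_def sum_distrib_left mult_ac)

lemma dird_cong: "(\<And>i. i \<in> I \<Longrightarrow> v i = w i) \<Longrightarrow> dird I F x v = dird I F x w"
  by (simp add: dird_def)

section \<open>Algebraic independence\<close>

text \<open>For \<open>X = UNIV\<close> this is algebraic independence of functions on affine space.
  A smaller \<open>X\<close> expresses independence of their restrictions, as needed along a chain
  of closed sets.\<close>

definition alg_indep :: "'j set \<Rightarrow> ('j \<Rightarrow> 'x \<Rightarrow> complex) \<Rightarrow> 'x set \<Rightarrow> bool" where
  "alg_indep J F X \<longleftrightarrow> (\<forall>P\<in>polyfun J. (\<forall>x\<in>X. P (\<lambda>j. F j x) = 0) \<longrightarrow> (\<forall>y. P y = 0))"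

lemma alg_indepD:
  assumes "alg_indep J F X" "P \<in> polyfun J" "\<And>x. x \<in> X \<Longrightarrow> P (\<lambda>j. F j x) = 0"
  shows "P y = 0"
  using bspec[OF assms(1)[unfolded alg_indep_def] assms(2)] assms(3) by simp

lemma poly_eq_sum_le:
  fixes p :: "'a::comm_semiring_1 poly"
  assumes "degree p \<le> d"
  shows "poly p x = (\<Sum>k\<le>d. coeff p k * x ^ k)"
proof -
  have "(\<Sum>k\<le>d. coeff p k * x ^ k) = (\<Sum>k\<le>degree p. coeff p k * x ^ k)"
    by (rule sum.mono_neutral_right) (use assms in \<open>auto simp: coeff_eq_0\<close>)
  then show ?thesis by (simp only: poly_altdef)
qed

text \<open>The polynomial in the variable \<open>i\<close> depends on the remaining coordinates, so
  the degree bound has to be uniform; this is what later permits a relation of least degree.\<close>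

lemma polyfun_expand:
  assumes "F \<in> polyfun (insert i J)"
  shows "\<exists>p d. (\<forall>k. (\<lambda>x. coeff (p x) k) \<in> polyfun J) \<and> (\<forall>x. degree (p x) \<le> d) \<and>
    (\<forall>x. F x = poly (p x) (x i))"
  using assms
proof induction
  case (const c)
  show ?case
    by (intro exI[of _ "\<lambda>x. [:c:]"] exI[of _ 0]) (auto intro: polyfun.const)
next
  case (coord j)
  show ?case
  proof (cases "j = i")
    case True
    then show ?thesis
      by (intro exI[of _ "\<lambda>x. [:0, 1:]"] exI[of _ 1]) (auto intro: polyfun.const)
  next
    case False
    then have "j \<in> J" using coord by simp
    then have "(\<lambda>x. coeff [:x j:] k) \<in> polyfun J" for k
      by (cases k) (auto intro: polyfun.intros)
    then show ?thesis
      by (intro exI[of _ "\<lambda>x. [:x j:]"] exI[of _ 0]) auto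
  qed
next
  case (add F G)
  then obtain p d q e where pq:
    "\<forall>k. (\<lambda>x. coeff (p x) k) \<in> polyfun J" "\<forall>x. degree (p x) \<le> d" "\<forall>x. F x = poly (p x) (x i)"
    "\<forall>k. (\<lambda>x. coeff (q x) k) \<in> polyfun J" "\<forall>x. degree (q x) \<le> e" "\<forall>x. G x = poly (q x) (x i)"
    by blast
  have "degree (p x + q x) \<le> max d e" for x
    using pq by (meson degree_add_le max.coboundedI1 max.coboundedI2)
  with pq show ?case
    by (intro exI[of _ "\<lambda>x. p x + q x"] exI[of _ "max d e"]) (auto intro: polyfun.add)
next
  case (mult F G)
  then obtain p d q e where pq:
    "\<forall>k. (\<lambda>x. coeff (p x) k) \<in> polyfun J" "\<forall>x. degree (p x) \<le> d" "\<forall>x. F x = poly (p x) (x i)"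
    "\<forall>k. (\<lambda>x. coeff (q x) k) \<in> polyfun J" "\<forall>x. degree (q x) \<le> e" "\<forall>x. G x = poly (q x) (x i)"
    by blast
  have "degree (p x * q x) \<le> d + e" for x
    using pq by (meson add_mono degree_mult_le order_trans)
  with pq show ?case
    by (intro exI[of _ "\<lambda>x. p x * q x"] exI[of _ "d + e"])
      (auto simp: coeff_mult intro!: polyfun_sum polyfun.mult)
qed

text \<open>The expansion of \<open>F\<close> around \<open>y\<close> by homogeneous parts: the
  coefficient of s^k is the part of degree \<open>k\<close> as a function of the direction
  \<open>w\<close>.\<close>

lemma polyfun_line_expand:
  assumes "F \<in> polyfun J"
  shows "\<exists>r d. (\<forall>k. (\<lambda>w. coeff (r w) k) \<in> polyfun J) \<and> (\<forall>w. degree (r w) \<le> d) \<and>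
    (\<forall>w s. F (\<lambda>j. y j + s * w j) = poly (r w) s)"
  using assms
proof induction
  case (const c)
  show ?case
    by (intro exI[of _ "\<lambda>x. [:c:]"] exI[of _ 0]) (auto intro: polyfun.const)
next
  case (coord j)
  have "(\<lambda>w. coeff [:y j, w j:] k) =
      (if k = 0 then (\<lambda>w. y j) else if k = 1 then (\<lambda>w. w j) else (\<lambda>w. 0))" for k
    by (auto simp: fun_eq_iff coeff_pCons split: nat.split)
  then have "(\<lambda>w. coeff [:y j, w j:] k) \<in> polyfun J" for k
    using coord by (auto intro: polyfun.intros)
  then show ?case
    by (intro exI[of _ "\<lambda>w. [:y j, w j:]"] exI[of _ 1]) auto
next
  case (add F G)
  then obtain p d q e where pq:
    "\<forall>k. (\<lambda>x. coeff (p x) k) \<in> polyfun J" "\<forall>x. degree (p x) \<le> d"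
    "\<forall>w s. F (\<lambda>j. y j + s * w j) = poly (p w) s"
    "\<forall>k. (\<lambda>x. coeff (q x) k) \<in> polyfun J" "\<forall>x. degree (q x) \<le> e"
    "\<forall>w s. G (\<lambda>j. y j + s * w j) = poly (q w) s"
    by blast
  have "degree (p x + q x) \<le> max d e" for x
    using pq by (meson degree_add_le max.coboundedI1 max.coboundedI2)
  with pq show ?case
    by (intro exI[of _ "\<lambda>x. p x + q x"] exI[of _ "max d e"]) (auto intro: polyfun.add)
next
  case (mult F G)
  then obtain p d q e where pq:
    "\<forall>k. (\<lambda>x. coeff (p x) k) \<in> polyfun J" "\<forall>x. degree (p x) \<le> d"
    "\<forall>w s. F (\<lambda>j. y j + s * w j) = poly (p w) s"
    "\<forall>k. (\<lambda>x. coeff (q x) k) \<in> polyfun J" "\<forall>x. degree (q x) \<le> e"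
    "\<forall>w s. G (\<lambda>j. y j + s * w j) = poly (q w) s"
    by blast
  have "degree (p x * q x) \<le> d + e" for x
    using pq by (meson add_mono degree_mult_le order_trans)
  with pq show ?case
    by (intro exI[of _ "\<lambda>x. p x * q x"] exI[of _ "d + e"])
      (auto simp: coeff_mult intro!: polyfun_sum polyfun.mult)
qed

section \<open>Counting monomials\<close>

lemma monomials_independent:
  fixes c :: "('j \<Rightarrow> nat) \<Rightarrow> complex"
  assumes "finite J"
    and "\<And>y. (\<Sum>\<beta>\<in>PiE J (\<lambda>_. {..N}). c \<beta> * (\<Prod>j\<in>J. y j ^ \<beta> j)) = 0"
    and "\<beta> \<in> PiE J (\<lambda>_. {..N})"
  shows "c \<beta> = 0"
  using assms
proof (induction J arbitrary: c \<beta> rule: finite_induct)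
  case empty
  then show ?case by simp
next
  case (insert i J)
  let ?A = "PiE J (\<lambda>_. {..N})"
  have inj: "inj_on (\<lambda>(e, \<beta>). \<beta>(i := e)) ({..N} \<times> ?A)"
  proof (rule inj_onI, clarsimp)
    fix a b a' b' assume h: "b \<in> ?A" "b' \<in> ?A" "b(i := a) = b'(i := a')"
    have "a = a'" using fun_cong[OF h(3), of i] by simp
    moreover have "b j = b' j" for j
    proof (cases "j = i")
      case True
      then show ?thesis using h insert.hyps by (auto simp: PiE_def extensional_def)
    next
      case False
      then show ?thesis using fun_cong[OF h(3), of j] by simp
    qed
    ultimately show "a = a' \<and> b = b'" by auto
  qed
  have split: "(\<Sum>\<beta>\<in>PiE (insert i J) (\<lambda>_. {..N}). c \<beta> * (\<Prod>j\<in>insert i J. y j ^ \<beta> j)) =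
      (\<Sum>e\<le>N. (\<Sum>\<beta>\<in>?A. c (\<beta>(i := e)) * (\<Prod>j\<in>J. y j ^ \<beta> j)) * y i ^ e)" for y
  proof -
    have "(\<Sum>\<beta>\<in>PiE (insert i J) (\<lambda>_. {..N}). c \<beta> * (\<Prod>j\<in>insert i J. y j ^ \<beta> j)) =
        (\<Sum>(e, \<beta>)\<in>{..N} \<times> ?A. c (\<beta>(i := e)) * (\<Prod>j\<in>insert i J. y j ^ (\<beta>(i := e)) j))"
      unfolding PiE_insert_eq by (subst sum.reindex) (use inj in \<open>auto simp: case_prod_unfold\<close>)
    also have "\<dots> = (\<Sum>e\<le>N. \<Sum>\<beta>\<in>?A. c (\<beta>(i := e)) * (\<Prod>j\<in>insert i J. y j ^ (\<beta>(i := e)) j))"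
      by (simp add: sum.cartesian_product)
    also have "\<dots> = (\<Sum>e\<le>N. (\<Sum>\<beta>\<in>?A. c (\<beta>(i := e)) * (\<Prod>j\<in>J. y j ^ \<beta> j)) * y i ^ e)"
    proof (intro sum.cong refl)
      fix e
      have "(\<Prod>j\<in>insert i J. y j ^ (\<beta>(i := e)) j) = y i ^ e * (\<Prod>j\<in>J. y j ^ \<beta> j)" for \<beta>
      proof -
        have "(\<Prod>j\<in>J. y j ^ (\<beta>(i := e)) j) = (\<Prod>j\<in>J. y j ^ \<beta> j)"
          by (rule prod.cong) (use insert.hyps in auto)
        then show ?thesis using insert.hyps by simp
      qed
      then show "(\<Sum>\<beta>\<in>?A. c (\<beta>(i := e)) * (\<Prod>j\<in>insert i J. y j ^ (\<beta>(i := e)) j)) =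
          (\<Sum>\<beta>\<in>?A. c (\<beta>(i := e)) * (\<Prod>j\<in>J. y j ^ \<beta> j)) * y i ^ e"
        by (simp only: sum_distrib_left mult_ac)
    qed
    finally show ?thesis .
  qed
  have zero: "(\<Sum>\<beta>\<in>?A. c (\<beta>(i := e)) * (\<Prod>j\<in>J. y j ^ \<beta> j)) = 0" if e: "e \<le> N" for e y
  proof -
    let ?f = "\<lambda>e. \<Sum>\<beta>\<in>?A. c (\<beta>(i := e)) * (\<Prod>j\<in>J. y j ^ \<beta> j)"
    define p where "p = (\<Sum>e\<le>N. monom (?f e) e)"
    have "poly p z = 0" for z
    proof -
      have "(\<Prod>j\<in>J. (y(i := z)) j ^ \<beta> j) = (\<Prod>j\<in>J. y j ^ \<beta> j)" for \<beta>
        by (rule prod.cong) (use insert.hyps in auto)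
      then have "(\<Sum>e\<le>N. ?f e * z ^ e) = 0"
        using split[of "y(i := z)"] insert.prems(1)[of "y(i := z)"] by simp
      then show ?thesis by (simp add: p_def poly_sum poly_monom)
    qed
    then have "p = 0" using poly_all_0_iff_0 by blast
    then have "coeff p e = 0" by simp
    moreover have "coeff p e = ?f e"
    proof -
      have "coeff p e = (\<Sum>k\<le>N. if k = e then ?f k else 0)"
        by (simp add: p_def coeff_sum)
      also have "\<dots> = ?f e" using e by (simp add: sum.delta)
      finally show ?thesis .
    qed
    ultimately show ?thesis by simp
  qed
  obtain e \<gamma> where \<beta>: "\<beta> = \<gamma>(i := e)" "e \<le> N" "\<gamma> \<in> ?A"
    using insert.prems(2) unfolding PiE_insert_eq by auto
  have "c (\<gamma>(i := e)) = 0"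
    by (rule insert.IH[of "\<lambda>\<gamma>. c (\<gamma>(i := e))"]) (use zero \<beta> in auto)
  then show ?case unfolding \<beta>(1) .
qed

text \<open>The degree is bounded in each variable separately, so that the exponents form a box and
  their number is a plain power.\<close>

definition mspan :: "'i set \<Rightarrow> nat \<Rightarrow> (('i \<Rightarrow> complex) \<Rightarrow> complex) set" where
  "mspan I d = {F. \<exists>a. F = (\<lambda>x. \<Sum>\<alpha>\<in>PiE I (\<lambda>_. {..d}). a \<alpha> * (\<Prod>i\<in>I. x i ^ \<alpha> i))}"

lemma mspan_add: "F \<in> mspan I d \<Longrightarrow> G \<in> mspan I d \<Longrightarrow> (\<lambda>x. F x + G x) \<in> mspan I d"
proof -
  assume "F \<in> mspan I d" "G \<in> mspan I d"
  then obtain a b where "F = (\<lambda>x. \<Sum>\<alpha>\<in>PiE I (\<lambda>_. {..d}). a \<alpha> * (\<Prod>i\<in>I. x i ^ \<alpha> i))"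
    "G = (\<lambda>x. \<Sum>\<alpha>\<in>PiE I (\<lambda>_. {..d}). b \<alpha> * (\<Prod>i\<in>I. x i ^ \<alpha> i))"
    unfolding mspan_def by auto
  then show ?thesis unfolding mspan_def
    by (intro CollectI exI[of _ "\<lambda>\<alpha>. a \<alpha> + b \<alpha>"]) (simp add: distrib_right sum.distrib)
qed

lemma mspan_scale: "F \<in> mspan I d \<Longrightarrow> (\<lambda>x. c * F x) \<in> mspan I d"
proof -
  assume "F \<in> mspan I d"
  then obtain a where "F = (\<lambda>x. \<Sum>\<alpha>\<in>PiE I (\<lambda>_. {..d}). a \<alpha> * (\<Prod>i\<in>I. x i ^ \<alpha> i))"
    unfolding mspan_def by auto
  then show ?thesis unfolding mspan_def
    by (intro CollectI exI[of _ "\<lambda>\<alpha>. c * a \<alpha>"]) (simp add: sum_distrib_left mult_ac)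
qed

lemma mspan_zero: "(\<lambda>x. 0) \<in> mspan I d"
  unfolding mspan_def by (intro CollectI exI[of _ "\<lambda>_. 0"]) simp

lemma mspan_sum: "(\<And>a. a \<in> A \<Longrightarrow> F a \<in> mspan I d) \<Longrightarrow> (\<lambda>x. \<Sum>a\<in>A. F a x) \<in> mspan I d"
  by (induction A rule: infinite_finite_induct) (auto intro: mspan_zero mspan_add)

lemma mspan_monom:
  assumes "finite I" "\<And>i. i \<in> I \<Longrightarrow> \<alpha> i \<le> d"
  shows "(\<lambda>x. \<Prod>i\<in>I. x i ^ \<alpha> i) \<in> mspan I d"
proof -
  let ?A = "PiE I (\<lambda>_. {..d})" and ?r = "restrict \<alpha> I"
  have "?r \<in> ?A" using assms by auto
  have fin: "finite ?A" using assms by (intro finite_PiE) auto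
  have "(\<Prod>i\<in>I. x i ^ \<alpha> i) = (\<Sum>\<gamma>\<in>?A. (if \<gamma> = ?r then 1 else 0) * (\<Prod>i\<in>I. x i ^ \<gamma> i))" for x :: "'a \<Rightarrow> complex"
  proof -
    have "(\<Sum>\<gamma>\<in>?A. (if \<gamma> = ?r then 1 else 0) * (\<Prod>i\<in>I. x i ^ \<gamma> i)) =
        (\<Sum>\<gamma>\<in>?A. if \<gamma> = ?r then (\<Prod>i\<in>I. x i ^ \<gamma> i) else 0)"
      by (rule sum.cong) auto
    also have "\<dots> = (\<Prod>i\<in>I. x i ^ ?r i)" using \<open>?r \<in> ?A\<close> fin by (simp add: sum.delta)
    finally show ?thesis by simp
  qed
  then show ?thesis unfolding mspan_def by (intro CollectI exI[of _ "\<lambda>\<gamma>. if \<gamma> = ?r then 1 else 0"]) auto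
qed

lemma mspan_mult:
  assumes "finite I" "F \<in> mspan I d" "G \<in> mspan I e"
  shows "(\<lambda>x. F x * G x) \<in> mspan I (d + e)"
proof -
  obtain a b where F: "F = (\<lambda>x. \<Sum>\<alpha>\<in>PiE I (\<lambda>_. {..d}). a \<alpha> * (\<Prod>i\<in>I. x i ^ \<alpha> i))"
    and G: "G = (\<lambda>x. \<Sum>\<alpha>\<in>PiE I (\<lambda>_. {..e}). b \<alpha> * (\<Prod>i\<in>I. x i ^ \<alpha> i))"
    using assms unfolding mspan_def by auto
  have eq: "(\<lambda>x. F x * G x) = (\<lambda>x. \<Sum>\<alpha>\<in>PiE I (\<lambda>_. {..d}). \<Sum>\<beta>\<in>PiE I (\<lambda>_. {..e}).
      (a \<alpha> * b \<beta>) * (\<Prod>i\<in>I. x i ^ (\<alpha> i + \<beta> i)))"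
    unfolding F G sum_product by (simp add: power_add prod.distrib mult_ac)
  show ?thesis unfolding eq
    by (intro mspan_sum mspan_scale mspan_monom assms) (auto intro!: add_mono simp: PiE_iff)
qed

lemma mspan_mono:
  assumes "finite I" "F \<in> mspan I d" "d \<le> e"
  shows "F \<in> mspan I e"
proof -
  have "(\<lambda>x. \<Prod>i\<in>I. x i ^ 0) \<in> mspan I (e - d)" using assms(1) by (rule mspan_monom) simp
  from mspan_mult[OF assms(1,2) this] show ?thesis using assms(3) by simp
qed

lemma polyfun_mspan:
  assumes "F \<in> polyfun I" "finite I"
  shows "\<exists>d. F \<in> mspan I d"
  using assms(1)
proof induction
  case (const c)
  have "(\<lambda>x. c * (\<Prod>i\<in>I. x i ^ 0)) \<in> mspan I 0"
    using assms(2) by (intro mspan_scale mspan_monom) simp_all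
  then show ?case by auto
next
  case (coord j)
  have "(\<lambda>x. \<Prod>i\<in>I. x i ^ (if i = j then 1 else 0)) \<in> mspan I 1"
    using assms(2) by (rule mspan_monom) auto
  moreover have "(\<Prod>i\<in>I. x i ^ (if i = j then 1 else 0)) = x j" for x :: "'a \<Rightarrow> complex"
  proof -
    have "(\<Prod>i\<in>I. x i ^ (if i = j then 1 else 0)) = (\<Prod>i\<in>I. if i = j then x i else 1)"
      by (rule prod.cong) auto
    then show ?thesis using coord assms(2) by (simp add: prod.delta)
  qed
  ultimately show ?case by auto
next
  case (add F G)
  then obtain d e where "F \<in> mspan I d" "G \<in> mspan I e" by auto
  then have "F \<in> mspan I (max d e)" "G \<in> mspan I (max d e)"
    using mspan_mono assms(2) by (metis max.cobounded1, metis max.cobounded2)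
  then show ?case using mspan_add by blast
next
  case (mult F G)
  then show ?case using mspan_mult[OF assms(2)] by blast
qed

lemma mspan_power: "finite I \<Longrightarrow> F \<in> mspan I d \<Longrightarrow> (\<lambda>x. F x ^ k) \<in> mspan I (k * d)"
proof (induction k)
  case 0
  have "(\<lambda>x. \<Prod>i\<in>I. x i ^ 0) \<in> mspan I 0" using 0 by (intro mspan_monom) simp_all
  then show ?case by simp
next
  case (Suc k)
  then show ?case using mspan_mult[of I F d "\<lambda>x. F x ^ k" "k * d"] by simp
qed

lemma mspan_prod:
  assumes "finite I" "finite J" "\<And>j. j \<in> J \<Longrightarrow> F j \<in> mspan I d"
  shows "(\<lambda>x. \<Prod>j\<in>J. F j x) \<in> mspan I (card J * d)"
  using assms(2,3)
proof (induction J rule: finite_induct)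
  case empty
  have "(\<lambda>x. \<Prod>i\<in>I. x i ^ 0) \<in> mspan I 0" using assms(1) by (intro mspan_monom) simp_all
  then show ?case by simp
next
  case (insert j J)
  then show ?case using mspan_mult[OF assms(1), of "F j" d "\<lambda>x. \<Prod>j\<in>J. F j x" "card J * d"] by simp
qed

text \<open>The products of the \<open>F j\<close> with exponents at most \<open>N\<close> span a space of monomials whose
  dimension grows like \<open>N ^ card I\<close>, while their number is \<open>(N + 1) ^ card J\<close>.\<close>

lemma alg_indep_card_le:
  assumes "finite I" "finite J" "\<And>j. j \<in> J \<Longrightarrow> F j \<in> polyfun I" "alg_indep J F UNIV"
  shows "card J \<le> card I"
proof (rule ccontr)
  assume neg: "\<not> card J \<le> card I"
  have "\<exists>d. \<forall>j\<in>J. F j \<in> mspan I d"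
  proof -
    have "\<forall>j\<in>J. \<exists>d. F j \<in> mspan I d" using polyfun_mspan assms by blast
    then obtain d where d: "\<forall>j\<in>J. F j \<in> mspan I (d j)" by metis
    have "F j \<in> mspan I (\<Sum>j\<in>J. d j)" if "j \<in> J" for j
      using mspan_mono[OF assms(1)] d that member_le_sum[of j J d] assms(2) by blast
    then show ?thesis by blast
  qed
  then obtain d where d: "\<And>j. j \<in> J \<Longrightarrow> F j \<in> mspan I d" by blast
  define k where "k = card J"
  \<comment> \<open>Chosen to make the count work: ((N + 1) (k d + 1))^card I equals (N + 1)^card I
    * N, which is less than (N + 1)^(card I + 1) and hence than the number of products.\<close>
  define N where "N = (k * d + 1) ^ card I"
  define e where "e = k * (N * d)"
  let ?V = "PiE J (\<lambda>_. {..N})" and ?E = "PiE I (\<lambda>_. {..e})"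
  have "(\<lambda>x. \<Prod>j\<in>J. F j x ^ \<beta> j) \<in> mspan I e" if "\<beta> \<in> ?V" for \<beta>
    unfolding e_def k_def
  proof (rule mspan_prod[OF assms(1,2)])
    fix j assume "j \<in> J"
    then have "\<beta> j \<le> N" using that by auto
    then show "(\<lambda>x. F j x ^ \<beta> j) \<in> mspan I (N * d)"
      using mspan_mono[OF assms(1) mspan_power[OF assms(1) d[OF \<open>j \<in> J\<close>]], of "\<beta> j" "N * d"] by simp
  qed
  then have "\<forall>\<beta>\<in>?V. \<exists>a. (\<lambda>x. \<Prod>j\<in>J. F j x ^ \<beta> j) = (\<lambda>x. \<Sum>\<alpha>\<in>?E. a \<alpha> * (\<Prod>i\<in>I. x i ^ \<alpha> i))"
    unfolding mspan_def by blast
  then have "\<exists>a. \<forall>\<beta>\<in>?V.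
      (\<lambda>x. \<Prod>j\<in>J. F j x ^ \<beta> j) = (\<lambda>x. \<Sum>\<alpha>\<in>?E. a \<beta> \<alpha> * (\<Prod>i\<in>I. x i ^ \<alpha> i))"
    by (rule bchoice)
  then obtain a where a': "\<forall>\<beta>\<in>?V.
      (\<lambda>x. \<Prod>j\<in>J. F j x ^ \<beta> j) = (\<lambda>x. \<Sum>\<alpha>\<in>?E. a \<beta> \<alpha> * (\<Prod>i\<in>I. x i ^ \<alpha> i))" ..
  have a: "(\<lambda>x. \<Prod>j\<in>J. F j x ^ \<beta> j) = (\<lambda>x. \<Sum>\<alpha>\<in>?E. a \<beta> \<alpha> * (\<Prod>i\<in>I. x i ^ \<alpha> i))"
    if "\<beta> \<in> ?V" for \<beta>
    using a' that by (rule bspec)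
  have fin: "finite ?V" "finite ?E" using assms by (auto intro!: finite_PiE)
  have "card ?E = (e + 1) ^ card I" using assms(1) by (simp add: card_PiE)
  also have "\<dots> \<le> ((N + 1) * (k * d + 1)) ^ card I"
    by (rule power_mono) (auto simp: e_def algebra_simps)
  also have "\<dots> = (N + 1) ^ card I * N" by (simp only: power_mult_distrib N_def[symmetric])
  also have "\<dots> < (N + 1) ^ card I * (N + 1)" by simp
  also have "\<dots> = (N + 1) ^ Suc (card I)" by simp
  also have "\<dots> \<le> (N + 1) ^ card J" using neg by (intro power_increasing) auto
  also have "\<dots> = card ?V" using assms(2) by (simp add: card_PiE)
  finally have "card ?E < card ?V" .
  then obtain c where c: "\<exists>\<beta>\<in>?V. c \<beta> \<noteq> 0" "\<forall>\<alpha>\<in>?E. (\<Sum>\<beta>\<in>?V. a \<beta> \<alpha> * c \<beta>) = 0"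
    using homogeneous_system_nontrivial[OF fin(2,1), of "\<lambda>\<alpha> \<beta>. a \<beta> \<alpha>"] by blast
  define P where "P = (\<lambda>y. \<Sum>\<beta>\<in>?V. c \<beta> * (\<Prod>j\<in>J. y j ^ \<beta> j))"
  have "P \<in> polyfun J" unfolding P_def
    by (intro polyfun_sum polyfun.mult polyfun.const polyfun_prod polyfun_power polyfun.coord)
  moreover have "P (\<lambda>j. F j x) = 0" for x
  proof -
    have "P (\<lambda>j. F j x) = (\<Sum>\<beta>\<in>?V. \<Sum>\<alpha>\<in>?E. c \<beta> * (a \<beta> \<alpha> * (\<Prod>i\<in>I. x i ^ \<alpha> i)))"
      unfolding P_def
    proof (rule sum.cong)
      fix \<beta> assume "\<beta> \<in> ?V"
      then show "c \<beta> * (\<Prod>j\<in>J. F j x ^ \<beta> j) = (\<Sum>\<alpha>\<in>?E. c \<beta> * (a \<beta> \<alpha> * (\<Prod>i\<in>I. x i ^ \<alpha> i)))"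
        using fun_cong[OF a, of \<beta> x] by (simp add: sum_distrib_left)
    qed simp
    also have "\<dots> = (\<Sum>\<alpha>\<in>?E. (\<Sum>\<beta>\<in>?V. a \<beta> \<alpha> * c \<beta>) * (\<Prod>i\<in>I. x i ^ \<alpha> i))"
      by (subst sum.swap) (simp only: sum_distrib_left mult_ac)
    also have "\<dots> = 0" using c(2) by simp
    finally show ?thesis .
  qed
  ultimately have P0: "P y = 0" for y using alg_indepD[OF assms(4), of P] by simp
  have "c \<beta> = 0" if "\<beta> \<in> ?V" for \<beta>
    by (rule monomials_independent[OF assms(2) _ that]) (use P0 in \<open>simp add: P_def\<close>)
  then show False using c(1) by blast
qed

text \<open>A nonzero relation \<open>P\<close> has a nonzero homogeneous part of lowest degree at
  the point \<open>G x0\<close>. Some direction does not kill this part, and by surjectivity a line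
  through \<open>x0\<close> leaves in that direction. Along this line \<open>P\<close> is t^k times
  a function that is nonzero at 0.\<close>

lemma alg_indep_of_dird_surj:
  assumes I: "finite I" "finite J" and G: "\<And>j. j \<in> J \<Longrightarrow> G j \<in> polyfun I"
    and surj: "\<And>w. \<exists>v. \<forall>j\<in>J. dird I (G j) x0 v = w j"
  shows "alg_indep J G UNIV"
  unfolding alg_indep_def
proof (intro ballI impI allI, rule ccontr)
  fix P y assume P: "P \<in> polyfun J" and rel: "\<forall>x\<in>UNIV. P (\<lambda>j. G j x) = 0" and y: "P y \<noteq> 0"
  obtain r d where r: "\<And>k. (\<lambda>w. coeff (r w) k) \<in> polyfun J" "\<And>w. degree (r w) \<le> d"
    "\<And>w s. P (\<lambda>j. G j x0 + s * w j) = poly (r w) s"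
    using polyfun_line_expand[OF P, of "\<lambda>j. G j x0"] by blast
  have "\<exists>k w. coeff (r w) k \<noteq> 0"
  proof (rule ccontr)
    assume "\<not> ?thesis"
    then have "r w = 0" for w by (simp add: poly_eq_iff)
    then show False using r(3)[of 1 "\<lambda>j. y j - G j x0"] y by simp
  qed
  then obtain w0 where w0: "coeff (r w0) (LEAST k. \<exists>w. coeff (r w) k \<noteq> 0) \<noteq> 0"
    using LeastI_ex[of "\<lambda>k. \<exists>w. coeff (r w) k \<noteq> 0"] by blast
  \<comment> \<open>The order of vanishing of \<open>P\<close> at the point
    \<open>G x0\<close>.\<close>
  define k where "k = (LEAST k. \<exists>w. coeff (r w) k \<noteq> 0)"
  have low: "coeff (r w) l = 0" if "l < k" for l w
    using not_less_Least[OF that[unfolded k_def]] by blast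
  obtain v where v: "\<forall>j\<in>J. dird I (G j) x0 v = w0 j" using surj by blast
  have "\<forall>j\<in>J. \<exists>q. (\<forall>t. G j (\<lambda>i. x0 i + t * v i) = G j x0 + t * poly q t) \<and> poly q 0 = w0 j"
    using polyfun_taylor[OF I(1) G, of _ 1 "\<lambda>i. [:x0 i:]" "\<lambda>i. [:v i:]"] v by simp
  then obtain q where q: "\<And>j t. j \<in> J \<Longrightarrow> G j (\<lambda>i. x0 i + t * v i) = G j x0 + t * poly (q j) t"
    "\<And>j. j \<in> J \<Longrightarrow> poly (q j) 0 = w0 j"
    by metis
  have zero: "poly (r (\<lambda>j. poly (q j) t)) t = 0" for t
  proof -
    have "P (\<lambda>j. G j x0 + t * poly (q j) t) = P (\<lambda>j. G j (\<lambda>i. x0 i + t * v i))"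
      by (rule polyfun_cong[OF P]) (simp add: q)
    then show ?thesis using rel r(3)[of t "\<lambda>j. poly (q j) t"] by simp
  qed
  have "\<forall>l. \<exists>p. \<forall>t. poly p t = coeff (r (\<lambda>j. poly (q j) t)) l"
    using polyfun_along_ex[OF r(1)] by blast
  then obtain p where p: "\<And>l t. poly (p l) t = coeff (r (\<lambda>j. poly (q j) t)) l"
    by metis
  \<comment> \<open>The relation along the line, divided by t^k; its value at 0 is the lowest part
    at \<open>w0\<close>.\<close>
  define S where "S = (\<Sum>l\<le>d. p (l + k) * monom 1 l)"
  have "t ^ k * poly S t = 0" for t
  proof -
    have "0 = poly (r (\<lambda>j. poly (q j) t)) t" by (simp add: zero)
    also have "\<dots> = (\<Sum>l\<le>d + k. poly (p l) t * t ^ l)"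
      by (subst poly_eq_sum_le[of _ "d + k"]) (auto simp: p intro: order_trans[OF r(2)])
    also have "\<dots> = (\<Sum>l\<in>{k..d + k}. poly (p l) t * t ^ l)"
      by (rule sum.mono_neutral_right) (auto simp: p low)
    also have "\<dots> = (\<Sum>l\<le>d. poly (p (l + k)) t * t ^ (l + k))"
      by (rule sum.reindex_bij_witness[of _ "\<lambda>l. l + k" "\<lambda>l. l - k"]) auto
    also have "\<dots> = t ^ k * poly S t"
      by (simp add: S_def poly_sum poly_monom sum_distrib_left power_add mult_ac)
    finally show ?thesis by simp
  qed
  then have "poly (monom 1 k * S) t = 0" for t by (simp add: poly_monom)
  then have "monom 1 k * S = 0" using poly_all_0_iff_0 by blast
  then have "S = 0" by simp
  then have "0 = poly S 0" by simp
  also have "\<dots> = (\<Sum>l\<le>d. poly (p (l + k)) 0 * 0 ^ l)"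
    by (simp add: S_def poly_sum poly_monom)
  also have "\<dots> = poly (p k) 0"
    by (subst sum.remove[of _ 0]) auto
  also have "\<dots> = coeff (r (\<lambda>j. poly (q j) 0)) k" by (rule p)
  also have "\<dots> = coeff (r w0) k"
    by (rule polyfun_cong[OF r(1)]) (simp add: q)
  finally show False using w0 by (simp add: k_def)
qed

text \<open>Take a relation of least degree in the new function. Degree 0 would be a relation among
  the old ones. If the derivative vanished along the family, it would give a relation of smaller
  degree unless it is zero, and in characteristic 0 a zero derivative forces degree 0.\<close>

lemma alg_indep_insert_relation:
  assumes indep: "alg_indep J G UNIV" and fin: "finite J"
    and dep: "\<not> alg_indep (insert i J) G UNIV"
  shows "\<exists>p d. (\<forall>k. (\<lambda>y. coeff (p y) k) \<in> polyfun J) \<and> (\<forall>y. degree (p y) \<le> d) \<and>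
    (\<forall>x. poly (p (\<lambda>j. G j x)) (G i x) = 0) \<and> (\<exists>x. poly (pderiv (p (\<lambda>j. G j x))) (G i x) \<noteq> 0)"
proof -
  define R where "R d \<longleftrightarrow> (\<exists>p. (\<forall>k. (\<lambda>y. coeff (p y) k) \<in> polyfun J) \<and> (\<forall>y. degree (p y) \<le> d) \<and>
    (\<forall>x. poly (p (\<lambda>j. G j x)) (G i x) = 0) \<and> (\<exists>y. p y \<noteq> 0))" for d
  obtain P y where P: "P \<in> polyfun (insert i J)" "\<And>x. P (\<lambda>j. G j x) = 0" "P y \<noteq> 0"
    using dep unfolding alg_indep_def by auto
  obtain p d where p: "\<forall>k. (\<lambda>x. coeff (p x) k) \<in> polyfun J" "\<forall>x. degree (p x) \<le> d"
    "\<forall>x. P x = poly (p x) (x i)"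
    using polyfun_expand[OF P(1)] by blast
  have "p y \<noteq> 0" using P(3) p(3) by auto
  moreover have "poly (p (\<lambda>j. G j x)) (G i x) = 0" for x using P(2)[of x] p(3) by simp
  ultimately have "R d" using p(1,2) unfolding R_def by blast
  define d0 where "d0 = (LEAST d. R d)"
  have "R d0" unfolding d0_def using \<open>R d\<close> by (rule LeastI)
  then obtain p where p: "\<And>k. (\<lambda>y. coeff (p y) k) \<in> polyfun J" "\<And>y. degree (p y) \<le> d0"
    "\<And>x. poly (p (\<lambda>j. G j x)) (G i x) = 0" "\<exists>y. p y \<noteq> 0"
    unfolding R_def by blast
  have pos: "d0 \<noteq> 0"
  proof
    assume "d0 = 0"
    then have c: "p y = [:coeff (p y) 0:]" for y
      using p(2)[of y] by (metis le_zero_eq degree_eq_zeroE coeff_pCons_0)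
    have "coeff (p (\<lambda>j. G j x)) 0 = 0" for x
      using p(3)[of x] by (subst (asm) c) simp
    then have "coeff (p y) 0 = 0" for y
      using alg_indepD[OF indep p(1)[of 0]] by simp
    then have "p y = 0" for y by (subst c) simp
    then show False using p(4) by blast
  qed
  have "\<exists>x. poly (pderiv (p (\<lambda>j. G j x))) (G i x) \<noteq> 0"
  proof (rule ccontr)
    assume neg: "\<not> ?thesis"
    have "\<not> R (d0 - 1)" using pos not_less_Least[of "d0 - 1" R] unfolding d0_def[symmetric] by simp
    moreover have "(\<lambda>y. coeff (pderiv (p y)) k) \<in> polyfun J" for k
      unfolding coeff_pderiv by (intro polyfun.mult polyfun.const p(1))
    moreover have "degree (pderiv (p y)) \<le> d0 - 1" for y
      using p(2)[of y] by (simp add: degree_pderiv)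
    ultimately have "pderiv (p y) = 0" for y
      using neg unfolding R_def by (auto dest!: spec[of _ "\<lambda>y. pderiv (p y)"])
    then have "degree (p y) \<le> 0" for y by (simp add: pderiv_eq_0_iff)
    then have "R 0" unfolding R_def using p by blast
    then have "d0 = 0" unfolding d0_def by (simp add: Least_eq_0)
    then show False using pos by simp
  qed
  then show ?thesis using p by blast
qed

text \<open>The Jacobian criterion: coordinates \<open>x i\<close>, \<open>i \<in> B\<close>, complete the \<open>F j\<close> to a maximal
  algebraically independent family, and differentiating the minimal relation of any other
  coordinate over this family shows that its variation is determined by the others.\<close>

lemma alg_indep_jacobian:
  fixes F :: "'j \<Rightarrow> ('i \<Rightarrow> complex) \<Rightarrow> complex"
  assumes I: "finite I" "finite J" and F: "\<And>j. j \<in> J \<Longrightarrow> F j \<in> polyfun I"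
    and indep: "alg_indep J F UNIV" and h: "h \<in> polyfun I" "h y \<noteq> 0"
  shows "\<exists>x B. h x \<noteq> 0 \<and> B \<subseteq> I \<and> card J + card B \<le> card I \<and>
    (\<forall>v. (\<forall>j\<in>J. dird I (F j) x v = 0) \<longrightarrow> (\<forall>i\<in>B. v i = 0) \<longrightarrow> (\<forall>i\<in>I. v i = 0))"
proof -
  \<comment> \<open>The family is indexed by a sum type: \<open>Inl\<close> for the given functions,
    \<open>Inr\<close> for the coordinates that complete them.\<close>
  define G where "G = case_sum F (\<lambda>i x. x i)"
  define good where "good B \<longleftrightarrow> B \<subseteq> I \<and> alg_indep (J <+> B) G UNIV" for B
  have "good {}"
    unfolding good_def alg_indep_def
  proof (intro conjI ballI impI allI)
    fix P y assume P: "P \<in> polyfun (J <+> {})" "\<forall>x\<in>UNIV. P (\<lambda>j. G j x) = 0"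
    let ?P = "\<lambda>w. P (\<lambda>j. case j of Inl j \<Rightarrow> w j | Inr i \<Rightarrow> 0)"
    have P1: "?P \<in> polyfun J"
      by (rule polyfun_compose[OF P(1)]) (auto intro: polyfun.intros)
    have P2: "?P (\<lambda>j. F j x) = 0" for x
    proof -
      have "?P (\<lambda>j. F j x) = P (\<lambda>j. G j x)"
        by (rule polyfun_cong[OF P(1)]) (auto simp: G_def)
      then show ?thesis using bspec[OF P(2), of x] by simp
    qed
    have "P y = ?P (\<lambda>j. y (Inl j))"
      by (rule polyfun_cong[OF P(1)]) auto
    also have "\<dots> = 0" by (rule alg_indepD[OF indep P1]) (rule P2)
    finally show "P y = 0" .
  qed simp
  moreover have "card B \<le> card I" if "good B" for B
    using that I by (auto simp: good_def intro: card_mono)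
  ultimately obtain B where B: "good B" "\<And>B'. good B' \<Longrightarrow> card B' \<le> card B"
    using ex_has_greatest_nat[of good "{}" card "Suc (card I)"] by (metis less_Suc_eq_le)
  have BI: "B \<subseteq> I" "finite B" and indB: "alg_indep (J <+> B) G UNIV"
    using B(1) I by (auto simp: good_def intro: finite_subset)
  have Gpoly: "G j \<in> polyfun I" if "j \<in> J <+> I" for j
    using that F by (auto simp: G_def intro: polyfun.intros)
  have le: "card J + card B \<le> card I"
  proof -
    have "card (J <+> B) \<le> card I"
      by (rule alg_indep_card_le[OF I(1) _ _ indB]) (use I BI Gpoly in auto)
    then show ?thesis using I BI by (simp add: card_Plus)
  qed
  have dep: "\<not> alg_indep (insert (Inr i) (J <+> B)) G UNIV" if "i \<in> I - B" for i
  proof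
    assume a: "alg_indep (insert (Inr i) (J <+> B)) G UNIV"
    have "insert (Inr i) (J <+> B) = J <+> insert i B" by auto
    then have "good (insert i B)" using a that BI by (auto simp: good_def)
    from B(2)[OF this] show False using that BI by simp
  qed
  have "\<forall>i\<in>I - B. \<exists>p d. (\<forall>k. (\<lambda>y. coeff (p y) k) \<in> polyfun (J <+> B)) \<and> (\<forall>y. degree (p y) \<le> d) \<and>
    (\<forall>x. poly (p (\<lambda>j. G j x)) (x i) = 0) \<and> (\<exists>x. poly (pderiv (p (\<lambda>j. G j x))) (x i) \<noteq> 0)"
  proof
    fix i assume "i \<in> I - B"
    from alg_indep_insert_relation[OF indB _ dep[OF this]]
    show "\<exists>p d. (\<forall>k. (\<lambda>y. coeff (p y) k) \<in> polyfun (J <+> B)) \<and> (\<forall>y. degree (p y) \<le> d) \<and>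
      (\<forall>x. poly (p (\<lambda>j. G j x)) (x i) = 0) \<and> (\<exists>x. poly (pderiv (p (\<lambda>j. G j x))) (x i) \<noteq> 0)"
      using I BI by (simp add: G_def)
  qed
  then obtain p where p: "\<forall>i\<in>I - B. \<exists>d. (\<forall>k. (\<lambda>y. coeff (p i y) k) \<in> polyfun (J <+> B)) \<and>
    (\<forall>y. degree (p i y) \<le> d) \<and> (\<forall>x. poly (p i (\<lambda>j. G j x)) (x i) = 0) \<and>
    (\<exists>x. poly (pderiv (p i (\<lambda>j. G j x))) (x i) \<noteq> 0)"
    by (rule bchoice[THEN exE])
  then obtain d where d': "\<forall>i\<in>I - B. (\<forall>k. (\<lambda>y. coeff (p i y) k) \<in> polyfun (J <+> B)) \<and>
    (\<forall>y. degree (p i y) \<le> d i) \<and> (\<forall>x. poly (p i (\<lambda>j. G j x)) (x i) = 0) \<and>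
    (\<exists>x. poly (pderiv (p i (\<lambda>j. G j x))) (x i) \<noteq> 0)"
    by (rule bchoice[THEN exE])
  have p1: "(\<lambda>y. coeff (p i y) k) \<in> polyfun (J <+> B)"
    and p2: "degree (p i y) \<le> d i" and p3: "poly (p i (\<lambda>j. G j x)) (x i) = 0"
    and p4: "\<exists>x. poly (pderiv (p i (\<lambda>j. G j x))) (x i) \<noteq> 0" if "i \<in> I - B" for i k x y
    using bspec[OF d' that] by simp_all
  define D where "D i x = poly (pderiv (p i (\<lambda>j. G j x))) (x i)" for i x
  have coeffG: "(\<lambda>x. coeff (p i (\<lambda>j. G j x)) k) \<in> polyfun I" if "i \<in> I - B" for i k
    by (rule polyfun_compose[OF p1[OF that]]) (use Gpoly BI in auto)
  have Dsum: "D i x = (\<Sum>k\<le>d i. of_nat (Suc k) * coeff (p i (\<lambda>j. G j x)) (Suc k) * x i ^ k)"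
    if "i \<in> I - B" for i x
  proof -
    have "degree (pderiv (p i (\<lambda>j. G j x))) \<le> d i"
      using p2[OF that, of "\<lambda>j. G j x"] by (simp add: degree_pderiv)
    then show ?thesis unfolding D_def by (subst poly_eq_sum_le) (simp_all add: coeff_pderiv)
  qed
  have Dpoly: "D i \<in> polyfun I" if "i \<in> I - B" for i
  proof -
    have "(\<lambda>x. D i x) \<in> polyfun I" unfolding Dsum[OF that]
      by (intro polyfun_sum polyfun.mult polyfun.const polyfun_power polyfun.coord coeffG)
        (use that in auto)
    then show ?thesis by simp
  qed
  \<comment> \<open>A common point off the zero sets of \<open>h\<close> and of all derivatives of
    minimal relations; there every remaining coordinate is determined to first order.\<close>
  have "\<exists>z. \<forall>a\<in>insert None (Some ` (I - B)). (case a of None \<Rightarrow> h | Some i \<Rightarrow> D i) z \<noteq> 0"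
  proof (rule polyfun_all_nonzero[where I = I])
    fix a assume "a \<in> insert None (Some ` (I - B))"
    then show "\<exists>x. (case a of None \<Rightarrow> h | Some i \<Rightarrow> D i) x \<noteq> 0"
      "(case a of None \<Rightarrow> h | Some i \<Rightarrow> D i) \<in> polyfun I"
      using h Dpoly p4 by (auto simp: D_def)
  qed (use I in auto)
  then obtain z where z: "h z \<noteq> 0" "\<And>i. i \<in> I - B \<Longrightarrow> D i z \<noteq> 0" by auto
  have "v i = 0" if v: "\<forall>j\<in>J. dird I (F j) z v = 0" "\<forall>i\<in>B. v i = 0" and i: "i \<in> I" for v i
  proof (cases "i \<in> B")
    case True
    then show ?thesis using v by simp
  next
    case False
    then have iB: "i \<in> I - B" using i by simp
    let ?l = "\<lambda>s j. z j + s * v j"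
    have G0: "((\<lambda>s. G j (?l s)) has_field_derivative 0) (at 0)" if "j \<in> J <+> B" for j
    proof (cases j)
      case (Inl a)
      then have "a \<in> J" using that by auto
      then show ?thesis using has_field_derivative_dird[OF I(1) F[of a], of z v] v(1) Inl
        by (simp add: G_def)
    next
      case (Inr b)
      then have "v b = 0" using v(2) that by auto
      then show ?thesis using Inr by (simp add: G_def)
    qed
    \<comment> \<open>The coefficients depend only on the maximal family, whose members are all
      stationary in the direction \<open>v\<close>.\<close>
    have c0: "((\<lambda>s. coeff (p i (\<lambda>j. G j (?l s))) k) has_field_derivative 0) (at 0)" for k
    proof -
      have "finite (J <+> B)" using I BI by simp
      from has_field_derivative_polyfun[OF this p1[OF iB, of k], of "\<lambda>j s. G j (?l s)" "\<lambda>_. 0" 0]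
      show ?thesis using G0 by (simp add: dird_def)
    qed
    let ?c = "\<lambda>s k. coeff (p i (\<lambda>j. G j (?l s))) k"
    have "((\<lambda>s. \<Sum>k\<le>Suc (d i). ?c s k * (z i + s * v i) ^ k) has_field_derivative
        (\<Sum>k\<le>Suc (d i). ?c 0 k * (of_nat k * z i ^ (k - 1) * v i))) (at 0)"
      by (rule DERIV_sum) (auto intro!: derivative_eq_intros c0)
    moreover have "(\<Sum>k\<le>Suc (d i). ?c s k * (z i + s * v i) ^ k) = 0" for s
    proof -
      have "degree (p i (\<lambda>j. G j (?l s))) \<le> Suc (d i)"
        using p2[OF iB, of "\<lambda>j. G j (?l s)"] by simp
      then show ?thesis using p3[OF iB, of "?l s"] by (simp only: poly_eq_sum_le)
    qed
    ultimately have "((\<lambda>s. 0) has_field_derivative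
        (\<Sum>k\<le>Suc (d i). ?c 0 k * (of_nat k * z i ^ (k - 1) * v i))) (at (0::complex))"
      by simp
    then have "0 = (\<Sum>k\<le>Suc (d i). ?c 0 k * (of_nat k * z i ^ (k - 1) * v i))"
      using DERIV_unique[OF DERIV_const] by blast
    also have "\<dots> = (\<Sum>k\<le>d i. ?c 0 (Suc k) * (of_nat (Suc k) * z i ^ k * v i))"
      by (subst sum.atMost_Suc_shift) simp
    also have "\<dots> = D i z * v i"
      unfolding Dsum[OF iB] by (simp add: sum_distrib_left mult_ac)
    finally show ?thesis using z(2)[OF iB] by simp
  qed
  then show ?thesis using z(1) BI le by (intro exI[of _ z] exI[of _ B]) auto
qed

section \<open>Krull dimension of subsets of affine space\<close>

lemma eval_cpoly_polyfun:
  assumes "f \<in> cpoly_ring I"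
  shows "(\<lambda>x. eval_cpoly id x f) \<in> polyfun I"
  unfolding eval_cpoly_def eval_monom_def
  by (intro polyfun_sum polyfun.mult polyfun.const polyfun_prod polyfun_power polyfun.coord)
    (use assms in \<open>auto simp: cpoly_ring_def\<close>)

lemma cpoly_ring_single: "Poly_Mapping.keys \<mu> \<subseteq> I \<Longrightarrow> Poly_Mapping.single \<mu> c \<in> cpoly_ring I"
  by (auto simp: cpoly_ring_def)

lemma cpoly_ring_add: "f \<in> cpoly_ring I \<Longrightarrow> g \<in> cpoly_ring I \<Longrightarrow> f + g \<in> cpoly_ring I"
  using Poly_Mapping.keys_add[of f g] by (fastforce simp: cpoly_ring_def)

lemma polyfun_cpoly_ex:
  assumes "F \<in> polyfun I"
  shows "\<exists>f\<in>cpoly_ring I. \<forall>x. eval_cpoly id x f = F x"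
  using assms
proof induction
  case (const c)
  show ?case
    by (intro bexI[of _ "Poly_Mapping.single 0 c"] allI, subst eval_cpoly_single)
      (auto simp: comm_ring_hom_id_complex eval_monom_def intro: cpoly_ring_single)
next
  case (coord i)
  then show ?case
    by (intro bexI[of _ "Poly_Mapping.single (Poly_Mapping.single i 1) 1"] allI, subst eval_cpoly_single)
      (auto simp: comm_ring_hom_id_complex eval_monom_def intro: cpoly_ring_single)
next
  case (add F G)
  then obtain f g where "f \<in> cpoly_ring I" "g \<in> cpoly_ring I"
    "\<forall>x. eval_cpoly id x f = F x" "\<forall>x. eval_cpoly id x g = G x" by blast
  then show ?case
    by (intro bexI[of _ "f + g"] allI, subst eval_cpoly_add)
      (simp_all add: comm_ring_hom_id_complex cpoly_ring_add del: id_apply)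
next
  case (mult F G)
  then obtain f g where "f \<in> cpoly_ring I" "g \<in> cpoly_ring I"
    "\<forall>x. eval_cpoly id x f = F x" "\<forall>x. eval_cpoly id x g = G x" by blast
  then show ?case
    by (intro bexI[of _ "f * g"] allI, subst eval_cpoly_mult)
      (simp_all add: comm_ring_hom_id_complex cpoly_ring_mult del: id_apply)
qed

lemma closedin_zariski_subtopology_zeros:
  assumes "F \<in> polyfun I" "S \<subseteq> I \<rightarrow>\<^sub>E UNIV"
  shows "closedin (subtopology (zariski I) S) {x \<in> S. F x = 0}"
proof -
  obtain f where f: "f \<in> cpoly_ring I" "\<forall>x. eval_cpoly id x f = F x"
    using polyfun_cpoly_ex[OF assms(1)] by blast
  have "closedin (zariski I) (affine_points id I {f})"
    unfolding closedin_zariski using f by blast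
  moreover have "{x \<in> S. F x = 0} = affine_points id I {f} \<inter> S"
    using assms(2) f(2) by (auto simp: affine_points_def)
  ultimately show ?thesis unfolding closedin_subtopology by blast
qed

lemma closedin_zariski_subtopology_separate:
  assumes "closedin (subtopology (zariski I) S) Z" "x \<in> S" "x \<notin> Z" "S \<subseteq> I \<rightarrow>\<^sub>E UNIV"
  shows "\<exists>F\<in>polyfun I. F x \<noteq> 0 \<and> (\<forall>z\<in>Z. F z = 0)"
proof -
  obtain T where "closedin (zariski I) T" "Z = T \<inter> S"
    using assms(1) unfolding closedin_subtopology by blast
  then obtain J where J: "J \<subseteq> cpoly_ring I" "Z = affine_points id I J \<inter> S"
    unfolding closedin_zariski by blast
  then have "x \<notin> affine_points id I J" using assms by blast
  then obtain f where "f \<in> J" "eval_cpoly id x f \<noteq> 0"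
    using assms(2,4) unfolding affine_points_def by blast
  then show ?thesis
    using J by (intro bexI[of _ "\<lambda>x. eval_cpoly id x f"])
      (auto simp: affine_points_def intro: eval_cpoly_polyfun)
qed

lemma subtopology_subtopology_subset:
  "Z \<subseteq> S \<Longrightarrow> subtopology (subtopology X S) Z = subtopology X Z"
  by (simp add: subtopology_subtopology Int_absorb1)

lemma irreducible_space_zariskiD:
  assumes "irreducible_space (subtopology (zariski I) Z)" "Z \<subseteq> I \<rightarrow>\<^sub>E UNIV"
    and "F \<in> polyfun I" "G \<in> polyfun I" "\<And>z. z \<in> Z \<Longrightarrow> F z * G z = 0"
  shows "(\<forall>z\<in>Z. F z = 0) \<or> (\<forall>z\<in>Z. G z = 0)"
proof -
  have top: "topspace (subtopology (zariski I) Z) = Z"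
    using assms(2) by (auto simp: topspace_zariski)
  have "{z \<in> Z. F z = 0} \<union> {z \<in> Z. G z = 0} = Z" using assms(5) by auto
  then have "{z \<in> Z. F z = 0} = Z \<or> {z \<in> Z. G z = 0} = Z"
    using assms(1) closedin_zariski_subtopology_zeros[OF assms(3,2)]
      closedin_zariski_subtopology_zeros[OF assms(4,2)]
    unfolding irreducible_space_def top by blast
  then show ?thesis by blast
qed

text \<open>Two proper closed subsets covering \<open>Z\<close> would be separated from suitable
  points by functions whose product vanishes on \<open>Z\<close>; so primality of the vanishing
  ideal is enough.\<close>

lemma irreducible_space_zariskiI:
  assumes "Z \<noteq> {}" "Z \<subseteq> I \<rightarrow>\<^sub>E UNIV"
    and "\<And>F G. F \<in> polyfun I \<Longrightarrow> G \<in> polyfun I \<Longrightarrow> (\<And>z. z \<in> Z \<Longrightarrow> F z * G z = 0) \<Longrightarrow>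
      (\<forall>z\<in>Z. F z = 0) \<or> (\<forall>z\<in>Z. G z = 0)"
  shows "irreducible_space (subtopology (zariski I) Z)"
proof -
  have top: "topspace (subtopology (zariski I) Z) = Z"
    using assms(2) by (auto simp: topspace_zariski)
  show ?thesis unfolding irreducible_space_def top
  proof (intro conjI allI impI)
    fix C D assume "closedin (subtopology (zariski I) Z) C \<and>
      closedin (subtopology (zariski I) Z) D \<and> C \<union> D = Z"
    then have C: "closedin (subtopology (zariski I) Z) C"
      and D: "closedin (subtopology (zariski I) Z) D" and CD: "C \<union> D = Z" by auto
    show "C = Z \<or> D = Z"
    proof (rule ccontr)
      assume "\<not> ?thesis"
      then obtain x y where xy: "x \<in> Z" "x \<notin> C" "y \<in> Z" "y \<notin> D" using CD by blast
      obtain F where F: "F \<in> polyfun I" "F x \<noteq> 0" "\<forall>z\<in>C. F z = 0"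
        using closedin_zariski_subtopology_separate[OF C xy(1,2) assms(2)] by blast
      obtain G where G: "G \<in> polyfun I" "G y \<noteq> 0" "\<forall>z\<in>D. G z = 0"
        using closedin_zariski_subtopology_separate[OF D xy(3,4) assms(2)] by blast
      have "F z * G z = 0" if "z \<in> Z" for z using that CD F G by auto
      from assms(3)[OF F(1) G(1) this] show False using xy F G by blast
    qed
  qed (rule assms(1))
qed

text \<open>Functions separating the members of a chain of irreducible closed sets are algebraically
  independent: restricted to the smaller set, a relation loses the terms containing the last
  function, and on the larger set this function can be cancelled.\<close>

lemma alg_indep_chain_step:
  assumes irr: "irreducible_space (subtopology (zariski I) Z')" and Z: "Z \<subseteq> Z'" "Z' \<subseteq> I \<rightarrow>\<^sub>E UNIV"
    and F: "\<And>i. i \<le> j \<Longrightarrow> F i \<in> polyfun I"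
    and indep: "alg_indep {..<j} F Z"
    and van: "\<And>z. z \<in> Z \<Longrightarrow> F j z = 0" and nonvan: "\<not> (\<forall>z\<in>Z'. F j z = 0)"
  shows "alg_indep {..<Suc j} F Z'"
  unfolding alg_indep_def
proof (intro ballI impI allI)
  fix P y assume P: "P \<in> polyfun {..<Suc j}" and rel: "\<forall>x\<in>Z'. P (\<lambda>j. F j x) = 0"
  have coeffs: "\<forall>k\<le>d. \<forall>y. c k y = 0"
    if "\<And>k. c k \<in> polyfun {..<j}"
      and "\<And>x. x \<in> Z' \<Longrightarrow> (\<Sum>k\<le>d. c k (\<lambda>j. F j x) * F j x ^ k) = 0" for c d
    using that
  proof (induction d arbitrary: c)
    case 0
    then have "c 0 (\<lambda>j. F j x) = 0" if "x \<in> Z" for x using that Z by force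
    then show ?case using alg_indepD[OF indep 0(1)[of 0]] by blast
  next
    case (Suc d)
    have zero: "c 0 (\<lambda>j. F j x) = 0" if "x \<in> Z" for x
    proof -
      have "(\<Sum>k\<le>Suc d. c k (\<lambda>j. F j x) * F j x ^ k) = c 0 (\<lambda>j. F j x)"
        using van[OF that] by (subst sum.remove[of _ 0]) auto
      then show ?thesis using Suc.prems(2)[of x] that Z by auto
    qed
    have c0: "c 0 y = 0" for y
      by (rule alg_indepD[OF indep Suc.prems(1)]) (rule zero)
    let ?G = "\<lambda>x. \<Sum>k\<le>d. c (Suc k) (\<lambda>j. F j x) * F j x ^ k"
    have "F j x * ?G x = 0" if "x \<in> Z'" for x
    proof -
      have "(\<Sum>k\<le>Suc d. c k (\<lambda>j. F j x) * F j x ^ k) = F j x * ?G x"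
        by (subst sum.atMost_Suc_shift) (simp add: c0 sum_distrib_left mult_ac)
      then show ?thesis using Suc.prems(2)[OF that] by simp
    qed
    moreover have "?G \<in> polyfun I"
      by (intro polyfun_sum polyfun.mult polyfun_power polyfun_compose[OF Suc.prems(1)] F) auto
    ultimately have "\<forall>z\<in>Z'. ?G z = 0"
      using irreducible_space_zariskiD[OF irr Z(2) F[of j], of ?G] nonvan by blast
    then have "\<forall>k\<le>d. \<forall>y. c (Suc k) y = 0"
      using Suc.IH[of "\<lambda>k. c (Suc k)"] Suc.prems(1) by blast
    then show ?case using c0 by (metis Suc_le_mono not0_implies_Suc)
  qed
  obtain p d where p: "\<forall>k. (\<lambda>x. coeff (p x) k) \<in> polyfun {..<j}" "\<forall>x. degree (p x) \<le> d"
    "\<forall>x. P x = poly (p x) (x j)"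
    using polyfun_expand[of P j "{..<j}"] P by (auto simp: lessThan_Suc)
  have "\<forall>k\<le>d. \<forall>y. coeff (p y) k = 0"
  proof (rule coeffs)
    fix x assume "x \<in> Z'"
    then show "(\<Sum>k\<le>d. coeff (p (\<lambda>j. F j x)) k * F j x ^ k) = 0"
      using p(2,3) rel by (simp add: poly_eq_sum_le[symmetric])
  qed (use p in blast)
  then have "coeff (p y) k = 0" for k
    using p(2)[rule_format, of y] by (cases "k \<le> d") (auto intro: coeff_eq_0)
  then have "p y = 0" by (simp add: poly_eq_iff)
  then show "P y = 0" using p(3) by simp
qed

lemma alg_indep_superset: "alg_indep J F X \<Longrightarrow> X \<subseteq> Y \<Longrightarrow> alg_indep J F Y"
  unfolding alg_indep_def by blast

text \<open>A chain of length \<open>k\<close> yields \<open>k\<close> functions, the one of index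
  \<open>i\<close> vanishing on \<open>Z i\<close> but not on its successor. By
  \<open>alg_indep_chain_step\<close> they are independent on the largest member and hence on
  \<open>S\<close>.\<close>

lemma krull_dim_zariski_le:
  fixes D :: nat
  assumes S: "S \<subseteq> I \<rightarrow>\<^sub>E UNIV"
    and bound: "\<And>F k. (\<And>i. i < k \<Longrightarrow> F i \<in> polyfun I) \<Longrightarrow> alg_indep {..<k} F S \<Longrightarrow> k \<le> D"
  shows "krull_dim (subtopology (zariski I) S) \<le> ereal (real D)"
  unfolding krull_dim_def
proof (rule Sup_least, clarify)
  fix k Z
  assume Z: "\<forall>i\<le>k. closedin (subtopology (zariski I) S) (Z i) \<and>
      irreducible_space (subtopology (subtopology (zariski I) S) (Z i))"
    and chain: "\<forall>i<k. Z i \<subset> Z (Suc i)"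
  have ZS: "Z i \<subseteq> S" if "i \<le> k" for i
  proof -
    have "closedin (subtopology (zariski I) S) (Z i)" using Z that by blast
    then show ?thesis using closedin_subset by fastforce
  qed
  have irr: "irreducible_space (subtopology (zariski I) (Z i))" if "i \<le> k" for i
    using Z that ZS[OF that] by (metis subtopology_subtopology_subset)
  have "\<exists>F\<in>polyfun I. (\<forall>z\<in>Z i. F z = 0) \<and> \<not> (\<forall>z\<in>Z (Suc i). F z = 0)" if "i < k" for i
  proof -
    obtain x where x: "x \<in> Z (Suc i)" "x \<notin> Z i" using chain \<open>i < k\<close> by blast
    have "closedin (subtopology (zariski I) S) (Z i)" using Z that by simp
    from closedin_zariski_subtopology_separate[OF this _ x(2) S]
    show ?thesis using x ZS[of "Suc i"] that by (meson Suc_leI subsetD)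
  qed
  then obtain F where F: "\<And>i. i < k \<Longrightarrow> F i \<in> polyfun I" "\<And>i z. i < k \<Longrightarrow> z \<in> Z i \<Longrightarrow> F i z = 0"
    "\<And>i. i < k \<Longrightarrow> \<not> (\<forall>z\<in>Z (Suc i). F i z = 0)"
    by metis
  have "alg_indep {..<j} F (Z j)" if "j \<le> k" for j
    using that
  proof (induction j)
    case 0
    obtain z where "z \<in> Z 0" using irr[of 0] by (auto simp: irreducible_space_def)
    then show ?case unfolding alg_indep_def
      by (auto dest: polyfun_cong)
        (metis (mono_tags, lifting) empty_iff polyfun_cong)
  next
    case (Suc j)
    show ?case
    proof (rule alg_indep_chain_step[where Z = "Z j"])
      show "irreducible_space (subtopology (zariski I) (Z (Suc j)))" using irr Suc.prems by blast
      show "Z j \<subseteq> Z (Suc j)" using chain[rule_format, of j] Suc.prems by auto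
      show "Z (Suc j) \<subseteq> I \<rightarrow>\<^sub>E UNIV" using ZS[of "Suc j"] Suc.prems S by blast
    qed (use F Suc in auto)
  qed
  from alg_indep_superset[OF this[of k] ZS[of k]] have "alg_indep {..<k} F S" by simp
  with bound[of k F] F(1) show "ereal (real k) \<le> ereal (real D)" by simp
qed

section \<open>Dimension bounds for parametrized sets\<close>

lemma dird_compose:
  assumes "finite I" "finite J" "F \<in> polyfun J" "\<And>j. j \<in> J \<Longrightarrow> \<phi> j \<in> polyfun I"
  shows "dird I (\<lambda>x. F (\<lambda>j. \<phi> j x)) x v = dird J F (\<lambda>j. \<phi> j x) (\<lambda>j. dird I (\<phi> j) x v)"
proof (rule dird_eqI[OF assms(1)])
  show "(\<lambda>x. F (\<lambda>j. \<phi> j x)) \<in> polyfun I" by (rule polyfun_compose[OF assms(3,4)])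
  have "((\<lambda>s. \<phi> j (\<lambda>i. x i + s * v i)) has_field_derivative dird I (\<phi> j) x v) (at 0)" if "j \<in> J" for j
    by (rule has_field_derivative_dird) (use assms that in auto)
  from has_field_derivative_polyfun[OF assms(2,3) this]
  show "((\<lambda>s. F (\<lambda>j. \<phi> j (\<lambda>i. x i + s * v i))) has_field_derivative
      dird J F (\<lambda>j. \<phi> j x) (\<lambda>j. dird I (\<phi> j) x v)) (at 0)" by simp
qed

text \<open>Hypothesis \<open>rank\<close> says that the \<open>card B\<close> linear forms \<beta>
  are jointly injective on the image of the differential, so that its rank is at most
  \<open>D\<close>. Independent functions on \<open>S\<close> pull back to independent functions of
  the parameters, and \<open>alg_indep_jacobian\<close> bounds their number by this rank. The forms
  may vary with the parameter; this matters because they conjugate back by the group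
  element.\<close>

theorem krull_dim_le_of_parametrization:
  fixes D :: nat and \<beta> :: "('i \<Rightarrow> complex) \<Rightarrow> 'b \<Rightarrow> 'j \<Rightarrow> complex"
  assumes fin: "finite I" "finite J" and \<phi>: "\<And>j. j \<in> J \<Longrightarrow> \<phi> j \<in> polyfun I"
    and h: "h \<in> polyfun I" "h y \<noteq> 0" and S: "S \<subseteq> J \<rightarrow>\<^sub>E UNIV"
    and param: "\<And>x. x \<in> S \<Longrightarrow> \<exists>p. h p \<noteq> 0 \<and> (\<forall>j\<in>J. x j = \<phi> j p)"
    and B: "finite B" "card B \<le> D"
    and rank: "\<And>p v. h p \<noteq> 0 \<Longrightarrow> (\<forall>b\<in>B. (\<Sum>j\<in>J. \<beta> p b j * dird I (\<phi> j) p v) = 0) \<Longrightarrow>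
      (\<forall>j\<in>J. dird I (\<phi> j) p v = 0)"
  shows "krull_dim (subtopology (zariski J) S) \<le> ereal (real D)"
proof (rule krull_dim_zariski_le[OF S])
  fix F :: "nat \<Rightarrow> _" and k
  assume F: "\<And>i. i < k \<Longrightarrow> F i \<in> polyfun J" and indep: "alg_indep {..<k} F S"
  define H where "H i p = F i (\<lambda>j. \<phi> j p)" for i p
  have H: "H i \<in> polyfun I" if "i < k" for i
  proof -
    have "(\<lambda>p. F i (\<lambda>j. \<phi> j p)) \<in> polyfun I" by (rule polyfun_compose[OF F[OF that] \<phi>])
    then show ?thesis by (simp add: H_def[abs_def])
  qed
  have indH: "alg_indep {..<k} H UNIV"
    unfolding alg_indep_def
  proof (intro ballI impI allI)
    fix P z assume P: "P \<in> polyfun {..<k}" "\<forall>x\<in>UNIV. P (\<lambda>j. H j x) = 0"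
    show "P z = 0"
    proof (rule alg_indepD[OF indep P(1)])
      fix x assume "x \<in> S"
      then obtain p where p: "\<forall>j\<in>J. x j = \<phi> j p" using param by blast
      have "P (\<lambda>j. F j x) = P (\<lambda>j. H j p)"
      proof (rule polyfun_cong[OF P(1)])
        fix i assume "i \<in> {..<k}"
        then show "F i x = H i p" unfolding H_def using p by (intro polyfun_cong[OF F]) auto
      qed
      then show "P (\<lambda>j. F j x) = 0" using P(2) by simp
    qed
  qed
  obtain p C where pC: "h p \<noteq> 0" "C \<subseteq> I" "card {..<k} + card C \<le> card I"
    "\<And>v. (\<forall>j\<in>{..<k}. dird I (H j) p v = 0) \<Longrightarrow> (\<forall>i\<in>C. v i = 0) \<Longrightarrow> (\<forall>i\<in>I. v i = 0)"
    using alg_indep_jacobian[OF fin(1) _ H indH h] by auto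
  show "k \<le> D"
  proof (rule ccontr)
    assume "\<not> k \<le> D"
    have finC: "finite C" using pC fin finite_subset by blast
    \<comment> \<open>Linear system for a parameter direction: \<open>Inl\<close> equations are the
      forms \<beta> pulled back, \<open>Inr\<close> equations fix the coordinates in
      \<open>C\<close>. If k > D, there are fewer equations than parameters.\<close>
    define a where "a e i = (case e of Inl b \<Rightarrow> (\<Sum>j\<in>J. \<beta> p b j * gradient I (\<phi> j) i p)
      | Inr c \<Rightarrow> if i = c then 1 else 0)" for e :: "'b + 'i" and i
    have "card (B <+> C) < card I"
      using B pC(3) finC \<open>\<not> k \<le> D\<close> by (simp add: card_Plus)
    then obtain v where v: "\<exists>i\<in>I. v i \<noteq> 0" "\<forall>e\<in>B <+> C. (\<Sum>i\<in>I. a e i * v i) = 0"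
      using homogeneous_system_nontrivial[of "B <+> C" I a] fin B finC by auto
    have "(\<Sum>j\<in>J. \<beta> p b j * dird I (\<phi> j) p v) = 0" if "b \<in> B" for b
    proof -
      have "0 = (\<Sum>i\<in>I. a (Inl b) i * v i)" using v(2) that by auto
      also have "\<dots> = (\<Sum>i\<in>I. \<Sum>j\<in>J. \<beta> p b j * (gradient I (\<phi> j) i p * v i))"
        by (simp add: a_def sum_distrib_right mult.assoc)
      also have "\<dots> = (\<Sum>j\<in>J. \<beta> p b j * dird I (\<phi> j) p v)"
        unfolding dird_def by (subst sum.swap) (simp add: sum_distrib_left)
      finally show ?thesis by simp
    qed
    then have zero: "\<forall>j\<in>J. dird I (\<phi> j) p v = 0" using rank[OF pC(1)] by blast
    have "dird I (H i) p v = 0" if "i < k" for i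
    proof -
      have "dird I (H i) p v = dird J (F i) (\<lambda>j. \<phi> j p) (\<lambda>j. dird I (\<phi> j) p v)"
        unfolding H_def[abs_def] by (rule dird_compose[OF fin F[OF that] \<phi>])
      also have "\<dots> = 0" unfolding dird_def[of J] using zero by simp
      finally show ?thesis .
    qed
    moreover have "v c = 0" if "c \<in> C" for c
    proof -
      have "0 = (\<Sum>i\<in>I. a (Inr c) i * v i)" using v(2) that by auto
      also have "\<dots> = (\<Sum>i\<in>I. if i = c then v i else 0)" by (rule sum.cong) (auto simp: a_def)
      also have "\<dots> = v c" using fin pC(2) that by (auto simp: sum.delta)
      finally show ?thesis by simp
    qed
    ultimately show False using pC(4)[of v] v(1) by auto
  qed
qed

lemma unitriangular_surj:
  fixes M :: "nat \<Rightarrow> nat \<Rightarrow> 'f::field"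
  assumes "\<And>a. a < n \<Longrightarrow> M a a = 1" "\<And>a b. b < a \<Longrightarrow> a < n \<Longrightarrow> M a b = 0"
  shows "\<exists>c. \<forall>a<n. (\<Sum>b<n. c b * M a b) = w a"
  using assms
proof (induction n arbitrary: w)
  case (Suc n)
  obtain c where c: "\<forall>a<n. (\<Sum>b<n. c b * M a b) = w a - w n * M a n"
    using Suc.IH[of "\<lambda>a. w a - w n * M a n"] Suc.prems by auto
  have sum_upd: "(\<Sum>b<n. (c(n := w n)) b * M a b) = (\<Sum>b<n. c b * M a b)" for a
    by (rule sum.cong) auto
  have "(\<Sum>b<Suc n. (c(n := w n)) b * M a b) = w a" if "a < Suc n" for a
  proof (cases "a = n")
    case True
    have "(\<Sum>b<n. c b * M n b) = 0" by (rule sum.neutral) (use Suc.prems(2) in auto)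
    then show ?thesis using True Suc.prems(1)[of n] sum_upd[of n] by simp
  next
    case False
    then show ?thesis using that c sum_upd[of a] by simp
  qed
  then show ?case by blast
qed simp

text \<open>A nonzero linear form killing the previously chosen directions and the coordinates in
  \<open>W\<close> cannot vanish on the whole image of the differential.\<close>

lemma triangular_directions_ex:
  assumes fin: "finite J" "W \<subseteq> J"
    and span: "\<And>l. (\<And>j. j \<in> W \<Longrightarrow> l j = 0) \<Longrightarrow>
      (\<And>v. (\<Sum>j\<in>J. l j * dird I (\<phi> j) p v) = 0) \<Longrightarrow> (\<forall>j\<in>J. l j = 0)"
    and "n \<le> card J - card W"
  shows "\<exists>v l. (\<forall>a<n. (\<Sum>j\<in>J. l a j * dird I (\<phi> j) p (v a)) = 1) \<and>
    (\<forall>a<n. \<forall>b<a. (\<Sum>j\<in>J. l a j * dird I (\<phi> j) p (v b)) = 0)"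
  using assms(4)
proof (induction n)
  case (Suc n)
  then obtain v l where vl: "\<forall>a<n. (\<Sum>j\<in>J. l a j * dird I (\<phi> j) p (v a)) = 1"
    "\<forall>a<n. \<forall>b<a. (\<Sum>j\<in>J. l a j * dird I (\<phi> j) p (v b)) = 0"
    by auto
  have finW: "finite W" using fin finite_subset by blast
  define A where "A e j = (case e of Inl w \<Rightarrow> if j = w then 1 else 0
    | Inr b \<Rightarrow> dird I (\<phi> j) p (v b))" for e j
  have "card (W <+> {..<n}) < card J"
    using Suc.prems finW by (simp add: card_Plus)
  then obtain c where c: "\<exists>j\<in>J. c j \<noteq> 0" "\<forall>e\<in>W <+> {..<n}. (\<Sum>j\<in>J. A e j * c j) = 0"
    using homogeneous_system_nontrivial[of "W <+> {..<n}" J A] fin finW by auto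
  have "c j = 0" if "j \<in> W" for j
  proof -
    have "0 = (\<Sum>i\<in>J. A (Inl j) i * c i)" using c(2) that by auto
    also have "\<dots> = (\<Sum>i\<in>J. if i = j then c i else 0)" by (rule sum.cong) (auto simp: A_def)
    also have "\<dots> = c j" using that fin by (auto simp: sum.delta)
    finally show ?thesis by simp
  qed
  then obtain u where u: "(\<Sum>j\<in>J. c j * dird I (\<phi> j) p u) \<noteq> 0" using span[of c] c(1) by blast
  define r where "r = (\<Sum>j\<in>J. c j * dird I (\<phi> j) p u)"
  have "(\<Sum>j\<in>J. c j * dird I (\<phi> j) p (\<lambda>i. 1 / r * u i)) = 1"
    unfolding dird_scale using u
    by (simp add: r_def sum_divide_distrib[symmetric])
  moreover have "(\<Sum>j\<in>J. c j * dird I (\<phi> j) p (v b)) = 0" if "b < n" for b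
  proof -
    have "0 = (\<Sum>j\<in>J. A (Inr b) j * c j)" using c(2) that by auto
    then show ?thesis by (simp add: A_def mult_ac)
  qed
  ultimately show ?case using vl
    by (intro exI[of _ "v(n := \<lambda>i. 1 / r * u i)"] exI[of _ "l(n := c)"]) (auto simp: less_Suc_eq)
qed simp

text \<open>The chain consists of the closures in \<open>S\<close> of the images of slices through
  \<open>p\<close> spanned by \<open>d\<close> directions. Each is irreducible, being dominated by
  an open part of an affine space. The inclusions are strict: d + 1 linear forms in \<phi> are
  dependent on the slice of dimension \<open>d\<close>, but on the next one their differentials are
  unitriangular. Hypothesis \<open>span\<close> is the dual form of the statement that the image of
  the differential and the coordinates in \<open>W\<close> span everything.\<close>

theorem krull_dim_ge_of_parametrization:
  assumes fin: "finite I" "finite J" and \<phi>: "\<And>j. j \<in> J \<Longrightarrow> \<phi> j \<in> polyfun I"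
    and h: "h \<in> polyfun I" "h p \<noteq> 0" and S: "S \<subseteq> J \<rightarrow>\<^sub>E UNIV"
    and param: "\<And>x. h x \<noteq> 0 \<Longrightarrow> (\<lambda>j\<in>J. \<phi> j x) \<in> S"
    and W: "W \<subseteq> J"
    and span: "\<And>l. (\<And>j. j \<in> W \<Longrightarrow> l j = 0) \<Longrightarrow>
      (\<And>v. (\<Sum>j\<in>J. l j * dird I (\<phi> j) p v) = 0) \<Longrightarrow> (\<forall>j\<in>J. l j = 0)"
  shows "ereal (real (card J - card W)) \<le> krull_dim (subtopology (zariski J) S)"
proof -
  define D where "D = card J - card W"
  obtain v l where vl: "\<forall>a<D. (\<Sum>j\<in>J. l a j * dird I (\<phi> j) p (v a)) = 1"
    "\<forall>a<D. \<forall>b<a. (\<Sum>j\<in>J. l a j * dird I (\<phi> j) p (v b)) = 0"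
    using triangular_directions_ex[OF fin(2) W span, where n = D] unfolding D_def by blast
  define L where "L d c i = p i + (\<Sum>b<d. c b * v b i)" for d and c :: "nat \<Rightarrow> complex" and i
  define \<psi> where "\<psi> d j c = \<phi> j (L d c)" for d j c
  define T where "T d = {(\<lambda>j\<in>J. \<psi> d j c) | c. h (L d c) \<noteq> 0}" for d
  \<comment> \<open>The closure of \<open>T d\<close> in \<open>S\<close>, written through the
    functions vanishing on \<open>T d\<close>.\<close>
  define Z where "Z d = {x \<in> S. \<forall>F\<in>polyfun J. (\<forall>y\<in>T d. F y = 0) \<longrightarrow> F x = 0}" for d
  have Lpoly: "(\<lambda>c. F (L d c)) \<in> polyfun {..<d}" if "F \<in> polyfun I" for F d
    unfolding L_def
    by (rule polyfun_compose[OF that])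
      (auto intro!: polyfun.add polyfun.const polyfun_sum polyfun.mult polyfun.coord)
  have \<psi>poly: "\<psi> d j \<in> polyfun {..<d}" if "j \<in> J" for d j
    using Lpoly[OF \<phi>[OF that]] by (simp add: \<psi>_def[abs_def])
  have TS: "T d \<subseteq> S" for d using param by (auto simp: T_def \<psi>_def)
  have TZ: "T d \<subseteq> Z d" for d using TS by (auto simp: Z_def)
  have L0: "L d (\<lambda>_. 0) = p" for d by (simp add: L_def fun_eq_iff)
  have Tne: "T d \<noteq> {}" for d using h(2) L0[of d] by (auto simp: T_def)
  have Lext: "L d c = L (Suc d) (c(d := 0))" for d c
  proof -
    have "(\<Sum>b<d. c b * v b i) = (\<Sum>b<d. (c(d := 0)) b * v b i)" for i
      by (rule sum.cong) auto
    then show ?thesis by (simp add: L_def fun_eq_iff)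
  qed
  have TSuc: "T d \<subseteq> T (Suc d)" for d
    unfolding T_def \<psi>_def Lext[of d] by blast
  have closed: "closedin (subtopology (zariski J) S) (Z d)" for d
  proof -
    let ?V = "{F \<in> polyfun J. \<forall>y\<in>T d. F y = 0}"
    have "Z d = (\<Inter>F\<in>?V. {x \<in> S. F x = 0})"
    proof -
      have "(\<lambda>x. 0) \<in> ?V" by (auto intro: polyfun.const)
      then show ?thesis unfolding Z_def by blast
    qed
    moreover have "?V \<noteq> {}" by (auto intro: polyfun.const exI[of _ "\<lambda>x. 0"])
    ultimately show ?thesis
      using closedin_zariski_subtopology_zeros[OF _ S] by (auto intro!: closedin_Inter)
  qed
  have onT: "\<forall>y\<in>T d. F y = 0" if F: "F \<in> polyfun J" "\<And>c. F (\<lambda>j. \<psi> d j c) = 0" for F d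
  proof
    fix y assume "y \<in> T d"
    then obtain c where "y = (\<lambda>j\<in>J. \<psi> d j c)" by (auto simp: T_def)
    then have "F y = F (\<lambda>j. \<psi> d j c)" by (intro polyfun_cong[OF F(1)]) simp
    then show "F y = 0" using F(2) by simp
  qed
  have Tzero: "F (\<lambda>j. \<psi> d j c) = 0" if F: "F \<in> polyfun J" "\<And>y. y \<in> T d \<Longrightarrow> F y = 0" for F d c
  proof (rule polyfun_zero_dense[where F = "\<lambda>c. F (\<lambda>j. \<psi> d j c)", OF _ Lpoly[OF h(1)]])
    show "(\<lambda>c. F (\<lambda>j. \<psi> d j c)) \<in> polyfun {..<d}" by (rule polyfun_compose[OF F(1) \<psi>poly])
    show "h (L d (\<lambda>_. 0)) \<noteq> 0" using h(2) L0 by simp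
    fix c assume "h (L d c) \<noteq> 0"
    then have "(\<lambda>j\<in>J. \<psi> d j c) \<in> T d" by (auto simp: T_def)
    then have "F (\<lambda>j\<in>J. \<psi> d j c) = 0" by (rule F(2))
    moreover have "F (\<lambda>j\<in>J. \<psi> d j c) = F (\<lambda>j. \<psi> d j c)"
      by (rule polyfun_cong[OF F(1)]) simp
    ultimately show "F (\<lambda>j. \<psi> d j c) = 0" by simp
  qed
  have irr: "irreducible_space (subtopology (zariski J) (Z d))" for d
  proof (rule irreducible_space_zariskiI)
    show "Z d \<noteq> {}" using Tne TZ by blast
    show "Z d \<subseteq> J \<rightarrow>\<^sub>E UNIV" using S by (auto simp: Z_def)
    fix F G assume FG: "F \<in> polyfun J" "G \<in> polyfun J" "\<And>z. z \<in> Z d \<Longrightarrow> F z * G z = 0"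
    have FG0: "F (\<lambda>j. \<psi> d j c) * G (\<lambda>j. \<psi> d j c) = 0" for c
      by (rule Tzero[OF polyfun.mult[OF FG(1,2)]]) (use FG(3) TZ in blast)
    have FG1: "(\<lambda>c. F (\<lambda>j. \<psi> d j c)) \<in> polyfun {..<d}"
      by (rule polyfun_compose[OF FG(1) \<psi>poly])
    have FG2: "(\<lambda>c. G (\<lambda>j. \<psi> d j c)) \<in> polyfun {..<d}"
      by (rule polyfun_compose[OF FG(2) \<psi>poly])
    from polyfun_both_nonzero[OF FG1 FG2]
    have "(\<forall>c. F (\<lambda>j. \<psi> d j c) = 0) \<or> (\<forall>c. G (\<lambda>j. \<psi> d j c) = 0)" using FG0 by fastforce
    then have "(\<forall>y\<in>T d. F y = 0) \<or> (\<forall>y\<in>T d. G y = 0)" using onT FG(1,2) by blast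
    then show "(\<forall>z\<in>Z d. F z = 0) \<or> (\<forall>z\<in>Z d. G z = 0)" using FG(1,2) by (auto simp: Z_def)
  qed
  have strict: "Z d \<subset> Z (Suc d)" if d: "d < D" for d
  proof
    show "Z d \<subseteq> Z (Suc d)" unfolding Z_def using TSuc[of d] by blast
    show "Z d \<noteq> Z (Suc d)"
    proof
      assume eq: "Z d = Z (Suc d)"
      define f where "f a x = (\<Sum>j\<in>J. l a j * x j)" for a and x :: "_ \<Rightarrow> complex"
      have fpoly: "f a \<in> polyfun J" for a
      proof -
        have "(\<lambda>x. f a x) \<in> polyfun J"
          unfolding f_def by (intro polyfun_sum polyfun.mult polyfun.const polyfun.coord)
        then show ?thesis by simp
      qed
      let ?G = "\<lambda>e a c. f a (\<lambda>j. \<psi> e j c)"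
      have Gpoly: "?G e a \<in> polyfun {..<e}" for e a
        by (rule polyfun_compose[OF fpoly \<psi>poly])
      \<comment> \<open>There are d + 1 functions of only \<open>d\<close> parameters.\<close>
      have "\<not> alg_indep {..<Suc d} (?G d) UNIV"
      proof
        assume "alg_indep {..<Suc d} (?G d) UNIV"
        then have "card {..<Suc d} \<le> card {..<d}"
          by (rule alg_indep_card_le[rotated 3]) (auto intro: Gpoly)
        then show False by simp
      qed
      then obtain P y where P: "P \<in> polyfun {..<Suc d}" "\<And>c. P (\<lambda>a. ?G d a c) = 0" "P y \<noteq> 0"
        unfolding alg_indep_def by auto
      let ?F = "\<lambda>x. P (\<lambda>a. f a x)"
      have Fpoly: "?F \<in> polyfun J" by (rule polyfun_compose[OF P(1) fpoly])
      have FT: "\<forall>y\<in>T d. ?F y = 0" by (rule onT[OF Fpoly]) (rule P(2))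
      have FZ: "?F x = 0" if "x \<in> Z (Suc d)" for x
      proof -
        have "\<forall>F\<in>polyfun J. (\<forall>y\<in>T d. F y = 0) \<longrightarrow> F x = 0"
          using that[folded eq] unfolding Z_def by simp
        from bspec[OF this Fpoly] FT show ?thesis by (rule mp)
      qed
      have PG: "P (\<lambda>a. ?G (Suc d) a c) = 0" for c
      proof (rule Tzero[OF Fpoly])
        fix y assume "y \<in> T (Suc d)"
        then have "y \<in> Z (Suc d)" using TZ by (rule subsetD[rotated])
        then show "?F y = 0" by (rule FZ)
      qed
      \<comment> \<open>At the origin of the larger slice the differential is the unitriangular
        matrix \<open>?M\<close>, hence surjective.\<close>
      have "alg_indep {..<Suc d} (?G (Suc d)) UNIV"
      proof (rule alg_indep_of_dird_surj[where I = "{..<Suc d}" and ?x0.0 = "\<lambda>_. 0"])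
        fix w :: "nat \<Rightarrow> complex"
        let ?M = "\<lambda>a b. \<Sum>j\<in>J. l a j * dird I (\<phi> j) p (v b)"
        obtain c where c: "\<forall>a<Suc d. (\<Sum>b<Suc d. c b * ?M a b) = w a"
          using unitriangular_surj[of "Suc d" ?M w] vl d by auto
        have "dird {..<Suc d} (?G (Suc d) a) (\<lambda>_. 0) c = w a" if a: "a < Suc d" for a
        proof (rule dird_eqI)
          show "?G (Suc d) a \<in> polyfun {..<Suc d}" by (rule Gpoly)
          let ?u = "\<lambda>i. \<Sum>b<Suc d. c b * v b i"
          have "?G (Suc d) a (\<lambda>i. 0 + s * c i) = (\<Sum>j\<in>J. l a j * \<phi> j (\<lambda>i. p i + s * ?u i))" for s
          proof -
            have "L (Suc d) (\<lambda>i. 0 + s * c i) = (\<lambda>i. p i + s * ?u i)"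
              by (rule ext) (simp add: L_def sum_distrib_left mult_ac del: sum.lessThan_Suc)
            then show ?thesis by (simp only: f_def \<psi>_def)
          qed
          moreover have "((\<lambda>s. \<Sum>j\<in>J. l a j * \<phi> j (\<lambda>i. p i + s * ?u i)) has_field_derivative
              (\<Sum>j\<in>J. l a j * dird I (\<phi> j) p ?u)) (at 0)"
            by (intro DERIV_sum DERIV_cmult has_field_derivative_dird fin \<phi>)
          moreover have "(\<Sum>j\<in>J. l a j * dird I (\<phi> j) p ?u) = (\<Sum>b<Suc d. c b * ?M a b)"
            unfolding dird_sum sum_distrib_left by (subst sum.swap) (simp only: mult_ac)
          ultimately show "((\<lambda>s. ?G (Suc d) a (\<lambda>i. 0 + s * c i)) has_field_derivative w a) (at 0)"
            using c a by simp
        qed simp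
        then show "\<exists>v. \<forall>j\<in>{..<Suc d}. dird {..<Suc d} (?G (Suc d) j) (\<lambda>_. 0) v = w j" by blast
      qed (auto intro: Gpoly)
      from alg_indepD[OF this P(1) PG] have "P y = 0" .
      then show False using P(3) by simp
    qed
  qed
  show ?thesis unfolding krull_dim_def D_def[symmetric]
  proof (rule Sup_upper, intro CollectI exI[of _ D] exI[of _ Z] conjI allI impI)
    fix i
    have "Z i \<subseteq> S" by (auto simp: Z_def)
    then show "irreducible_space (subtopology (subtopology (zariski J) S) (Z i))"
      using irr subtopology_subtopology_subset by metis
  qed (use closed strict in auto)
qed

section \<open>Combinatorics of chains\<close>

text \<open>A set \<open>B \<subseteq> {1..<n}\<close> of links cuts \<open>{..<n}\<close> into chains of consecutive indices, where
  \<open>i \<in> B\<close> means that \<open>i\<close> is linked to \<open>i - 1\<close>. Below, \<open>chain_len B i\<close> is the number of links from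
  \<open>i\<close> to the last element of its chain, and \<open>chain_pos B i\<close> that from the first element to \<open>i\<close>.\<close>

definition chain_len :: "nat set \<Rightarrow> nat \<Rightarrow> nat" where
  "chain_len B i = (LEAST k. i + k + 1 \<notin> B)"

definition chain_pos :: "nat set \<Rightarrow> nat \<Rightarrow> nat" where
  "chain_pos B i = (LEAST k. i - k \<notin> B)"

lemma chain_len_eqI:
  assumes "i + k + 1 \<notin> B" "\<And>j. j < k \<Longrightarrow> i + j + 1 \<in> B"
  shows "chain_len B i = k"
  unfolding chain_len_def by (rule Least_equality) (use assms not_less in blast)+

lemma chain_len_link: "0 < j \<Longrightarrow> j \<le> chain_len B i \<Longrightarrow> i + j \<in> B"
  using not_less_Least[of "j - 1" "\<lambda>k. i + k + 1 \<notin> B"] unfolding chain_len_def by force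

lemma chain_len_end:
  assumes "finite B"
  shows "i + chain_len B i + 1 \<notin> B"
proof -
  have "\<exists>k. i + k + 1 \<notin> B"
  proof (rule ccontr)
    assume "\<not> ?thesis"
    then have "(\<lambda>k. i + k + 1) ` UNIV \<subseteq> B" by auto
    moreover have "infinite ((\<lambda>k. i + k + 1) ` UNIV)"
      by (subst finite_image_iff) (auto simp: inj_on_def)
    ultimately show False using assms finite_subset by blast
  qed
  then show ?thesis unfolding chain_len_def by (rule LeastI_ex)
qed

lemma chain_len_add:
  assumes "finite B" "j \<le> chain_len B i"
  shows "chain_len B (i + j) = chain_len B i - j"
proof (rule chain_len_eqI)
  show "i + j + (chain_len B i - j) + 1 \<notin> B" using chain_len_end[OF assms(1), of i] assms(2) by simp
  fix k assume "k < chain_len B i - j"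
  then show "i + j + k + 1 \<in> B" using chain_len_link[of "j + k + 1" B i] by (simp add: add.assoc)
qed

lemma chain_len_less:
  assumes "B \<subseteq> {1..<n}" "i < n"
  shows "i + chain_len B i < n"
proof (cases "chain_len B i")
  case (Suc k)
  then show ?thesis using chain_len_link[of "chain_len B i" B i] assms by auto
qed (use assms in simp)

lemma chain_pos_le: "0 \<notin> B \<Longrightarrow> chain_pos B i \<le> i"
  unfolding chain_pos_def by (rule Least_le) simp

lemma chain_pos_start:
  assumes "0 \<notin> B"
  shows "i - chain_pos B i \<notin> B"
  unfolding chain_pos_def by (rule LeastI[of _ i]) (use assms in simp)

lemma chain_pos_link: "j < chain_pos B i \<Longrightarrow> i - j \<in> B"
  using not_less_Least[of j "\<lambda>k. i - k \<notin> B"] unfolding chain_pos_def by blast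

lemma chain_pos_0_iff: "0 \<notin> B \<Longrightarrow> chain_pos B i = 0 \<longleftrightarrow> i \<notin> B"
  using chain_pos_link[of 0 B i] chain_pos_start[of B i] by fastforce

lemma chain_len_diff:
  assumes "0 \<notin> B" "k \<le> chain_pos B i" "finite B"
  shows "chain_len B (i - k) = chain_len B i + k"
proof (rule chain_len_eqI)
  have ki: "k \<le> i" using assms chain_pos_le order_trans by blast
  show "i - k + (chain_len B i + k) + 1 \<notin> B" using chain_len_end[OF assms(3), of i] ki by simp
  fix j assume j: "j < chain_len B i + k"
  show "i - k + j + 1 \<in> B"
  proof (cases "j < k")
    case True
    then have "i - (k - j - 1) \<in> B" using assms(2) by (intro chain_pos_link) simp
    moreover have "i - (k - j - 1) = i - k + j + 1" using ki True by linarith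
    ultimately show ?thesis by (simp only:)
  next
    case False
    then have "i + (j - k + 1) \<in> B" using j by (intro chain_len_link) auto
    then show ?thesis using False ki by (simp add: algebra_simps)
  qed
qed

text \<open>The positions indexing a basis of the cokernel of the commutator with the nilpotent matrix
  of the chains: the class of a matrix unit only depends on its diagonal string, and the string
  survives if and only if it starts in one of these positions.\<close>

definition reps :: "nat \<Rightarrow> nat set \<Rightarrow> (nat \<times> nat) set" where
  "reps n B = {(r, c). r < n \<and> c < n \<and> c \<notin> B \<and> chain_len B r \<le> chain_len B c}"

lemma finite_reps: "finite (reps n B)"
  by (rule finite_subset[of _ "{..<n} \<times> {..<n}"]) (auto simp: reps_def)

context
  fixes n :: nat and B :: "nat set"
  assumes B: "B \<subseteq> {1..<n}"
begin

lemma links_finite: "finite B" and links_0: "0 \<notin> B"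
  using B by (auto intro: finite_subset)

text \<open>\<open>L\<close> stands for a linear form on matrices with value \<open>L r c\<close> at
  a matrix unit. The assumption is that it kills the commutators of all matrix units with
  \<open>chain_mat n B\<close>; each such commutator is a difference of neighbours on a diagonal,
  one of which may be missing.\<close>

lemma commutator_form_string:
  fixes L :: "nat \<Rightarrow> nat \<Rightarrow> 'a::zero"
  assumes L: "\<And>r c. r < n \<Longrightarrow> c < n \<Longrightarrow>
      (if r \<in> B then L (r - 1) c else 0) = (if c + 1 \<in> B then L r (c + 1) else 0)"
    and "c < n" "j \<le> chain_len B c" "j \<le> chain_len B r"
  shows "L (r + j) (c + j) = L r c"
  using assms(3,4)
proof (induction j)
  case (Suc j)
  have "r + j + 1 \<in> B" "c + j + 1 \<in> B"
    using chain_len_link[of "Suc j" B] Suc.prems by auto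
  moreover from this have "r + j + 1 < n" "c + j < n" using B by auto
  ultimately show ?case using L[of "r + j + 1" "c + j"] Suc by simp
qed simp

text \<open>Moving up a diagonal string, one reaches its starting column unless a row starts first
  and the value is 0. In a starting column the position lies in \<open>reps\<close>, or else the
  column chain ends before the row chain does; then the relation at this end gives 0, which is
  carried back along the string.\<close>

lemma commutator_form_zero:
  fixes L :: "nat \<Rightarrow> nat \<Rightarrow> 'a::zero"
  assumes L: "\<And>r c. r < n \<Longrightarrow> c < n \<Longrightarrow>
      (if r \<in> B then L (r - 1) c else 0) = (if c + 1 \<in> B then L r (c + 1) else 0)"
    and reps: "\<And>r c. (r, c) \<in> reps n B \<Longrightarrow> L r c = 0"
    and "r < n" "c < n"
  shows "L r c = 0"
  using assms(3,4)
proof (induction c arbitrary: r rule: less_induct)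
  case (less c)
  show ?case
  proof (cases "c \<in> B")
    case True
    then have "c \<ge> 1" using B by auto
    then have "(if r \<in> B then L (r - 1) (c - 1) else 0) = L r c"
      using L[of r "c - 1"] less.prems True by simp
    then show ?thesis using less.IH[of "c - 1" "r - 1"] less.prems \<open>c \<ge> 1\<close> by (auto split: if_splits)
  next
    case False
    show ?thesis
    proof (cases "chain_len B r \<le> chain_len B c")
      case True
      then show ?thesis using reps False less.prems by (simp add: reps_def)
    next
      case False
      let ?h = "chain_len B c"
      have "r + ?h + 1 \<in> B" using chain_len_link[of "?h + 1" B r] False by simp
      moreover from this have "r + ?h + 1 < n" using B by auto
      moreover have "c + ?h + 1 \<notin> B" by (rule chain_len_end[OF links_finite])
      moreover have "c + ?h < n" using chain_len_less[OF B] less.prems by blast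
      ultimately have "L (r + ?h) (c + ?h) = 0" using L[of "r + ?h + 1" "c + ?h"] by simp
      moreover have "L (r + ?h) (c + ?h) = L r c"
        by (rule commutator_form_string[OF L less.prems(2)]) (use False in auto)
      ultimately show ?thesis by simp
    qed
  qed
qed

text \<open>The sum along the string telescopes. Both boundary terms are absent: the column starts a
  chain, and the summation stops where the row chain ends.\<close>

lemma commutator_string_sum:
  fixes Z :: "nat \<Rightarrow> nat \<Rightarrow> 'a::ab_group_add"
  assumes Y: "\<And>r c. r < n \<Longrightarrow> c < n \<Longrightarrow>
      Y r c = (if r + 1 \<in> B then Z (r + 1) c else 0) - (if c \<in> B then Z r (c - 1) else 0)"
    and rc: "(r, c) \<in> reps n B"
  shows "(\<Sum>i\<le>chain_len B r. Y (r + i) (c + i)) = 0"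
proof -
  let ?h = "chain_len B r"
  have rc': "r < n" "c < n" "c \<notin> B" "?h \<le> chain_len B c" using rc by (auto simp: reps_def)
  have "Y (r + i) (c + i) = (if i < ?h then Z (r + Suc i) (c + i) else 0) -
      (if i = 0 then 0 else Z (r + i) (c + i - 1))" if "i \<le> ?h" for i
  proof -
    have "r + ?h < n" "c + chain_len B c < n" using chain_len_less[OF B] rc' by blast+
    then have "r + i < n" "c + i < n" using that rc' by linarith+
    moreover have "r + i + 1 \<in> B \<longleftrightarrow> i < ?h"
      using chain_len_end[OF links_finite, of r] chain_len_link[of "Suc i" B r] that
      by (cases "i = ?h") auto
    moreover have "c + i \<in> B \<longleftrightarrow> i \<noteq> 0"
      using chain_len_link[of i B c] that rc' by (cases "i = 0") auto
    ultimately show ?thesis using Y[of "r + i" "c + i"] by simp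
  qed
  then have "(\<Sum>i\<le>?h. Y (r + i) (c + i)) = (\<Sum>i\<le>?h. (if i < ?h then Z (r + Suc i) (c + i) else 0)) -
      (\<Sum>i\<le>?h. (if i = 0 then 0 else Z (r + i) (c + i - 1)))"
    by (simp add: sum_subtractf)
  also have "(\<Sum>i\<le>?h. (if i < ?h then Z (r + Suc i) (c + i) else 0)) = (\<Sum>i<?h. Z (r + Suc i) (c + i))"
    by (rule sum.mono_neutral_cong_right) auto
  also have "(\<Sum>i\<le>?h. (if i = 0 then 0 else Z (r + i) (c + i - 1))) =
      (\<Sum>i\<in>{1..?h}. Z (r + i) (c + i - 1))"
    by (rule sum.mono_neutral_cong_right) auto
  also have "\<dots> = (\<Sum>i<?h. Z (r + Suc i) (c + i))"
    by (rule sum.reindex_bij_witness[of _ Suc "\<lambda>i. i - 1"]) auto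
  finally show ?thesis by simp
qed

subsection \<open>Removing the first link of a chain\<close>

context
  fixes s :: nat
  assumes s: "s < n" "s \<notin> B" "s + 1 \<in> B"
begin

text \<open>Chains are represented by their first index; the cardinality is the number u of the
  overview.\<close>

definition shorter :: "nat set" where
  "shorter = {c. c < n \<and> c \<notin> B \<and> chain_len B c < chain_len B s}"

lemma finite_shorter: "finite shorter"
  by (simp add: shorter_def)

lemma len_s_pos: "0 < chain_len B s"
  using s chain_len_end[OF links_finite, of s] by (cases "chain_len B s") auto

lemma top_s_less: "s + chain_len B s < n"
  by (rule chain_len_less[OF B s(1)])

lemma removed_link_subset: "(B - {s + 1}) \<subseteq> {1..<n}"
  using B by auto

lemma chain_len_removed: "chain_len (B - {s + 1}) s = 0"
  by (rule chain_len_eqI) auto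

text \<open>As \<open>s\<close> starts its chain, no earlier index reaches it by links, so only the
  chain counted from \<open>s\<close> itself is shortened.\<close>

lemma chain_len_other:
  assumes "i \<noteq> s"
  shows "chain_len (B - {s + 1}) i = chain_len B i"
proof (rule chain_len_eqI)
  show "i + chain_len B i + 1 \<notin> (B - {s + 1})" using chain_len_end[OF links_finite] by auto
  fix j assume j: "j < chain_len B i"
  have "i + j \<noteq> s"
    using s(2) chain_len_link[of j B i] j assms by (cases "j = 0") auto
  then show "i + j + 1 \<in> (B - {s + 1})" using chain_len_link[of "Suc j" B i] j by auto
qed

lemma top_shorter_neq_s:
  assumes "c \<in> shorter"
  shows "c + chain_len B c \<noteq> s"
  using chain_len_link[of "chain_len B c" B c] assms s
  by (cases "chain_len B c = 0") (auto simp: shorter_def)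

lemma link_below_top:
  assumes "j < chain_len B s"
  shows "s + chain_len B s - j \<in> B"
proof -
  have "s + (chain_len B s - j) \<in> B" by (rule chain_len_link) (use assms in auto)
  then show ?thesis using assms by simp
qed

text \<open>Apart from 2 u + 2 exceptional positions, the positions of the cut matrix inject into
  those of the original one: the columns \<open>s\<close> and \<open>s + 1\<close>, both starting
  chains after the cut, are merged into column \<open>s\<close>.\<close>

lemma card_reps_removed: "card (reps n (B - {s + 1})) \<le> card (reps n B) + 2 * card shorter + 2"
proof -
  define h where "h = chain_len B s"
  \<comment> \<open>Positions created by the cut: row \<open>s\<close>, whose chain now has length
    0, fits into every column, and column \<open>s\<close> accepts the ends of all chains.\<close>
  define X where "X = insert (s, s) (insert (s, s + 1)
    ((\<lambda>c. (s, c)) ` shorter \<union> (\<lambda>c. (c + chain_len B c, s)) ` shorter))"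
  \<comment> \<open>Column \<open>s + 1\<close> supplies the rows of length below \<open>h\<close>.
    In column \<open>s\<close> the row ends a chain with at least \<open>h\<close> links, and going
    back \<open>h\<close> steps gives a row of length exactly \<open>h\<close>; so the two images
    are disjoint.\<close>
  define g where "g = (\<lambda>(r, c). if c = s + 1 then (r, s) else if c = s then (r - h, s) else (r, c))"
  have col_top: "chain_len B r < h" if "(r, s + 1) \<in> reps n (B - {s + 1}) - X" for r
  proof -
    have "r \<noteq> s" using that by (auto simp: X_def)
    moreover have "chain_len B (s + 1) = h - 1"
      using chain_len_add[OF links_finite, of 1 s] len_s_pos by (simp add: h_def)
    ultimately have "chain_len B r \<le> h - 1"
      using that chain_len_other[of r] chain_len_other[of "s + 1"] by (simp add: reps_def)
    then show ?thesis using len_s_pos by (simp add: h_def)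
  qed
  have col_s: "h \<le> r \<and> chain_len B (r - h) = h" if "(r, s) \<in> reps n (B - {s + 1}) - X" for r
  proof -
    have rs: "r \<noteq> s" "r < n" using that by (auto simp: X_def reps_def)
    then have r0: "chain_len B r = 0"
      using that chain_len_other[of r] chain_len_removed by (simp add: reps_def)
    let ?c = "r - chain_pos B r"
    have "?c \<notin> B" by (rule chain_pos_start[OF links_0])
    moreover have c: "chain_len B ?c = chain_pos B r"
      using chain_len_diff[OF links_0 order_refl links_finite, of r] r0 by simp
    moreover have "r = ?c + chain_len B ?c" using c chain_pos_le[OF links_0, of r] by simp
    moreover have "(r, s) \<notin> (\<lambda>c. (c + chain_len B c, s)) ` shorter" using that by (simp add: X_def)
    ultimately have "?c \<notin> shorter" by blast
    then have "h \<le> chain_pos B r"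
      using \<open>?c \<notin> B\<close> c rs(2) by (auto simp: shorter_def h_def)
    then show ?thesis
      using chain_len_diff[OF links_0 _ links_finite, of h r] r0 chain_pos_le[OF links_0, of r] by simp
  qed
  have sub: "g ` (reps n (B - {s + 1}) - X) \<subseteq> reps n B"
  proof (rule image_subsetI)
    fix x assume x: "x \<in> reps n (B - {s + 1}) - X"
    obtain r c where rc: "x = (r, c)" by (cases x)
    have bound: "r < n" "c < n" "c \<notin> (B - {s + 1})" using x by (auto simp: rc reps_def)
    consider "c = s + 1" | "c = s" | "c \<noteq> s" "c \<noteq> s + 1" by blast
    then show "g x \<in> reps n B"
    proof cases
      case 1
      then show ?thesis using col_top[of r] x bound s by (auto simp: rc g_def reps_def h_def)
    next
      case 2
      then show ?thesis using col_s[of r] x bound s by (auto simp: rc g_def reps_def h_def)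
    next
      case 3
      then have "c \<notin> B" using bound by auto
      moreover have "chain_len B r \<le> chain_len B c"
      proof (cases "r = s")
        case True
        then have "c \<notin> shorter" using x by (auto simp: rc X_def)
        then show ?thesis using True \<open>c \<notin> B\<close> bound by (auto simp: shorter_def)
      next
        case False
        then show ?thesis using x chain_len_other[of r] chain_len_other[of c] 3
          by (simp add: rc reps_def)
      qed
      ultimately show ?thesis using 3 bound by (auto simp: rc g_def reps_def)
    qed
  qed
  have inj: "inj_on g (reps n (B - {s + 1}) - X)"
  proof (rule inj_onI)
    fix x y assume x: "x \<in> reps n (B - {s + 1}) - X" and y: "y \<in> reps n (B - {s + 1}) - X" and eq: "g x = g y"
    obtain r c where rc: "x = (r, c)" by (cases x)
    obtain r' c' where rc': "y = (r', c')" by (cases y)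
    show "x = y"
      using eq x y col_top[of r] col_top[of r'] col_s[of r] col_s[of r']
      by (auto simp: rc rc' g_def split: if_splits)
  qed
  have finX: "finite X" by (simp add: X_def finite_shorter)
  have "card (reps n (B - {s + 1})) \<le> card ((reps n (B - {s + 1}) - X) \<union> X)"
    by (rule card_mono) (use finX finite_reps in auto)
  also have "\<dots> \<le> card (reps n (B - {s + 1}) - X) + card X" by (rule card_Un_le)
  also have "card (reps n (B - {s + 1}) - X) \<le> card (reps n B)"
    using card_mono[OF finite_reps sub] by (simp only: card_image[OF inj])
  also have "card X \<le> 2 * card shorter + 2"
  proof -
    have "card X \<le> Suc (Suc (card ((\<lambda>c. (s, c)) ` shorter \<union> (\<lambda>c. (c + chain_len B c, s)) ` shorter)))"
      unfolding X_def using finite_shorter by (intro order_trans[OF card_insert_le_m1]) (auto simp: card_insert_if)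
    also have "\<dots> \<le> Suc (Suc (card shorter + card shorter))"
      using card_image_le[OF finite_shorter] card_Un_le
      by (meson Suc_le_mono add_mono order_trans)
    finally show ?thesis by simp
  qed
  finally show ?thesis by simp
qed

text \<open>The 2 u + 2 classes reached by commutators with \<open>z\<close> in the next power of
  \<open>t\<close>: at these positions the relations of \<open>cone_functional_relations\<close>
  force a functional to vanish once it vanishes at \<open>(s, s)\<close>.\<close>

definition tangent_cone_reps :: "(nat \<times> nat) set" where
  "tangent_cone_reps = {(s, s + 1), (s + 1, s + 1)} \<union>
    ((\<lambda>c. (c, s + 1)) ` shorter \<union> (\<lambda>c. (s, c)) ` shorter)"

text \<open>In the last coefficient 2 u + 2 further classes are reached by tangent vectors. The
  tangent vector at the ends of the two chains,
  \<open>(s + chain_len B s, c + chain_len B c)\<close>, is represented by the start of its diagonal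
  string in column \<open>c\<close>, as \<open>reps\<close> demands. The position
  \<open>(c0, c0)\<close> is tied to \<open>(s + 1, s + 1)\<close> by a difference of diagonal
  units.\<close>

definition tangent_reps :: "nat \<Rightarrow> (nat \<times> nat) set" where
  "tangent_reps c0 = tangent_cone_reps \<union> ({(s + chain_len B s, s), (c0, c0)} \<union>
    ((\<lambda>c. (c + chain_len B c, s)) ` shorter \<union> (\<lambda>c. (s + chain_len B s - chain_len B c, c)) ` shorter))"

lemma shorter_start:
  assumes "c \<in> shorter"
  shows "c < n" "c \<notin> B" "chain_len B c < chain_len B s" "c \<noteq> s" "c \<noteq> s + 1"
  using assms s by (auto simp: shorter_def)

lemma chain_len_removed_start: "chain_len (B - {s + 1}) (s + 1) = chain_len B s - 1"
  using chain_len_add[OF links_finite, of 1 s] chain_len_other[of "s + 1"] len_s_pos by simp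

lemma shorter_len_le: "c \<in> shorter \<Longrightarrow> chain_len (B - {s + 1}) c \<le> chain_len (B - {s + 1}) (s + 1)"
  using shorter_start[of c] chain_len_other[of c] chain_len_removed_start by simp

lemma tangent_cone_reps_subset: "tangent_cone_reps \<subseteq> reps n (B - {s + 1})"
proof -
  have s1: "s + 1 < n" using s(3) B by auto
  have "(c, s + 1) \<in> reps n (B - {s + 1})" "(s, c) \<in> reps n (B - {s + 1})" if "c \<in> shorter" for c
    using shorter_start[OF that] shorter_len_le[OF that] s s1 chain_len_removed
    by (simp_all add: reps_def)
  moreover have "(s, s + 1) \<in> reps n (B - {s + 1})" "(s + 1, s + 1) \<in> reps n (B - {s + 1})"
    using s s1 chain_len_removed by (simp_all add: reps_def)
  ultimately show ?thesis by (auto simp: tangent_cone_reps_def)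
qed

lemma card_tangent_cone_reps: "card tangent_cone_reps = 2 * card shorter + 2"
proof -
  have "card ((\<lambda>c. (c, s + 1)) ` shorter \<union> (\<lambda>c. (s, c)) ` shorter) = card shorter + card shorter"
    by (subst card_Un_disjoint) (auto simp: finite_shorter card_image inj_on_def dest: shorter_start)
  moreover have "card {(s, s + 1), (s + 1, s + 1)} = 2" by simp
  ultimately show ?thesis
    unfolding tangent_cone_reps_def
    by (subst card_Un_disjoint) (auto simp: finite_shorter dest: shorter_start)
qed

lemma top_minus_in_B:
  assumes "c \<in> shorter"
  shows "s + chain_len B s - chain_len B c \<in> B"
  using link_below_top shorter_start[OF assms] by blast

lemma chain_top_inj:
  assumes "finite A" "c \<notin> A" "c' \<notin> A" "c + chain_len A c = c' + chain_len A c'"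
  shows "c = c'"
proof (rule ccontr)
  assume "c \<noteq> c'"
  then consider "c < c'" | "c' < c" by linarith
  then show False
  proof cases
    case 1
    then have "c + (c' - c) \<in> A" using assms(4) by (intro chain_len_link) auto
    then show False using 1 assms(3) by simp
  next
    case 2
    then have "c' + (c - c') \<in> A" using assms(4) by (intro chain_len_link) auto
    then show False using 2 assms(2) by simp
  qed
qed

lemma chain_len_top_minus:
  assumes "c \<in> shorter"
  shows "chain_len (B - {s + 1}) (s + chain_len B s - chain_len B c) = chain_len B c"
proof -
  have c: "chain_len B c < chain_len B s" using shorter_start[OF assms] by blast
  then have "chain_len B (s + (chain_len B s - chain_len B c)) = chain_len B c"
    using chain_len_add[OF links_finite, of "chain_len B s - chain_len B c" s] by simp
  moreover have "s + (chain_len B s - chain_len B c) \<noteq> s" using c by simp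
  ultimately show ?thesis using chain_len_other c by (metis Nat.add_diff_assoc less_imp_le)
qed

lemma tangent_reps_subset:
  assumes "c0 \<in> shorter"
  shows "tangent_reps c0 \<subseteq> reps n (B - {s + 1})"
proof -
  have "(c + chain_len B c, s) \<in> reps n (B - {s + 1})" if "c \<in> shorter" for c
  proof -
    have "c + chain_len B c < n" using chain_len_less[OF B] shorter_start[OF that] by blast
    moreover have "chain_len (B - {s + 1}) (c + chain_len B c) = 0"
      using chain_len_other[OF top_shorter_neq_s[OF that]]
        chain_len_add[OF links_finite order_refl, of c] by simp
    ultimately show ?thesis using s by (simp add: reps_def)
  qed
  moreover have "(s + chain_len B s - chain_len B c, c) \<in> reps n (B - {s + 1})" if "c \<in> shorter" for c
    using chain_len_top_minus[OF that] shorter_start[OF that] chain_len_other[of c] top_s_less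
    by (simp add: reps_def)
  moreover have "(s + chain_len B s, s) \<in> reps n (B - {s + 1})"
    using top_s_less s chain_len_other[of "s + chain_len B s"] len_s_pos
      chain_len_add[OF links_finite order_refl, of s] by (simp add: reps_def)
  moreover have "(c0, c0) \<in> reps n (B - {s + 1})" using shorter_start[OF assms] by (simp add: reps_def)
  ultimately show ?thesis
    using tangent_cone_reps_subset by (auto simp: tangent_reps_def)
qed

lemma card_tangent_reps:
  assumes "c0 \<in> shorter"
  shows "card (tangent_reps c0) = 4 * card shorter + 4"
proof -
  let ?z = "s + chain_len B s"
  let ?T = "(\<lambda>c. (c + chain_len B c, s)) ` shorter" and ?U = "(\<lambda>c. (?z - chain_len B c, c)) ` shorter"
  have "card ?T = card shorter"
    by (rule card_image) (auto simp: inj_on_def dest: chain_top_inj[OF links_finite] shorter_start)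
  moreover have "card ?U = card shorter"
    by (rule card_image) (auto simp: inj_on_def)
  moreover have "?T \<inter> ?U = {}" by (auto dest: shorter_start)
  ultimately have TU: "card (?T \<union> ?U) = 2 * card shorter"
    by (subst card_Un_disjoint) (auto simp: finite_shorter)
  have zT: "(?z, s) \<notin> ?T"
    using chain_top_inj[OF links_finite s(2)] shorter_start by force
  have zU: "(?z, s) \<notin> ?U" using shorter_start(4) by force
  have c0: "(c0, c0) \<notin> ?T" "(c0, c0) \<notin> ?U" "(c0, c0) \<noteq> (?z, s)"
    using shorter_start[OF assms] top_minus_in_B[OF assms] by auto
  have "card ({(?z, s), (c0, c0)} \<union> (?T \<union> ?U)) = 2 + 2 * card shorter"
    using zT zU c0 TU finite_shorter by (subst card_Un_disjoint) auto
  moreover have "tangent_cone_reps \<inter> ({(?z, s), (c0, c0)} \<union> (?T \<union> ?U)) = {}"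
    using shorter_start top_minus_in_B s assms len_s_pos
    by (fastforce simp: tangent_cone_reps_def)
  ultimately show ?thesis
    unfolding tangent_reps_def using card_tangent_cone_reps
    by (subst card_Un_disjoint) (auto simp: finite_shorter tangent_cone_reps_def)
qed

end
end

section \<open>Matrices\<close>

lemma mult_mat_index:
  assumes "A \<in> carrier_mat n n" "B \<in> carrier_mat n n" "i < n" "j < n"
  shows "(A * B) $$ (i, j) = (\<Sum>k<n. A $$ (i, k) * B $$ (k, j))"
  using assms by (simp add: scalar_prod_def atLeast0LessThan)

lemma mult_mat_1_commute:
  fixes A :: "'a::field mat"
  assumes "A \<in> carrier_mat n n" "B \<in> carrier_mat n n" "A * B = 1\<^sub>m n"
  shows "B * A = 1\<^sub>m n"
  using mat_mult_left_right_inverse[OF assms] .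

lemma invertible_mat_det_nonzero:
  fixes A :: "'a::field mat"
  assumes "A \<in> carrier_mat n n" "B \<in> carrier_mat n n" "A * B = 1\<^sub>m n"
  shows "det A \<noteq> 0"
proof
  assume "det A = 0"
  then have "det (1\<^sub>m n :: 'a mat) = 0" using det_mult[OF assms(1,2)] assms(3) by simp
  then show False by simp
qed

lemma smult_smult_mat: "a \<cdot>\<^sub>m (b \<cdot>\<^sub>m A) = (a * b :: 'a::comm_ring_1) \<cdot>\<^sub>m A"
  by (rule eq_matI) (auto simp: mult.assoc)

lemma smult_mult_left_mat:
  fixes a :: "'a::comm_ring_1"
  assumes "A \<in> carrier_mat n n" "B \<in> carrier_mat n n"
  shows "(a \<cdot>\<^sub>m A) * B = a \<cdot>\<^sub>m (A * B)"
  using mult_smult_assoc_mat[OF assms] .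

lemma smult_mult_right_mat:
  fixes a :: "'a::comm_ring_1"
  assumes "A \<in> carrier_mat n n" "B \<in> carrier_mat n n"
  shows "A * (a \<cdot>\<^sub>m B) = a \<cdot>\<^sub>m (A * B)"
  using mult_smult_distrib[OF assms] .

lemma (in comm_ring_hom) hom_adj_mat: "map_mat hom (adj_mat A) = adj_mat (map_mat hom A)"
proof -
  have "cofactor (map_mat hom A) j i = hom (cofactor A j i)" for i j
  proof -
    have "mat_delete (map_mat hom A) j i = map_mat hom (mat_delete A j i)"
      by (rule eq_matI) (auto simp: mat_delete_def)
    then show ?thesis by (simp add: cofactor_def hom_mult hom_power hom_uminus)
  qed
  then show ?thesis by (intro eq_matI) (auto simp: adj_mat_def)
qed

text \<open>Closure under ring operations is all that determinants and adjugates require. The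
  abstraction serves three rings of functions: polynomial functions, polynomials in \<open>t\<close>
  with polynomial coefficients, and families differentiable at 0.\<close>

definition fun_subring :: "('x \<Rightarrow> 'r::comm_ring_1) set \<Rightarrow> bool" where
  "fun_subring R \<longleftrightarrow> (\<lambda>x. 1) \<in> R \<and> (\<forall>f\<in>R. (\<lambda>x. - f x) \<in> R) \<and>
    (\<forall>f\<in>R. \<forall>g\<in>R. (\<lambda>x. f x + g x) \<in> R \<and> (\<lambda>x. f x * g x) \<in> R)"

definition mat_fun :: "('x \<Rightarrow> 'r::comm_ring_1) set \<Rightarrow> nat \<Rightarrow> ('x \<Rightarrow> 'r mat) \<Rightarrow> bool" where
  "mat_fun R n M \<longleftrightarrow> (\<forall>x. M x \<in> carrier_mat n n) \<and> (\<forall>i<n. \<forall>j<n. (\<lambda>x. M x $$ (i, j)) \<in> R)"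

context
  fixes R :: "('x \<Rightarrow> 'r::comm_ring_1) set"
  assumes R: "fun_subring R"
begin

lemma fun_subring_one: "(\<lambda>x. 1) \<in> R"
  and fun_subring_uminus: "f \<in> R \<Longrightarrow> (\<lambda>x. - f x) \<in> R"
  and fun_subring_add: "f \<in> R \<Longrightarrow> g \<in> R \<Longrightarrow> (\<lambda>x. f x + g x) \<in> R"
  and fun_subring_mult: "f \<in> R \<Longrightarrow> g \<in> R \<Longrightarrow> (\<lambda>x. f x * g x) \<in> R"
  using R by (auto simp: fun_subring_def)

lemma fun_subring_zero: "(\<lambda>x. 0) \<in> R"
  using fun_subring_add[OF fun_subring_one fun_subring_uminus[OF fun_subring_one]] by simp

lemma fun_subring_sum: "(\<And>a. a \<in> A \<Longrightarrow> f a \<in> R) \<Longrightarrow> (\<lambda>x. \<Sum>a\<in>A. f a x) \<in> R"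
  by (induction A rule: infinite_finite_induct) (auto intro: fun_subring_zero fun_subring_add)

lemma fun_subring_prod: "(\<And>a. a \<in> A \<Longrightarrow> f a \<in> R) \<Longrightarrow> (\<lambda>x. \<Prod>a\<in>A. f a x) \<in> R"
  by (induction A rule: infinite_finite_induct) (auto intro: fun_subring_one fun_subring_mult)

lemma mat_funD: "mat_fun R n M \<Longrightarrow> M x \<in> carrier_mat n n"
  "mat_fun R n M \<Longrightarrow> i < n \<Longrightarrow> j < n \<Longrightarrow> (\<lambda>x. M x $$ (i, j)) \<in> R"
  by (auto simp: mat_fun_def)

lemma mat_funI: "(\<And>x. M x \<in> carrier_mat n n) \<Longrightarrow>
  (\<And>i j. i < n \<Longrightarrow> j < n \<Longrightarrow> (\<lambda>x. M x $$ (i, j)) \<in> R) \<Longrightarrow> mat_fun R n M"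
  by (auto simp: mat_fun_def)

lemma mat_fun_mult:
  assumes "mat_fun R n M" "mat_fun R n N"
  shows "mat_fun R n (\<lambda>x. M x * N x)"
proof (rule mat_funI)
  fix i j assume ij: "i < n" "j < n"
  have "(M x * N x) $$ (i, j) = (\<Sum>k<n. M x $$ (i, k) * N x $$ (k, j))" for x
    by (rule mult_mat_index) (use assms ij mat_funD in auto)
  moreover have "(\<lambda>x. \<Sum>k<n. M x $$ (i, k) * N x $$ (k, j)) \<in> R"
    by (intro fun_subring_sum fun_subring_mult mat_funD(2)[OF assms(1)] mat_funD(2)[OF assms(2)])
      (use ij in auto)
  ultimately show "(\<lambda>x. (M x * N x) $$ (i, j)) \<in> R" by simp
qed (rule mult_carrier_mat[OF mat_funD(1)[OF assms(1)] mat_funD(1)[OF assms(2)]])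

lemma mat_fun_add:
  assumes "mat_fun R n M" "mat_fun R n N"
  shows "mat_fun R n (\<lambda>x. M x + N x)"
proof (rule mat_funI)
  fix i j assume ij: "i < n" "j < n"
  have "(M x + N x) $$ (i, j) = M x $$ (i, j) + N x $$ (i, j)" for x
    using ij mat_funD(1)[OF assms(1), of x] mat_funD(1)[OF assms(2), of x] by simp
  then show "(\<lambda>x. (M x + N x) $$ (i, j)) \<in> R"
    using fun_subring_add[OF mat_funD(2)[OF assms(1) ij] mat_funD(2)[OF assms(2) ij]] by simp
qed (use assms mat_funD in auto)

lemma mat_fun_smult:
  assumes "f \<in> R" "mat_fun R n M"
  shows "mat_fun R n (\<lambda>x. f x \<cdot>\<^sub>m M x)"
proof (rule mat_funI)
  fix i j assume ij: "i < n" "j < n"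
  have "(f x \<cdot>\<^sub>m M x) $$ (i, j) = f x * M x $$ (i, j)" for x
    using ij mat_funD(1)[OF assms(2), of x] by simp
  then show "(\<lambda>x. (f x \<cdot>\<^sub>m M x) $$ (i, j)) \<in> R"
    using fun_subring_mult[OF assms(1) mat_funD(2)[OF assms(2) ij]] by simp
qed (use assms mat_funD in auto)

lemma mat_fun_pow:
  assumes "mat_fun R n M"
  shows "mat_fun R n (\<lambda>x. M x ^\<^sub>m k)"
proof (induction k)
  case 0
  have d: "dim_row (M x) = n" for x using mat_funD(1)[OF assms, of x] by simp
  have "(\<lambda>x. (1\<^sub>m n :: 'r mat) $$ (i, j)) \<in> R" if "i < n" "j < n" for i j
    using that fun_subring_one fun_subring_zero by simp
  then show ?case by (intro mat_funI) (simp_all add: d)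
next
  case (Suc k)
  then show ?case using mat_fun_mult[OF Suc assms] by simp
qed

lemma fun_subring_det:
  assumes "mat_fun R n M"
  shows "(\<lambda>x. det (M x)) \<in> R"
proof -
  have "det (M x) = (\<Sum>p\<in>{p. p permutes {0..<n}}. signof p * (\<Prod>i = 0..<n. M x $$ (i, p i)))" for x
    by (rule det_def'[OF mat_funD(1)[OF assms]])
  moreover have "(\<lambda>x. signof p) \<in> R" for p
    using fun_subring_one fun_subring_uminus[OF fun_subring_one] by (simp add: sign_def)
  then have "(\<lambda>x. \<Sum>p\<in>{p. p permutes {0..<n}}. signof p * (\<Prod>i = 0..<n. M x $$ (i, p i))) \<in> R"
    by (intro fun_subring_sum fun_subring_mult fun_subring_prod mat_funD(2)[OF assms])
      (auto simp: permutes_in_image)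
  ultimately show ?thesis by simp
qed

lemma mat_fun_adj:
  assumes "mat_fun R n M"
  shows "mat_fun R n (\<lambda>x. adj_mat (M x))"
proof (rule mat_funI)
  fix i j assume ij: "i < n" "j < n"
  have d: "dim_row (M x) = n" "dim_col (M x) = n" for x using mat_funD(1)[OF assms, of x] by auto
  have "mat_fun R (n - 1) (\<lambda>x. mat_delete (M x) j i)"
  proof (rule mat_funI)
    fix k l assume kl: "k < n - 1" "l < n - 1"
    have "mat_delete (M x) j i $$ (k, l) =
        M x $$ (if k < j then k else Suc k, if l < i then l else Suc l)" for x
      using kl by (simp add: mat_delete_def d)
    then show "(\<lambda>x. mat_delete (M x) j i $$ (k, l)) \<in> R"
      using mat_funD(2)[OF assms] kl by simp
  qed (use mat_delete_carrier mat_funD(1)[OF assms] in blast)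
  note det = fun_subring_det[OF this]
  have "(\<lambda>x. (- 1) ^ (j + i)) \<in> R"
    using fun_subring_one fun_subring_uminus[OF fun_subring_one] by (cases "even (j + i)") simp_all
  then have "(\<lambda>x. (- 1) ^ (j + i) * det (mat_delete (M x) j i)) \<in> R"
    by (rule fun_subring_mult[OF _ det])
  moreover have "adj_mat (M x) $$ (i, j) = (- 1) ^ (j + i) * det (mat_delete (M x) j i)" for x
    using ij by (simp add: adj_mat_def d cofactor_def)
  ultimately show "(\<lambda>x. adj_mat (M x) $$ (i, j)) \<in> R" by simp
qed (use adj_mat(1) mat_funD(1)[OF assms] in blast)

end

section \<open>Polynomial families of matrices and their derivatives\<close>

lemma fun_subring_polyfun: "fun_subring (polyfun I)"
  by (auto simp: fun_subring_def intro: polyfun.intros polyfun_uminus)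

definition polyfun_poly :: "'i set \<Rightarrow> (('i \<Rightarrow> complex) \<Rightarrow> complex poly) set" where
  "polyfun_poly I = {f. \<forall>d. (\<lambda>x. coeff (f x) d) \<in> polyfun I}"

lemma fun_subring_polyfun_poly: "fun_subring (polyfun_poly I)"
  by (auto simp: fun_subring_def polyfun_poly_def coeff_mult
      intro!: polyfun.add polyfun.mult polyfun.const polyfun_uminus polyfun_sum)

text \<open>The derivative is taken in the parameter \<open>s\<close> at 0, coefficient by
  coefficient; the polynomial variable is the jet variable \<open>t\<close>.\<close>

definition has_poly_derivative :: "(complex \<Rightarrow> complex poly) \<Rightarrow> complex poly \<Rightarrow> bool" where
  "has_poly_derivative f f' \<longleftrightarrow> (\<forall>d. ((\<lambda>s. coeff (f s) d) has_field_derivative coeff f' d) (at 0))"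

lemma has_poly_derivative_const: "has_poly_derivative (\<lambda>s. p) 0"
  by (simp add: has_poly_derivative_def)

lemma has_poly_derivative_add:
  "has_poly_derivative f f' \<Longrightarrow> has_poly_derivative g g' \<Longrightarrow>
    has_poly_derivative (\<lambda>s. f s + g s) (f' + g')"
  by (auto simp: has_poly_derivative_def intro: DERIV_add)

lemma has_poly_derivative_uminus:
  "has_poly_derivative f f' \<Longrightarrow> has_poly_derivative (\<lambda>s. - f s) (- f')"
  by (auto simp: has_poly_derivative_def intro: DERIV_minus)

lemma has_poly_derivative_mult:
  assumes "has_poly_derivative f f'" "has_poly_derivative g g'"
  shows "has_poly_derivative (\<lambda>s. f s * g s) (f' * g 0 + f 0 * g')"
  unfolding has_poly_derivative_def
proof
  fix d
  have "((\<lambda>s. \<Sum>i\<le>d. coeff (f s) i * coeff (g s) (d - i)) has_field_derivative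
      (\<Sum>i\<le>d. coeff f' i * coeff (g 0) (d - i) + coeff g' (d - i) * coeff (f 0) i)) (at 0)"
    by (intro DERIV_sum DERIV_mult) (use assms in \<open>auto simp: has_poly_derivative_def\<close>)
  moreover have "(\<Sum>i\<le>d. coeff f' i * coeff (g 0) (d - i) + coeff g' (d - i) * coeff (f 0) i) =
      coeff (f' * g 0 + f 0 * g') d"
    unfolding coeff_add coeff_mult sum.distrib by (simp only: mult.commute[of "coeff g' _"])
  ultimately show "((\<lambda>s. coeff (f s * g s) d) has_field_derivative coeff (f' * g 0 + f 0 * g') d) (at 0)"
    by (simp only: coeff_mult)
qed

lemma has_poly_derivative_sum:
  "(\<And>a. a \<in> A \<Longrightarrow> has_poly_derivative (f a) (f' a)) \<Longrightarrow>
    has_poly_derivative (\<lambda>s. \<Sum>a\<in>A. f a s) (\<Sum>a\<in>A. f' a)"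
  by (induction A rule: infinite_finite_induct)
    (auto intro: has_poly_derivative_const has_poly_derivative_add)

lemma has_poly_derivative_unique:
  "has_poly_derivative f p \<Longrightarrow> has_poly_derivative f q \<Longrightarrow> p = q"
  unfolding has_poly_derivative_def poly_eq_iff using DERIV_unique by blast

lemma fun_subring_has_poly_derivative: "fun_subring {f. \<exists>f'. has_poly_derivative f f'}"
  unfolding fun_subring_def
  using has_poly_derivative_const has_poly_derivative_add has_poly_derivative_uminus
    has_poly_derivative_mult by blast

definition has_mat_derivative :: "nat \<Rightarrow> (complex \<Rightarrow> complex poly mat) \<Rightarrow> complex poly mat \<Rightarrow> bool" where
  "has_mat_derivative n F F' \<longleftrightarrow> (\<forall>s. F s \<in> carrier_mat n n) \<and> F' \<in> carrier_mat n n \<and>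
    (\<forall>i<n. \<forall>j<n. has_poly_derivative (\<lambda>s. F s $$ (i, j)) (F' $$ (i, j)))"

lemma has_mat_derivativeD:
  assumes "has_mat_derivative n F F'"
  shows "F s \<in> carrier_mat n n" "F' \<in> carrier_mat n n"
    "i < n \<Longrightarrow> j < n \<Longrightarrow> has_poly_derivative (\<lambda>s. F s $$ (i, j)) (F' $$ (i, j))"
  using assms by (auto simp: has_mat_derivative_def)

lemma has_mat_derivative_const:
  "A \<in> carrier_mat n n \<Longrightarrow> has_mat_derivative n (\<lambda>s. A) (0\<^sub>m n n)"
  by (simp add: has_mat_derivative_def has_poly_derivative_const)

lemma has_mat_derivative_mult:
  assumes "has_mat_derivative n F F'" "has_mat_derivative n G G'"
  shows "has_mat_derivative n (\<lambda>s. F s * G s) (F' * G 0 + F 0 * G')"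
  unfolding has_mat_derivative_def
proof (intro conjI allI impI)
  note F = has_mat_derivativeD[OF assms(1)] and G = has_mat_derivativeD[OF assms(2)]
  show "F s * G s \<in> carrier_mat n n" for s by (rule mult_carrier_mat[OF F(1) G(1)])
  show "F' * G 0 + F 0 * G' \<in> carrier_mat n n" using F(1)[of 0] F(2) G(1)[of 0] G(2) by simp
  fix i j assume ij: "i < n" "j < n"
  have "has_poly_derivative (\<lambda>s. \<Sum>k<n. F s $$ (i, k) * G s $$ (k, j))
      (\<Sum>k<n. F' $$ (i, k) * G 0 $$ (k, j) + F 0 $$ (i, k) * G' $$ (k, j))"
    by (intro has_poly_derivative_sum has_poly_derivative_mult F G) (use ij in auto)
  moreover have "(F s * G s) $$ (i, j) = (\<Sum>k<n. F s $$ (i, k) * G s $$ (k, j))" for s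
    by (rule mult_mat_index) (use F G ij in auto)
  moreover have "(F' * G 0 + F 0 * G') $$ (i, j) =
      (\<Sum>k<n. F' $$ (i, k) * G 0 $$ (k, j) + F 0 $$ (i, k) * G' $$ (k, j))"
    using ij mult_mat_index[OF F(2) G(1) ij, of 0] mult_mat_index[OF F(1) G(2) ij, of 0]
      F(1)[of 0] F(2) G(1)[of 0] G(2) by (simp add: sum.distrib)
  ultimately show "has_poly_derivative (\<lambda>s. (F s * G s) $$ (i, j)) ((F' * G 0 + F 0 * G') $$ (i, j))"
    by simp
qed

lemma has_mat_derivative_smult:
  assumes "has_poly_derivative f f'" "has_mat_derivative n G G'"
  shows "has_mat_derivative n (\<lambda>s. f s \<cdot>\<^sub>m G s) (f' \<cdot>\<^sub>m G 0 + f 0 \<cdot>\<^sub>m G')"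
  unfolding has_mat_derivative_def
proof (intro conjI allI impI)
  note G = has_mat_derivativeD[OF assms(2)]
  show "f s \<cdot>\<^sub>m G s \<in> carrier_mat n n" for s using G by simp
  show "f' \<cdot>\<^sub>m G 0 + f 0 \<cdot>\<^sub>m G' \<in> carrier_mat n n" using G(1)[of 0] G(2) by simp
  fix i j assume ij: "i < n" "j < n"
  have "(f s \<cdot>\<^sub>m G s) $$ (i, j) = f s * G s $$ (i, j)" for s using G(1)[of s] ij by simp
  moreover have "(f' \<cdot>\<^sub>m G 0 + f 0 \<cdot>\<^sub>m G') $$ (i, j) = f' * G 0 $$ (i, j) + f 0 * G' $$ (i, j)"
    using G(1)[of 0] G(2) ij by simp
  ultimately show "has_poly_derivative (\<lambda>s. (f s \<cdot>\<^sub>m G s) $$ (i, j))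
      ((f' \<cdot>\<^sub>m G 0 + f 0 \<cdot>\<^sub>m G') $$ (i, j))"
    using has_poly_derivative_mult[OF assms(1) G(3)[OF ij]] by simp
qed

lemma has_mat_derivative_unique:
  assumes "has_mat_derivative n F P" "has_mat_derivative n F Q"
  shows "P = Q"
proof (rule eq_matI)
  note P = has_mat_derivativeD[OF assms(1)] and Q = has_mat_derivativeD[OF assms(2)]
  fix i j assume "i < dim_row Q" "j < dim_col Q"
  then have "i < n" "j < n" using Q(2) by auto
  then show "P $$ (i, j) = Q $$ (i, j)" by (intro has_poly_derivative_unique[OF P(3) Q(3)])
qed (use has_mat_derivativeD(2)[OF assms(1)] has_mat_derivativeD(2)[OF assms(2)] in auto)

lemma has_mat_derivative_adj_ex:
  assumes "has_mat_derivative n F F'"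
  shows "\<exists>A'. has_mat_derivative n (\<lambda>s. adj_mat (F s)) A'"
    and "\<exists>d'. has_poly_derivative (\<lambda>s. det (F s)) d'"
proof -
  let ?R = "{f. \<exists>f'. has_poly_derivative f f'}"
  note F = has_mat_derivativeD[OF assms]
  have mf: "mat_fun ?R n F"
    by (rule mat_funI[OF fun_subring_has_poly_derivative]) (use F in auto)
  show "\<exists>d'. has_poly_derivative (\<lambda>s. det (F s)) d'"
    using fun_subring_det[OF fun_subring_has_poly_derivative mf] by simp
  have mf': "mat_fun ?R n (\<lambda>s. adj_mat (F s))"
    by (rule mat_fun_adj[OF fun_subring_has_poly_derivative mf])
  then have "\<forall>ij\<in>{..<n} \<times> {..<n}. \<exists>f'. has_poly_derivative (\<lambda>s. adj_mat (F s) $$ ij) f'"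
    by (auto simp: mat_fun_def)
  then obtain f' where f': "\<forall>ij\<in>{..<n} \<times> {..<n}. has_poly_derivative (\<lambda>s. adj_mat (F s) $$ ij) (f' ij)"
    by (rule bchoice[THEN exE])
  have "has_mat_derivative n (\<lambda>s. adj_mat (F s)) (mat n n f')"
    unfolding has_mat_derivative_def using f' adj_mat(1)[OF F(1)] by auto
  then show "\<exists>A'. has_mat_derivative n (\<lambda>s. adj_mat (F s)) A'" by blast
qed

text \<open>Obtained by differentiating \<open>A adj A = det A\<close>.\<close>

lemma has_mat_derivative_adj:
  assumes "has_mat_derivative n F F'"
  obtains A' d' where "has_mat_derivative n (\<lambda>s. adj_mat (F s)) A'"
    "has_poly_derivative (\<lambda>s. det (F s)) d'" "F' * adj_mat (F 0) + F 0 * A' = d' \<cdot>\<^sub>m 1\<^sub>m n"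
proof -
  obtain A' d' where A': "has_mat_derivative n (\<lambda>s. adj_mat (F s)) A'"
    and d': "has_poly_derivative (\<lambda>s. det (F s)) d'"
    using has_mat_derivative_adj_ex[OF assms] by blast
  have "F s * adj_mat (F s) = det (F s) \<cdot>\<^sub>m 1\<^sub>m n" for s
    using adj_mat(2) has_mat_derivativeD(1)[OF assms] by blast
  then have "has_mat_derivative n (\<lambda>s. det (F s) \<cdot>\<^sub>m 1\<^sub>m n) (F' * adj_mat (F 0) + F 0 * A')"
    using has_mat_derivative_mult[OF assms A'] by simp
  moreover have "has_mat_derivative n (\<lambda>s. det (F s) \<cdot>\<^sub>m 1\<^sub>m n)
      (d' \<cdot>\<^sub>m 1\<^sub>m n + det (F 0) \<cdot>\<^sub>m 0\<^sub>m n n)"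
    by (rule has_mat_derivative_smult[OF d' has_mat_derivative_const]) simp
  moreover have "d' \<cdot>\<^sub>m 1\<^sub>m n + det (F 0) \<cdot>\<^sub>m 0\<^sub>m n n = d' \<cdot>\<^sub>m (1\<^sub>m n :: complex poly mat)"
    by (rule eq_matI) auto
  ultimately show ?thesis using that[OF A' d'] has_mat_derivative_unique by metis
qed

subsection \<open>Congruence of matrices modulo an element\<close>

text \<open>With \<open>q = monom 1 (Suc m)\<close> this is equality of matrices over the truncated
  polynomial ring, kept on representatives so that determinants and evaluation at
  \<open>t = 0\<close> stay available.\<close>

definition mat_cong :: "'a::comm_ring_1 \<Rightarrow> nat \<Rightarrow> 'a mat \<Rightarrow> 'a mat \<Rightarrow> bool" where
  "mat_cong q n A B \<longleftrightarrow> A \<in> carrier_mat n n \<and> B \<in> carrier_mat n n \<and>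
    (\<forall>i<n. \<forall>j<n. q dvd A $$ (i, j) - B $$ (i, j))"

lemma mat_congD:
  assumes "mat_cong q n A B"
  shows "A \<in> carrier_mat n n" "B \<in> carrier_mat n n" "i < n \<Longrightarrow> j < n \<Longrightarrow> q dvd A $$ (i, j) - B $$ (i, j)"
  using assms by (auto simp: mat_cong_def)

lemma mat_cong_refl: "A \<in> carrier_mat n n \<Longrightarrow> mat_cong q n A A"
  by (simp add: mat_cong_def)

lemma mat_cong_sym: "mat_cong q n A B \<Longrightarrow> mat_cong q n B A"
  unfolding mat_cong_def by (metis dvd_minus_iff minus_diff_eq)

lemma mat_cong_trans: "mat_cong q n A B \<Longrightarrow> mat_cong q n B C \<Longrightarrow> mat_cong q n A C"
  unfolding mat_cong_def using dvd_add by (metis (no_types, lifting) diff_add_cancel diff_diff_eq2 add_diff_eq)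

lemma mat_cong_mult:
  assumes "mat_cong q n A A'" "mat_cong q n B B'"
  shows "mat_cong q n (A * B) (A' * B')"
  unfolding mat_cong_def
proof (intro conjI allI impI)
  note A = mat_congD[OF assms(1)] and B = mat_congD[OF assms(2)]
  show "A * B \<in> carrier_mat n n" "A' * B' \<in> carrier_mat n n" using A B by auto
  fix i j assume ij: "i < n" "j < n"
  have "(A * B) $$ (i, j) - (A' * B') $$ (i, j) =
      (\<Sum>k<n. A $$ (i, k) * (B $$ (k, j) - B' $$ (k, j)) + (A $$ (i, k) - A' $$ (i, k)) * B' $$ (k, j))"
    unfolding mult_mat_index[OF A(1) B(1) ij] mult_mat_index[OF A(2) B(2) ij]
    by (simp add: sum_subtractf[symmetric] algebra_simps)
  also have "q dvd \<dots>"
    by (intro dvd_sum dvd_add dvd_mult dvd_mult2 A B) (use ij in auto)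
  finally show "q dvd (A * B) $$ (i, j) - (A' * B') $$ (i, j)" .
qed

lemma mat_cong_smult:
  assumes "mat_cong q n A B"
  shows "mat_cong q n (a \<cdot>\<^sub>m A) (a \<cdot>\<^sub>m B)"
proof -
  note A = mat_congD[OF assms]
  show ?thesis unfolding mat_cong_def
    using A by (auto simp: right_diff_distrib[symmetric])
qed

lemma mat_cong_smult_left:
  assumes "q dvd a - b" "A \<in> carrier_mat n n"
  shows "mat_cong q n (a \<cdot>\<^sub>m A) (b \<cdot>\<^sub>m A)"
  using assms by (auto simp: mat_cong_def left_diff_distrib[symmetric])

section \<open>Nilpotent matrices made of chains\<close>

definition chain_mat :: "nat \<Rightarrow> nat set \<Rightarrow> 'a::{zero,one} mat" where
  "chain_mat n B = mat n n (\<lambda>(i, j). if j = i + 1 \<and> j \<in> B then 1 else 0)"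

definition weighted_chain :: "nat \<Rightarrow> (nat \<Rightarrow> 'a::zero) \<Rightarrow> 'a mat" where
  "weighted_chain n w = mat n n (\<lambda>(i, j). if j = i + 1 then w j else 0)"

definition diag_of :: "nat \<Rightarrow> (nat \<Rightarrow> 'a::zero) \<Rightarrow> 'a mat" where
  "diag_of n p = mat n n (\<lambda>(i, j). if i = j then p i else 0)"

lemma chain_mat_carrier [simp]: "chain_mat n B \<in> carrier_mat n n"
  and weighted_chain_carrier [simp]: "weighted_chain n w \<in> carrier_mat n n"
  and diag_of_carrier [simp]: "diag_of n p \<in> carrier_mat n n"
  by (simp_all add: chain_mat_def weighted_chain_def diag_of_def)

lemma chain_mat_dim [simp]: "dim_row (chain_mat n B) = n" "dim_col (chain_mat n B) = n"
  by (simp_all add: chain_mat_def)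

lemma diag_of_mult_left:
  fixes A :: "'a::comm_ring_1 mat"
  assumes "A \<in> carrier_mat n n" "i < n" "j < n"
  shows "(diag_of n p * A) $$ (i, j) = p i * A $$ (i, j)"
proof -
  have "(diag_of n p * A) $$ (i, j) = (\<Sum>k<n. diag_of n p $$ (i, k) * A $$ (k, j))"
    by (rule mult_mat_index) (use assms in auto)
  also have "\<dots> = (\<Sum>k<n. if k = i then p i * A $$ (k, j) else 0)"
    by (rule sum.cong) (use assms in \<open>auto simp: diag_of_def\<close>)
  finally show ?thesis using assms by (simp add: sum.delta)
qed

lemma diag_of_mult_right:
  fixes A :: "'a::comm_ring_1 mat"
  assumes "A \<in> carrier_mat n n" "i < n" "j < n"
  shows "(A * diag_of n p) $$ (i, j) = A $$ (i, j) * p j"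
proof -
  have "(A * diag_of n p) $$ (i, j) = (\<Sum>k<n. A $$ (i, k) * diag_of n p $$ (k, j))"
    by (rule mult_mat_index) (use assms in auto)
  also have "\<dots> = (\<Sum>k<n. if k = j then A $$ (i, k) * p k else 0)"
    by (rule sum.cong) (use assms in \<open>auto simp: diag_of_def\<close>)
  finally show ?thesis using assms by (simp add: sum.delta)
qed

lemma chain_mat_mult_left:
  fixes A :: "'a::comm_ring_1 mat"
  assumes "B \<subseteq> {1..<n}" "A \<in> carrier_mat n n" "i < n" "j < n"
  shows "(chain_mat n B * A) $$ (i, j) = (if i + 1 \<in> B then A $$ (i + 1, j) else 0)"
proof -
  have "(chain_mat n B * A) $$ (i, j) = (\<Sum>k<n. chain_mat n B $$ (i, k) * A $$ (k, j))"
    by (rule mult_mat_index) (use assms in auto)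
  also have "\<dots> = (\<Sum>k<n. if k = i + 1 then (if i + 1 \<in> B then A $$ (k, j) else 0) else 0)"
    by (rule sum.cong) (use assms in \<open>auto simp: chain_mat_def\<close>)
  finally show ?thesis using assms by (auto simp: sum.delta)
qed

lemma chain_mat_mult_right:
  fixes A :: "'a::comm_ring_1 mat"
  assumes "B \<subseteq> {1..<n}" "A \<in> carrier_mat n n" "i < n" "j < n"
  shows "(A * chain_mat n B) $$ (i, j) = (if j \<in> B then A $$ (i, j - 1) else 0)"
proof -
  have "(A * chain_mat n B) $$ (i, j) = (\<Sum>k<n. A $$ (i, k) * chain_mat n B $$ (k, j))"
    by (rule mult_mat_index) (use assms in auto)
  also have "\<dots> = (\<Sum>k<n. if k = j - 1 then (if j \<in> B then A $$ (i, k) else 0) else 0)"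
    by (rule sum.cong) (use assms in \<open>auto simp: chain_mat_def\<close>)
  finally show ?thesis using assms by (auto simp: sum.delta)
qed

lemma chain_pos_Suc:
  assumes "j \<in> B" "0 \<notin> B"
  shows "chain_pos B j = Suc (chain_pos B (j - 1))"
proof -
  have "(LEAST k. j - k \<notin> B) = Suc (LEAST k. j - Suc k \<notin> B)"
    by (rule Least_Suc[of _ j]) (use assms in auto)
  then show ?thesis by (simp add: chain_pos_def)
qed

lemma chain_mat_pow:
  fixes k :: nat
  assumes "B \<subseteq> {1..<n}" "i < n" "j < n"
  shows "(chain_mat n B ^\<^sub>m k :: 'a::comm_ring_1 mat) $$ (i, j) =
    (if j = i + k \<and> k \<le> chain_pos B j then 1 else 0)"
  using assms(3)
proof (induction k arbitrary: j)
  case 0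
  then show ?case using assms by (auto simp: chain_mat_def)
next
  case (Suc k)
  have B0: "0 \<notin> B" using assms(1) by auto
  have "chain_mat n B ^\<^sub>m k \<in> carrier_mat n n" by simp
  from chain_mat_mult_right[OF assms(1) this assms(2) Suc.prems]
  have "(chain_mat n B ^\<^sub>m Suc k :: 'a mat) $$ (i, j) =
      (if j \<in> B then (chain_mat n B ^\<^sub>m k) $$ (i, j - 1) else 0)" by simp
  also have "\<dots> = (if j = i + Suc k \<and> Suc k \<le> chain_pos B j then 1 else 0)"
  proof (cases "j \<in> B")
    case True
    then have "j \<ge> 1" using assms(1) by auto
    then show ?thesis using Suc.IH[of "j - 1"] Suc.prems True chain_pos_Suc[OF True B0] by auto
  next
    case False
    then show ?thesis using chain_pos_0_iff[OF B0, of j] by simp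
  qed
  finally show ?case .
qed

lemma chain_mat_nilpotent:
  assumes "B \<subseteq> {1..<n}"
  shows "chain_mat n B ^\<^sub>m n = (0\<^sub>m n n :: 'a::comm_ring_1 mat)"
proof (rule eq_matI)
  fix i j assume "i < dim_row (0\<^sub>m n n :: 'a mat)" "j < dim_col (0\<^sub>m n n :: 'a mat)"
  then have ij: "i < n" "j < n" by auto
  have "0 \<notin> B" using assms by auto
  then show "(chain_mat n B ^\<^sub>m n) $$ (i, j) = (0\<^sub>m n n :: 'a mat) $$ (i, j)"
    using chain_mat_pow[OF assms ij, of n, where 'a = 'a] chain_pos_le[of B j] ij by simp
qed auto

lemma chain_mat_sl: "chain_mat n B \<in> sl_mat n"
  by (simp add: sl_mat_def chain_mat_def)

text \<open>Conjugation by a diagonal matrix rescales the weights; the product of the inverse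
  nonzero weights turns them all into 1.\<close>

lemma weighted_chain_similar:
  fixes w :: "nat \<Rightarrow> complex"
  assumes "\<And>j. 0 < j \<Longrightarrow> j < n \<Longrightarrow> w j \<noteq> 0 \<longleftrightarrow> j \<in> B"
  shows "similar_mat (weighted_chain n w) (chain_mat n B)"
proof -
  define p where "p i = (\<Prod>j\<in>{1..i}. if w j = 0 then 1 else 1 / w j)" for i
  have p: "p i \<noteq> 0" for i by (simp add: p_def)
  have pS: "p (Suc i) = p i * (if w (Suc i) = 0 then 1 else 1 / w (Suc i))" for i
    by (simp add: p_def)
  let ?P = "diag_of n p" and ?Q = "diag_of n (\<lambda>i. 1 / p i)"
  show ?thesis
  proof (rule similar_matI)
    show "{weighted_chain n w, chain_mat n B, ?P, ?Q} \<subseteq> carrier_mat n n" by simp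
    show "?P * ?Q = 1\<^sub>m n"
      by (rule eq_matI) (auto simp: diag_of_mult_left[of _ n] p, auto simp: diag_of_def p)
    show "?Q * ?P = 1\<^sub>m n"
      by (rule eq_matI) (auto simp: diag_of_mult_left[of _ n] p, auto simp: diag_of_def p)
    show "weighted_chain n w = ?P * chain_mat n B * ?Q"
    proof (rule eq_matI)
      fix i j assume "i < dim_row (?P * chain_mat n B * ?Q)" "j < dim_col (?P * chain_mat n B * ?Q)"
      then have ij: "i < n" "j < n" by (auto simp: diag_of_def)
      have "(?P * chain_mat n B * ?Q) $$ (i, j) = (?P * chain_mat n B) $$ (i, j) * (1 / p j)"
        by (rule diag_of_mult_right[OF mult_carrier_mat[OF diag_of_carrier chain_mat_carrier]]) (use ij in auto)
      also have "(?P * chain_mat n B) $$ (i, j) = p i * chain_mat n B $$ (i, j)"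
        by (rule diag_of_mult_left) (use ij in auto)
      finally show "weighted_chain n w $$ (i, j) = (?P * chain_mat n B * ?Q) $$ (i, j)"
        using ij p[of i] assms[of j] pS[of i] by (auto simp: weighted_chain_def chain_mat_def)
    qed (auto simp: weighted_chain_def diag_of_def)
  qed
qed

text \<open>Prepending a block shifts the later links by its size \<open>k\<close>; index
  \<open>k\<close> stays unlinked because 0 is never a link. The last conjunct keeps a chain for
  every block size, from which chains of different lengths are later obtained.\<close>

lemma jordan_matrix_chain:
  assumes "0 \<notin> set ks"
  shows "\<exists>B\<subseteq>{1..<sum_list ks}. jordan_matrix (map (\<lambda>k. (k, 0 :: complex)) ks) = chain_mat (sum_list ks) B \<and>
    (\<forall>k\<in>set ks. \<exists>c<sum_list ks. c \<notin> B \<and> chain_len B c = k - 1)"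
  using assms
proof (induction ks)
  case Nil
  have "jordan_matrix [] = (chain_mat 0 {} :: complex mat)"
    by (rule eq_matI) (auto simp: chain_mat_def jordan_matrix_def)
  then show ?case by auto
next
  case (Cons k ks)
  let ?N = "sum_list ks"
  obtain B where B: "B \<subseteq> {1..<?N}"
    "jordan_matrix (map (\<lambda>k. (k, 0 :: complex)) ks) = chain_mat ?N B"
    "\<And>k. k \<in> set ks \<Longrightarrow> \<exists>c<?N. c \<notin> B \<and> chain_len B c = k - 1"
    using Cons by auto
  have k: "k \<ge> 1" using Cons.prems by (simp add: Suc_leI)
  define C where "C = {1..<k} \<union> (\<lambda>i. k + i) ` B"
  have memC: "k + i \<in> C \<longleftrightarrow> i \<in> B" for i by (auto simp: C_def)
  have finB: "finite B" using B(1) finite_subset by blast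
  have "C \<subseteq> {1..<sum_list (k # ks)}" using B(1) k by (auto simp: C_def)
  moreover have "jordan_matrix (map (\<lambda>k. (k, 0 :: complex)) (k # ks)) = chain_mat (sum_list (k # ks)) C"
  proof -
    have "jordan_matrix (map (\<lambda>k. (k, 0 :: complex)) (k # ks)) =
        four_block_mat (jordan_block k 0) (0\<^sub>m k ?N) (0\<^sub>m ?N k) (chain_mat ?N B)"
      using B(2) by (simp add: jordan_matrix_def Let_def chain_mat_def)
    also have "\<dots> = chain_mat (sum_list (k # ks)) C"
    proof (rule eq_matI)
      fix i j assume "i < dim_row (chain_mat (sum_list (k # ks)) C :: complex mat)"
        "j < dim_col (chain_mat (sum_list (k # ks)) C :: complex mat)"
      then have ij: "i < k + ?N" "j < k + ?N" by (auto simp: chain_mat_def)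
      have jC: "j \<in> C \<longleftrightarrow> (if j < k then j \<ge> 1 else j - k \<in> B)"
        using memC[of "j - k"] by (auto simp: C_def)
      have 0: "0 \<notin> B" using B(1) by auto
      show "four_block_mat (jordan_block k 0) (0\<^sub>m k ?N) (0\<^sub>m ?N k) (chain_mat ?N B) $$ (i, j) =
          (chain_mat (sum_list (k # ks)) C :: complex mat) $$ (i, j)"
        using ij 0 by (auto simp: chain_mat_def jC Suc_diff_le)
    qed (auto simp: chain_mat_def)
    finally show ?thesis .
  qed
  moreover have "\<exists>c<sum_list (k # ks). c \<notin> C \<and> chain_len C c = k' - 1" if k': "k' \<in> set (k # ks)" for k'
  proof (cases "k' = k")
    case True
    have "chain_len C 0 = k - 1"
      by (rule chain_len_eqI) (use k B(1) in \<open>auto simp: C_def\<close>)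
    then show ?thesis using True k B(1) by (intro exI[of _ 0]) (auto simp: C_def)
  next
    case False
    then obtain c where c: "c < ?N" "c \<notin> B" "chain_len B c = k' - 1" using B(3) k' by auto
    have "chain_len C (k + c) = chain_len B c"
    proof (rule chain_len_eqI)
      show "k + c + chain_len B c + 1 \<notin> C"
        using memC[of "c + chain_len B c + 1"] chain_len_end[OF finB, of c] by (simp add: add.assoc)
      fix j assume "j < chain_len B c"
      then show "k + c + j + 1 \<in> C"
        using memC[of "c + j + 1"] chain_len_link[of "j + 1" B c] by (simp add: add.assoc)
    qed
    then show ?thesis using c memC[of c] by (intro exI[of _ "k + c"]) auto
  qed
  ultimately show ?case by blast
qed

abbreviation chain_orbit :: "nat \<Rightarrow> nat set \<Rightarrow> complex mat set" where
  "chain_orbit n B \<equiv> {X. similar_mat X (chain_mat n B)}"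

lemma chain_orbit_carrier: "chain_orbit n B \<subseteq> carrier_mat n n"
proof safe
  fix X assume "similar_mat X (chain_mat n B :: complex mat)"
  from similar_matD[OF this] show "X \<in> carrier_mat n n" by fastforce
qed

section \<open>Orbit closures and their jets in terms of polynomial functions\<close>

text \<open>Vanishing on the orbit itself is demanded, which by \<open>mem_orbit_closure\<close>
  gives the same functions as vanishing on its closure. \<open>($$) A\<close> is the matrix as an
  assignment of all indices; only those in \<open>mat_coords n\<close> are read.\<close>

definition vanishing_fun :: "nat \<Rightarrow> complex mat set \<Rightarrow> ((nat \<times> nat \<Rightarrow> complex) \<Rightarrow> complex) set" where
  "vanishing_fun n Ob = {F \<in> polyfun (mat_coords n). \<forall>A\<in>Ob. F (($$) A) = 0}"

lemma finite_mat_coords: "finite (mat_coords n)"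
  by (simp add: mat_coords_def)

lemma polyfun_mat_point:
  assumes "F \<in> polyfun (mat_coords n)"
  shows "F (mat_point n A) = F (($$) A)"
  by (rule polyfun_cong[OF assms]) (simp add: mat_point_def)

lemma mat_point_extensional: "mat_point n A \<in> mat_coords n \<rightarrow>\<^sub>E UNIV"
  by (auto simp: mat_point_def)

lemma mem_orbit_closure:
  "A \<in> orbit_closure n Ob \<longleftrightarrow>
    A \<in> carrier_mat n n \<and> (\<forall>F\<in>vanishing_fun n Ob. F (($$) A) = 0)"
proof -
  let ?X = "zariski (mat_coords n)" and ?S = "mat_point n ` Ob"
  have top: "topspace ?X = mat_coords n \<rightarrow>\<^sub>E UNIV" by (rule topspace_zariski)
  have X: "subtopology ?X (mat_coords n \<rightarrow>\<^sub>E UNIV) = ?X"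
    using subtopology_topspace[of ?X] by (simp add: top)
  have sub: "?S \<subseteq> topspace ?X" using mat_point_extensional by (auto simp: top)
  have "mat_point n A \<in> ?X closure_of ?S \<longleftrightarrow> (\<forall>F\<in>vanishing_fun n Ob. F (($$) A) = 0)"
  proof
    assume A: "mat_point n A \<in> ?X closure_of ?S"
    show "\<forall>F\<in>vanishing_fun n Ob. F (($$) A) = 0"
    proof
      fix F assume F: "F \<in> vanishing_fun n Ob"
      let ?Z = "{x \<in> mat_coords n \<rightarrow>\<^sub>E UNIV. F x = 0}"
      have Fp: "F \<in> polyfun (mat_coords n)" using F by (simp add: vanishing_fun_def)
      have "closedin ?X ?Z"
        using closedin_zariski_subtopology_zeros[OF Fp order_refl] by (simp only: X)
      moreover have "?S \<subseteq> ?Z"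
        using F mat_point_extensional by (auto simp: vanishing_fun_def polyfun_mat_point)
      ultimately have "mat_point n A \<in> ?Z" using A closure_of_minimal by blast
      then show "F (($$) A) = 0" by (simp add: polyfun_mat_point[OF Fp])
    qed
  next
    assume A: "\<forall>F\<in>vanishing_fun n Ob. F (($$) A) = 0"
    show "mat_point n A \<in> ?X closure_of ?S"
    proof (rule ccontr)
      assume "mat_point n A \<notin> ?X closure_of ?S"
      moreover have "closedin (subtopology ?X (mat_coords n \<rightarrow>\<^sub>E UNIV)) (?X closure_of ?S)"
        by (simp add: X)
      ultimately obtain F where F: "F \<in> polyfun (mat_coords n)" "F (mat_point n A) \<noteq> 0"
        "\<forall>z\<in>?X closure_of ?S. F z = 0"
        using closedin_zariski_subtopology_separate mat_point_extensional order_refl by metis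
      have "F (($$) C) = 0" if "C \<in> Ob" for C
        using F(3) closure_of_subset[OF sub] that polyfun_mat_point[OF F(1), of C] by auto
      then have "F \<in> vanishing_fun n Ob" using F(1) by (simp add: vanishing_fun_def)
      then show False using A F(2) polyfun_mat_point[OF F(1)] by simp
    qed
  qed
  then show ?thesis by (simp add: orbit_closure_def)
qed

section \<open>Jets as tuples of polynomials\<close>

lemma comm_ring_hom_poly: "comm_ring_hom (\<lambda>p. poly p t :: 'a::comm_ring_1)"
  by unfold_locales auto

lemma poly_eval_cpoly:
  fixes f :: "'i cpoly"
  shows "poly (eval_cpoly (\<lambda>c. [:c:]) y f) t = eval_cpoly id (\<lambda>i. poly (y i) t) f"
  using eval_cpoly_hom[OF comm_ring_hom_poly[of t], where h = "\<lambda>c. [:c:]" and x = y and f = f]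
  by (simp add: id_def)

text \<open>An element of \<open>polyfun\<close> is a function on numbers and cannot be applied to
  polynomials in \<open>t\<close>. Its composite with a jet is therefore the polynomial
  \<open>p\<close> with the prescribed values, which exists and is unique over an infinite
  field.\<close>

lemma jet_points_iff:
  assumes Ob: "Ob \<subseteq> carrier_mat n n"
  shows "x \<in> jet_points id (mat_coords n)
      (vanishing_ideal (mat_coords n) (mat_point n ` orbit_closure n Ob)) m \<longleftrightarrow>
    x \<in> (mat_coords n \<times> {..m}) \<rightarrow>\<^sub>E UNIV \<and>
    (\<forall>F\<in>vanishing_fun n Ob. \<forall>p. (\<forall>t. poly p t = F (\<lambda>i. poly (jet_coord m x i) t)) \<longrightarrow>
      monom 1 (Suc m) dvd p)"
proof -
  let ?I = "vanishing_ideal (mat_coords n) (mat_point n ` orbit_closure n Ob)"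
  have I: "f \<in> ?I \<longleftrightarrow> f \<in> cpoly_ring (mat_coords n) \<and> (\<lambda>x. eval_cpoly id x f) \<in> vanishing_fun n Ob" for f
  proof -
    have "(\<forall>x\<in>mat_point n ` orbit_closure n Ob. eval_cpoly id x f = 0) \<longleftrightarrow>
        (\<lambda>x. eval_cpoly id x f) \<in> vanishing_fun n Ob" if f: "f \<in> cpoly_ring (mat_coords n)"
    proof -
      note Fp = eval_cpoly_polyfun[OF f]
      have "Ob \<subseteq> orbit_closure n Ob"
        using Ob by (auto simp: mem_orbit_closure vanishing_fun_def)
      then show ?thesis
        using Fp polyfun_mat_point[OF Fp] by (auto simp: mem_orbit_closure vanishing_fun_def)
    qed
    then show ?thesis unfolding vanishing_ideal_def by blast
  qed
  have "comm_ring_hom (id :: complex \<Rightarrow> complex)" by (rule comm_ring_hom_id_complex)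
  note jets = jet_scheme_points[OF this, of "mat_coords n" ?I m]
  have "(\<forall>f\<in>?I. monom 1 (Suc m) dvd eval_cpoly (\<lambda>c. [:id c:]) (jet_coord m x) f) \<longleftrightarrow>
    (\<forall>F\<in>vanishing_fun n Ob. \<forall>p. (\<forall>t. poly p t = F (\<lambda>i. poly (jet_coord m x i) t)) \<longrightarrow>
      monom 1 (Suc m) dvd p)" (is "?L \<longleftrightarrow> ?R")
  proof
    assume L: ?L
    show ?R
    proof (intro ballI allI impI)
      fix F p assume F: "F \<in> vanishing_fun n Ob"
        and p: "\<forall>t. poly p t = F (\<lambda>i. poly (jet_coord m x i) t)"
      obtain f where f: "f \<in> cpoly_ring (mat_coords n)" "\<forall>x. eval_cpoly id x f = F x"
        using polyfun_cpoly_ex[of F "mat_coords n"] F unfolding vanishing_fun_def by blast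
      have "(\<lambda>x. eval_cpoly id x f) = F" using f(2) by auto
      then have "f \<in> ?I" using f F I by simp
      then have "monom 1 (Suc m) dvd eval_cpoly (\<lambda>c. [:c:]) (jet_coord m x) f" using L by auto
      moreover have "eval_cpoly (\<lambda>c. [:c:]) (jet_coord m x) f = p"
        using f(2) p by (intro poly_eqI_degree_lead_coeff poly_ext) (simp_all add: poly_eval_cpoly)
      ultimately show "monom 1 (Suc m) dvd p" by simp
    qed
  next
    assume R: ?R
    show ?L
    proof
      fix f assume f: "f \<in> ?I"
      then have "(\<lambda>x. eval_cpoly id x f) \<in> vanishing_fun n Ob" using I by blast
      from R[rule_format, OF this] show "monom 1 (Suc m) dvd eval_cpoly (\<lambda>c. [:id c:]) (jet_coord m x) f"
        by (simp add: poly_eval_cpoly)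
    qed
  qed
  then show ?thesis unfolding jets by simp
qed

section \<open>Jets over an orbit\<close>

lemma chain_start_unique:
  assumes "a \<notin> B" "a' \<notin> B" "x \<le> chain_len B a" "x' \<le> chain_len B a'" "a + x = a' + x'"
  shows "a = a'"
proof (rule ccontr)
  assume "a \<noteq> a'"
  then consider "a < a'" | "a' < a" by linarith
  then show False
  proof cases
    case 1
    then have "a + (a' - a) \<in> B" using assms by (intro chain_len_link) auto
    then show False using 1 assms by simp
  next
    case 2
    then have "a' + (a - a') \<in> B" using assms by (intro chain_len_link) auto
    then show False using 2 assms by simp
  qed
qed

lemma chain_pos_add:
  assumes "0 \<notin> B" "j \<le> chain_len B i"
  shows "chain_pos B (i + j) = chain_pos B i + j"
  using assms(2)
proof (induction j)
  case (Suc j)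
  have "i + Suc j \<in> B" by (rule chain_len_link) (use Suc.prems in auto)
  from chain_pos_Suc[OF this assms(1)] show ?case using Suc by simp
qed simp

text \<open>Normalized to constant coefficient 1, \<delta> is 1 - Y with \<open>Y\<close> divisible
  by the variable, and the truncated geometric series inverts it.\<close>

lemma poly_unit_mod_monom:
  fixes \<delta> :: "'a::field poly"
  assumes "poly \<delta> 0 \<noteq> 0"
  shows "\<exists>d. monom 1 (Suc m) dvd d * \<delta> - 1"
proof -
  let ?c = "1 / poly \<delta> 0"
  define Y where "Y = 1 - Polynomial.smult ?c \<delta>"
  have "poly Y 0 = 0" using assms by (simp add: Y_def)
  then have "[:0, 1:] dvd Y" using poly_eq_0_iff_dvd[of Y 0] by simp
  then have "[:0, 1:] ^ Suc m dvd Y ^ Suc m" by (rule dvd_power_same)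
  then have dvd: "monom 1 (Suc m) dvd Y ^ Suc m" by (simp add: monom_altdef)
  have "Polynomial.smult ?c \<delta> = 1 - Y" by (simp add: Y_def)
  then have "(Polynomial.smult ?c (\<Sum>k\<le>m. Y ^ k)) * \<delta> = (1 - Y) * (\<Sum>k\<le>m. Y ^ k)"
    by (metis mult.commute mult_smult_left mult_smult_right)
  also have "\<dots> = 1 - Y ^ Suc m" by (rule sum_gp_basic)
  finally have "(Polynomial.smult ?c (\<Sum>k\<le>m. Y ^ k)) * \<delta> - 1 = - (Y ^ Suc m)" by simp
  then show ?thesis using dvd by (metis dvd_minus_iff)
qed

lemma pow_mat_commute:
  fixes A :: "'a::comm_ring_1 mat"
  assumes "A \<in> carrier_mat n n"
  shows "A * A ^\<^sub>m k = A ^\<^sub>m Suc k"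
proof (induction k)
  case 0
  then show ?case using assms by simp
next
  case (Suc k)
  have "A * A ^\<^sub>m Suc k = (A * A ^\<^sub>m k) * A"
    using assoc_mult_mat[OF assms pow_carrier_mat[OF assms, of k] assms] by simp
  then show ?case using Suc by simp
qed

text \<open>If \<open>k A k'\<close> has the rank of \<open>A\<close> and \<open>E\<close> completes it to an invertible matrix, where \<open>E\<close> and
  \<open>A\<close> have complementary sets of nonzero columns, then their images are complementary.\<close>

lemma complement_inverse:
  fixes A :: "'a::field mat"
  assumes c: "A \<in> carrier_mat n n" "k \<in> carrier_mat n n" "k' \<in> carrier_mat n n"
      "E \<in> carrier_mat n n" "P \<in> carrier_mat n n" "Mi \<in> carrier_mat n n"
    and AP: "A * P = 0\<^sub>m n n" and EP: "E * P = E" and PP: "P * P = P"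
    and inv: "(k * A * k' + E) * Mi = 1\<^sub>m n"
  shows "E * Mi * E = E"
proof -
  define J where "J = 1\<^sub>m n - P"
  define Z where "Z = J * k' - P"
  define T where "T = k * A - E"
  have J: "J \<in> carrier_mat n n" and Z: "Z \<in> carrier_mat n n" and T: "T \<in> carrier_mat n n"
    using c by (auto simp: J_def Z_def T_def)
  note assoc = assoc_mult_mat[of _ n n _ n _ n]
  have AJ: "A * J = A" "E * J = 0\<^sub>m n n" "P * J = 0\<^sub>m n n"
    unfolding J_def using c
    by (simp_all add: mult_minus_distrib_mat[of _ n n _ n] AP EP PP minus_r_inv_mat) auto
  have TJ: "T * J = k * A"
  proof -
    have "T * J = k * A * J - E * J"
      unfolding T_def using c J by (intro minus_mult_distrib_mat) auto
    also have "k * A * J = k * A" using c J AJ(1) by (simp add: assoc)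
    finally show ?thesis using c AJ(2) by auto
  qed
  have TP: "T * P = - E"
  proof -
    have "T * P = k * A * P - E * P"
      unfolding T_def using c by (intro minus_mult_distrib_mat) auto
    also have "k * A * P = 0\<^sub>m n n" using c AP by (simp add: assoc)
    finally show ?thesis using c EP by auto
  qed
  have TZ: "T * Z = k * A * k' + E"
  proof -
    have "T * Z = T * (J * k') - T * P"
      unfolding Z_def using c J T by (intro mult_minus_distrib_mat) auto
    also have "T * (J * k') = k * A * k'" using assoc_mult_mat[OF T J c(3)] TJ by simp
    finally show ?thesis using c by (auto simp: TP)
  qed
  have PZ: "P * Z = - P"
  proof -
    have "P * Z = P * (J * k') - P * P"
      unfolding Z_def using c J by (intro mult_minus_distrib_mat) auto
    also have "P * (J * k') = 0\<^sub>m n n" using assoc_mult_mat[OF c(5) J c(3)] AJ(3) c by simp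
    finally show ?thesis using c PP by auto
  qed
  have "T * (Z * Mi) = 1\<^sub>m n" using assoc_mult_mat[OF T Z c(6)] inv TZ by simp
  then have "(Z * Mi) * T = 1\<^sub>m n"
    by (rule mult_mat_1_commute[rotated 2]) (use c T Z in auto)
  then have "P = P * ((Z * Mi) * T)" using c by simp
  also have "\<dots> = (P * Z) * (Mi * T)" using c Z T by (simp add: assoc)
  also have "\<dots> = - (P * (Mi * T))" unfolding PZ using c T by simp
  finally have P: "P * (Mi * T) = - P" using c T by (metis mult_carrier_mat uminus_uminus_mat)
  have "E * Mi * E = (T * P) * Mi * (T * P)" unfolding TP using c by simp
  also have "\<dots> = T * ((P * (Mi * T)) * P)" using c T by (simp add: assoc)
  also have "(P * (Mi * T)) * P = - P" unfolding P using c PP by simp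
  also have "T * (- P) = E" using c T TP by simp
  finally show ?thesis .
qed

section \<open>Polynomial equations expressing constancy of rank\<close>

lemma (in comm_ring_hom) hom_add_mat:
  "A \<in> carrier_mat n n \<Longrightarrow> B \<in> carrier_mat n n \<Longrightarrow> map_mat hom (A + B) = map_mat hom A + map_mat hom B"
  by (rule eq_matI) (auto simp: hom_add)

lemma (in comm_ring_hom) hom_pow_mat:
  "A \<in> carrier_mat n n \<Longrightarrow> map_mat hom (A ^\<^sub>m k) = map_mat hom A ^\<^sub>m k"
  by (rule mat_hom_pow)

lemma (in comm_ring_hom) hom_mult_mat:
  "A \<in> carrier_mat n n \<Longrightarrow> B \<in> carrier_mat n n \<Longrightarrow> map_mat hom (A * B) = map_mat hom A * map_mat hom B"
  by (rule mat_hom_mult)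

lemma (in comm_ring_hom) hom_det_mat: "det (map_mat hom A) = hom (det A)"
  by (rule hom_det)

text \<open>With M = Z^l + E, the equation \<open>E * inverse M * E = E\<close> cleared of
  denominators. The second factor \<open>det M\<close> makes it hold also where \<open>M\<close> is
  singular, so that it is a polynomial identity on the whole orbit.\<close>

definition complement_eq :: "'a::comm_ring_1 mat \<Rightarrow> nat \<Rightarrow> 'a mat \<Rightarrow> 'a mat" where
  "complement_eq E l Z = (let M = Z ^\<^sub>m l + E in
    det M \<cdot>\<^sub>m (E * adj_mat M * E + (- det M) \<cdot>\<^sub>m E))"

lemma (in comm_ring_hom) hom_complement_eq:
  assumes "E \<in> carrier_mat n n" "Z \<in> carrier_mat n n"
  shows "map_mat hom (complement_eq E l Z) = complement_eq (map_mat hom E) l (map_mat hom Z)"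
proof -
  let ?M = "Z ^\<^sub>m l + E"
  have M: "?M \<in> carrier_mat n n" using assms by auto
  then have aM: "adj_mat ?M \<in> carrier_mat n n" by (rule adj_mat(1))
  have hM: "map_mat hom ?M = map_mat hom Z ^\<^sub>m l + map_mat hom E"
    using assms mat_hom_pow[OF assms(2)] by (simp add: hom_add_mat[of _ n])
  have smult: "map_mat hom (a \<cdot>\<^sub>m A) = hom a \<cdot>\<^sub>m map_mat hom A" for a A
    by (rule eq_matI) (auto simp: hom_mult)
  have "map_mat hom (E * adj_mat ?M * E + (- det ?M) \<cdot>\<^sub>m E) =
      map_mat hom (E * adj_mat ?M * E) + map_mat hom ((- det ?M) \<cdot>\<^sub>m E)"
    by (rule hom_add_mat[of _ n]) (use assms aM in auto)
  also have "map_mat hom (E * adj_mat ?M * E) =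
      map_mat hom E * adj_mat (map_mat hom ?M) * map_mat hom E"
    by (simp only: mat_hom_mult[OF mult_carrier_mat[OF assms(1) aM] assms(1)]
        mat_hom_mult[OF assms(1) aM] hom_adj_mat)
  finally show ?thesis
    by (simp add: complement_eq_def Let_def smult hom_det[symmetric] hM hom_uminus del: hom_det)
qed

lemma mat_fun_const: "A \<in> carrier_mat n n \<Longrightarrow> mat_fun (polyfun I) n (\<lambda>x. A)"
  by (simp add: mat_fun_def polyfun.const)

lemma mat_fun_coords: "mat_fun (polyfun (mat_coords n)) n (\<lambda>z. mat n n z)"
  by (auto simp: mat_fun_def mat_coords_def intro!: polyfun.coord)

lemma complement_eq_polyfun:
  assumes "E \<in> carrier_mat n n" "i < n" "j < n"
  shows "(\<lambda>z. complement_eq E l (mat n n z) $$ (i, j)) \<in> polyfun (mat_coords n)"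
proof -
  note R = fun_subring_polyfun[of "mat_coords n"]
  note E = mat_fun_const[OF assms(1), of "mat_coords n"]
  have M: "mat_fun (polyfun (mat_coords n)) n (\<lambda>z. mat n n z ^\<^sub>m l + E)"
    by (intro mat_fun_add[OF R] mat_fun_pow[OF R] mat_fun_coords E)
  have "mat_fun (polyfun (mat_coords n)) n (\<lambda>z. complement_eq E l (mat n n z))"
    unfolding complement_eq_def Let_def
    by (intro mat_fun_add[OF R mat_fun_mult[OF R mat_fun_mult[OF R E mat_fun_adj[OF R M]] E]]
        mat_fun_smult[OF R] fun_subring_det[OF R M] fun_subring_uminus[OF R] E)
  then show ?thesis using assms by (simp add: mat_fun_def)
qed

lemma complement_eq_carrier:
  assumes "E \<in> carrier_mat n n" "Z \<in> carrier_mat n n"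
  shows "complement_eq E l Z \<in> carrier_mat n n"
  unfolding complement_eq_def Let_def using assms adj_mat(1)[of "Z ^\<^sub>m l + E" n] by auto

lemma one_smult_mat: "1 \<cdot>\<^sub>m A = (A :: 'a::comm_ring_1 mat)"
  by (rule eq_matI) auto

text \<open>Where the determinant vanishes the outer factor does the work; elsewhere this is
  \<open>complement_inverse\<close>, applied to the conjugating matrices of a point of the
  orbit.\<close>

lemma complement_eq_similar:
  fixes X :: "complex mat"
  assumes E: "E \<in> carrier_mat n n" "P \<in> carrier_mat n n" "E * P = E" "P * P = P"
    and A: "A \<in> carrier_mat n n" "A ^\<^sub>m l * P = 0\<^sub>m n n" and sim: "similar_mat X A"
  shows "complement_eq E l X = 0\<^sub>m n n"
proof -
  obtain k k' where w: "similar_mat_wit X A k k'" using sim by (auto simp: similar_mat_def)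
  have X: "X \<in> carrier_mat n n"
    using similar_matD[OF sim] A by fastforce
  note k = similar_mat_witD2[OF X w]
  let ?M = "X ^\<^sub>m l + E"
  have M: "?M \<in> carrier_mat n n" using X E by auto
  have adj: "adj_mat ?M \<in> carrier_mat n n" "?M * adj_mat ?M = det ?M \<cdot>\<^sub>m 1\<^sub>m n"
    using adj_mat[OF M] by auto
  have Xl: "X ^\<^sub>m l = k * A ^\<^sub>m l * k'" by (rule similar_mat_wit_pow_id[OF w])
  show ?thesis
  proof (cases "det ?M = 0")
    case True
    then show ?thesis using E by (auto simp: complement_eq_def intro!: eq_matI)
  next
    case False
    let ?Mi = "(1 / det ?M) \<cdot>\<^sub>m adj_mat ?M"
    have "?M * ?Mi = (1 / det ?M * det ?M) \<cdot>\<^sub>m 1\<^sub>m n"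
      using smult_mult_right_mat[OF M adj(1)] adj(2) by (simp add: smult_smult_mat)
    then have "(k * A ^\<^sub>m l * k' + E) * ?Mi = 1\<^sub>m n" using False Xl by (simp add: one_smult_mat)
    from complement_inverse[OF _ _ _ E(1,2) _ A(2) E(3,4) this]
    have "E * ?Mi * E = E" using A(1) k adj(1) by simp
    moreover have "E * ?Mi * E = (1 / det ?M) \<cdot>\<^sub>m (E * adj_mat ?M * E)"
      using smult_mult_right_mat[OF E(1) adj(1)]
        smult_mult_left_mat[OF mult_carrier_mat[OF E(1) adj(1)] E(1)] by simp
    ultimately have eq: "E = (1 / det ?M) \<cdot>\<^sub>m (E * adj_mat ?M * E)" by simp
    have "det ?M \<cdot>\<^sub>m E = det ?M \<cdot>\<^sub>m ((1 / det ?M) \<cdot>\<^sub>m (E * adj_mat ?M * E))"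
      using eq by (rule arg_cong)
    also have "\<dots> = (det ?M * (1 / det ?M)) \<cdot>\<^sub>m (E * adj_mat ?M * E)" by (rule smult_smult_mat)
    also have "det ?M * (1 / det ?M) = 1" using False by simp
    finally have "E * adj_mat ?M * E = det ?M \<cdot>\<^sub>m E" by (simp only: one_smult_mat)
    then have "E * adj_mat ?M * E + (- det ?M) \<cdot>\<^sub>m E = det ?M \<cdot>\<^sub>m E + (- det ?M) \<cdot>\<^sub>m E" by simp
    also have "\<dots> = 0\<^sub>m n n" using E by (auto intro!: eq_matI)
    finally show ?thesis by (auto simp: complement_eq_def Let_def intro!: eq_matI)
  qed
qed

text \<open>In a chain with L = chain_pos + chain_len + 1 elements, the l-th power of the chain
  matrix kills the first \<open>l\<close> positions and misses the last \<open>l\<close>. This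
  matrix maps the former onto the latter. If L < l, the truncated subtraction gives 0 and the whole
  chain is mapped identically.\<close>

definition completion :: "nat \<Rightarrow> nat set \<Rightarrow> nat \<Rightarrow> 'a::{zero,one} mat" where
  "completion n B l = mat n n (\<lambda>(r, c). if chain_pos B c < l \<and>
    r = c + (chain_pos B c + chain_len B c + 1 - l) then 1 else 0)"

definition low_proj :: "nat \<Rightarrow> nat set \<Rightarrow> nat \<Rightarrow> 'a::{zero,one} mat" where
  "low_proj n B l = diag_of n (\<lambda>i. if chain_pos B i < l then 1 else 0)"

lemma completion_carrier [simp]: "completion n B l \<in> carrier_mat n n"
  and low_proj_carrier [simp]: "low_proj n B l \<in> carrier_mat n n"
  by (simp_all add: completion_def low_proj_def)

lemma completion_dim [simp]: "dim_row (completion n B l) = n" "dim_col (completion n B l) = n"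
  and low_proj_dim [simp]: "dim_row (low_proj n B l) = n" "dim_col (low_proj n B l) = n"
  by (simp_all add: completion_def low_proj_def diag_of_def)

context
  fixes n :: nat and B :: "nat set"
  assumes B: "B \<subseteq> {1..<n}"
begin

lemma low_proj_mult:
  fixes A :: "'a::comm_ring_1 mat"
  assumes "A \<in> carrier_mat n n" "i < n" "j < n"
  shows "(A * low_proj n B l) $$ (i, j) = (if chain_pos B j < l then A $$ (i, j) else 0)"
  unfolding low_proj_def by (subst diag_of_mult_right[OF assms]) simp

lemma chain_pow_low_proj:
  "chain_mat n B ^\<^sub>m l * low_proj n B l = (0\<^sub>m n n :: 'a::comm_ring_1 mat)"
  by (rule eq_matI) (auto simp: low_proj_mult chain_mat_pow[OF B] simp del: index_mult_mat(1))

lemma completion_low_proj: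
  "completion n B l * low_proj n B l = (completion n B l :: 'a::comm_ring_1 mat)"
proof (rule eq_matI)
  fix i j assume "i < dim_row (completion n B l :: 'a mat)" "j < dim_col (completion n B l :: 'a mat)"
  then have "i < n" "j < n" by (auto simp: completion_def)
  then show "(completion n B l * low_proj n B l) $$ (i, j) = (completion n B l :: 'a mat) $$ (i, j)"
    by (subst low_proj_mult) (auto simp: completion_def)
qed (auto simp: low_proj_def diag_of_def completion_def)

lemma low_proj_idem:
  "low_proj n B l * low_proj n B l = (low_proj n B l :: 'a::comm_ring_1 mat)"
proof (rule eq_matI)
  fix i j assume "i < dim_row (low_proj n B l :: 'a mat)" "j < dim_col (low_proj n B l :: 'a mat)"
  then have "i < n" "j < n" by (auto simp: low_proj_def diag_of_def)
  then show "(low_proj n B l * low_proj n B l) $$ (i, j) = (low_proj n B l :: 'a mat) $$ (i, j)"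
    by (subst low_proj_mult) (auto simp: low_proj_def diag_of_def)
qed (auto simp: low_proj_def diag_of_def)

text \<open>The sum is a permutation matrix: \<sigma> rotates every chain with at least
  \<open>l\<close> elements by \<open>l\<close> steps and fixes the shorter ones.\<close>

lemma completion_invertible:
  "det (chain_mat n B ^\<^sub>m l + completion n B l :: 'a::field mat) \<noteq> 0"
proof -
  have B0: "0 \<notin> B" and finB: "finite B" using B finite_subset by auto
  define \<sigma> where "\<sigma> c = (if l \<le> chain_pos B c then c - l
    else c + (chain_pos B c + chain_len B c + 1 - l))" for c
  define f where "f c = (if l \<le> chain_pos B c then chain_pos B c - l
    else chain_pos B c + (chain_pos B c + chain_len B c + 1 - l))" for c
  define a where "a c = c - chain_pos B c" for c
  have ca: "c = a c + chain_pos B c" for c using chain_pos_le[OF B0, of c] by (simp add: a_def)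
  have aB: "a c \<notin> B" for c unfolding a_def by (rule chain_pos_start[OF B0])
  have la: "chain_len B (a c) = chain_len B c + chain_pos B c" for c
    unfolding a_def by (rule chain_len_diff[OF B0 order_refl finB])
  have fa: "f c \<le> chain_len B (a c)" for c unfolding la by (auto simp: f_def)
  have \<sigma>a: "\<sigma> c = a c + f c" for c using ca[of c] by (auto simp: \<sigma>_def f_def)
  have \<sigma>n: "\<sigma> c < n" if "c < n" for c
  proof -
    have "a c + chain_len B (a c) < n" using that by (intro chain_len_less[OF B]) (simp add: a_def)
    then show ?thesis using fa[of c] \<sigma>a[of c] by linarith
  qed
  have \<sigma>inj: "c = c'" if "\<sigma> c = \<sigma> c'" for c c'
  proof -
    have "a c = a c'"
      by (rule chain_start_unique[OF aB aB fa fa]) (use that \<sigma>a in simp)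
    then have "f c = f c'" "chain_len B c + chain_pos B c = chain_len B c' + chain_pos B c'"
      using that \<sigma>a[of c] \<sigma>a[of c'] la[of c] la[of c'] by auto
    then have "chain_pos B c = chain_pos B c'" by (auto simp: f_def split: if_splits)
    then show ?thesis using ca[of c] ca[of c'] \<open>a c = a c'\<close> by simp
  qed
  let ?M = "chain_mat n B ^\<^sub>m l + completion n B l :: 'a mat"
  let ?T = "mat n n (\<lambda>(i, j). if j = \<sigma> i then 1 else 0) :: 'a mat"
  have M: "?M $$ (r, c) = (if r = \<sigma> c then 1 else 0)" if "r < n" "c < n" for r c
    using that chain_pos_le[OF B0, of c]
    by (auto simp: chain_mat_pow[OF B] completion_def \<sigma>_def)
  have "?T * ?M = 1\<^sub>m n"
  proof (rule eq_matI)
    fix i j assume "i < dim_row (1\<^sub>m n :: 'a mat)" "j < dim_col (1\<^sub>m n :: 'a mat)"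
    then have ij: "i < n" "j < n" by auto
    have "(?T * ?M) $$ (i, j) = (\<Sum>k<n. ?T $$ (i, k) * ?M $$ (k, j))"
      by (rule mult_mat_index) (use ij in auto)
    also have "\<dots> = (\<Sum>k<n. if k = \<sigma> i then (if \<sigma> i = \<sigma> j then 1 else 0) else 0)"
      by (rule sum.cong) (use ij M in auto)
    also have "\<dots> = (if i = j then 1 else 0)"
      using \<sigma>n[OF ij(1)] \<sigma>inj[of i j] by (auto simp: sum.delta)
    finally show "(?T * ?M) $$ (i, j) = (1\<^sub>m n :: 'a mat) $$ (i, j)" using ij by simp
  qed auto
  then have "?M * ?T = 1\<^sub>m n" by (rule mult_mat_1_commute[rotated 2]) auto
  then show ?thesis by (rule invertible_mat_det_nonzero[rotated 2]) auto
qed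

text \<open>For a jet \<open>N\<close> over the chain matrix itself, vectors in the kernel of \<open>N(0) ^ l\<close> lift to
  the kernel of \<open>N ^ l\<close>, because the rank of \<open>N ^ l\<close> does not jump.\<close>

lemma kernel_lift:
  fixes N :: "complex poly mat"
  assumes N: "N \<in> carrier_mat n n" and N0: "map_mat (\<lambda>p. poly p 0) N = chain_mat n B"
    and jet: "\<forall>F\<in>vanishing_fun n (chain_orbit n B).
      \<forall>p. (\<forall>t. poly p t = F (\<lambda>i. poly (N $$ i) t)) \<longrightarrow> monom 1 (Suc m) dvd p"
  shows "\<exists>Q\<in>carrier_mat n n. mat_cong (monom 1 (Suc m)) n (N ^\<^sub>m l * Q) (0\<^sub>m n n) \<and>
    map_mat (\<lambda>p. poly p 0) Q = low_proj n B l"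
proof -
  let ?q = "monom 1 (Suc m) :: complex poly"
  define Ec :: "complex mat" where "Ec = completion n B l"
  define E :: "complex poly mat" where "E = completion n B l"
  have E: "E \<in> carrier_mat n n" "Ec \<in> carrier_mat n n" by (simp_all add: E_def Ec_def)
  have evE: "map_mat (\<lambda>p. poly p t) E = Ec" for t
    by (rule eq_matI) (auto simp: E_def Ec_def completion_def)
  define M where "M = N ^\<^sub>m l + E"
  have M: "M \<in> carrier_mat n n" using N E by (simp add: M_def)
  define aM where "aM = adj_mat M"
  have aM: "aM \<in> carrier_mat n n" "M * aM = det M \<cdot>\<^sub>m 1\<^sub>m n" "aM * M = det M \<cdot>\<^sub>m 1\<^sub>m n"
    using adj_mat[OF M] by (auto simp: aM_def)
  define W where "W = E * aM * E"
  have W: "W \<in> carrier_mat n n" using E aM by (simp add: W_def)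
  have evM: "map_mat (\<lambda>p. poly p 0) M = chain_mat n B ^\<^sub>m l + Ec"
    unfolding M_def using poly_hom.hom_add_mat[OF pow_carrier_mat[OF N] E(1)] poly_hom.hom_pow_mat[OF N] N0
    by (simp add: evE)
  have det0: "poly (det M) 0 \<noteq> 0"
    using completion_invertible[of l, where 'a = complex] poly_hom.hom_det_mat[where a = 0 and A = M] evM
    by (simp add: Ec_def)
  obtain d where d: "?q dvd d * det M - 1" using poly_unit_mod_monom[OF det0] by blast
  \<comment> \<open>The entries of \<open>complement_eq\<close> are polynomial functions vanishing
    on the orbit, hence on the jet modulo t^(m+1).\<close>
  have key: "?q dvd det M * (W $$ (i, j) - det M * E $$ (i, j))" if ij: "i < n" "j < n" for i j
  proof (rule jet[rule_format])
    let ?F = "\<lambda>z. complement_eq Ec l (mat n n z) $$ (i, j)"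
    have "?F (($$) X) = 0" if sim: "similar_mat X (chain_mat n B)" for X
    proof -
      have X: "X \<in> carrier_mat n n" using similar_matD[OF sim] by fastforce
      then have "mat n n (($$) X) = X" by (intro eq_matI) auto
      moreover have "complement_eq Ec l X = 0\<^sub>m n n"
        by (rule complement_eq_similar[OF E(2) low_proj_carrier[of n B l] _ low_proj_idem
              chain_mat_carrier chain_pow_low_proj sim]) (simp add: Ec_def completion_low_proj)
      ultimately show ?thesis using ij by simp
    qed
    then show "?F \<in> vanishing_fun n (chain_orbit n B)"
      using complement_eq_polyfun[OF E(2) ij] by (simp add: vanishing_fun_def)
    fix t
    have "det M * (W $$ (i, j) - det M * E $$ (i, j)) = complement_eq E l N $$ (i, j)"
      using ij W E by (simp add: complement_eq_def Let_def M_def[symmetric] aM_def[symmetric] W_def[symmetric])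
    then have "poly (det M * (W $$ (i, j) - det M * E $$ (i, j))) t =
        map_mat (\<lambda>p. poly p t) (complement_eq E l N) $$ (i, j)"
      using ij complement_eq_carrier[OF E(1) N, of l] by simp
    also have "\<dots> = complement_eq Ec l (map_mat (\<lambda>p. poly p t) N) $$ (i, j)"
      by (simp add: poly_hom.hom_complement_eq[OF E(1) N] evE)
    also have "map_mat (\<lambda>p. poly p t) N = mat n n (\<lambda>i. poly (N $$ i) t)"
      using N by (intro eq_matI) auto
    finally show "poly (det M * (W $$ (i, j) - det M * E $$ (i, j))) t =
        ?F (\<lambda>i. poly (N $$ i) t)" .
  qed
  have key2: "?q dvd d * W $$ (i, j) - E $$ (i, j)" if ij: "i < n" "j < n" for i j
  proof -
    let ?w = "W $$ (i, j)" and ?e = "E $$ (i, j)"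
    have "d * ?w - ?e = d * d * (det M * (?w - det M * ?e)) - (d * det M - 1) * (d * ?w)
        + (d * det M - 1) * ((d * det M + 1) * ?e)"
      by (simp add: algebra_simps)
    moreover have "?q dvd \<dots>"
      by (intro dvd_add dvd_diff dvd_mult[OF key[OF ij]] dvd_mult2 d)
    ultimately show ?thesis by simp
  qed
  \<comment> \<open>Modulo t^(m+1) this is M^(-1) E, and N^l = M - E sends it to E - E M^(-1) E,
    which is 0 by \<open>key2\<close>.\<close>
  define Q where "Q = d \<cdot>\<^sub>m (aM * E)"
  have Q: "Q \<in> carrier_mat n n" using aM E by (simp add: Q_def)
  have NQ: "N ^\<^sub>m l * Q = (d * det M) \<cdot>\<^sub>m E - d \<cdot>\<^sub>m W"
  proof -
    have "N ^\<^sub>m l = M - E" using N E by (auto simp: M_def intro!: eq_matI)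
    then have "N ^\<^sub>m l * Q = M * Q - E * Q"
      using minus_mult_distrib_mat[OF M E(1) Q] by simp
    also have "M * Q = d \<cdot>\<^sub>m ((M * aM) * E)"
      unfolding Q_def using smult_mult_right_mat[OF M mult_carrier_mat[OF aM(1) E(1)]]
        assoc_mult_mat[OF M aM(1) E(1)] by simp
    also have "(M * aM) * E = det M \<cdot>\<^sub>m E"
      unfolding aM(2) using smult_mult_left_mat[of "1\<^sub>m n" n E] E by simp
    also have "E * Q = d \<cdot>\<^sub>m W"
      unfolding Q_def W_def using smult_mult_right_mat[OF E(1) mult_carrier_mat[OF aM(1) E(1)]]
        assoc_mult_mat[OF E(1) aM(1) E(1)] by simp
    finally show ?thesis by (simp add: smult_smult_mat)
  qed
  have "mat_cong ?q n (N ^\<^sub>m l * Q) (0\<^sub>m n n)"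
    unfolding mat_cong_def NQ
  proof (intro conjI allI impI)
    fix i j assume ij: "i < n" "j < n"
    have "((d * det M) \<cdot>\<^sub>m E - d \<cdot>\<^sub>m W) $$ (i, j) - (0\<^sub>m n n) $$ (i, j) =
        (d * det M - 1) * E $$ (i, j) - (d * W $$ (i, j) - E $$ (i, j))"
      using ij E W by (simp add: algebra_simps)
    also have "?q dvd \<dots>" by (intro dvd_diff dvd_mult2 d key2 ij)
    finally show "?q dvd ((d * det M) \<cdot>\<^sub>m E - d \<cdot>\<^sub>m W) $$ (i, j) - (0\<^sub>m n n) $$ (i, j)" .
  qed (use E W in auto)
  moreover have "map_mat (\<lambda>p. poly p 0) Q = low_proj n B l"
  proof -
    let ?P = "low_proj n B l :: complex mat"
    let ?M0 = "map_mat (\<lambda>p. poly p 0) M" and ?a0 = "map_mat (\<lambda>p. poly p 0) aM"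
    have P: "?P \<in> carrier_mat n n" by simp
    have c: "?M0 \<in> carrier_mat n n" "?a0 \<in> carrier_mat n n" using M aM by auto
    \<comment> \<open>At \<open>t = 0\<close> the matrix \<open>M\<close> maps the kernel projection
      to \<open>E\<close>, so M^(-1) E is this projection.\<close>
    have "?M0 * ?P = chain_mat n B ^\<^sub>m l * ?P + Ec * ?P"
      unfolding evM using E by (intro add_mult_distrib_mat) auto
    also have "\<dots> = Ec" using E chain_pow_low_proj[where 'a = complex] completion_low_proj[where 'a = complex]
      by (simp add: Ec_def)
    finally have MP: "?M0 * ?P = Ec" .
    have "?a0 * Ec = (?a0 * ?M0) * ?P"
      using assoc_mult_mat[OF c(2,1) P] MP by simp
    also have "?a0 * ?M0 = map_mat (\<lambda>p. poly p 0) (det M \<cdot>\<^sub>m 1\<^sub>m n)"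
      using poly_hom.hom_mult_mat[OF aM(1) M] aM(3) by simp
    also have "\<dots> = poly (det M) 0 \<cdot>\<^sub>m 1\<^sub>m n" by (rule eq_matI) auto
    also have "\<dots> * ?P = poly (det M) 0 \<cdot>\<^sub>m ?P"
      using smult_mult_left_mat[OF one_carrier_mat P] P by simp
    finally have aE: "?a0 * Ec = poly (det M) 0 \<cdot>\<^sub>m ?P" .
    have "map_mat (\<lambda>p. poly p 0) Q = poly d 0 \<cdot>\<^sub>m map_mat (\<lambda>p. poly p 0) (aM * E)"
      unfolding Q_def by (rule eq_matI) auto
    also have "map_mat (\<lambda>p. poly p 0) (aM * E) = poly (det M) 0 \<cdot>\<^sub>m ?P"
      using poly_hom.hom_mult_mat[OF aM(1) E(1)] aE by (simp add: evE)
    also have "poly d 0 \<cdot>\<^sub>m (poly (det M) 0 \<cdot>\<^sub>m ?P) = (poly d 0 * poly (det M) 0) \<cdot>\<^sub>m ?P"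
      by (rule smult_smult_mat)
    also have "poly d 0 * poly (det M) 0 = 1"
    proof -
      obtain e where "d * det M - 1 = ?q * e" using d by blast
      then have "poly (d * det M - 1) 0 = poly (?q * e) 0" by simp
      then show ?thesis by (simp add: poly_monom)
    qed
    finally show ?thesis by (simp add: one_smult_mat)
  qed
  ultimately show ?thesis using Q by blast
qed

text \<open>The lifted tops of the chains and their images under \<open>N\<close> form a Jordan basis.\<close>

lemma jet_jordan_basis:
  fixes N :: "complex poly mat"
  assumes N: "N \<in> carrier_mat n n" and N0: "map_mat (\<lambda>p. poly p 0) N = chain_mat n B"
    and jet: "\<forall>F\<in>vanishing_fun n (chain_orbit n B).
      \<forall>p. (\<forall>t. poly p t = F (\<lambda>i. poly (N $$ i) t)) \<longrightarrow> monom 1 (Suc m) dvd p"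
  shows "\<exists>K\<in>carrier_mat n n. mat_cong (monom 1 (Suc m)) n (N * K) (K * chain_mat n B) \<and>
    map_mat (\<lambda>p. poly p 0) K = 1\<^sub>m n"
proof -
  let ?q = "monom 1 (Suc m) :: complex poly"
  have B0: "0 \<notin> B" and finB: "finite B" using B finite_subset by auto
  have "\<forall>l. \<exists>Q. Q \<in> carrier_mat n n \<and> mat_cong ?q n (N ^\<^sub>m l * Q) (0\<^sub>m n n) \<and>
      map_mat (\<lambda>p. poly p 0) Q = low_proj n B l"
    using kernel_lift[OF N N0 jet] by blast
  then obtain Q where Q: "\<And>l. Q l \<in> carrier_mat n n"
    "\<And>l. mat_cong ?q n (N ^\<^sub>m l * Q l) (0\<^sub>m n n)"
    "\<And>l. map_mat (\<lambda>p. poly p 0) (Q l) = low_proj n B l"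
    by metis
  define h where "h i = chain_len B i" for i
  \<comment> \<open>The number of elements of the chain through \<open>i\<close>. Its last element
    \<open>i + h i\<close> has position \<open>l i - 1\<close>, so it is killed by the power
    \<open>l i\<close> and has a lift in column \<open>i + h i\<close> of
    \<open>Q (l i)\<close>.\<close>
  define l where "l i = chain_pos B i + h i + 1" for i
  define K where "K = mat n n (\<lambda>(r, i). (N ^\<^sub>m h i * Q (l i)) $$ (r, i + h i))"
  have K: "K \<in> carrier_mat n n" by (simp add: K_def)
  have top: "i + h i < n" if "i < n" for i unfolding h_def by (rule chain_len_less[OF B that])
  have Nk: "N ^\<^sub>m k \<in> carrier_mat n n" for k using N by simp
  have NQ: "N ^\<^sub>m k * Q l \<in> carrier_mat n n" for k l using Nk Q(1) by (rule mult_carrier_mat)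
  have NK: "(N * K) $$ (r, i) = (N ^\<^sub>m Suc (h i) * Q (l i)) $$ (r, i + h i)"
    if "r < n" "i < n" for r i
  proof -
    have "(N * K) $$ (r, i) = (\<Sum>k<n. N $$ (r, k) * K $$ (k, i))"
      by (rule mult_mat_index[OF N K that])
    also have "\<dots> = (\<Sum>k<n. N $$ (r, k) * (N ^\<^sub>m h i * Q (l i)) $$ (k, i + h i))"
      by (rule sum.cong) (use that in \<open>auto simp: K_def\<close>)
    also have "\<dots> = (N * (N ^\<^sub>m h i * Q (l i))) $$ (r, i + h i)"
      by (rule mult_mat_index[symmetric, OF N NQ]) (use that top in auto)
    also have "N * (N ^\<^sub>m h i * Q (l i)) = N ^\<^sub>m Suc (h i) * Q (l i)"
      using assoc_mult_mat[OF N Nk Q(1), of "h i" "l i"] pow_mat_commute[OF N, of "h i"] by simp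
    finally show ?thesis .
  qed
  have "mat_cong ?q n (N * K) (K * chain_mat n B)"
    unfolding mat_cong_def
  proof (intro conjI allI impI)
    fix r i assume ri: "r < n" "i < n"
    show "?q dvd (N * K) $$ (r, i) - (K * chain_mat n B) $$ (r, i)"
    proof (cases "i \<in> B")
      case True
      then have i1: "i \<ge> 1" using B by auto
      have "chain_pos B i = Suc (chain_pos B (i - 1))" by (rule chain_pos_Suc[OF True B0])
      moreover have "h (i - 1) = Suc (h i)"
        using chain_len_diff[OF B0, of 1 i] chain_pos_Suc[OF True B0] finB by (simp add: h_def)
      ultimately have "l (i - 1) = l i" "i - 1 + h (i - 1) = i + h i" "h (i - 1) = Suc (h i)"
        using i1 by (auto simp: l_def)
      then have "(K * chain_mat n B) $$ (r, i) = (N ^\<^sub>m Suc (h i) * Q (l i)) $$ (r, i + h i)"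
        using chain_mat_mult_right[OF B K ri] True ri by (simp add: K_def)
      then show ?thesis using NK[OF ri] by simp
    next
      case False
      then have "chain_pos B i = 0" using chain_pos_0_iff[OF B0] by simp
      then have "Suc (h i) = l i" by (simp add: l_def)
      then have "(N * K) $$ (r, i) = (N ^\<^sub>m l i * Q (l i)) $$ (r, i + h i)"
        using NK[OF ri] by simp
      moreover have "(K * chain_mat n B) $$ (r, i) = 0"
        using chain_mat_mult_right[OF B K ri] False by simp
      ultimately show ?thesis
        using mat_congD(3)[OF Q(2)[of "l i"] ri(1) top[OF ri(2)]] ri top by simp
    qed
  qed (use N K in auto)
  moreover have "map_mat (\<lambda>p. poly p 0) K = 1\<^sub>m n"
  proof (rule eq_matI)
    fix r i assume "r < dim_row (1\<^sub>m n :: complex mat)" "i < dim_col (1\<^sub>m n :: complex mat)"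
    then have ri: "r < n" "i < n" by auto
    have posn: "chain_pos B (i + h i) = chain_pos B i + h i"
      unfolding h_def by (rule chain_pos_add[OF B0 order_refl])
    have "map_mat (\<lambda>p. poly p 0) K $$ (r, i) =
        map_mat (\<lambda>p. poly p 0) (N ^\<^sub>m h i * Q (l i)) $$ (r, i + h i)"
      using ri top[OF ri(2)] carrier_matD[OF NQ[of "h i" "l i"]]
      by (simp add: K_def del: index_mult_mat)
    also have "map_mat (\<lambda>p. poly p 0) (N ^\<^sub>m h i * Q (l i)) =
        chain_mat n B ^\<^sub>m h i * low_proj n B (l i)"
      using poly_hom.hom_mult_mat[OF Nk Q(1)] poly_hom.hom_pow_mat[OF N] N0 Q(3) by simp
    also have "\<dots> $$ (r, i + h i) = (chain_mat n B ^\<^sub>m h i) $$ (r, i + h i)"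
      using ri top posn by (subst low_proj_mult) (auto simp: l_def)
    also have "\<dots> = (if r = i then 1 else 0)"
      using ri top posn by (subst chain_mat_pow[OF B]) auto
    finally show "map_mat (\<lambda>p. poly p 0) K $$ (r, i) = (1\<^sub>m n :: complex mat) $$ (r, i)"
      using ri by simp
  qed (auto simp: K_def)
  ultimately show ?thesis using K by blast
qed

end

section \<open>Jets as matrices over polynomials\<close>

definition jet_mat :: "nat \<Rightarrow> nat \<Rightarrow> ((nat \<times> nat) \<times> nat \<Rightarrow> complex) \<Rightarrow> complex poly mat" where
  "jet_mat n m x = mat n n (jet_coord m x)"

lemma jet_mat_carrier [simp]: "jet_mat n m x \<in> carrier_mat n n"
  and jet_mat_dim [simp]: "dim_row (jet_mat n m x) = n" "dim_col (jet_mat n m x) = n"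
  by (simp_all add: jet_mat_def)

lemma coeff_jet_coord: "coeff (jet_coord m x i) d = (if d \<le> m then x (i, d) else 0)"
proof -
  have "coeff (jet_coord m x i) d = (\<Sum>k\<le>m. if k = d then x (i, k) else 0)"
    by (simp add: jet_coord_def coeff_sum)
  then show ?thesis by (simp add: sum.delta)
qed

lemma jet_coord_cong: "(\<And>d. d \<le> m \<Longrightarrow> x (i, d) = coeff f d) \<Longrightarrow> monom 1 (Suc m) dvd jet_coord m x i - f"
  unfolding monom_1_dvd_iff' by (simp add: coeff_jet_coord less_Suc_eq_le)

lemma mat_cong_coeff:
  assumes "mat_cong (monom 1 (Suc m)) n A A'" "i < n" "j < n" "d \<le> m"
  shows "coeff (A $$ (i, j)) d = coeff (A' $$ (i, j)) d"
  using mat_congD(3)[OF assms(1-3)] assms(4) unfolding monom_1_dvd_iff' by (simp add: less_Suc_eq_le)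

lemma mat_cong_coeffI:
  assumes "A \<in> carrier_mat n n" "A' \<in> carrier_mat n n"
    "\<And>i j d. i < n \<Longrightarrow> j < n \<Longrightarrow> d \<le> m \<Longrightarrow> coeff (A $$ (i, j)) d = coeff (A' $$ (i, j)) d"
  shows "mat_cong (monom 1 (Suc m)) n A A'"
  using assms unfolding mat_cong_def monom_1_dvd_iff' by (simp add: less_Suc_eq_le)

text \<open>Conjugation is not polynomial in the conjugating matrix; the adjugate replaces the
  inverse, and a free scalar \<rho> absorbs the determinant. The coefficients of \<rho> sit at the
  index \<open>(n, n)\<close>, just outside \<open>mat_coords n\<close>.\<close>

definition conj_jet :: "nat \<Rightarrow> nat \<Rightarrow> nat set \<Rightarrow> ((nat \<times> nat) \<times> nat \<Rightarrow> complex) \<Rightarrow> complex poly mat" where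
  "conj_jet n m B p = jet_coord m p (n, n) \<cdot>\<^sub>m
    (jet_mat n m p * chain_mat n B * adj_mat (jet_mat n m p))"

lemma has_mat_derivative_jet_mat:
  "has_mat_derivative n (\<lambda>s. jet_mat n m (\<lambda>i. p i + s * v i)) (jet_mat n m v)"
  unfolding has_mat_derivative_def has_poly_derivative_def
  by (auto simp: jet_mat_def coeff_jet_coord intro!: derivative_eq_intros)

lemma jet_coord_polyfun_poly:
  assumes "\<And>d. d \<le> m \<Longrightarrow> (i, d) \<in> I"
  shows "(\<lambda>x. jet_coord m x i) \<in> polyfun_poly I"
proof -
  have "(\<lambda>x. if d \<le> m then x (i, d) else 0) \<in> polyfun I" for d
    using assms by (cases "d \<le> m") (auto intro: polyfun.intros)
  then show ?thesis by (simp add: polyfun_poly_def coeff_jet_coord)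
qed

lemma mat_fun_jet_mat:
  assumes "mat_coords n \<times> {..m} \<subseteq> I"
  shows "mat_fun (polyfun_poly I) n (jet_mat n m)"
  unfolding mat_fun_def
proof (intro conjI allI impI)
  fix i j assume "i < n" "j < n"
  then have "((i, j), d) \<in> I" if "d \<le> m" for d
    using assms that by (auto simp: mat_coords_def)
  then show "(\<lambda>x. jet_mat n m x $$ (i, j)) \<in> polyfun_poly I"
    using \<open>i < n\<close> \<open>j < n\<close> jet_coord_polyfun_poly[of m "(i, j)" I] by (simp add: jet_mat_def)
qed simp

lemma mat_fun_poly_const:
  "A \<in> carrier_mat n n \<Longrightarrow> mat_fun (polyfun_poly I) n (\<lambda>x. A)"
  by (simp add: mat_fun_def polyfun_poly_def polyfun.const)

lemma conj_jet_polyfun: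
  assumes "mat_coords n \<times> {..m} \<subseteq> I" "{(n, n)} \<times> {..m} \<subseteq> I"
  shows "mat_fun (polyfun_poly I) n (conj_jet n m B)"
proof -
  note R = fun_subring_polyfun_poly[of I]
  note K = mat_fun_jet_mat[OF assms(1)]
  have "(\<lambda>p. jet_coord m p (n, n)) \<in> polyfun_poly I"
    using assms(2) by (intro jet_coord_polyfun_poly) auto
  then have "mat_fun (polyfun_poly I) n (\<lambda>p. jet_coord m p (n, n) \<cdot>\<^sub>m
    (jet_mat n m p * chain_mat n B * adj_mat (jet_mat n m p)))"
    by (intro mat_fun_smult[OF R] mat_fun_mult[OF R mat_fun_mult[OF R K mat_fun_poly_const] mat_fun_adj[OF R K]])
      simp_all
  then show ?thesis by (simp add: conj_jet_def[abs_def])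
qed

lemma polyfun_conjugate:
  assumes "F \<in> polyfun (mat_coords n)" "q \<in> carrier_mat n n" "q' \<in> carrier_mat n n"
  shows "(\<lambda>z. F (($$) (q' * mat n n z * q))) \<in> polyfun (mat_coords n)"
proof (rule polyfun_compose[OF assms(1)])
  note R = fun_subring_polyfun[of "mat_coords n"]
  have "mat_fun (polyfun (mat_coords n)) n (\<lambda>z. q' * mat n n z * q)"
    by (intro mat_fun_mult[OF R mat_fun_mult[OF R mat_fun_const mat_fun_coords] mat_fun_const] assms)
  then show "(\<lambda>z. (q' * mat n n z * q) $$ i) \<in> polyfun (mat_coords n)" if "i \<in> mat_coords n" for i
    using that by (auto simp: mat_fun_def mat_coords_def)
qed

lemma conjugate_conjugate_mat:
  fixes A :: "'a::comm_ring_1 mat"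
  assumes "q \<in> carrier_mat n n" "q' \<in> carrier_mat n n" "A \<in> carrier_mat n n"
  shows "q' * (q * A * q') * q = (q' * q) * A * (q' * q)"
  using assms by (simp add: assoc_mult_mat[of _ n n _ n _ n])

section \<open>Parametrization of the jets over the orbit and upper bound\<close>

context
  fixes n :: nat and B :: "nat set"
  assumes B: "B \<subseteq> {1..<n}"
begin

lemma jet_over_orbit_param:
  assumes x: "x \<in> jet_preimage n m (chain_orbit n B) (chain_orbit n B)"
  shows "\<exists>p. poly (det (jet_mat n m p)) 0 \<noteq> 0 \<and>
    (\<forall>ij\<in>mat_coords n. \<forall>d\<le>m. x (ij, d) = coeff (conj_jet n m B p $$ ij) d)"
proof -
  let ?O = "chain_orbit n B"
  let ?q = "monom 1 (Suc m) :: complex poly"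
  note Oc = chain_orbit_carrier[of n B]
  define X where "X = jet_mat n m x"
  have X: "X \<in> carrier_mat n n" by (simp add: X_def)
  have jets: "\<forall>F\<in>vanishing_fun n ?O. \<forall>p. (\<forall>t. poly p t = F (\<lambda>i. poly (jet_coord m x i) t)) \<longrightarrow> ?q dvd p"
    and proj: "jet_proj (mat_coords n) x \<in> mat_point n ` ?O"
    using x jet_points_iff[OF Oc] unfolding jet_preimage_def by auto
  obtain X0 where X0: "similar_mat X0 (chain_mat n B)" "jet_proj (mat_coords n) x = mat_point n X0"
    using proj by auto
  have X0c: "X0 \<in> carrier_mat n n" using X0(1) Oc by auto
  have evX: "map_mat (\<lambda>p. poly p 0) X = X0"
  proof (rule eq_matI)
    fix i j assume "i < dim_row X0" "j < dim_col X0"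
    then have ij: "i < n" "j < n" using X0c by auto
    have "x ((i, j), 0) = X0 $$ (i, j)"
      using fun_cong[OF X0(2), of "(i, j)"] ij by (simp add: jet_proj_def mat_point_def mat_coords_def)
    then show "map_mat (\<lambda>p. poly p 0) X $$ (i, j) = X0 $$ (i, j)"
      using ij by (simp add: X_def jet_mat_def poly_0_coeff_0 coeff_jet_coord)
  qed (use X0c in \<open>auto simp: X_def\<close>)
  obtain q q' where w: "similar_mat_wit X0 (chain_mat n B) q q'"
    using X0(1) by (auto simp: similar_mat_def)
  note q = similar_mat_witD2[OF X0c w]
  have qc: "q \<in> carrier_mat n n" "q' \<in> carrier_mat n n" using q by auto
  let ?c = "map_mat (\<lambda>c. [:c:]) :: complex mat \<Rightarrow> complex poly mat"
  have cc: "?c q \<in> carrier_mat n n" "?c q' \<in> carrier_mat n n" using qc by auto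
  have evc: "map_mat (\<lambda>p. poly p t) (?c A) = A" for t A by (rule eq_matI) auto
  interpret ch: comm_ring_hom "\<lambda>c. [:c:] :: complex poly"
    by unfold_locales auto
  have cmult: "?c (A * A') = ?c A * ?c A'" if "A \<in> carrier_mat n n" "A' \<in> carrier_mat n n" for A A'
    using that by (rule ch.hom_mult_mat)
  have c1: "?c (1\<^sub>m n) = 1\<^sub>m n" by (rule eq_matI) auto
  have cinv: "?c q * ?c q' = 1\<^sub>m n" "?c q' * ?c q = 1\<^sub>m n"
    using cmult[OF qc] cmult[OF qc(2,1)] q(1,2) c1 by auto
  note assoc = assoc_mult_mat[of _ n n _ n _ n]
  \<comment> \<open>Conjugation by a constant matrix moves the base point of the jet to the chain
    matrix itself, where \<open>jet_jordan_basis\<close> applies.\<close>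
  define N where "N = ?c q' * X * ?c q"
  have N: "N \<in> carrier_mat n n" using cc X by (simp add: N_def)
  have evN: "map_mat (\<lambda>p. poly p t) N = q' * map_mat (\<lambda>p. poly p t) X * q" for t
    unfolding N_def
    using poly_hom.hom_mult_mat[OF mult_carrier_mat[OF cc(2) X] cc(1)] poly_hom.hom_mult_mat[OF cc(2) X]
    by (simp add: evc)
  have N0: "map_mat (\<lambda>p. poly p 0) N = chain_mat n B"
  proof -
    have "q' * X0 * q = (q' * q) * chain_mat n B * (q' * q)"
      unfolding q(3) by (rule conjugate_conjugate_mat[OF qc chain_mat_carrier])
    then show ?thesis using evN[of 0] q(2) evX by simp
  qed
  have "\<forall>F\<in>vanishing_fun n ?O. \<forall>p. (\<forall>t. poly p t = F (\<lambda>i. poly (N $$ i) t)) \<longrightarrow> ?q dvd p"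
  proof (intro ballI allI impI)
    fix F p assume F: "F \<in> vanishing_fun n ?O" and p: "\<forall>t. poly p t = F (\<lambda>i. poly (N $$ i) t)"
    have Fp: "F \<in> polyfun (mat_coords n)" using F by (simp add: vanishing_fun_def)
    let ?G = "\<lambda>z. F (($$) (q' * mat n n z * q))"
    have "?G (($$) Y) = 0" if "similar_mat Y (chain_mat n B)" for Y
    proof -
      have Yc: "Y \<in> carrier_mat n n" using that Oc by auto
      then have "mat n n (($$) Y) = Y" by (intro eq_matI) auto
      moreover have "similar_mat (q' * Y * q) Y"
        by (rule similar_matI[of _ _ q' q n]) (use Yc qc q in auto)
      then have "similar_mat (q' * Y * q) (chain_mat n B)" using that similar_mat_trans by blast
      ultimately show ?thesis using F by (simp add: vanishing_fun_def)
    qed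
    then have G: "?G \<in> vanishing_fun n ?O"
      using polyfun_conjugate[OF Fp qc] by (simp add: vanishing_fun_def)
    have "poly p t = ?G (\<lambda>i. poly (jet_coord m x i) t)" for t
    proof -
      have "mat n n (\<lambda>i. poly (jet_coord m x i) t) = map_mat (\<lambda>p. poly p t) X"
        by (rule eq_matI) (auto simp: X_def jet_mat_def)
      then have "?G (\<lambda>i. poly (jet_coord m x i) t) = F (($$) (map_mat (\<lambda>p. poly p t) N))"
        by (simp add: evN)
      also have "\<dots> = F (\<lambda>i. poly (N $$ i) t)"
        by (rule polyfun_cong[OF Fp]) (use N in \<open>auto simp: mat_coords_def\<close>)
      finally show ?thesis using p by simp
    qed
    then show "?q dvd p" by (intro bspec[OF jets G, rule_format]) simp
  qed
  from jet_jordan_basis[OF B N N0 this]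
  obtain K where K: "K \<in> carrier_mat n n" "mat_cong ?q n (N * K) (K * chain_mat n B)"
    "map_mat (\<lambda>p. poly p 0) K = 1\<^sub>m n" by blast
  define L where "L = ?c q * K"
  have L: "L \<in> carrier_mat n n" using cc K by (simp add: L_def)
  have XL: "mat_cong ?q n (X * L) (L * chain_mat n B)"
  proof -
    have "?c q * (N * K) = (?c q * ?c q') * X * (?c q * K)"
      unfolding N_def using cc X K(1) by (simp add: assoc)
    then have "X * L = ?c q * (N * K)" using cinv(1) X by (simp add: L_def)
    moreover have "L * chain_mat n B = ?c q * (K * chain_mat n B)"
      unfolding L_def using assoc_mult_mat[OF cc(1) K(1) chain_mat_carrier] .
    ultimately show ?thesis using mat_cong_mult[OF mat_cong_refl[OF cc(1)] K(2)] by simp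
  qed
  define p1 where "p1 = (\<lambda>(ij, d). coeff (L $$ ij) d)"
  define \<delta> where "\<delta> = det (jet_mat n m p1)"
  have ev1: "map_mat (\<lambda>p. poly p 0) (jet_mat n m p1) = q"
  proof -
    have "map_mat (\<lambda>p. poly p 0) (jet_mat n m p1) = map_mat (\<lambda>p. poly p 0) L"
      using L by (intro eq_matI) (auto simp: jet_mat_def p1_def poly_0_coeff_0 coeff_jet_coord)
    also have "\<dots> = q"
      unfolding L_def using poly_hom.hom_mult_mat[OF cc(1) K(1), of 0] K(3) qc by (simp add: evc)
    finally show ?thesis .
  qed
  have \<delta>0: "poly \<delta> 0 \<noteq> 0"
    unfolding \<delta>_def poly_hom.hom_det_mat[symmetric] ev1
    by (rule invertible_mat_det_nonzero[OF qc q(1)])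
  obtain \<rho> where \<rho>: "?q dvd \<rho> * \<delta> - 1" using poly_unit_mod_monom[OF \<delta>0] by blast
  \<comment> \<open>The parameters are the truncation of \<open>L\<close> and, at the extra index,
    of the inverse \<rho> of its determinant modulo t^(m+1).\<close>
  define p where "p = (\<lambda>(ij, d). if ij = (n, n) then coeff \<rho> d else p1 (ij, d))"
  have pp1: "jet_mat n m p = jet_mat n m p1"
  proof (rule eq_matI)
    fix i j assume "i < dim_row (jet_mat n m p1)" "j < dim_col (jet_mat n m p1)"
    then have ij: "i < n" "j < n" by auto
    then have "jet_coord m p (i, j) = jet_coord m p1 (i, j)" by (simp add: jet_coord_def p_def)
    then show "jet_mat n m p $$ (i, j) = jet_mat n m p1 $$ (i, j)" using ij by (simp add: jet_mat_def)
  qed simp_all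
  define M where "M = jet_mat n m p"
  have M: "M \<in> carrier_mat n n" by (simp add: M_def)
  have aM: "adj_mat M \<in> carrier_mat n n" "M * adj_mat M = \<delta> \<cdot>\<^sub>m 1\<^sub>m n"
    using adj_mat[OF M] by (auto simp: M_def pp1 \<delta>_def)
  have cML: "mat_cong ?q n M L"
    by (rule mat_cong_coeffI) (use M L in \<open>auto simp: M_def jet_mat_def coeff_jet_coord p_def p1_def\<close>)
  have "mat_cong ?q n (X * M) (M * chain_mat n B)"
    using mat_cong_trans[OF mat_cong_trans[OF mat_cong_mult[OF mat_cong_refl[OF X] cML] XL]
      mat_cong_mult[OF mat_cong_sym[OF cML] mat_cong_refl[OF chain_mat_carrier]]] .
  from mat_cong_mult[OF this mat_cong_refl[OF aM(1)]]
  have "mat_cong ?q n (\<delta> \<cdot>\<^sub>m X) (M * chain_mat n B * adj_mat M)"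
    using assoc_mult_mat[OF X M aM(1)] aM(2) smult_mult_right_mat[OF X one_carrier_mat] X by simp
  from mat_cong_smult[OF this, of \<rho>]
  have "mat_cong ?q n ((\<rho> * \<delta>) \<cdot>\<^sub>m X) (\<rho> \<cdot>\<^sub>m (M * chain_mat n B * adj_mat M))"
    by (simp add: smult_smult_mat)
  moreover have "mat_cong ?q n (1 \<cdot>\<^sub>m X) ((\<rho> * \<delta>) \<cdot>\<^sub>m X)"
    by (rule mat_cong_sym[OF mat_cong_smult_left[OF \<rho> X]])
  moreover have "mat_cong ?q n (\<rho> \<cdot>\<^sub>m (M * chain_mat n B * adj_mat M)) (conj_jet n m B p)"
    unfolding conj_jet_def M_def[symmetric]
  proof (rule mat_cong_smult_left)
    have "?q dvd jet_coord m p (n, n) - \<rho>" by (rule jet_coord_cong) (simp add: p_def)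
    then show "?q dvd \<rho> - jet_coord m p (n, n)" by (metis dvd_minus_iff minus_diff_eq)
    show "M * chain_mat n B * adj_mat M \<in> carrier_mat n n"
      by (intro mult_carrier_mat[OF mult_carrier_mat[OF M chain_mat_carrier] aM(1)])
  qed
  ultimately have XC: "mat_cong ?q n X (conj_jet n m B p)"
    unfolding one_smult_mat using mat_cong_trans by blast
  have "x (ij, d) = coeff (conj_jet n m B p $$ ij) d" if "ij \<in> mat_coords n" "d \<le> m" for ij d
    using mat_cong_coeff[OF XC, of "fst ij" "snd ij" d] that
    by (auto simp: mat_coords_def X_def jet_mat_def coeff_jet_coord)
  then show ?thesis using \<delta>0 by (intro exI[of _ p]) (auto simp: pp1 \<delta>_def)
qed

text \<open>Among the positions of a string starting in \<open>reps\<close>, only the first one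
  belongs to \<open>reps\<close>, since all later columns are linked. As the string sum of a
  commutator is 0, that entry is determined by the others. This is the bound on the rank of the
  commutator map.\<close>

lemma commutator_reps_vanish:
  fixes W Z :: "complex poly mat"
  assumes Z: "Z \<in> carrier_mat n n" and W: "W = chain_mat n B * Z - Z * chain_mat n B"
    and nonrep: "\<And>r c d. r < n \<Longrightarrow> c < n \<Longrightarrow> (r, c) \<notin> reps n B \<Longrightarrow> d \<le> m \<Longrightarrow> coeff (W $$ (r, c)) d = 0"
    and "r < n" "c < n" "d \<le> m"
  shows "coeff (W $$ (r, c)) d = 0"
proof (cases "(r, c) \<in> reps n B")
  case True
  have entries: "W $$ (r, c) = (if r + 1 \<in> B then Z $$ (r + 1, c) else 0) -
      (if c \<in> B then Z $$ (r, c - 1) else 0)" if "r < n" "c < n" for r c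
    unfolding W using chain_mat_mult_left[OF B Z that] chain_mat_mult_right[OF B Z that] Z that by simp
  have "(\<Sum>i\<le>chain_len B r. W $$ (r + i, c + i)) = 0"
    by (rule commutator_string_sum[OF B _ True, where Z = "\<lambda>r c. Z $$ (r, c)"]) (rule entries)
  then have "0 = (\<Sum>i\<le>chain_len B r. coeff (W $$ (r + i, c + i)) d)"
    by (metis coeff_0 coeff_sum)
  also have "\<dots> = coeff (W $$ (r, c)) d"
  proof -
    have zero: "coeff (W $$ (r + i, c + i)) d = 0" if i: "i \<le> chain_len B r" "i \<noteq> 0" for i
    proof -
      have rc: "chain_len B r \<le> chain_len B c" using True by (simp add: reps_def)
      then have "c + i \<in> B" by (intro chain_len_link) (use i in auto)
      moreover have "r + i \<in> B" by (rule chain_len_link) (use i in auto)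
      ultimately show ?thesis
        using nonrep[of "r + i" "c + i" d] subsetD[OF B, of "c + i"] subsetD[OF B, of "r + i"] assms(6)
        by (auto simp: reps_def)
    qed
    have "(\<Sum>i\<le>chain_len B r. coeff (W $$ (r + i, c + i)) d) =
        (\<Sum>i\<in>{0}. coeff (W $$ (r + i, c + i)) d)"
      by (rule sum.mono_neutral_right) (use zero in auto)
    then show ?thesis by simp
  qed
  finally show ?thesis by simp
next
  case False
  then show ?thesis using nonrep assms by blast
qed

text \<open>The grading element with eigenvalues 0, 1, 2, ...: links raise the index by one. It
  exhibits the chain matrix as a commutator.\<close>

lemma chain_mat_commutator_diag:
  "chain_mat n B * diag_of n of_nat - diag_of n of_nat * chain_mat n B = (chain_mat n B :: 'a::comm_ring_1 mat)"
proof (rule eq_matI)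
  fix i j assume "i < dim_row (chain_mat n B :: 'a mat)" "j < dim_col (chain_mat n B :: 'a mat)"
  then have ij: "i < n" "j < n" by auto
  have "(chain_mat n B * diag_of n of_nat - diag_of n of_nat * chain_mat n B) $$ (i, j) =
      (chain_mat n B * diag_of n of_nat) $$ (i, j) - (diag_of n of_nat * chain_mat n B :: 'a mat) $$ (i, j)"
    by (rule index_minus_mat) (use ij in \<open>auto simp: diag_of_def\<close>)
  also have "\<dots> = (chain_mat n B :: 'a mat) $$ (i, j) * of_nat j - of_nat i * (chain_mat n B :: 'a mat) $$ (i, j)"
    by (simp only: diag_of_mult_left[OF chain_mat_carrier ij] diag_of_mult_right[OF chain_mat_carrier ij])
  also have "\<dots> = (chain_mat n B :: 'a mat) $$ (i, j)"
    using ij by (auto simp: chain_mat_def)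
  finally show "(chain_mat n B * diag_of n of_nat - diag_of n of_nat * chain_mat n B) $$ (i, j) =
      (chain_mat n B :: 'a mat) $$ (i, j)" .
qed (auto simp: diag_of_def)

text \<open>Conjugating back, the differential of \<open>(\<rho>, k) \<mapsto> \<rho> k A adj k\<close> takes its values in the
  commutators with \<open>A\<close>; the terms coming from \<open>\<rho>\<close> and from \<open>det k\<close> are multiples of \<open>A\<close>,
  which is itself a commutator.\<close>

lemma conj_jet_derivative_commutator:
  fixes K K' a A' X' C :: "complex poly mat"
  assumes c: "C \<in> carrier_mat n n" "K \<in> carrier_mat n n" "K' \<in> carrier_mat n n"
      "a \<in> carrier_mat n n" "A' \<in> carrier_mat n n"
    and Ka: "K * a = \<delta> \<cdot>\<^sub>m 1\<^sub>m n" and aK: "a * K = \<delta> \<cdot>\<^sub>m 1\<^sub>m n" and \<delta>: "\<delta> \<noteq> 0"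
    and der: "K' * a + K * A' = \<delta>' \<cdot>\<^sub>m 1\<^sub>m n"
    and X': "X' = \<eta> \<cdot>\<^sub>m (K * C * a) + \<rho> \<cdot>\<^sub>m (K' * C * a + K * C * A')"
    and D: "D \<in> carrier_mat n n" "C * D - D * C = C"
  shows "\<exists>Z\<in>carrier_mat n n. a * X' * K = C * Z - Z * C"
proof -
  note assoc = assoc_mult_mat[of _ n n _ n _ n]
  define S where "S = a * K'"
  have S: "S \<in> carrier_mat n n" using c by (simp add: S_def)
  have smult1: "(x \<cdot>\<^sub>m 1\<^sub>m n) * Y = x \<cdot>\<^sub>m Y" "Y * (x \<cdot>\<^sub>m 1\<^sub>m n) = x \<cdot>\<^sub>m Y"
    if "Y \<in> carrier_mat n n" for x :: "complex poly" and Y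
    using smult_mult_left_mat[OF one_carrier_mat that, of x] smult_mult_right_mat[OF that one_carrier_mat, of x]
      that by simp_all
  have 1: "a * (K * C * a) * K = (\<delta> * \<delta>) \<cdot>\<^sub>m C"
    unfolding conjugate_conjugate_mat[OF c(2,4,1)] aK using c(1) smult1 by (simp add: smult_smult_mat)
  have 2: "a * (K' * C * a) * K = \<delta> \<cdot>\<^sub>m (S * C)"
  proof -
    have "a * (K' * C * a) * K = S * C * (a * K)" unfolding S_def using c by (simp add: assoc)
    then show ?thesis unfolding aK using c(1) S smult1 by simp
  qed
  \<comment> \<open>Multiplying \<open>der\<close> by \<open>a\<close> on the left and by
    \<open>K\<close> on the right gives this identity times \<delta>, which can be cancelled in the
    domain of polynomials.\<close>
  have A'K: "A' * K = \<delta>' \<cdot>\<^sub>m 1\<^sub>m n - S"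
  proof -
    have AK: "A' * K \<in> carrier_mat n n" using c by simp
    have "a * (K' * a + K * A') * K = (S * (a * K)) + (a * K) * (A' * K)"
      unfolding S_def using c mult_add_distrib_mat[of a n n "K' * a" n "K * A'"]
        add_mult_distrib_mat[of "a * (K' * a)" n n "a * (K * A')" K n] by (simp add: assoc)
    then have "\<delta>' \<cdot>\<^sub>m (a * K) = (S * (a * K)) + (a * K) * (A' * K)"
      unfolding der using c smult1[of a] smult_mult_left_mat[OF c(4,2)] by simp
    then have eq: "(\<delta>' * \<delta>) \<cdot>\<^sub>m 1\<^sub>m n = \<delta> \<cdot>\<^sub>m S + \<delta> \<cdot>\<^sub>m (A' * K)"
      unfolding aK using S AK smult1 by (simp add: smult_smult_mat)
    show ?thesis
    proof (rule eq_matI)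
      fix i j assume "i < dim_row (\<delta>' \<cdot>\<^sub>m 1\<^sub>m n - S)" "j < dim_col (\<delta>' \<cdot>\<^sub>m 1\<^sub>m n - S)"
      then have ij: "i < n" "j < n" using S by auto
      have "\<delta> * (\<delta>' * (1\<^sub>m n) $$ (i, j)) = \<delta> * (S $$ (i, j) + (A' * K) $$ (i, j))"
        using arg_cong[OF eq, of "\<lambda>Y. Y $$ (i, j)"] ij carrier_matD[OF S] carrier_matD[OF AK]
        by (simp add: algebra_simps del: index_mult_mat)
      then have "\<delta>' * (1\<^sub>m n) $$ (i, j) = S $$ (i, j) + (A' * K) $$ (i, j)" using \<delta> by simp
      then show "(A' * K) $$ (i, j) = (\<delta>' \<cdot>\<^sub>m 1\<^sub>m n - S) $$ (i, j)"
        using ij carrier_matD[OF S] by (simp add: algebra_simps del: index_mult_mat)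
    qed (use c S AK in auto)
  qed
  have CS: "C * S \<in> carrier_mat n n" "S * C \<in> carrier_mat n n" "C * D \<in> carrier_mat n n"
    "D * C \<in> carrier_mat n n" using c S D by simp_all
  have 3: "a * (K * C * A') * K = \<delta> \<cdot>\<^sub>m (\<delta>' \<cdot>\<^sub>m C - C * S)"
  proof -
    have "a * (K * C * A') * K = (a * K) * (C * (A' * K))" using c by (simp add: assoc)
    also have "C * (A' * K) = \<delta>' \<cdot>\<^sub>m C - C * S"
      unfolding A'K using c S smult1 by (simp add: mult_minus_distrib_mat[of _ n n _ n])
    also have "(a * K) * (\<delta>' \<cdot>\<^sub>m C - C * S) = \<delta> \<cdot>\<^sub>m (\<delta>' \<cdot>\<^sub>m C - C * S)"
      unfolding aK by (rule smult1(1)[OF minus_carrier_mat[OF CS(1)]])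
    finally show ?thesis .
  qed
  define x where "x = \<eta> * \<delta> * \<delta> + \<rho> * \<delta> * \<delta>'"
  define y where "y = \<rho> * \<delta>"
  \<comment> \<open>\<open>D\<close> accounts for all multiples of \<open>C\<close>, and
    \<open>S\<close> for the genuine variation of the conjugating matrix.\<close>
  define Z where "Z = x \<cdot>\<^sub>m D - y \<cdot>\<^sub>m S"
  have Z: "Z \<in> carrier_mat n n" unfolding Z_def by (rule minus_carrier_mat[OF smult_carrier_mat[OF S]])
  let ?U = "K * C * a" and ?V = "K' * C * a" and ?W = "K * C * A'"
  have U: "?U \<in> carrier_mat n n" "?V \<in> carrier_mat n n" "?W \<in> carrier_mat n n" using c by simp_all
  have "a * X' = \<eta> \<cdot>\<^sub>m (a * ?U) + \<rho> \<cdot>\<^sub>m (a * ?V + a * ?W)"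
    unfolding X' using c U
    by (simp add: mult_add_distrib_mat[of _ n n _ n] smult_mult_right_mat[of _ n])
  then have "a * X' * K = \<eta> \<cdot>\<^sub>m (a * ?U * K) + \<rho> \<cdot>\<^sub>m (a * ?V * K + a * ?W * K)"
    using c U by (simp add: add_mult_distrib_mat[of _ n n _ _ n] smult_mult_left_mat[of _ n])
  then have eq1: "a * X' * K = \<eta> \<cdot>\<^sub>m ((\<delta> * \<delta>) \<cdot>\<^sub>m C) +
      \<rho> \<cdot>\<^sub>m (\<delta> \<cdot>\<^sub>m (S * C) + \<delta> \<cdot>\<^sub>m (\<delta>' \<cdot>\<^sub>m C - C * S))"
    unfolding 1 2 3 .
  have eq2: "C * Z = x \<cdot>\<^sub>m (C * D) - y \<cdot>\<^sub>m (C * S)" "Z * C = x \<cdot>\<^sub>m (D * C) - y \<cdot>\<^sub>m (S * C)"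
    unfolding Z_def using c D S
    by (simp_all add: mult_minus_distrib_mat[of _ n n _ n] minus_mult_distrib_mat[of _ n n _ _ n]
        smult_mult_right_mat[of _ n] smult_mult_left_mat[of _ n])
  have "a * X' * K = C * Z - Z * C"
    unfolding eq1 eq2
  proof (rule eq_matI)
    fix i j assume "i < dim_row (x \<cdot>\<^sub>m (C * D) - y \<cdot>\<^sub>m (C * S) - (x \<cdot>\<^sub>m (D * C) - y \<cdot>\<^sub>m (S * C)))"
      "j < dim_col (x \<cdot>\<^sub>m (C * D) - y \<cdot>\<^sub>m (C * S) - (x \<cdot>\<^sub>m (D * C) - y \<cdot>\<^sub>m (S * C)))"
    then have ij: "i < n" "j < n" using c D S by auto
    note d = carrier_matD[OF CS(1)] carrier_matD[OF CS(2)] carrier_matD[OF CS(3)] carrier_matD[OF CS(4)]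
      carrier_matD[OF c(1)]
    have CD: "C $$ (i, j) = (C * D) $$ (i, j) - (D * C) $$ (i, j)"
      using arg_cong[OF D(2), of "\<lambda>Y. Y $$ (i, j)"] ij d by (simp del: index_mult_mat)
    show "(\<eta> \<cdot>\<^sub>m ((\<delta> * \<delta>) \<cdot>\<^sub>m C) + \<rho> \<cdot>\<^sub>m (\<delta> \<cdot>\<^sub>m (S * C) + \<delta> \<cdot>\<^sub>m (\<delta>' \<cdot>\<^sub>m C - C * S))) $$ (i, j) =
        (x \<cdot>\<^sub>m (C * D) - y \<cdot>\<^sub>m (C * S) - (x \<cdot>\<^sub>m (D * C) - y \<cdot>\<^sub>m (S * C))) $$ (i, j)"
      using ij d by (simp add: CD x_def y_def algebra_simps del: index_mult_mat)
  qed (use c D S in auto)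
  then show ?thesis using Z by blast
qed

text \<open>Explicit coefficients of a linear form in \<open>u\<close>: these are the forms \<beta>
  that test the differential in \<open>jet_preimage_dim_le\<close>.\<close>

lemma jet_mat_conjugate_coeff:
  fixes a K :: "complex poly mat"
  assumes "a \<in> carrier_mat n n" "K \<in> carrier_mat n n" "i < n" "j < n"
  shows "coeff ((a * jet_mat n m u * K) $$ (i, j)) d =
    (\<Sum>((i', j'), d')\<in>mat_coords n \<times> {..m}. coeff (monom 1 d' * (a $$ (i, i') * K $$ (j', j))) d * u ((i', j'), d'))"
proof -
  let ?g = "\<lambda>i' j' d'. monom 1 d' * (a $$ (i, i') * K $$ (j', j))"
  have "(a * jet_mat n m u * K) $$ (i, j) = (\<Sum>j'<n. (a * jet_mat n m u) $$ (i, j') * K $$ (j', j))"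
    by (rule mult_mat_index[OF mult_carrier_mat[OF assms(1) jet_mat_carrier] assms(2-4)])
  also have "\<dots> = (\<Sum>j'<n. \<Sum>i'<n. \<Sum>d'\<le>m. Polynomial.smult (u ((i', j'), d')) (?g i' j' d'))"
  proof (rule sum.cong[OF refl])
    fix j' assume "j' \<in> {..<n}"
    then have j': "j' < n" by simp
    have "(a * jet_mat n m u) $$ (i, j') * K $$ (j', j) =
        (\<Sum>i'<n. a $$ (i, i') * jet_coord m u (i', j') * K $$ (j', j))"
      unfolding mult_mat_index[OF assms(1) jet_mat_carrier assms(3) j'] sum_distrib_right
      by (rule sum.cong) (use j' in \<open>auto simp: jet_mat_def\<close>)
    also have "\<dots> = (\<Sum>i'<n. \<Sum>d'\<le>m. Polynomial.smult (u ((i', j'), d')) (?g i' j' d'))"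
    proof (rule sum.cong[OF refl])
      fix i'
      have m1: "monom (u ((i', j'), d')) d' = Polynomial.smult (u ((i', j'), d')) (monom 1 d')" for d'
        by (simp add: smult_monom)
      show "a $$ (i, i') * jet_coord m u (i', j') * K $$ (j', j) =
          (\<Sum>d'\<le>m. Polynomial.smult (u ((i', j'), d')) (?g i' j' d'))"
        unfolding jet_coord_def m1 sum_distrib_left sum_distrib_right
        by (rule sum.cong) (simp_all add: mult_ac)
    qed
    finally show "(a * jet_mat n m u) $$ (i, j') * K $$ (j', j) =
        (\<Sum>i'<n. \<Sum>d'\<le>m. Polynomial.smult (u ((i', j'), d')) (?g i' j' d'))" .
  qed
  finally have "coeff ((a * jet_mat n m u * K) $$ (i, j)) d =
      (\<Sum>j'<n. \<Sum>i'<n. \<Sum>d'\<le>m. u ((i', j'), d') * coeff (?g i' j' d') d)"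
    by (simp only: coeff_sum coeff_smult)
  also have "\<dots> = (\<Sum>i'<n. \<Sum>j'<n. \<Sum>d'\<le>m. u ((i', j'), d') * coeff (?g i' j' d') d)"
    by (rule sum.swap)
  also have "\<dots> = (\<Sum>i'<n. \<Sum>j'<n. \<Sum>d'\<le>m. coeff (?g i' j' d') d * u ((i', j'), d'))"
    by (simp only: mult.commute[of "u _"])
  also have "\<dots> = (\<Sum>((i', j'), d')\<in>mat_coords n \<times> {..m}. coeff (?g i' j' d') d * u ((i', j'), d'))"
  proof -
    have "(\<Sum>i'<n. \<Sum>j'<n. \<Sum>d'\<le>m. coeff (?g i' j' d') d * u ((i', j'), d')) =
        (\<Sum>ij\<in>mat_coords n. \<Sum>d'\<le>m. coeff (?g (fst ij) (snd ij) d') d * u (ij, d'))"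
      unfolding mat_coords_def by (subst sum.cartesian_product) (simp add: case_prod_unfold)
    also have "\<dots> = (\<Sum>((i', j'), d')\<in>mat_coords n \<times> {..m}. coeff (?g i' j' d') d * u ((i', j'), d'))"
      by (subst sum.cartesian_product) (simp add: case_prod_unfold)
    finally show ?thesis .
  qed
  finally show ?thesis .
qed

lemma conj_jet_derivative:
  fixes m :: nat and p v :: "(nat \<times> nat) \<times> nat \<Rightarrow> complex"
  assumes \<delta>: "det (jet_mat n m p) \<noteq> 0"
  obtains X' Z where "has_mat_derivative n (\<lambda>s. conj_jet n m B (\<lambda>i. p i + s * v i)) X'"
    "Z \<in> carrier_mat n n"
    "adj_mat (jet_mat n m p) * X' * jet_mat n m p = chain_mat n B * Z - Z * chain_mat n B"
proof -
  let ?K = "\<lambda>s. jet_mat n m (\<lambda>i. p i + s * v i)" and ?K' = "jet_mat n m v"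
  let ?C = "chain_mat n B :: complex poly mat" and ?L = "jet_mat n m p"
  have K0: "?K 0 = ?L" by simp
  note dK = has_mat_derivative_jet_mat[of n m p v]
  obtain A' d' where A': "has_mat_derivative n (\<lambda>s. adj_mat (?K s)) A'"
    and "has_poly_derivative (\<lambda>s. det (?K s)) d'"
    and der: "?K' * adj_mat (?K 0) + ?K 0 * A' = d' \<cdot>\<^sub>m 1\<^sub>m n"
    by (rule has_mat_derivative_adj[OF dK])
  have A'c: "A' \<in> carrier_mat n n" using A' by (rule has_mat_derivativeD)
  have adj: "adj_mat ?L \<in> carrier_mat n n" "?L * adj_mat ?L = det ?L \<cdot>\<^sub>m 1\<^sub>m n"
    "adj_mat ?L * ?L = det ?L \<cdot>\<^sub>m 1\<^sub>m n"
    using adj_mat[of ?L n] by simp_all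
  have dr: "has_poly_derivative (\<lambda>s. jet_coord m (\<lambda>i. p i + s * v i) (n, n)) (jet_coord m v (n, n))"
    unfolding has_poly_derivative_def
    by (auto simp: coeff_jet_coord intro!: derivative_eq_intros)
  have dKC: "has_mat_derivative n (\<lambda>s. ?K s * ?C) (?K' * ?C)"
  proof -
    have "?K' * ?C + ?K 0 * 0\<^sub>m n n = ?K' * ?C"
      using mult_carrier_mat[OF jet_mat_carrier[of n m v] chain_mat_carrier[of n B]]
        right_mult_zero_mat[OF jet_mat_carrier[of n m p], of n] by simp
    then show ?thesis
      using has_mat_derivative_mult[OF dK has_mat_derivative_const[OF chain_mat_carrier[of n B]]] by simp
  qed
  let ?X' = "jet_coord m v (n, n) \<cdot>\<^sub>m (?L * ?C * adj_mat ?L) +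
    jet_coord m p (n, n) \<cdot>\<^sub>m (?K' * ?C * adj_mat ?L + ?L * ?C * A')"
  have "has_mat_derivative n (\<lambda>s. conj_jet n m B (\<lambda>i. p i + s * v i)) ?X'"
    unfolding conj_jet_def
    using has_mat_derivative_smult[OF dr has_mat_derivative_mult[OF dKC A']] by simp
  moreover obtain Z where "Z \<in> carrier_mat n n"
    "adj_mat ?L * ?X' * ?L = ?C * Z - Z * ?C"
    using conj_jet_derivative_commutator[OF chain_mat_carrier jet_mat_carrier jet_mat_carrier adj(1) A'c
        adj(2,3) \<delta> der[unfolded K0] refl diag_of_carrier chain_mat_commutator_diag] by blast
  ultimately show ?thesis by (rule that)
qed

text \<open>The differential, conjugated back, is a commutator with the chain matrix. Its entries
  outside \<open>reps\<close>, in degrees up to \<open>m\<close>, are the testing forms; if they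
  vanish, so do all the others, and the conjugation can be undone modulo t^(m+1).\<close>

theorem jet_preimage_dim_le:
  "jet_preimage_dim n m (chain_orbit n B) (chain_orbit n B) \<le>
    ereal (real ((n * n - card (reps n B)) * (m + 1)))"
proof -
  let ?O = "chain_orbit n B"
  let ?J = "mat_coords n \<times> {..m}" and ?I = "insert (n, n) (mat_coords n) \<times> {..m}"
  let ?q = "monom 1 (Suc m) :: complex poly"
  define \<phi> where "\<phi> o' p = coeff (conj_jet n m B p $$ fst o') (snd o')" for o' p
  define Bs where "Bs = (mat_coords n - reps n B) \<times> {..m}"
  define \<beta> where "\<beta> p b o' = (case (b, o') of (((i, j), d), ((i', j'), d')) \<Rightarrow>
    coeff (monom 1 d' * (adj_mat (jet_mat n m p) $$ (i, i') * jet_mat n m p $$ (j', j))) d)"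
    for p :: "(nat \<times> nat) \<times> nat \<Rightarrow> complex" and b o' :: "(nat \<times> nat) \<times> nat"
  have \<phi>poly: "\<phi> o' \<in> polyfun ?I" if "o' \<in> ?J" for o'
  proof -
    obtain i j d where o': "o' = ((i, j), d)" by (metis surj_pair)
    then have "i < n" "j < n" using that by (auto simp: mat_coords_def)
    moreover have "mat_fun (polyfun_poly ?I) n (conj_jet n m B)" by (rule conj_jet_polyfun) auto
    ultimately have "(\<lambda>p. conj_jet n m B p $$ (i, j)) \<in> polyfun_poly ?I" by (simp add: mat_fun_def)
    then have "(\<lambda>p. \<phi> o' p) \<in> polyfun ?I" by (simp add: polyfun_poly_def \<phi>_def o')
    then show ?thesis by simp
  qed
  define e :: "(nat \<times> nat) \<times> nat \<Rightarrow> complex"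
    where "e = (\<lambda>((i, j), d). if i = j \<and> d = 0 then 1 else 0)"
  have "jet_mat n m e = 1\<^sub>m n"
  proof (rule eq_matI)
    fix i j assume "i < dim_row (1\<^sub>m n :: complex poly mat)" "j < dim_col (1\<^sub>m n :: complex poly mat)"
    then have ij: "i < n" "j < n" by auto
    have "jet_coord m e (i, j) = (if i = j then 1 else 0)"
      by (rule poly_eqI) (auto simp: coeff_jet_coord e_def)
    then show "jet_mat n m e $$ (i, j) = (1\<^sub>m n :: complex poly mat) $$ (i, j)"
      using ij by (simp add: jet_mat_def)
  qed simp_all
  then have h1: "poly (det (jet_mat n m e)) 0 \<noteq> 0" by simp
  have hpoly: "(\<lambda>p. poly (det (jet_mat n m p)) 0) \<in> polyfun ?I"
  proof -
    have "mat_fun (polyfun_poly ?I) n (jet_mat n m)" by (rule mat_fun_jet_mat) auto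
    from fun_subring_det[OF fun_subring_polyfun_poly this]
    show ?thesis by (simp add: polyfun_poly_def poly_0_coeff_0)
  qed
  have "krull_dim (subtopology (zariski ?J) (jet_preimage n m ?O ?O)) \<le> ereal (real (card Bs))"
  proof (rule krull_dim_le_of_parametrization[where I = ?I and \<phi> = \<phi> and
        h = "\<lambda>p. poly (det (jet_mat n m p)) 0" and y = e and B = Bs and \<beta> = \<beta>])
    show "finite ?I" "finite ?J" "finite Bs"
      by (simp_all add: finite_mat_coords Bs_def)
    show "\<phi> j \<in> polyfun ?I" if "j \<in> ?J" for j using that by (rule \<phi>poly)
    show "jet_preimage n m ?O ?O \<subseteq> ?J \<rightarrow>\<^sub>E UNIV"
      by (auto simp: jet_preimage_def jet_points_def affine_points_def)
    show "\<exists>p. poly (det (jet_mat n m p)) 0 \<noteq> 0 \<and> (\<forall>j\<in>?J. x j = \<phi> j p)"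
      if "x \<in> jet_preimage n m ?O ?O" for x
      using jet_over_orbit_param[OF that] by (auto simp: \<phi>_def)
    fix p v :: "(nat \<times> nat) \<times> nat \<Rightarrow> complex"
    assume h: "poly (det (jet_mat n m p)) 0 \<noteq> 0"
      and zero: "\<forall>b\<in>Bs. (\<Sum>j\<in>?J. \<beta> p b j * dird ?I (\<phi> j) p v) = 0"
    define \<delta> where "\<delta> = det (jet_mat n m p)"
    let ?K = "jet_mat n m p" and ?a = "adj_mat (jet_mat n m p)"
    have \<delta>0: "\<delta> \<noteq> 0" using h by (auto simp: \<delta>_def)
    obtain X' Z where X': "has_mat_derivative n (\<lambda>s. conj_jet n m B (\<lambda>i. p i + s * v i)) X'"
      and Z: "Z \<in> carrier_mat n n" "?a * X' * ?K = chain_mat n B * Z - Z * chain_mat n B"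
      using conj_jet_derivative[OF \<delta>0[unfolded \<delta>_def]] .
    have X'c: "X' \<in> carrier_mat n n" using X' by (rule has_mat_derivativeD)
    have a: "?a \<in> carrier_mat n n" "?K * ?a = \<delta> \<cdot>\<^sub>m 1\<^sub>m n"
      using adj_mat[of ?K n] by (simp_all add: \<delta>_def)
    have dird: "dird ?I (\<phi> ((i, j), d)) p v = coeff (X' $$ (i, j)) d" if "i < n" "j < n" "d \<le> m" for i j d
    proof (rule dird_eqI)
      show "\<phi> ((i, j), d) \<in> polyfun ?I" using that by (intro \<phi>poly) (simp add: mat_coords_def)
      show "((\<lambda>s. \<phi> ((i, j), d) (\<lambda>i. p i + s * v i)) has_field_derivative coeff (X' $$ (i, j)) d) (at 0)"
        using has_mat_derivativeD(3)[OF X' that(1,2)] by (simp add: \<phi>_def has_poly_derivative_def)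
    qed (simp add: finite_mat_coords)
    \<comment> \<open>The derivative \<open>X'\<close> may have terms of degree above
      \<open>m\<close>, which the coordinates do not see; this is its truncation.\<close>
    define U where "U = jet_mat n m (\<lambda>j. dird ?I (\<phi> j) p v)"
    have XU: "mat_cong ?q n X' U"
      by (rule mat_cong_coeffI) (use X'c dird in \<open>auto simp: U_def jet_mat_def coeff_jet_coord\<close>)
    then have XU': "mat_cong ?q n (?a * X' * ?K) (?a * U * ?K)"
      by (intro mat_cong_mult mat_cong_refl a) simp_all
    have vanish: "coeff ((?a * X' * ?K) $$ (i, j)) d = 0" if ijd: "i < n" "j < n" "d \<le> m" for i j d
    proof (rule commutator_reps_vanish[OF Z _ ijd])
      fix r c d assume rc: "r < n" "c < n" "(r, c) \<notin> reps n B" "d \<le> m"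
      have "coeff ((?a * X' * ?K) $$ (r, c)) d = coeff ((?a * U * ?K) $$ (r, c)) d"
        by (rule mat_cong_coeff[OF XU' rc(1,2,4)])
      also have "\<dots> = (\<Sum>j\<in>?J. \<beta> p ((r, c), d) j * dird ?I (\<phi> j) p v)"
        unfolding U_def jet_mat_conjugate_coeff[OF a(1) jet_mat_carrier rc(1,2)]
        by (rule sum.cong) (auto simp: \<beta>_def)
      also have "\<dots> = 0"
        using zero rc by (auto simp: Bs_def mat_coords_def)
      finally show "coeff ((?a * X' * ?K) $$ (r, c)) d = 0" .
    qed
    have "mat_cong ?q n (?a * X' * ?K) (0\<^sub>m n n)"
      by (rule mat_cong_coeffI) (use vanish a X'c in \<open>auto simp del: index_mult_mat(1)\<close>)
    from mat_cong_mult[OF mat_cong_mult[OF mat_cong_refl[OF jet_mat_carrier[of n m p]] this] mat_cong_refl[OF a(1)]]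
    have "mat_cong ?q n (?K * (?a * X' * ?K) * ?a) (0\<^sub>m n n)" using a by simp
    also have "?K * (?a * X' * ?K) * ?a = (?K * ?a) * X' * (?K * ?a)"
      by (rule conjugate_conjugate_mat[OF a(1) jet_mat_carrier X'c])
    also have "\<dots> = (\<delta> * \<delta>) \<cdot>\<^sub>m X'"
      unfolding a(2) using X'c smult_mult_left_mat[OF one_carrier_mat X'c, of \<delta>]
        smult_mult_right_mat[OF smult_carrier_mat[OF X'c] one_carrier_mat, of \<delta> \<delta>]
      by (simp add: smult_smult_mat)
    finally have \<delta>X: "mat_cong ?q n ((\<delta> * \<delta>) \<cdot>\<^sub>m X') (0\<^sub>m n n)" .
    \<comment> \<open>The determinant has nonzero constant term, hence the factor \<delta> *
      \<delta> cancels modulo t^(m+1).\<close>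
    obtain d where d: "?q dvd d * \<delta> - 1" using poly_unit_mod_monom h by (auto simp: \<delta>_def)
    have "coeff (X' $$ (i, j)) k = 0" if ijk: "i < n" "j < n" "k \<le> m" for i j k
    proof -
      let ?x = "X' $$ (i, j)"
      have x: "?q dvd \<delta> * \<delta> * ?x" using mat_congD(3)[OF \<delta>X ijk(1,2)] X'c ijk by simp
      have "?q dvd d * d * (\<delta> * \<delta> * ?x) - (d * \<delta> - 1) * ((d * \<delta> + 1) * ?x)"
        by (rule dvd_diff[OF dvd_mult[OF x] dvd_mult2[OF d]])
      also have "d * d * (\<delta> * \<delta> * ?x) - (d * \<delta> - 1) * ((d * \<delta> + 1) * ?x) = ?x"
        by (simp add: algebra_simps)
      finally show ?thesis using ijk unfolding monom_1_dvd_iff' by simp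
    qed
    then show "\<forall>j\<in>?J. dird ?I (\<phi> j) p v = 0" using dird by (auto simp: mat_coords_def)
  qed (use h1 hpoly in auto)
  moreover have "card Bs = (n * n - card (reps n B)) * (m + 1)"
  proof -
    have "reps n B \<subseteq> mat_coords n" by (auto simp: reps_def mat_coords_def)
    then show ?thesis
      using finite_mat_coords finite_reps
      by (simp add: Bs_def card_cartesian_product card_Diff_subset mat_coords_def)
  qed
  ultimately show ?thesis by (simp add: jet_preimage_dim_def)
qed

end

section \<open>Tangent vectors at a smaller orbit\<close>

text \<open>Scaling only changes the weights of the links, so the orbit is a cone. This permits
  adjugates in place of inverses in \<open>chain_orbit_adj\<close>.\<close>

lemma chain_orbit_smult:
  assumes "X \<in> chain_orbit n B" "a \<noteq> 0"
  shows "a \<cdot>\<^sub>m X \<in> chain_orbit n B"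
proof -
  have "a \<cdot>\<^sub>m chain_mat n B = weighted_chain n (\<lambda>j. if j \<in> B then a else 0)"
    by (rule eq_matI) (auto simp: chain_mat_def weighted_chain_def)
  moreover have "similar_mat (weighted_chain n (\<lambda>j. if j \<in> B then a else 0)) (chain_mat n B)"
    by (rule weighted_chain_similar) (use assms in auto)
  ultimately have "similar_mat (a \<cdot>\<^sub>m chain_mat n B) (chain_mat n B :: complex mat)" by simp
  moreover have "similar_mat (a \<cdot>\<^sub>m X) (a \<cdot>\<^sub>m chain_mat n B)"
    using assms(1) by (intro similar_mat_smult) simp
  ultimately show ?thesis using similar_mat_trans by blast
qed

lemma chain_orbit_conjugate:
  assumes "X \<in> chain_orbit n B" "P \<in> carrier_mat n n" "Q \<in> carrier_mat n n" "P * Q = 1\<^sub>m n"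
  shows "P * X * Q \<in> chain_orbit n B"
proof -
  have X: "X \<in> carrier_mat n n" using assms(1) chain_orbit_carrier by blast
  have "similar_mat (P * X * Q) X"
    by (rule similar_matI[of _ _ P Q n]) (use assms X mult_mat_1_commute[OF assms(2-4)] in auto)
  then show ?thesis using assms(1) similar_mat_trans by blast
qed

lemma chain_orbit_adj:
  assumes "X \<in> chain_orbit n B" "P \<in> carrier_mat n n" "det P \<noteq> 0"
  shows "P * X * adj_mat P \<in> chain_orbit n B"
proof -
  have X: "X \<in> carrier_mat n n" using assms(1) chain_orbit_carrier by blast
  let ?Q = "(1 / det P) \<cdot>\<^sub>m adj_mat P"
  have a: "adj_mat P \<in> carrier_mat n n" using adj_mat(1)[OF assms(2)] .
  have "P * ?Q = 1\<^sub>m n"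
    using smult_mult_right_mat[OF assms(2) a] adj_mat(2)[OF assms(2)] assms(3)
    by (simp add: smult_smult_mat one_smult_mat)
  then have "det P \<cdot>\<^sub>m (P * X * ?Q) \<in> chain_orbit n B"
    by (intro chain_orbit_smult chain_orbit_conjugate assms) (use a in auto)
  also have "det P \<cdot>\<^sub>m (P * X * ?Q) = P * X * adj_mat P"
    using smult_mult_right_mat[OF mult_carrier_mat[OF assms(2) X] a] assms(3)
    by (simp add: smult_smult_mat one_smult_mat)
  finally show ?thesis .
qed

text \<open>When \<open>y\<close> lies in the orbit closure, this is the Zariski tangent space of
  the reduced closure at \<open>y\<close>, as a set of matrices.\<close>

definition tangent :: "nat \<Rightarrow> complex mat set \<Rightarrow> complex mat \<Rightarrow> complex mat set" where
  "tangent n Ob y = {Y \<in> carrier_mat n n.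
    \<forall>F\<in>vanishing_fun n Ob. dird (mat_coords n) F (($$) y) (($$) Y) = 0}"

lemma tangent_transport:
  assumes Y: "Y \<in> tangent n Ob y" and y: "y \<in> carrier_mat n n"
    and PQ: "P \<in> carrier_mat n n" "Q \<in> carrier_mat n n"
    and Ob: "\<And>X. X \<in> Ob \<Longrightarrow> P * X * Q \<in> Ob" "Ob \<subseteq> carrier_mat n n"
    and F: "F \<in> vanishing_fun n Ob"
  shows "dird (mat_coords n) F (($$) (P * y * Q)) (($$) (P * Y * Q)) = 0"
proof -
  have Yc: "Y \<in> carrier_mat n n" using Y by (simp add: tangent_def)
  have Fp: "F \<in> polyfun (mat_coords n)" using F by (simp add: vanishing_fun_def)
  let ?G = "\<lambda>z. F (($$) (P * mat n n z * Q))"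
  have Gp: "?G \<in> polyfun (mat_coords n)" by (rule polyfun_conjugate[OF Fp PQ(2,1)])
  have mat: "mat n n (($$) X) = X" if "X \<in> carrier_mat n n" for X :: "complex mat"
    using that by (intro eq_matI) auto
  have "?G (($$) X) = 0" if X: "X \<in> Ob" for X
    using F Ob(1)[OF X] mat[of X] X Ob(2) by (auto simp: vanishing_fun_def)
  then have "?G \<in> vanishing_fun n Ob" using Gp by (simp add: vanishing_fun_def)
  then have "0 = dird (mat_coords n) ?G (($$) y) (($$) Y)" using Y by (simp add: tangent_def)
  also have "\<dots> = dird (mat_coords n) F (($$) (P * y * Q)) (($$) (P * Y * Q))"
  proof (rule dird_eqI[OF finite_mat_coords Gp])
    have "?G (\<lambda>i. y $$ i + s * Y $$ i) = F (\<lambda>i. (P * y * Q) $$ i + s * (P * Y * Q) $$ i)" for s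
    proof (rule polyfun_cong[OF Fp])
      fix ij assume "ij \<in> mat_coords n"
      then obtain i j where ij: "ij = (i, j)" "i < n" "j < n" by (auto simp: mat_coords_def)
      have "mat n n (\<lambda>i. y $$ i + s * Y $$ i) = y + s \<cdot>\<^sub>m Y"
        using y Yc by (intro eq_matI) auto
      then have "P * mat n n (\<lambda>i. y $$ i + s * Y $$ i) * Q = P * y * Q + s \<cdot>\<^sub>m (P * Y * Q)"
        using y Yc PQ smult_mult_right_mat[OF PQ(1) Yc] smult_mult_left_mat[OF mult_carrier_mat[OF PQ(1) Yc] PQ(2)]
        by (simp add: mult_add_distrib_mat[of _ n n _ n] add_mult_distrib_mat[of _ n n _ _ n])
      moreover have "dim_row (P * y * Q) = n" "dim_col (P * y * Q) = n"
        "dim_row (P * Y * Q) = n" "dim_col (P * Y * Q) = n"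
        using y Yc PQ by auto
      ultimately show "(P * mat n n (\<lambda>i. y $$ i + s * Y $$ i) * Q) $$ ij =
          (P * y * Q) $$ ij + s * (P * Y * Q) $$ ij"
        using ij by (simp del: index_mult_mat(1))
    qed
    then show "((\<lambda>s. ?G (\<lambda>i. y $$ i + s * Y $$ i)) has_field_derivative
        dird (mat_coords n) F (($$) (P * y * Q)) (($$) (P * Y * Q))) (at 0)"
      using has_field_derivative_dird[OF finite_mat_coords Fp] by simp
  qed
  finally show ?thesis by simp
qed

lemma dird_mat_lincomb:
  assumes "Y \<in> carrier_mat n n" "Z \<in> carrier_mat n n"
  shows "dird (mat_coords n) F x (($$) (a \<cdot>\<^sub>m Y + b \<cdot>\<^sub>m Z)) =
    a * dird (mat_coords n) F x (($$) Y) + b * dird (mat_coords n) F x (($$) Z)"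
proof -
  have "dird (mat_coords n) F x (($$) (a \<cdot>\<^sub>m Y + b \<cdot>\<^sub>m Z)) =
      dird (mat_coords n) F x (\<lambda>i. a * Y $$ i + b * Z $$ i)"
    by (rule dird_cong) (use assms in \<open>auto simp: mat_coords_def\<close>)
  also have "\<dots> = dird (mat_coords n) F x (\<lambda>i. a * Y $$ i) + dird (mat_coords n) F x (\<lambda>i. b * Z $$ i)"
    by (rule dird_add)
  finally show ?thesis by (simp only: dird_scale)
qed

lemma tangent_lincomb:
  assumes "Y \<in> tangent n Ob y" "Z \<in> tangent n Ob y"
  shows "a \<cdot>\<^sub>m Y + b \<cdot>\<^sub>m Z \<in> tangent n Ob y"
  using assms dird_mat_lincomb[of Y n Z] by (auto simp: tangent_def)

text \<open>Conjugation by \<open>1 + \<sigma> \<gamma>\<close> for all \<open>\<sigma>\<close>; comparing \<open>\<sigma> = 1\<close> and \<open>\<sigma> = - 1\<close> isolates the bracket.\<close>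

lemma tangent_bracket:
  assumes Y: "Y \<in> tangent n (chain_orbit n B) y" and y: "y \<in> carrier_mat n n"
    and \<gamma>: "\<gamma> \<in> carrier_mat n n" "\<gamma> * \<gamma> = 0\<^sub>m n n" "\<gamma> * y = y * \<gamma>"
  shows "\<gamma> * Y - Y * \<gamma> \<in> tangent n (chain_orbit n B) y"
proof -
  have Yc: "Y \<in> carrier_mat n n" using Y by (simp add: tangent_def)
  define g where "g \<sigma> = 1\<^sub>m n + \<sigma> \<cdot>\<^sub>m \<gamma>" for \<sigma> :: complex
  have g: "g \<sigma> \<in> carrier_mat n n" for \<sigma> using \<gamma> by (simp add: g_def)
  have expand: "g \<sigma> * Z * g (- \<sigma>) = Z + \<sigma> \<cdot>\<^sub>m (\<gamma> * Z - Z * \<gamma>) + (- (\<sigma> * \<sigma>)) \<cdot>\<^sub>m (\<gamma> * Z * \<gamma>)"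
    if Z: "Z \<in> carrier_mat n n" for Z \<sigma>
  proof -
    have c: "\<gamma> * Z \<in> carrier_mat n n" "Z * \<gamma> \<in> carrier_mat n n" "\<gamma> * Z * \<gamma> \<in> carrier_mat n n"
      using \<gamma> Z by simp_all
    have "g \<sigma> * Z = Z + \<sigma> \<cdot>\<^sub>m (\<gamma> * Z)"
      unfolding g_def using \<gamma> Z smult_mult_left_mat[OF \<gamma>(1) Z]
      by (simp add: add_mult_distrib_mat[of _ n n _ _ n])
    then have "g \<sigma> * Z * g (- \<sigma>) = (Z + \<sigma> \<cdot>\<^sub>m (\<gamma> * Z)) + ((- \<sigma>) \<cdot>\<^sub>m (Z * \<gamma>) + (- \<sigma>) \<cdot>\<^sub>m (\<sigma> \<cdot>\<^sub>m (\<gamma> * Z * \<gamma>)))"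
      unfolding g_def using \<gamma> Z c smult_mult_right_mat[of "Z + \<sigma> \<cdot>\<^sub>m (\<gamma> * Z)" n \<gamma> "- \<sigma>"]
        smult_mult_left_mat[OF c(1) \<gamma>(1)]
      by (simp add: mult_add_distrib_mat[of _ n n _ n] add_mult_distrib_mat[of _ n n _ _ n]
          add_smult_distrib_left_mat[of _ n n])
    also have "\<dots> = Z + \<sigma> \<cdot>\<^sub>m (\<gamma> * Z - Z * \<gamma>) + (- (\<sigma> * \<sigma>)) \<cdot>\<^sub>m (\<gamma> * Z * \<gamma>)"
      using Z carrier_matD[OF c(1)] carrier_matD[OF c(2)] carrier_matD[OF c(3)]
      by (intro eq_matI) (auto simp: algebra_simps simp del: index_mult_mat(1))
    finally show ?thesis .
  qed
  have gg: "g \<sigma> * g (- \<sigma>) = 1\<^sub>m n" for \<sigma>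
  proof -
    have "g \<sigma> * g (- \<sigma>) = g \<sigma> * 1\<^sub>m n * g (- \<sigma>)" using g[of \<sigma>] by simp
    also have "\<dots> = 1\<^sub>m n" using expand[of "1\<^sub>m n" \<sigma>] \<gamma> by (auto intro!: eq_matI)
    finally show ?thesis .
  qed
  have gy: "g \<sigma> * y * g (- \<sigma>) = y" for \<sigma>
  proof -
    have "g \<sigma> * y = y * g \<sigma>"
      unfolding g_def using \<gamma> y smult_mult_left_mat[OF \<gamma>(1) y] smult_mult_right_mat[OF y \<gamma>(1)]
      by (simp add: add_mult_distrib_mat[of _ n n _ _ n] mult_add_distrib_mat[of _ n n _ n])
    then have "g \<sigma> * y * g (- \<sigma>) = y * (g \<sigma> * g (- \<sigma>))"
      using assoc_mult_mat[OF y g g] by simp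
    then show ?thesis using gg y by simp
  qed
  let ?b = "\<gamma> * Y - Y * \<gamma>" and ?c = "\<gamma> * Y * \<gamma>"
  have bc: "?b \<in> carrier_mat n n" "?c \<in> carrier_mat n n"
    using \<gamma> Yc by (auto intro: minus_carrier_mat)
  have "dird (mat_coords n) F (($$) y) (($$) ?b) = 0" if F: "F \<in> vanishing_fun n (chain_orbit n B)" for F
  proof -
    let ?D = "\<lambda>Z. dird (mat_coords n) F (($$) y) (($$) Z)"
    have YD: "?D Y = 0" using Y F by (simp add: tangent_def)
    have "\<sigma> * ?D ?b - \<sigma> * \<sigma> * ?D ?c = 0" for \<sigma>
    proof -
      have "?D (g \<sigma> * Y * g (- \<sigma>)) = 0"
        using tangent_transport[OF Y y g g _ chain_orbit_carrier F, of \<sigma> "- \<sigma>"]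
          chain_orbit_conjugate[OF _ g g gg] gy by simp
      moreover have "g \<sigma> * Y * g (- \<sigma>) = 1 \<cdot>\<^sub>m Y + 1 \<cdot>\<^sub>m (\<sigma> \<cdot>\<^sub>m ?b + (- (\<sigma> * \<sigma>)) \<cdot>\<^sub>m ?c)"
        unfolding expand[OF Yc] using Yc bc by (simp add: one_smult_mat)
      ultimately show ?thesis
        using dird_mat_lincomb[of Y n "\<sigma> \<cdot>\<^sub>m ?b + (- (\<sigma> * \<sigma>)) \<cdot>\<^sub>m ?c" F "($$) y" 1 1]
          dird_mat_lincomb[OF bc, of F "($$) y" \<sigma> "- (\<sigma> * \<sigma>)"] Yc bc YD by simp
    qed
    from this[of 1] this[of "- 1"] show ?thesis by simp
  qed
  then show ?thesis using bc by (simp add: tangent_def)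
qed

text \<open>The restriction to the line is a polynomial in one variable vanishing off 0, hence zero,
  also at the limit point.\<close>

lemma vanishing_fun_line:
  assumes y: "y \<in> carrier_mat n n" and Y: "Y \<in> carrier_mat n n"
    and line: "\<And>s. s \<noteq> 0 \<Longrightarrow> y + s \<cdot>\<^sub>m Y \<in> Ob" and F: "F \<in> vanishing_fun n Ob"
  shows "F (\<lambda>i. y $$ i + s * Y $$ i) = 0"
proof -
  have Fp: "F \<in> polyfun (mat_coords n)" using F by (simp add: vanishing_fun_def)
  obtain p where p: "\<forall>s. poly p s = F (\<lambda>i. y $$ i + s * Y $$ i)"
    using polyfun_line_ex[OF Fp] by blast
  have "poly p s = 0" if "s \<noteq> 0" for s
  proof -
    have "F (\<lambda>i. y $$ i + s * Y $$ i) = F (($$) (y + s \<cdot>\<^sub>m Y))"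
      by (rule polyfun_cong[OF Fp]) (use y Y in \<open>auto simp: mat_coords_def\<close>)
    then show ?thesis using p F line[OF that] by (auto simp: vanishing_fun_def)
  qed
  then have "poly ([:0, 1:] * p) s = 0" for s by (cases "s = 0") simp_all
  then have "[:0, 1:] * p = 0" using poly_all_0_iff_0 by blast
  then have "p = 0" by simp
  then show ?thesis using p by (metis poly_0)
qed

lemma tangent_of_line:
  assumes y: "y \<in> carrier_mat n n" and Y: "Y \<in> carrier_mat n n"
    and line: "\<And>s. s \<noteq> 0 \<Longrightarrow> y + s \<cdot>\<^sub>m Y \<in> Ob"
  shows "Y \<in> tangent n Ob y"
proof -
  have "dird (mat_coords n) F (($$) y) (($$) Y) = 0" if F: "F \<in> vanishing_fun n Ob" for F
    by (rule dird_eqI[OF finite_mat_coords])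
      (use F vanishing_fun_line[OF y Y line F] in \<open>simp_all add: vanishing_fun_def\<close>)
  then show ?thesis using Y by (simp add: tangent_def)
qed

subsection \<open>Chain maps\<close>

definition unit_mat :: "nat \<Rightarrow> nat \<Rightarrow> nat \<Rightarrow> 'a::{zero,one} mat" where
  "unit_mat n r c = mat n n (\<lambda>(i, j). if i = r \<and> j = c then 1 else 0)"

text \<open>Maps the basis vector of index u + a to that of index v + a for a \<le> h, and kills all
  other basis vectors.\<close>

definition chain_map :: "nat \<Rightarrow> nat \<Rightarrow> nat \<Rightarrow> nat \<Rightarrow> 'a::{zero,one} mat" where
  "chain_map n u v h = mat n n (\<lambda>(i, j). if u \<le> j \<and> j \<le> u + h \<and> i + u = j + v then 1 else 0)"

lemma unit_mat_carrier [simp]: "unit_mat n r c \<in> carrier_mat n n"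
  and chain_map_carrier [simp]: "chain_map n u v h \<in> carrier_mat n n"
  and unit_mat_dim [simp]: "dim_row (unit_mat n r c) = n" "dim_col (unit_mat n r c) = n"
  and chain_map_dim [simp]: "dim_row (chain_map n u v h) = n" "dim_col (chain_map n u v h) = n"
  by (simp_all add: unit_mat_def chain_map_def)

lemma chain_map_index:
  "i < n \<Longrightarrow> j < n \<Longrightarrow> chain_map n u v h $$ (i, j) = (if u \<le> j \<and> j \<le> u + h \<and> i + u = j + v then 1 else 0)"
  by (simp add: chain_map_def)

lemma mult_unit_mat_index:
  fixes A :: "'a::comm_ring_1 mat"
  assumes "A \<in> carrier_mat n n" "i < n" "j < n" "r < n" "c < n"
  shows "(A * unit_mat n r c) $$ (i, j) = (if j = c then A $$ (i, r) else 0)"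
    and "(unit_mat n r c * A) $$ (i, j) = (if i = r then A $$ (c, j) else 0)"
proof -
  have "(A * unit_mat n r c) $$ (i, j) = (\<Sum>k<n. A $$ (i, k) * unit_mat n r c $$ (k, j))"
    by (rule mult_mat_index) (use assms in auto)
  also have "\<dots> = (\<Sum>k<n. if k = r then (if j = c then A $$ (i, k) else 0) else 0)"
    by (rule sum.cong) (use assms in \<open>auto simp: unit_mat_def\<close>)
  finally show "(A * unit_mat n r c) $$ (i, j) = (if j = c then A $$ (i, r) else 0)"
    using assms by (simp add: sum.delta)
  have "(unit_mat n r c * A) $$ (i, j) = (\<Sum>k<n. unit_mat n r c $$ (i, k) * A $$ (k, j))"
    by (rule mult_mat_index) (use assms in auto)
  also have "\<dots> = (\<Sum>k<n. if k = c then (if i = r then A $$ (k, j) else 0) else 0)"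
    by (rule sum.cong) (use assms in \<open>auto simp: unit_mat_def\<close>)
  finally show "(unit_mat n r c * A) $$ (i, j) = (if i = r then A $$ (c, j) else 0)"
    using assms by (simp add: sum.delta)
qed

lemma chain_map_unit:
  assumes "r < n" "c < n"
  shows "chain_map n u v h * unit_mat n r c =
      (if u \<le> r \<and> r \<le> u + h then unit_mat n (r - u + v) c else (0\<^sub>m n n :: 'a::comm_ring_1 mat))"
proof (rule eq_matI)
  fix i j assume "i < dim_row (if u \<le> r \<and> r \<le> u + h then unit_mat n (r - u + v) c else (0\<^sub>m n n :: 'a mat))"
    "j < dim_col (if u \<le> r \<and> r \<le> u + h then unit_mat n (r - u + v) c else (0\<^sub>m n n :: 'a mat))"
  then have ij: "i < n" "j < n" by (auto split: if_splits)
  show "(chain_map n u v h * unit_mat n r c) $$ (i, j) =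
      (if u \<le> r \<and> r \<le> u + h then unit_mat n (r - u + v) c else (0\<^sub>m n n :: 'a mat)) $$ (i, j)"
    unfolding mult_unit_mat_index(1)[OF chain_map_carrier ij assms]
    using ij assms by (auto simp: chain_map_def unit_mat_def)
qed auto

lemma unit_chain_map:
  assumes "r < n" "c < n" "u + h < n"
  shows "unit_mat n r c * chain_map n u v h =
      (if v \<le> c \<and> c \<le> v + h then unit_mat n r (c - v + u) else (0\<^sub>m n n :: 'a::comm_ring_1 mat))"
proof (rule eq_matI)
  fix i j assume "i < dim_row (if v \<le> c \<and> c \<le> v + h then unit_mat n r (c - v + u) else (0\<^sub>m n n :: 'a mat))"
    "j < dim_col (if v \<le> c \<and> c \<le> v + h then unit_mat n r (c - v + u) else (0\<^sub>m n n :: 'a mat))"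
  then have ij: "i < n" "j < n" by (auto split: if_splits)
  show "(unit_mat n r c * chain_map n u v h) $$ (i, j) =
      (if v \<le> c \<and> c \<le> v + h then unit_mat n r (c - v + u) else (0\<^sub>m n n :: 'a mat)) $$ (i, j)"
    unfolding mult_unit_mat_index(2)[OF chain_map_carrier ij assms(1,2)]
    using ij assms by (auto simp: chain_map_def unit_mat_def)
qed auto

text \<open>A chain matrix lowers indices along chains, so an initial segment of a chain spans a
  submodule and a final segment a quotient. The hypotheses make the interval at \<open>u\<close>
  final and the interval at \<open>v\<close> initial: the map is a quotient followed by an
  inclusion.\<close>

lemma chain_map_commute:
  fixes A :: "nat set"
  assumes A: "A \<subseteq> {1..<n}" and u: "\<And>a. 0 < a \<Longrightarrow> a \<le> h \<Longrightarrow> u + a \<in> A" "u + h + 1 \<notin> A"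
    and v: "v \<notin> A" "\<And>a. 0 < a \<Longrightarrow> a \<le> h \<Longrightarrow> v + a \<in> A"
  shows "chain_map n u v h * chain_mat n A = (chain_mat n A * chain_map n u v h :: 'a::comm_ring_1 mat)"
proof (rule eq_matI)
  fix i j assume "i < dim_row (chain_mat n A * chain_map n u v h :: 'a mat)"
    "j < dim_col (chain_mat n A * chain_map n u v h :: 'a mat)"
  then have ij: "i < n" "j < n" by auto
  have vA: "v + a \<in> A \<longleftrightarrow> 0 < a" if "a \<le> h" for a using v that by (cases "a = 0") auto
  have "(j \<in> A \<and> u \<le> j - 1 \<and> j - 1 \<le> u + h \<and> i + u = j - 1 + v) \<longleftrightarrow>
      (i + 1 \<in> A \<and> u \<le> j \<and> j \<le> u + h \<and> i + 1 + u = j + v)" (is "?L \<longleftrightarrow> ?R")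
  proof
    assume L: ?L
    then have j: "j \<ge> 1" using A by auto
    have "j \<noteq> u + h + 1" using L u(2) by auto
    then have "j - u \<le> h" "u < j" using L j by linarith+
    moreover have "i + 1 = v + (j - u)" using L j by linarith
    ultimately show ?R using vA[of "j - u"] by auto
  next
    assume R: ?R
    then have "i + 1 = v + (j - u)" "j - u \<le> h" by linarith+
    then have ju: "0 < j - u" using R vA[of "j - u"] by auto
    then have "j \<in> A" using u(1)[of "j - u"] \<open>j - u \<le> h\<close> by simp
    then show ?L using R ju by linarith
  qed
  moreover have "j \<in> A \<Longrightarrow> j - 1 < n" "i + 1 \<in> A \<Longrightarrow> i + 1 < n" using A ij by auto
  then have "(chain_map n u v h * chain_mat n A :: 'a mat) $$ (i, j) =
      (if j \<in> A \<and> u \<le> j - 1 \<and> j - 1 \<le> u + h \<and> i + u = j - 1 + v then 1 else 0)"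
    "(chain_mat n A * chain_map n u v h :: 'a mat) $$ (i, j) =
      (if i + 1 \<in> A \<and> u \<le> j \<and> j \<le> u + h \<and> i + 1 + u = j + v then 1 else 0)"
    unfolding chain_mat_mult_left[OF A chain_map_carrier ij] chain_mat_mult_right[OF A chain_map_carrier ij]
    using ij by (simp_all add: chain_map_index)
  ultimately show "(chain_map n u v h * chain_mat n A) $$ (i, j) = (chain_mat n A * chain_map n u v h :: 'a mat) $$ (i, j)"
    by (simp only:)
qed auto

lemma chain_map_square_zero:
  assumes "\<And>a. a \<le> h \<Longrightarrow> \<not> (u \<le> v + a \<and> v + a \<le> u + h)"
  shows "chain_map n u v h * chain_map n u v h = (0\<^sub>m n n :: 'a::comm_ring_1 mat)"
proof (rule eq_matI)
  fix i j assume "i < dim_row (0\<^sub>m n n :: 'a mat)" "j < dim_col (0\<^sub>m n n :: 'a mat)"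
  then have ij: "i < n" "j < n" by auto
  have "chain_map n u v h $$ (i, k) * chain_map n u v h $$ (k, j) = (0 :: 'a)" if "k < n" for k
  proof -
    have False if "u \<le> k" "k \<le> u + h" "u \<le> j" "j \<le> u + h" "k + u = j + v"
    proof -
      have "k = v + (j - u)" "j - u \<le> h" using that by linarith+
      then show False using assms[of "j - u"] that by auto
    qed
    then show ?thesis using that ij by (auto simp: chain_map_def)
  qed
  then have "(chain_map n u v h * chain_map n u v h) $$ (i, j) = (0 :: 'a)"
    by (subst mult_mat_index[of _ n]) (use ij in \<open>auto intro!: sum.neutral\<close>)
  then show "(chain_map n u v h * chain_map n u v h) $$ (i, j) = (0\<^sub>m n n :: 'a mat) $$ (i, j)"
    using ij by simp
qed auto

section \<open>Jets over a smaller orbit: lower bound for the dimension\<close>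

definition line_mat :: "nat \<Rightarrow> complex mat \<Rightarrow> complex mat \<Rightarrow> complex poly mat" where
  "line_mat n y z = mat n n (\<lambda>ij. [:y $$ ij, z $$ ij:])"

definition monom_mat :: "nat \<Rightarrow> complex mat \<Rightarrow> complex poly mat" where
  "monom_mat d Y = map_mat (\<lambda>c. monom c d) Y"

text \<open>The coefficients of the combination are parameters stored at the indices
  \<open>((n, k), 0)\<close>, disjoint from the entries of the conjugating matrix.\<close>

definition tangent_comb :: "nat \<Rightarrow> complex mat list \<Rightarrow> ((nat \<times> nat) \<times> nat \<Rightarrow> complex) \<Rightarrow> complex mat" where
  "tangent_comb n Ts p = mat n n (\<lambda>ij. \<Sum>k<length Ts. p ((n, k), 0) * (Ts ! k) $$ ij)"

definition cone_jet :: "nat \<Rightarrow> nat \<Rightarrow> complex mat \<Rightarrow> complex mat \<Rightarrow> complex mat list \<Rightarrow>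
    ((nat \<times> nat) \<times> nat \<Rightarrow> complex) \<Rightarrow> complex poly mat" where
  "cone_jet n m y z Ts p =
    jet_mat n m p * (line_mat n y z + monom_mat m (tangent_comb n Ts p)) * adj_mat (jet_mat n m p)"

lemma line_mat_carrier [simp]: "line_mat n y z \<in> carrier_mat n n"
  and tangent_comb_carrier [simp]: "tangent_comb n Ts p \<in> carrier_mat n n"
  by (simp_all add: line_mat_def tangent_comb_def)

lemma monom_mat_carrier [simp]: "Y \<in> carrier_mat n n \<Longrightarrow> monom_mat d Y \<in> carrier_mat n n"
  by (simp add: monom_mat_def)

lemma tangent_comb_tangent:
  assumes "set Ts \<subseteq> tangent n Ob y"
  shows "tangent_comb n Ts p \<in> tangent n Ob y"
proof -
  have "dird (mat_coords n) F (($$) y) (($$) (tangent_comb n Ts p)) = 0" if F: "F \<in> vanishing_fun n Ob" for F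
  proof -
    have "dird (mat_coords n) F (($$) y) (($$) (tangent_comb n Ts p)) =
        dird (mat_coords n) F (($$) y) (\<lambda>ij. \<Sum>k<length Ts. p ((n, k), 0) * (Ts ! k) $$ ij)"
      by (rule dird_cong) (auto simp: tangent_comb_def mat_coords_def)
    also have "\<dots> = (\<Sum>k<length Ts. p ((n, k), 0) * dird (mat_coords n) F (($$) y) (($$) (Ts ! k)))"
      by (rule dird_sum)
    also have "\<dots> = 0"
    proof (rule sum.neutral, rule ballI)
      fix k assume "k \<in> {..<length Ts}"
      then have "Ts ! k \<in> tangent n Ob y" using assms by (simp add: subset_eq)
      then show "p ((n, k), 0) * dird (mat_coords n) F (($$) y) (($$) (Ts ! k)) = 0"
        using F by (simp add: tangent_def)
    qed
    finally show ?thesis .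
  qed
  then show ?thesis by (simp add: tangent_def)
qed

lemma eval_conjugate:
  assumes "K \<in> carrier_mat n n" "X \<in> carrier_mat n n"
  shows "map_mat (\<lambda>f. poly f t) (K * X * adj_mat K) =
    map_mat (\<lambda>f. poly f t) K * map_mat (\<lambda>f. poly f t) X * adj_mat (map_mat (\<lambda>f. poly f t) K :: complex mat)"
  using poly_hom.hom_mult_mat[OF mult_carrier_mat[OF assms] adj_mat(1)[OF assms(1)], of t]
    poly_hom.hom_mult_mat[OF assms, of t] poly_hom.hom_adj_mat[of t K] by simp

text \<open>Write the jet as a + t^m (b + t g). The curve \<open>a\<close> lies in the orbit for
  almost all \<open>t\<close>, so \<open>F\<close> vanishes along it. By the Taylor expansion
  \<open>F\<close> of the jet is then t^m r, and r(0) is the derivative of \<open>F\<close> at the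
  base point along a transported tangent vector, which is 0; this gains the missing power of
  \<open>t\<close>.\<close>

lemma cone_jet_mem_jet_preimage:
  fixes y z :: "complex mat"
  assumes yz: "y \<in> carrier_mat n n" "z \<in> carrier_mat n n"
    and line: "\<And>t. t \<noteq> 0 \<Longrightarrow> y + t \<cdot>\<^sub>m z \<in> chain_orbit n B"
    and Ts: "set Ts \<subseteq> tangent n (chain_orbit n B) y"
    and Ob': "\<And>P. P \<in> carrier_mat n n \<Longrightarrow> det P \<noteq> 0 \<Longrightarrow> P * y * adj_mat P \<in> Ob'"
    and m: "m \<ge> 1" and p: "poly (det (jet_mat n m p)) 0 \<noteq> 0"
  shows "(\<lambda>j\<in>mat_coords n \<times> {..m}. coeff (cone_jet n m y z Ts p $$ fst j) (snd j))
    \<in> jet_preimage n m (chain_orbit n B) Ob'"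
proof -
  let ?J = "mat_coords n \<times> {..m}"
  define x where "x = (\<lambda>j\<in>?J. coeff (cone_jet n m y z Ts p $$ fst j) (snd j))"
  let ?K = "jet_mat n m p" and ?T = "tangent_comb n Ts p"
  define a where "a = ?K * line_mat n y z * adj_mat ?K"
  define b where "b = ?K * monom_mat 0 ?T * adj_mat ?K"
  let ?ev = "\<lambda>t. map_mat (\<lambda>f. poly f t)"
  have adj: "adj_mat ?K \<in> carrier_mat n n" using adj_mat(1)[of ?K n] by simp
  have T0: "monom_mat 0 ?T \<in> carrier_mat n n" by simp
  have ac: "a \<in> carrier_mat n n" and bc: "b \<in> carrier_mat n n"
    unfolding a_def b_def
    by (intro mult_carrier_mat[OF mult_carrier_mat[OF jet_mat_carrier] adj] line_mat_carrier T0)+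
  have evl: "?ev t (line_mat n y z) = y + t \<cdot>\<^sub>m z" for t
    by (rule eq_matI) (use yz in \<open>auto simp: line_mat_def\<close>)
  have evT: "?ev t (monom_mat 0 ?T) = ?T" for t
    by (rule eq_matI) (auto simp: monom_mat_def monom_0)
  have eva: "?ev t a = ?ev t ?K * (y + t \<cdot>\<^sub>m z) * adj_mat (?ev t ?K)" for t
    unfolding a_def eval_conjugate[OF jet_mat_carrier line_mat_carrier] evl ..
  have evb: "?ev t b = ?ev t ?K * ?T * adj_mat (?ev t ?K)" for t
    unfolding b_def eval_conjugate[OF jet_mat_carrier T0] evT ..
  have split: "cone_jet n m y z Ts p = a + monom 1 m \<cdot>\<^sub>m b"
  proof -
    have "monom_mat m ?T = monom 1 m \<cdot>\<^sub>m monom_mat 0 ?T"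
      by (rule eq_matI) (auto simp: monom_mat_def mult_monom)
    then have "cone_jet n m y z Ts p =
        (?K * line_mat n y z + monom 1 m \<cdot>\<^sub>m (?K * monom_mat 0 ?T)) * adj_mat ?K"
      unfolding cone_jet_def
      using smult_mult_right_mat[OF jet_mat_carrier T0, of m p "monom 1 m"]
      by (simp add: mult_add_distrib_mat[OF jet_mat_carrier line_mat_carrier smult_carrier_mat[OF T0]])
    also have "\<dots> = a + monom 1 m \<cdot>\<^sub>m b"
      unfolding a_def b_def
      by (simp only: smult_mult_left_mat[OF mult_carrier_mat[OF jet_mat_carrier T0] adj]
          add_mult_distrib_mat[OF mult_carrier_mat[OF jet_mat_carrier line_mat_carrier]
            smult_carrier_mat[OF mult_carrier_mat[OF jet_mat_carrier T0]] adj])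
    finally show ?thesis .
  qed
  have ev_index: "(?ev t A) $$ ij = poly (A $$ ij) t" if "A \<in> carrier_mat n n" "ij \<in> mat_coords n" for A t ij
    using that by (auto simp: mat_coords_def)
  \<comment> \<open>The tail cut off when the jet is truncated at degree \<open>m\<close>, divided
    by t^(m+1).\<close>
  define g where "g ij = (jet_coord m x ij - cone_jet n m y z Ts p $$ ij) div monom 1 (Suc m)" for ij
  have g: "jet_coord m x ij = a $$ ij + monom 1 m * (b $$ ij + [:0, 1:] * g ij)" if "ij \<in> mat_coords n" for ij
  proof -
    have "monom 1 (Suc m) dvd jet_coord m x ij - cone_jet n m y z Ts p $$ ij"
      by (rule jet_coord_cong) (use that in \<open>simp add: x_def\<close>)
    then have "jet_coord m x ij = cone_jet n m y z Ts p $$ ij + monom 1 (Suc m) * g ij"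
      unfolding g_def by simp
    moreover have "monom 1 (Suc m) = monom 1 m * [:0, 1 :: complex:]"
      by (simp add: monom_Suc)
    moreover have "cone_jet n m y z Ts p $$ ij = a $$ ij + monom 1 m * b $$ ij"
      unfolding split using that ac bc by (auto simp: mat_coords_def)
    ultimately show ?thesis by (simp add: algebra_simps)
  qed
  have "monom 1 (Suc m) dvd q" if F: "F \<in> vanishing_fun n (chain_orbit n B)"
    and q: "\<forall>t. poly q t = F (\<lambda>i. poly (jet_coord m x i) t)" for F q
  proof -
    have Fp: "F \<in> polyfun (mat_coords n)" using F by (simp add: vanishing_fun_def)
    obtain r where r: "\<forall>t. F (\<lambda>i. poly (a $$ i) t + t ^ m * poly (b $$ i + [:0, 1:] * g i) t) =
        F (\<lambda>i. poly (a $$ i) t) + t ^ m * poly r t"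
      and r0: "poly r 0 = dird (mat_coords n) F (\<lambda>i. poly (a $$ i) 0) (\<lambda>i. poly (b $$ i + [:0, 1:] * g i) 0)"
      using polyfun_taylor[OF finite_mat_coords Fp m, of "\<lambda>i. a $$ i" "\<lambda>i. b $$ i + [:0, 1:] * g i"] by blast
    obtain f where f: "\<forall>t. poly f t = F (\<lambda>i. poly (a $$ i) t)"
      using polyfun_along_ex[OF Fp, of "\<lambda>i. a $$ i"] by auto
    have fa: "F (\<lambda>i. poly (a $$ i) t) = F (($$) (?ev t a))" for t
      by (rule polyfun_cong[OF Fp]) (simp add: ev_index[OF ac])
    \<comment> \<open>The two extra factors cover the exceptional values of \<open>t\<close>: the
      limit point \<open>t = 0\<close>, and the zeros of the determinant.\<close>
    have "poly ([:0, 1:] * det ?K * f) t = 0" for t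
    proof (cases "t = 0 \<or> poly (det ?K) t = 0")
      case False
      then have "?ev t a \<in> chain_orbit n B"
        unfolding eva by (intro chain_orbit_adj line) (simp_all add: poly_hom.hom_det_mat)
      then have "poly f t = 0" using f fa F by (simp add: vanishing_fun_def)
      then show ?thesis by simp
    qed auto
    then have "[:0, 1:] * det ?K * f = 0" using poly_all_0_iff_0 by blast
    moreover have "det ?K \<noteq> 0" using p by auto
    ultimately have "f = 0" by simp
    have "poly r 0 = dird (mat_coords n) F (($$) (?ev 0 ?K * y * adj_mat (?ev 0 ?K)))
        (($$) (?ev 0 ?K * ?T * adj_mat (?ev 0 ?K)))"
    proof -
      have "?ev 0 a = ?ev 0 ?K * y * adj_mat (?ev 0 ?K)"
      proof -
        have "y + 0 \<cdot>\<^sub>m z = y" using yz by (intro eq_matI) auto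
        then show ?thesis using eva[of 0] by simp
      qed
      note eva0 = this
      have "poly r 0 = dird (mat_coords n) F (\<lambda>i. poly (a $$ i) 0) (($$) (?ev 0 b))"
        unfolding r0 by (rule dird_cong) (simp add: ev_index[OF bc])
      also have "\<dots> = dird (mat_coords n) F (($$) (?ev 0 a)) (($$) (?ev 0 b))"
      proof (rule dird_eqI[OF finite_mat_coords Fp])
        have "F (\<lambda>i. poly (a $$ i) 0 + s * (?ev 0 b) $$ i) = F (\<lambda>i. (?ev 0 a) $$ i + s * (?ev 0 b) $$ i)" for s
          by (rule polyfun_cong[OF Fp]) (simp add: ev_index[OF ac])
        then show "((\<lambda>s. F (\<lambda>i. poly (a $$ i) 0 + s * (?ev 0 b) $$ i)) has_field_derivative
            dird (mat_coords n) F (($$) (?ev 0 a)) (($$) (?ev 0 b))) (at 0)"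
          using has_field_derivative_dird[OF finite_mat_coords Fp] by simp
      qed
      finally show ?thesis unfolding eva0 evb .
    qed
    also have "\<dots> = 0"
    proof (rule tangent_transport[OF tangent_comb_tangent[OF Ts] yz(1) _ _ _ chain_orbit_carrier F])
      have Kc: "?ev 0 ?K \<in> carrier_mat n n" by simp
      then show "?ev 0 ?K \<in> carrier_mat n n" "adj_mat (?ev 0 ?K) \<in> carrier_mat n n"
        using adj_mat(1) by blast+
      have "det (?ev 0 ?K) \<noteq> 0" using p by (simp add: poly_hom.hom_det_mat)
      then show "?ev 0 ?K * X * adj_mat (?ev 0 ?K) \<in> chain_orbit n B" if "X \<in> chain_orbit n B" for X
        using chain_orbit_adj[OF that Kc] by blast
    qed
    finally have "[:0, 1:] dvd r" by (simp add: dvd_iff_poly_eq_0[of 0, simplified])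
    have "poly q t = poly (monom 1 m * r) t" for t
    proof -
      have "F (\<lambda>i. poly (jet_coord m x i) t) = F (\<lambda>i. poly (a $$ i) t + t ^ m * poly (b $$ i + [:0, 1:] * g i) t)"
        by (rule polyfun_cong[OF Fp]) (simp add: g poly_monom)
      then show ?thesis using q r f \<open>f = 0\<close> by (simp add: poly_monom)
    qed
    then have "q = monom 1 m * r" by (intro poly_ext) simp
    moreover have "monom 1 (Suc m) = monom 1 m * [:0, 1 :: complex:]" by (simp add: monom_Suc)
    ultimately show ?thesis using \<open>[:0, 1:] dvd r\<close> by (simp only: mult_dvd_mono dvd_refl)
  qed
  moreover have "x \<in> ?J \<rightarrow>\<^sub>E UNIV" by (simp add: x_def)
  ultimately have jets: "x \<in> jet_points id (mat_coords n)
      (vanishing_ideal (mat_coords n) (mat_point n ` orbit_closure n (chain_orbit n B))) m"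
    unfolding jet_points_iff[OF chain_orbit_carrier] by blast
  let ?y' = "?ev 0 ?K * y * adj_mat (?ev 0 ?K)"
  have "jet_proj (mat_coords n) x = mat_point n ?y'"
  proof -
    have "x (ij, 0) = ?y' $$ ij" if ij: "ij \<in> mat_coords n" for ij
    proof -
      have "x (ij, 0) = poly (a $$ ij + monom 1 m * (b $$ ij + [:0, 1:] * g ij)) 0"
        using g[OF ij] coeff_jet_coord[of m x ij 0] by (metis bot_nat_0.extremum poly_0_coeff_0)
      also have "\<dots> = poly (a $$ ij) 0" using m by (simp add: poly_monom)
      also have "\<dots> = ?ev 0 a $$ ij" using ev_index[OF ac ij] by simp
      also have "y + 0 \<cdot>\<^sub>m z = y" using yz by (intro eq_matI) auto
      then have "?ev 0 a = ?y'" using eva[of 0] by simp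
      finally show ?thesis .
    qed
    then show ?thesis by (auto simp: jet_proj_def mat_point_def)
  qed
  moreover have "?y' \<in> Ob'" using p by (intro Ob') (simp_all add: poly_hom.hom_det_mat)
  ultimately show ?thesis using jets unfolding x_def[symmetric] jet_preimage_def by blast
qed


section \<open>Linear forms on jets\<close>

definition mat_pair :: "nat \<Rightarrow> (nat \<times> nat \<Rightarrow> complex) \<Rightarrow> complex mat \<Rightarrow> complex" where
  "mat_pair n L Y = (\<Sum>ij\<in>mat_coords n. L ij * Y $$ ij)"

definition jet_pair :: "nat \<Rightarrow> nat \<Rightarrow> ((nat \<times> nat) \<times> nat \<Rightarrow> complex) \<Rightarrow> complex poly mat \<Rightarrow> complex" where
  "jet_pair n m l P = (\<Sum>j\<in>mat_coords n \<times> {..m}. l j * coeff (P $$ fst j) (snd j))"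

lemma jet_pair_add:
  assumes "P \<in> carrier_mat n n" "Q \<in> carrier_mat n n"
  shows "jet_pair n m l (P + Q) = jet_pair n m l P + jet_pair n m l Q"
  unfolding jet_pair_def sum.distrib[symmetric]
  by (rule sum.cong) (use assms in \<open>auto simp: mat_coords_def distrib_left\<close>)

lemma jet_pair_smult:
  assumes "P \<in> carrier_mat n n"
  shows "jet_pair n m l (f \<cdot>\<^sub>m P) = (\<Sum>e\<le>m. coeff f e * jet_pair n m l (monom 1 e \<cdot>\<^sub>m P))"
proof -
  have "l j * coeff ((f \<cdot>\<^sub>m P) $$ fst j) (snd j) =
      (\<Sum>e\<le>m. coeff f e * (l j * coeff ((monom 1 e \<cdot>\<^sub>m P) $$ fst j) (snd j)))"
    if j: "j \<in> mat_coords n \<times> {..m}" for j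
  proof -
    obtain i i' d where j': "j = ((i, i'), d)" "i < n" "i' < n" "d \<le> m"
      using j by (auto simp: mat_coords_def)
    have c: "coeff (monom 1 e * P $$ (i, i')) d = (if e \<le> d then coeff (P $$ (i, i')) (d - e) else 0)" for e
      by (simp add: coeff_monom_mult)
    have "coeff (f * P $$ (i, i')) d = (\<Sum>e\<le>d. coeff f e * coeff (monom 1 e * P $$ (i, i')) d)"
      unfolding coeff_mult[of f] by (rule sum.cong) (simp_all add: c)
    also have "\<dots> = (\<Sum>e\<le>m. coeff f e * coeff (monom 1 e * P $$ (i, i')) d)"
      by (rule sum.mono_neutral_left) (use j' in \<open>auto simp: c\<close>)
    finally show ?thesis
      using j' assms by (simp add: sum_distrib_left mult_ac)
  qed
  then have "jet_pair n m l (f \<cdot>\<^sub>m P) = (\<Sum>j\<in>mat_coords n \<times> {..m}.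
      \<Sum>e\<le>m. coeff f e * (l j * coeff ((monom 1 e \<cdot>\<^sub>m P) $$ fst j) (snd j)))"
    unfolding jet_pair_def by (rule sum.cong[OF refl])
  also have "\<dots> = (\<Sum>e\<le>m. coeff f e * jet_pair n m l (monom 1 e \<cdot>\<^sub>m P))"
    unfolding jet_pair_def sum_distrib_left by (rule sum.swap)
  finally show ?thesis .
qed

lemma jet_pair_monom_mat:
  assumes "Y \<in> carrier_mat n n"
  shows "jet_pair n m l (monom_mat d Y) = (if d \<le> m then mat_pair n (\<lambda>ij. l (ij, d)) Y else 0)"
proof -
  have "jet_pair n m l (monom_mat d Y) =
      (\<Sum>ij\<in>mat_coords n. \<Sum>k\<le>m. if k = d then l (ij, d) * Y $$ ij else 0)"
    unfolding jet_pair_def sum.cartesian_product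
    by (rule sum.cong) (use assms in \<open>auto simp: monom_mat_def mat_coords_def\<close>)
  also have "\<dots> = (if d \<le> m then mat_pair n (\<lambda>ij. l (ij, d)) Y else 0)"
    by (simp add: mat_pair_def)
  finally show ?thesis .
qed

lemma line_mat_monom_mat:
  assumes "y \<in> carrier_mat n n" "z \<in> carrier_mat n n"
  shows "line_mat n y z = monom_mat 0 y + monom_mat 1 z"
  by (rule eq_matI) (use assms in \<open>auto simp: line_mat_def monom_mat_def monom_0 monom_Suc\<close>)

lemma monom_mat_mult:
  assumes "Y \<in> carrier_mat n n" "Z \<in> carrier_mat n n"
  shows "monom_mat d Y * monom_mat e Z = monom_mat (d + e) (Y * Z)"
proof (rule eq_matI)
  fix i j assume "i < dim_row (monom_mat (d + e) (Y * Z))" "j < dim_col (monom_mat (d + e) (Y * Z))"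
  then have ij: "i < n" "j < n" using assms by (auto simp: monom_mat_def)
  have c: "monom_mat d Y \<in> carrier_mat n n" "monom_mat e Z \<in> carrier_mat n n" using assms by simp_all
  have "(monom_mat d Y * monom_mat e Z) $$ (i, j) =
      (\<Sum>k<n. monom_mat d Y $$ (i, k) * monom_mat e Z $$ (k, j))"
    by (rule mult_mat_index[OF c ij])
  also have "\<dots> = (\<Sum>k<n. monom (Y $$ (i, k) * Z $$ (k, j)) (d + e))"
    by (rule sum.cong) (use assms ij in \<open>auto simp: monom_mat_def mult_monom\<close>)
  also have "\<dots> = monom ((Y * Z) $$ (i, j)) (d + e)"
    unfolding mult_mat_index[OF assms ij] by (rule poly_eqI) (simp add: coeff_sum)
  also have "\<dots> = monom_mat (d + e) (Y * Z) $$ (i, j)"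
    using assms ij by (simp add: monom_mat_def del: index_mult_mat(1))
  finally show "(monom_mat d Y * monom_mat e Z) $$ (i, j) = monom_mat (d + e) (Y * Z) $$ (i, j)" .
qed (use assms in \<open>auto simp: monom_mat_def\<close>)

text \<open>A direction t^k G meets \<open>y\<close> in degree \<open>k\<close> and t z in degree k
  + 1; this couples consecutive levels of a functional. What exceeds degree \<open>m\<close> is cut
  off.\<close>

lemma jet_pair_commutator:
  assumes G: "G \<in> carrier_mat n n" and yz: "y \<in> carrier_mat n n" "z \<in> carrier_mat n n"
  defines "X \<equiv> line_mat n y z"
  shows "jet_pair n m l (monom_mat k G * X - X * monom_mat k G) =
    (if k \<le> m then mat_pair n (\<lambda>ij. l (ij, k)) (G * y - y * G) else 0) +
    (if k + 1 \<le> m then mat_pair n (\<lambda>ij. l (ij, k + 1)) (G * z - z * G) else 0)"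
proof -
  have c: "monom_mat d Y \<in> carrier_mat n n" if "Y \<in> carrier_mat n n" for d Y using that by simp
  have GX: "monom_mat k G * X = monom_mat k (G * y) + monom_mat (k + 1) (G * z)"
    unfolding X_def line_mat_monom_mat[OF yz] mult_add_distrib_mat[OF c[OF G] c[OF yz(1)] c[OF yz(2)]]
      monom_mat_mult[OF G yz(1)] monom_mat_mult[OF G yz(2)] by simp
  have XG: "X * monom_mat k G = monom_mat k (y * G) + monom_mat (k + 1) (z * G)"
    unfolding X_def line_mat_monom_mat[OF yz] add_mult_distrib_mat[OF c[OF yz(1)] c[OF yz(2)] c[OF G]]
      monom_mat_mult[OF yz(1) G] monom_mat_mult[OF yz(2) G] by (simp add: add.commute)
  have Gc: "G * y \<in> carrier_mat n n" "y * G \<in> carrier_mat n n" "G * z \<in> carrier_mat n n" "z * G \<in> carrier_mat n n"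
    using G yz by simp_all
  have bc: "G * y - y * G \<in> carrier_mat n n" "G * z - z * G \<in> carrier_mat n n"
    using Gc by (auto intro: minus_carrier_mat)
  have "monom_mat k G * X - X * monom_mat k G =
      monom_mat k (G * y - y * G) + monom_mat (k + 1) (G * z - z * G)"
    unfolding GX XG using carrier_matD[OF Gc(1)] carrier_matD[OF Gc(2)] carrier_matD[OF Gc(3)] carrier_matD[OF Gc(4)]
    by (intro eq_matI) (simp_all add: monom_mat_def diff_monom[symmetric] del: index_mult_mat(1))
  then show ?thesis
    by (simp only: jet_pair_add[OF c[OF bc(1)] c[OF bc(2)]] jet_pair_monom_mat[OF bc(1)] jet_pair_monom_mat[OF bc(2)])
qed


lemma has_poly_derivative_power:
  assumes "has_poly_derivative f f'" "f 0 = 1"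
  shows "has_poly_derivative (\<lambda>s. f s ^ k) (of_nat k * f')"
proof (induction k)
  case 0
  show ?case using has_poly_derivative_const[of 1] by simp
next
  case (Suc k)
  show ?case using has_poly_derivative_mult[OF assms(1) Suc] assms(2) by (simp add: algebra_simps)
qed

text \<open>At the identity, differentiating \<open>K * adj K = det K\<close> gives
  \<open>adj\<close> the derivative \<open>d' - G\<close>. The derivative \<open>d'\<close> of the
  determinant is left unspecified; its contribution is a multiple of \<open>X\<close>.\<close>

lemma cone_jet_derivative:
  fixes p v :: "(nat \<times> nat) \<times> nat \<Rightarrow> complex"
  assumes p1: "jet_mat n m p = 1\<^sub>m n" and p0: "\<And>k. p ((n, k), 0) = 0"
    and yz: "y \<in> carrier_mat n n" "z \<in> carrier_mat n n"
    and d': "has_poly_derivative (\<lambda>s. det (jet_mat n m (\<lambda>i. p i + s * v i))) d'"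
  defines "X \<equiv> line_mat n y z" and "G \<equiv> jet_mat n m v"
  shows "has_mat_derivative n (\<lambda>s. cone_jet n m y z Ts (\<lambda>i. p i + s * v i))
    (((G * X - X * G) + d' \<cdot>\<^sub>m X) + monom_mat m (tangent_comb n Ts v))"
proof -
  let ?K = "\<lambda>s. jet_mat n m (\<lambda>i. p i + s * v i)"
  let ?M = "\<lambda>s. line_mat n y z + monom_mat m (tangent_comb n Ts (\<lambda>i. p i + s * v i))"
  let ?T = "monom_mat m (tangent_comb n Ts v)"
  have Xc: "X \<in> carrier_mat n n" and Gc: "G \<in> carrier_mat n n" and Tc: "?T \<in> carrier_mat n n"
    by (simp_all add: X_def G_def)
  have dK: "has_mat_derivative n ?K G" unfolding G_def by (rule has_mat_derivative_jet_mat)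
  obtain A' e where A': "has_mat_derivative n (\<lambda>s. adj_mat (?K s)) A'"
    "has_poly_derivative (\<lambda>s. det (?K s)) e" "G * adj_mat (?K 0) + ?K 0 * A' = e \<cdot>\<^sub>m 1\<^sub>m n"
    by (rule has_mat_derivative_adj[OF dK])
  have "e = d'" by (rule has_poly_derivative_unique[OF A'(2) d'])
  have A'c: "A' \<in> carrier_mat n n" using A'(1) by (rule has_mat_derivativeD)
  have K0: "?K 0 = 1\<^sub>m n" using p1 by simp
  have adj1: "adj_mat (1\<^sub>m n :: complex poly mat) = 1\<^sub>m n"
    using adj_mat(1,2)[of "1\<^sub>m n :: complex poly mat" n] by (simp add: one_smult_mat)
  have A'eq: "A' = d' \<cdot>\<^sub>m 1\<^sub>m n - G"
  proof -
    have "G + A' = d' \<cdot>\<^sub>m 1\<^sub>m n"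
      using A'(3) Gc A'c unfolding K0 adj1 \<open>e = d'\<close> by simp
    then have "A' $$ (i, j) = (d' \<cdot>\<^sub>m 1\<^sub>m n) $$ (i, j) - G $$ (i, j)" if "i < n" "j < n" for i j
      using Gc A'c that by (metis add_diff_cancel_left' carrier_matD(1) carrier_matD(2) index_add_mat(1))
    then show ?thesis using Gc A'c by (intro eq_matI) auto
  qed
  have M0: "?M 0 = X"
    unfolding X_def by (rule eq_matI) (auto simp: monom_mat_def tangent_comb_def line_mat_def p0)
  have dM: "has_mat_derivative n ?M ?T"
    unfolding has_mat_derivative_def
  proof (intro conjI allI impI)
    fix i j assume ij: "i < n" "j < n"
    have "((\<lambda>s. coeff (?M s $$ (i, j)) d) has_field_derivative coeff (?T $$ (i, j)) d) (at 0)" for d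
      using ij by (cases "m = d")
        (auto simp: monom_mat_def tangent_comb_def line_mat_def p0 intro!: derivative_eq_intros)
    then show "has_poly_derivative (\<lambda>s. ?M s $$ (i, j)) (?T $$ (i, j))"
      by (simp add: has_poly_derivative_def)
  qed simp_all
  have "has_mat_derivative n (\<lambda>s. ?K s * ?M s * adj_mat (?K s))
      ((G * ?M 0 + ?K 0 * ?T) * adj_mat (?K 0) + (?K 0 * ?M 0) * A')"
    by (rule has_mat_derivative_mult[OF has_mat_derivative_mult[OF dK dM] A'(1)])
  also have "(G * ?M 0 + ?K 0 * ?T) * adj_mat (?K 0) + (?K 0 * ?M 0) * A' =
      ((G * X - X * G) + d' \<cdot>\<^sub>m X) + ?T"
  proof -
    have XA: "X * A' = d' \<cdot>\<^sub>m X - X * G"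
      unfolding A'eq using Xc Gc smult_mult_right_mat[OF Xc one_carrier_mat, of d']
      by (simp add: mult_minus_distrib_mat[of _ n n _ n])
    have GX: "G * X \<in> carrier_mat n n" "X * G \<in> carrier_mat n n" using Xc Gc by simp_all
    have "(G * ?M 0 + ?K 0 * ?T) * adj_mat (?K 0) + (?K 0 * ?M 0) * A' = (G * X + ?T) + (d' \<cdot>\<^sub>m X - X * G)"
      unfolding M0 K0 adj1 left_mult_one_mat[OF Tc] left_mult_one_mat[OF Xc] XA
      using right_mult_one_mat[OF add_carrier_mat[OF Tc, of "G * X"]] by simp
    also have "\<dots> = ((G * X - X * G) + d' \<cdot>\<^sub>m X) + ?T"
      using carrier_matD[OF GX(1)] carrier_matD[OF GX(2)] carrier_matD[OF Xc] carrier_matD[OF Tc]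
      by (intro eq_matI) (simp_all add: algebra_simps del: index_mult_mat(1))
    finally show ?thesis .
  qed
  finally show ?thesis unfolding cone_jet_def .
qed

lemma cone_jet_polyfun:
  assumes "mat_coords n \<times> {..m} \<subseteq> I" "\<And>k. k < length Ts \<Longrightarrow> ((n, k), 0) \<in> I"
    and yz: "y \<in> carrier_mat n n" "z \<in> carrier_mat n n"
  shows "mat_fun (polyfun_poly I) n (cone_jet n m y z Ts)"
proof -
  note R = fun_subring_polyfun_poly[of I]
  note K = mat_fun_jet_mat[OF assms(1)]
  have "mat_fun (polyfun_poly I) n (\<lambda>p. monom_mat m (tangent_comb n Ts p))"
  proof (rule mat_funI[OF R])
    fix i j assume ij: "i < n" "j < n"
    have "(\<lambda>p. coeff (monom (\<Sum>k<length Ts. p ((n, k), 0) * (Ts ! k) $$ (i, j)) m) d) \<in> polyfun I" for d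
      by (cases "m = d") (auto intro!: polyfun.const polyfun_sum polyfun.mult polyfun.coord assms)
    then show "(\<lambda>p. monom_mat m (tangent_comb n Ts p) $$ (i, j)) \<in> polyfun_poly I"
      using ij by (simp add: polyfun_poly_def monom_mat_def tangent_comb_def)
  qed simp
  then have "mat_fun (polyfun_poly I) n (\<lambda>p. line_mat n y z + monom_mat m (tangent_comb n Ts p))"
    by (intro mat_fun_add[OF R] mat_fun_poly_const) simp_all
  then show ?thesis
    unfolding cone_jet_def[abs_def] by (intro mat_fun_mult[OF R] K mat_fun_adj[OF R K])
qed

text \<open>Scalar directions show that the functional kills the multiples of \<open>y + t z\<close>; these arise from
  the factor \<open>adj g\<close>, as \<open>g \<mapsto> g X adj g\<close> has differential \<open>\<gamma> \<mapsto> \<gamma> X - X \<gamma> + tr(\<gamma>) X\<close> at 1.\<close>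

theorem jet_preimage_dim_ge:
  fixes y z :: "complex mat" and n m :: nat
  assumes n: "n \<ge> 1" and yz: "y \<in> carrier_mat n n" "z \<in> carrier_mat n n"
    and line: "\<And>t. t \<noteq> 0 \<Longrightarrow> y + t \<cdot>\<^sub>m z \<in> chain_orbit n B"
    and Ts: "set Ts \<subseteq> tangent n (chain_orbit n B) y"
    and Ob': "\<And>P. P \<in> carrier_mat n n \<Longrightarrow> det P \<noteq> 0 \<Longrightarrow> P * y * adj_mat P \<in> Ob'"
    and m: "m \<ge> 1" and W: "W \<subseteq> mat_coords n \<times> {..m}"
    and span: "\<And>L k ij. (\<And>k ij. m < k \<Longrightarrow> L k ij = 0) \<Longrightarrow> (\<And>k ij. (ij, k) \<in> W \<Longrightarrow> L k ij = 0) \<Longrightarrow>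
      (\<And>k G. G \<in> carrier_mat n n \<Longrightarrow>
        mat_pair n (L k) (G * y - y * G) + mat_pair n (L (k + 1)) (G * z - z * G) = 0) \<Longrightarrow>
      (\<And>Y. Y \<in> set Ts \<Longrightarrow> mat_pair n (L m) Y = 0) \<Longrightarrow> k \<le> m \<Longrightarrow> ij \<in> mat_coords n \<Longrightarrow> L k ij = 0"
  shows "ereal (real (n * n * (m + 1) - card W)) \<le> jet_preimage_dim n m (chain_orbit n B) Ob'"
proof -
  let ?J = "mat_coords n \<times> {..m}" and ?I = "mat_coords n \<times> {..m} \<union> ({n} \<times> {..<length Ts}) \<times> {0}"
  define \<phi> where "\<phi> j p = coeff (cone_jet n m y z Ts p $$ fst j) (snd j)" for j p
  let ?h = "\<lambda>p. poly (det (jet_mat n m p)) 0"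
  have \<phi>poly: "\<phi> j \<in> polyfun ?I" if "j \<in> ?J" for j
  proof -
    obtain a b d where j: "j = ((a, b), d)" by (metis surj_pair)
    then have "a < n" "b < n" using that by (auto simp: mat_coords_def)
    moreover have "mat_fun (polyfun_poly ?I) n (cone_jet n m y z Ts)" by (rule cone_jet_polyfun) (use yz in auto)
    ultimately have "(\<lambda>p. cone_jet n m y z Ts p $$ (a, b)) \<in> polyfun_poly ?I" by (simp add: mat_fun_def)
    then have "(\<lambda>p. \<phi> j p) \<in> polyfun ?I" by (simp add: polyfun_poly_def \<phi>_def j)
    then show ?thesis by simp
  qed
  define e :: "(nat \<times> nat) \<times> nat \<Rightarrow> complex"
    where "e = (\<lambda>((i, j), d). if i = j \<and> d = 0 \<and> i < n then 1 else 0)"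
  have e1: "jet_mat n m e = 1\<^sub>m n"
  proof (rule eq_matI)
    fix i j assume "i < dim_row (1\<^sub>m n :: complex poly mat)" "j < dim_col (1\<^sub>m n :: complex poly mat)"
    then have ij: "i < n" "j < n" by auto
    have "jet_coord m e (i, j) = (if i = j then 1 else 0)"
      by (rule poly_eqI) (use ij in \<open>auto simp: coeff_jet_coord e_def\<close>)
    then show "jet_mat n m e $$ (i, j) = (1\<^sub>m n :: complex poly mat) $$ (i, j)"
      using ij by (simp add: jet_mat_def)
  qed simp_all
  have e0: "e ((n, k), 0) = 0" for k by (simp add: e_def)
  have hpoly: "?h \<in> polyfun ?I"
  proof -
    have "mat_fun (polyfun_poly ?I) n (jet_mat n m)" by (rule mat_fun_jet_mat) auto
    from fun_subring_det[OF fun_subring_polyfun_poly this]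
    show ?thesis by (simp add: polyfun_poly_def poly_0_coeff_0)
  qed
  let ?X = "line_mat n y z"
  have "ereal (real (card ?J - card W)) \<le>
      krull_dim (subtopology (zariski ?J) (jet_preimage n m (chain_orbit n B) Ob'))"
  proof (rule krull_dim_ge_of_parametrization[where I = ?I and \<phi> = \<phi> and h = ?h and p = e])
    show "finite ?I" "finite ?J" by (simp_all add: finite_mat_coords)
    show "\<phi> j \<in> polyfun ?I" if "j \<in> ?J" for j using that by (rule \<phi>poly)
    show "jet_preimage n m (chain_orbit n B) Ob' \<subseteq> ?J \<rightarrow>\<^sub>E UNIV"
      by (auto simp: jet_preimage_def jet_points_def affine_points_def)
    show "(\<lambda>j\<in>?J. \<phi> j x) \<in> jet_preimage n m (chain_orbit n B) Ob'" if "?h x \<noteq> 0" for x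
      unfolding \<phi>_def by (rule cone_jet_mem_jet_preimage[OF yz line Ts Ob' m that])
    fix l assume lW: "\<And>j. j \<in> W \<Longrightarrow> l j = 0"
      and l0: "\<And>v. (\<Sum>j\<in>?J. l j * dird ?I (\<phi> j) e v) = 0"
    have pair0: "jet_pair n m l ((G * ?X - ?X * G) + d' \<cdot>\<^sub>m ?X) + mat_pair n (\<lambda>ij. l (ij, m)) (tangent_comb n Ts v) = 0"
      if d': "has_poly_derivative (\<lambda>s. det (jet_mat n m (\<lambda>i. e i + s * v i))) d'" and G: "G = jet_mat n m v"
      for v d' G
    proof -
      let ?D = "((G * ?X - ?X * G) + d' \<cdot>\<^sub>m ?X) + monom_mat m (tangent_comb n Ts v)"
      have Gc: "G \<in> carrier_mat n n" by (simp add: G)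
      have C: "G * ?X - ?X * G \<in> carrier_mat n n"
        by (intro minus_carrier_mat mult_carrier_mat[OF line_mat_carrier Gc])
      have D: "has_mat_derivative n (\<lambda>s. cone_jet n m y z Ts (\<lambda>i. e i + s * v i)) ?D"
        unfolding G by (rule cone_jet_derivative[OF e1 e0 yz d'])
      have "dird ?I (\<phi> j) e v = coeff (?D $$ fst j) (snd j)" if j: "j \<in> ?J" for j
      proof (rule dird_eqI)
        show "\<phi> j \<in> polyfun ?I" using j by (rule \<phi>poly)
        obtain a b d where j': "j = ((a, b), d)" "a < n" "b < n"
          using j by (auto simp: mat_coords_def)
        show "((\<lambda>s. \<phi> j (\<lambda>i. e i + s * v i)) has_field_derivative coeff (?D $$ fst j) (snd j)) (at 0)"
          using has_mat_derivativeD(3)[OF D j'(2,3)] by (simp add: \<phi>_def has_poly_derivative_def j'(1))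
      qed (simp add: finite_mat_coords)
      then have "jet_pair n m l ?D = (\<Sum>j\<in>?J. l j * dird ?I (\<phi> j) e v)"
        unfolding jet_pair_def by (intro sum.cong) auto
      then have "jet_pair n m l ?D = 0" using l0 by simp
      moreover have "(G * ?X - ?X * G) + d' \<cdot>\<^sub>m ?X \<in> carrier_mat n n"
        by (intro add_carrier_mat smult_carrier_mat line_mat_carrier)
      ultimately show ?thesis
        using jet_pair_add[of "(G * ?X - ?X * G) + d' \<cdot>\<^sub>m ?X" n "monom_mat m (tangent_comb n Ts v)" m l]
          jet_pair_monom_mat[OF tangent_comb_carrier, of n m l m Ts v] by simp
    qed
    define dir :: "nat \<Rightarrow> complex mat \<Rightarrow> (nat \<times> nat) \<times> nat \<Rightarrow> complex"
      where "dir k G = (\<lambda>((i, j), d). if i < n \<and> j < n \<and> d = k then G $$ (i, j) else 0)" for k G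
    have dir: "jet_mat n m (dir k G) = monom_mat k G" if "k \<le> m" "G \<in> carrier_mat n n" for k G
    proof (rule eq_matI)
      fix i j assume "i < dim_row (monom_mat k G)" "j < dim_col (monom_mat k G)"
      then have ij: "i < n" "j < n" using that by (auto simp: monom_mat_def)
      have "jet_coord m (dir k G) (i, j) = monom (G $$ (i, j)) k"
        by (rule poly_eqI) (use ij that in \<open>auto simp: coeff_jet_coord dir_def\<close>)
      then show "jet_mat n m (dir k G) $$ (i, j) = monom_mat k G $$ (i, j)"
        using ij that by (simp add: jet_mat_def monom_mat_def)
    qed (use that in \<open>auto simp: monom_mat_def\<close>)
    have dir_comb: "mat_pair n L (tangent_comb n Ts (dir k G)) = 0" for L k G
      unfolding mat_pair_def
      by (rule sum.neutral) (auto simp: tangent_comb_def dir_def mat_coords_def)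
    \<comment> \<open>In the direction t^k times the identity the commutator vanishes and the
      determinant is (1 + s t^k)^n, so \<open>n\<close> times the pairing with t^k X is 0. By
      \<open>jet_pair_smult\<close> all polynomial multiples of \<open>X\<close> are then
      killed.\<close>
    have scalar: "jet_pair n m l (monom 1 k \<cdot>\<^sub>m ?X) = 0" if k: "k \<le> m" for k
    proof -
      let ?v = "dir k (1\<^sub>m n)"
      have m1: "monom_mat k (1\<^sub>m n) = monom 1 k \<cdot>\<^sub>m 1\<^sub>m n"
        by (rule eq_matI) (auto simp: monom_mat_def)
      have J: "jet_mat n m (\<lambda>i. e i + s * ?v i) = (1 + Polynomial.smult s (monom 1 k)) \<cdot>\<^sub>m 1\<^sub>m n" for s
      proof (rule eq_matI)
        fix i j assume "i < dim_row ((1 + Polynomial.smult s (monom 1 k)) \<cdot>\<^sub>m 1\<^sub>m n)"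
          "j < dim_col ((1 + Polynomial.smult s (monom 1 k)) \<cdot>\<^sub>m 1\<^sub>m n)"
        then have ij: "i < n" "j < n" by auto
        have "jet_coord m (\<lambda>i. e i + s * ?v i) (i, j) = jet_coord m e (i, j) + Polynomial.smult s (jet_coord m ?v (i, j))"
          by (rule poly_eqI) (simp add: coeff_jet_coord)
        moreover have "jet_coord m e (i, j) = (1\<^sub>m n) $$ (i, j)"
          using arg_cong[OF e1, of "\<lambda>M. M $$ (i, j)"] ij by (simp add: jet_mat_def)
        moreover have "jet_coord m ?v (i, j) = monom_mat k (1\<^sub>m n) $$ (i, j)"
          using arg_cong[OF dir[OF k, of "1\<^sub>m n"], of "\<lambda>M. M $$ (i, j)"] ij by (simp add: jet_mat_def)
        ultimately show "jet_mat n m (\<lambda>i. e i + s * ?v i) $$ (i, j) =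
            ((1 + Polynomial.smult s (monom 1 k)) \<cdot>\<^sub>m 1\<^sub>m n) $$ (i, j)"
          using ij by (simp add: jet_mat_def monom_mat_def)
      qed simp_all
      have "has_poly_derivative (\<lambda>s. 1 + Polynomial.smult s (monom 1 k)) (monom 1 k)"
        unfolding has_poly_derivative_def by (auto intro!: derivative_eq_intros)
      from has_poly_derivative_power[OF this, of n]
      have "has_poly_derivative (\<lambda>s. det (jet_mat n m (\<lambda>i. e i + s * ?v i))) (of_nat n * monom 1 k)"
        unfolding J by simp
      from pair0[OF this refl]
      have "jet_pair n m l ((monom_mat k (1\<^sub>m n) * ?X - ?X * monom_mat k (1\<^sub>m n)) + (of_nat n * monom 1 k) \<cdot>\<^sub>m ?X) = 0"
        unfolding dir[OF k one_carrier_mat] dir_comb by simp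
      also have "monom_mat k (1\<^sub>m n) * ?X - ?X * monom_mat k (1\<^sub>m n) = 0\<^sub>m n n"
        unfolding m1 smult_mult_left_mat[OF one_carrier_mat line_mat_carrier]
          smult_mult_right_mat[OF line_mat_carrier one_carrier_mat]
        by (simp add: left_mult_one_mat[OF line_mat_carrier] right_mult_one_mat[OF line_mat_carrier])
      finally have "jet_pair n m l ((of_nat n * monom 1 k) \<cdot>\<^sub>m ?X) = 0" by simp
      also have "jet_pair n m l ((of_nat n * monom 1 k) \<cdot>\<^sub>m ?X) =
          (\<Sum>d\<le>m. if d = k then of_nat n * jet_pair n m l (monom 1 k \<cdot>\<^sub>m ?X) else 0)"
        unfolding jet_pair_smult[OF line_mat_carrier, of _ _ _ "of_nat n * monom 1 k"]
        by (rule sum.cong) (auto simp: of_nat_poly)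
      also have "\<dots> = of_nat n * jet_pair n m l (monom 1 k \<cdot>\<^sub>m ?X)" using k by simp
      finally show ?thesis using n by simp
    qed
    \<comment> \<open>Extended by 0 above \<open>m\<close>, so that the relation at level
      \<open>m\<close> keeps only its commutator with \<open>y\<close>.\<close>
    define L where "L k ij = (if k \<le> m then l (ij, k) else 0)" for k ij
    have "L k ij = 0" if kij: "k \<le> m" "ij \<in> mat_coords n" for k ij
    proof (rule span[OF _ _ _ _ kij])
      show "L k ij = 0" if "m < k" for k ij using that by (simp add: L_def)
      show "L k ij = 0" if "(ij, k) \<in> W" for k ij using lW[OF that] by (simp add: L_def)
      have pairL: "mat_pair n (L k) Y = (if k \<le> m then mat_pair n (\<lambda>ij. l (ij, k)) Y else 0)" for k Y
        by (simp add: mat_pair_def L_def)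
      show "mat_pair n (L k) (G * y - y * G) + mat_pair n (L (k + 1)) (G * z - z * G) = 0"
        if G: "G \<in> carrier_mat n n" for k G
      proof (cases "k \<le> m")
        case True
        have "has_mat_derivative n (\<lambda>s. jet_mat n m (\<lambda>i. e i + s * dir k G i)) (jet_mat n m (dir k G))"
          by (rule has_mat_derivative_jet_mat)
        then obtain d' where d': "has_poly_derivative (\<lambda>s. det (jet_mat n m (\<lambda>i. e i + s * dir k G i))) d'"
          using has_mat_derivative_adj_ex(2) by blast
        have c: "monom_mat k G * ?X - ?X * monom_mat k G \<in> carrier_mat n n" "d' \<cdot>\<^sub>m ?X \<in> carrier_mat n n"
          using G by (auto intro!: minus_carrier_mat mult_carrier_mat[OF line_mat_carrier])
        have "jet_pair n m l (d' \<cdot>\<^sub>m ?X) = 0"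
          unfolding jet_pair_smult[OF line_mat_carrier, of _ _ _ d'] using scalar by simp
        then have "jet_pair n m l (monom_mat k G * ?X - ?X * monom_mat k G) = 0"
          using pair0[OF d' refl] unfolding dir[OF True G] dir_comb jet_pair_add[OF c] by simp
        then show ?thesis unfolding jet_pair_commutator[OF G yz] pairL .
      qed (simp add: pairL)
      show "mat_pair n (L m) Y = 0" if "Y \<in> set Ts" for Y
      proof -
        obtain b where b: "b < length Ts" "Y = Ts ! b" using \<open>Y \<in> set Ts\<close> by (auto simp: in_set_conv_nth)
        define v :: "(nat \<times> nat) \<times> nat \<Rightarrow> complex" where "v = (\<lambda>j. if j = ((n, b), 0) then 1 else 0)"
        have v0: "v (ij, d) = 0" if "ij \<in> mat_coords n" for ij d
          using that by (auto simp: v_def mat_coords_def)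
        have "jet_mat n m v = 0\<^sub>m n n"
          by (rule eq_matI) (auto simp: jet_mat_def jet_coord_def v0 mat_coords_def)
        moreover have "jet_mat n m (\<lambda>i. e i + s * v i) = jet_mat n m e" for s
          by (rule eq_matI) (auto simp: jet_mat_def jet_coord_def v0 mat_coords_def)
        then have "has_poly_derivative (\<lambda>s. det (jet_mat n m (\<lambda>i. e i + s * v i))) 0"
          by (simp add: has_poly_derivative_const)
        note pair0[OF this refl]
        moreover have "jet_pair n m l ((0\<^sub>m n n * ?X - ?X * 0\<^sub>m n n) + 0 \<cdot>\<^sub>m ?X) = 0"
          using left_mult_zero_mat[OF line_mat_carrier[of n y z], of n] right_mult_zero_mat[OF line_mat_carrier[of n y z], of n]
          unfolding jet_pair_def by (intro sum.neutral) (auto simp: mat_coords_def line_mat_def)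
        ultimately have "mat_pair n (\<lambda>ij. l (ij, m)) (tangent_comb n Ts v) = 0" by simp
        moreover have "tangent_comb n Ts v $$ ij = Y $$ ij" if "ij \<in> mat_coords n" for ij
        proof -
          have "tangent_comb n Ts v $$ ij = (\<Sum>k<length Ts. v ((n, k), 0) * (Ts ! k) $$ ij)"
            using that by (auto simp: tangent_comb_def mat_coords_def)
          also have "\<dots> = (\<Sum>k<length Ts. if k = b then Y $$ ij else 0)"
            by (rule sum.cong) (auto simp: v_def b)
          finally show ?thesis using b by simp
        qed
        ultimately show ?thesis unfolding pairL by (simp add: mat_pair_def cong: sum.cong)
      qed
    qed
    then show "\<forall>j\<in>?J. l j = 0" by (auto simp: L_def)
  qed (use e1 hpoly W in auto)
  moreover have "card ?J = n * n * (m + 1)"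
    by (simp add: card_cartesian_product mat_coords_def)
  ultimately show ?thesis by (simp add: jet_preimage_dim_def)
qed

section \<open>Matrix units and reindexing\<close>

lemma mat_pair_unit_mat:
  assumes "r < n" "c < n"
  shows "mat_pair n L (unit_mat n r c) = L (r, c)"
proof -
  have "mat_pair n L (unit_mat n r c) = (\<Sum>ij\<in>mat_coords n. if ij = (r, c) then L (r, c) else 0)"
    unfolding mat_pair_def by (rule sum.cong) (auto simp: unit_mat_def mat_coords_def split: if_splits)
  then show ?thesis using assms finite_mat_coords by (simp add: mat_coords_def)
qed

lemma mat_pair_diff:
  assumes "Y \<in> carrier_mat n n" "Z \<in> carrier_mat n n"
  shows "mat_pair n L (Y - Z) = mat_pair n L Y - mat_pair n L Z"
  unfolding mat_pair_def sum_subtractf[symmetric]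
  by (rule sum.cong) (use assms in \<open>auto simp: mat_coords_def right_diff_distrib\<close>)

lemma unit_mat_mult_unit_mat:
  assumes "r < n" "c < n" "r' < n" "c' < n"
  shows "unit_mat n r c * unit_mat n r' c' = (if c = r' then unit_mat n r c' else (0\<^sub>m n n :: 'a::comm_ring_1 mat))"
proof (rule eq_matI)
  fix i j assume "i < dim_row (if c = r' then unit_mat n r c' else (0\<^sub>m n n :: 'a mat))"
    "j < dim_col (if c = r' then unit_mat n r c' else (0\<^sub>m n n :: 'a mat))"
  then have ij: "i < n" "j < n" by (auto split: if_splits)
  show "(unit_mat n r c * unit_mat n r' c') $$ (i, j) =
      (if c = r' then unit_mat n r c' else (0\<^sub>m n n :: 'a mat)) $$ (i, j)"
    unfolding mult_unit_mat_index(1)[OF unit_mat_carrier ij assms(3,4)]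
    using ij assms by (auto simp: unit_mat_def)
qed auto

lemma unit_mat_chain_mat:
  assumes "B \<subseteq> {1..<n}" "r < n" "c < n"
  shows "unit_mat n r c * chain_mat n B = (if c + 1 \<in> B then unit_mat n r (c + 1) else (0\<^sub>m n n :: 'a::comm_ring_1 mat))"
    and "chain_mat n B * unit_mat n r c = (if r \<in> B then unit_mat n (r - 1) c else (0\<^sub>m n n :: 'a mat))"
proof (rule eq_matI)
  fix i j assume "i < dim_row (if c + 1 \<in> B then unit_mat n r (c + 1) else (0\<^sub>m n n :: 'a mat))"
    "j < dim_col (if c + 1 \<in> B then unit_mat n r (c + 1) else (0\<^sub>m n n :: 'a mat))"
  then have ij: "i < n" "j < n" by (auto split: if_splits)
  show "(unit_mat n r c * chain_mat n B) $$ (i, j) =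
      (if c + 1 \<in> B then unit_mat n r (c + 1) else (0\<^sub>m n n :: 'a mat)) $$ (i, j)"
    unfolding chain_mat_mult_right[OF assms(1) unit_mat_carrier ij]
    using ij assms by (auto simp: unit_mat_def)
next
  show "chain_mat n B * unit_mat n r c = (if r \<in> B then unit_mat n (r - 1) c else (0\<^sub>m n n :: 'a mat))"
  proof (rule eq_matI)
    fix i j assume "i < dim_row (if r \<in> B then unit_mat n (r - 1) c else (0\<^sub>m n n :: 'a mat))"
      "j < dim_col (if r \<in> B then unit_mat n (r - 1) c else (0\<^sub>m n n :: 'a mat))"
    then have ij: "i < n" "j < n" by (auto split: if_splits)
    have B0: "0 \<notin> B" "i + 1 \<in> B \<Longrightarrow> i + 1 < n" using assms(1) by auto
    show "(chain_mat n B * unit_mat n r c) $$ (i, j) =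
        (if r \<in> B then unit_mat n (r - 1) c else (0\<^sub>m n n :: 'a mat)) $$ (i, j)"
      unfolding chain_mat_mult_left[OF assms(1) unit_mat_carrier ij]
      using ij assms B0 by (cases r) (auto simp: unit_mat_def)
  qed auto
qed auto

lemma similar_mat_reindex:
  fixes A :: "'a::comm_ring_1 mat"
  assumes A: "A \<in> carrier_mat n n" and \<tau>: "\<And>i. i < n \<Longrightarrow> \<tau> i < n" "inj_on \<tau> {..<n}"
  shows "similar_mat (mat n n (\<lambda>(i, j). A $$ (\<tau> i, \<tau> j))) A"
proof -
  define P :: "'a mat" where "P = mat n n (\<lambda>(i, j). if j = \<tau> i then 1 else 0)"
  define Q :: "'a mat" where "Q = mat n n (\<lambda>(i, j). if i = \<tau> j then 1 else 0)"
  have PQ: "P \<in> carrier_mat n n" "Q \<in> carrier_mat n n" by (simp_all add: P_def Q_def)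
  have surj: "\<exists>k<n. \<tau> k = i" if "i < n" for i
  proof -
    have "\<tau> ` {..<n} = {..<n}" using \<tau> by (intro card_subset_eq) (auto simp: card_image)
    then show ?thesis using that by (metis imageE lessThan_iff)
  qed
  have PX: "(P * X) $$ (i, j) = X $$ (\<tau> i, j)" if "X \<in> carrier_mat n n" "i < n" "j < n" for X i j
  proof -
    have "(P * X) $$ (i, j) = (\<Sum>k<n. if k = \<tau> i then X $$ (k, j) else 0)"
      unfolding mult_mat_index[OF PQ(1) that] by (rule sum.cong) (use that in \<open>auto simp: P_def\<close>)
    then show ?thesis using \<tau>(1)[OF that(2)] by simp
  qed
  have XQ: "(X * Q) $$ (i, j) = X $$ (i, \<tau> j)" if "X \<in> carrier_mat n n" "i < n" "j < n" for X i j
  proof -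
    have "(X * Q) $$ (i, j) = (\<Sum>k<n. if k = \<tau> j then X $$ (i, k) else 0)"
      unfolding mult_mat_index[OF that(1) PQ(2) that(2,3)] by (rule sum.cong) (use that in \<open>auto simp: Q_def\<close>)
    then show ?thesis using \<tau>(1)[OF that(3)] by simp
  qed
  have QP: "Q * P = 1\<^sub>m n"
  proof (rule eq_matI)
    fix i j assume "i < dim_row (1\<^sub>m n :: 'a mat)" "j < dim_col (1\<^sub>m n :: 'a mat)"
    then have ij: "i < n" "j < n" by auto
    have "(Q * P) $$ (i, j) = (\<Sum>k<n. if \<tau> k = i \<and> \<tau> k = j then 1 else 0)"
      unfolding mult_mat_index[OF PQ(2,1) ij] by (rule sum.cong) (use ij in \<open>auto simp: P_def Q_def\<close>)
    also have "\<dots> = (if i = j then 1 else 0)"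
    proof (cases "i = j")
      case True
      obtain k0 where k0: "k0 < n" "\<tau> k0 = i" using surj[OF ij(1)] by blast
      have "(\<Sum>k<n. if \<tau> k = i \<and> \<tau> k = j then 1 else 0) = (\<Sum>k<n. if k = k0 then 1 else (0 :: 'a))"
        by (rule sum.cong) (use True k0 \<tau>(2) in \<open>auto simp: inj_on_def\<close>)
      then show ?thesis using True k0 by simp
    qed (auto intro: sum.neutral)
    finally show "(Q * P) $$ (i, j) = 1\<^sub>m n $$ (i, j)" using ij by simp
  qed (use PQ in auto)
  show ?thesis
  proof (rule similar_matI)
    show "P * Q = 1\<^sub>m n"
    proof (rule eq_matI)
      fix i j assume "i < dim_row (1\<^sub>m n :: 'a mat)" "j < dim_col (1\<^sub>m n :: 'a mat)"
      then have ij: "i < n" "j < n" by auto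
      then show "(P * Q) $$ (i, j) = 1\<^sub>m n $$ (i, j)"
        unfolding PX[OF PQ(2) ij] using \<tau> by (auto simp: Q_def inj_on_def)
    qed (use PQ in auto)
    show "mat n n (\<lambda>(i, j). A $$ (\<tau> i, \<tau> j)) = P * A * Q"
    proof (rule eq_matI)
      fix i j assume "i < dim_row (P * A * Q)" "j < dim_col (P * A * Q)"
      then have ij: "i < n" "j < n" using PQ by auto
      show "mat n n (\<lambda>(i, j). A $$ (\<tau> i, \<tau> j)) $$ (i, j) = (P * A * Q) $$ (i, j)"
        unfolding XQ[OF mult_carrier_mat[OF PQ(1) A] ij] PX[OF A ij(1) \<tau>(1)[OF ij(2)]] using ij by simp
    qed (use PQ in auto)
  qed (use A PQ QP in auto)
qed

section \<open>Tangent vectors and functionals at the cut matrix\<close>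

context
  fixes n :: nat and B :: "nat set" and s :: nat
  assumes B: "B \<subseteq> {1..<n}" and s: "s < n" "s \<notin> B" "s + 1 \<in> B"
begin

private abbreviation "B' \<equiv> B - {s + 1}"
private abbreviation "top_s \<equiv> s + chain_len B s"
private abbreviation "chain_top c \<equiv> c + chain_len B c"
private abbreviation "short \<equiv> shorter n B s"
private abbreviation "tang \<equiv> tangent n (chain_orbit n B) (chain_mat n B')"

lemma removed_link_add:
  assumes "t \<noteq> 0"
  shows "chain_mat n B' + t \<cdot>\<^sub>m unit_mat n s (s + 1) \<in> chain_orbit n B"
proof -
  have "chain_mat n B' + t \<cdot>\<^sub>m unit_mat n s (s + 1) =
      weighted_chain n (\<lambda>j. if j = s + 1 then t else if j \<in> B then 1 else 0)"
    by (rule eq_matI) (auto simp: chain_mat_def unit_mat_def weighted_chain_def)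
  then show ?thesis using weighted_chain_similar[of n _ B] assms s by auto
qed

text \<open>The isolated index \<open>s\<close> is attached behind the last element of the rest of
  its chain. This restores a chain of the original length, and a rotation of its indices brings it
  into the original order.\<close>

lemma top_start_link_add:
  assumes "t \<noteq> 0"
  shows "chain_mat n B' + t \<cdot>\<^sub>m unit_mat n top_s s \<in> chain_orbit n B"
proof -
  let ?A = "chain_mat n B' + t \<cdot>\<^sub>m unit_mat n top_s s"
  \<comment> \<open>The new order of the chain: s + 1, ..., \<open>top_s\<close>, then
    \<open>s\<close>.\<close>
  define \<tau> where "\<tau> i = (if s \<le> i \<and> i < top_s then i + 1 else if i = top_s then s else i)" for i
  have zn: "top_s < n" by (rule top_s_less[OF B s])
  have h: "0 < chain_len B s" by (rule len_s_pos[OF B s])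
  have fin: "finite B" using B finite_subset by blast
  have zB: "top_s \<in> B" using chain_len_link[of "chain_len B s" B s] h by simp
  have zB1: "Suc top_s \<notin> B" using chain_len_end[OF fin, of s] by simp
  have mid: "j + 1 \<in> B'" if "s < j" "j < top_s" for j
    using chain_len_link[of "j + 1 - s" B s] that by auto
  have mid': "j \<in> B" if "s < j" "j \<le> top_s" for j
    using chain_len_link[of "j - s" B s] that by auto
  have "mat n n (\<lambda>(i, j). ?A $$ (\<tau> i, \<tau> j)) =
      weighted_chain n (\<lambda>j. if j = top_s then t else if j \<in> B then 1 else 0)"
  proof (rule eq_matI)
    fix i j assume "i < dim_row (weighted_chain n (\<lambda>j. if j = top_s then t else if j \<in> B then 1 else 0))"
      "j < dim_col (weighted_chain n (\<lambda>j. if j = top_s then t else if j \<in> B then 1 else 0))"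
    then have ij: "i < n" "j < n" by (auto simp: weighted_chain_def)
    have \<tau>n: "\<tau> k < n" if "k < n" for k using that zn by (auto simp: \<tau>_def)
    have A: "?A $$ (\<tau> i, \<tau> j) = (if \<tau> j = \<tau> i + 1 \<and> \<tau> j \<in> B' then 1 else 0) +
        (if \<tau> i = top_s \<and> \<tau> j = s then t else 0)"
      using \<tau>n ij by (simp add: chain_mat_def unit_mat_def)
    consider "j < s" | "j = s" | "s < j" "j < top_s" | "j = top_s" | "top_s < j" by linarith
    then have "?A $$ (\<tau> i, \<tau> j) = (if j = i + 1 then if j = top_s then t else if j \<in> B then 1 else 0 else 0)"
    proof cases
      case 1
      then show ?thesis unfolding A by (auto simp: \<tau>_def)
    next
      case 2
      then show ?thesis unfolding A using s h by (auto simp: \<tau>_def)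
    next
      case 3
      then show ?thesis unfolding A using mid[OF 3] mid'[of j] by (auto simp: \<tau>_def)
    next
      case 4
      then show ?thesis unfolding A using s h by (auto simp: \<tau>_def)
    next
      case 5
      moreover have "top_s + 1 < j" if "j \<in> B" using that 5 zB1 by (cases "j = top_s + 1") auto
      ultimately show ?thesis unfolding A using s by (auto simp: \<tau>_def)
    qed
    then show "mat n n (\<lambda>(i, j). ?A $$ (\<tau> i, \<tau> j)) $$ (i, j) =
        weighted_chain n (\<lambda>j. if j = top_s then t else if j \<in> B then 1 else 0) $$ (i, j)"
      using ij by (simp add: weighted_chain_def)
  qed (auto simp: weighted_chain_def)
  moreover have "similar_mat (weighted_chain n (\<lambda>j. if j = top_s then t else if j \<in> B then 1 else 0)) (chain_mat n B)"
    by (rule weighted_chain_similar) (use assms zB in auto)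
  moreover have "similar_mat (mat n n (\<lambda>(i, j). ?A $$ (\<tau> i, \<tau> j))) ?A"
    by (rule similar_mat_reindex) (use zn in \<open>auto simp: \<tau>_def inj_on_def split: if_splits\<close>)
  ultimately have "similar_mat ?A (mat n n (\<lambda>(i, j). ?A $$ (\<tau> i, \<tau> j)))"
    "similar_mat (mat n n (\<lambda>(i, j). ?A $$ (\<tau> i, \<tau> j))) (chain_mat n B)"
    by (simp_all only: similar_mat_sym)
  from similar_mat_trans[OF this] show ?thesis by simp
qed

lemma short_disjoint:
  assumes c: "c \<in> short" and "a \<le> chain_len B c" "x \<le> chain_len B s"
  shows "c + a \<noteq> s + x"
  using chain_start_unique[of c B s a x] shorter_start[OF B s c] s assms by auto

lemma tangent_bracket_chain_map:
  assumes Y: "Y \<in> tang"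
    and u: "\<And>a. 0 < a \<Longrightarrow> a \<le> h \<Longrightarrow> u + a \<in> B'" "u + h + 1 \<notin> B'"
    and v: "v \<notin> B'" "\<And>a. 0 < a \<Longrightarrow> a \<le> h \<Longrightarrow> v + a \<in> B'"
    and disj: "\<And>a. a \<le> h \<Longrightarrow> \<not> (u \<le> v + a \<and> v + a \<le> u + h)"
  shows "chain_map n u v h * Y - Y * chain_map n u v h \<in> tang"
  by (rule tangent_bracket[OF Y chain_mat_carrier chain_map_carrier chain_map_square_zero[OF disj]
      chain_map_commute[OF removed_link_subset[OF B s] u v]])

lemma minus_zero_mat: "A \<in> carrier_mat n n \<Longrightarrow> A - 0\<^sub>m n n = (A :: complex mat)"
  by (rule eq_matI) auto

lemma removed_link_tangent: "unit_mat n s (s + 1) \<in> tang"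
  by (rule tangent_of_line[OF chain_mat_carrier unit_mat_carrier removed_link_add])

lemma top_start_tangent: "unit_mat n top_s s \<in> tang"
  by (rule tangent_of_line[OF chain_mat_carrier unit_mat_carrier top_start_link_add])

text \<open>Two brackets starting from the removed link: first \<open>s\<close> is sent to
  \<open>c\<close>, which gives the unit at \<open>(c, s + 1)\<close>; then the whole chain of
  \<open>c\<close> is sent to the beginning of the remaining chain at \<open>s + 1\<close>. The
  latter requires that the chain of \<open>c\<close> is shorter.\<close>

lemma short_diag_tangent:
  assumes c: "c \<in> short"
  shows "unit_mat n (s + 1) (s + 1) - unit_mat n c c \<in> tang"
proof -
  note c' = shorter_start[OF B s c]
  have s1: "s + 1 < n" using s B by auto
  have h: "c + chain_len B c < n" using chain_len_less[OF B c'(1)] .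
  have fin: "finite B" using B finite_subset by blast
  let ?h = "chain_len B c"
  have "chain_map n s c 0 * unit_mat n s (s + 1) - unit_mat n s (s + 1) * chain_map n s c 0 \<in> tang"
    by (rule tangent_bracket_chain_map[OF removed_link_tangent]) (use c' in auto)
  also have "chain_map n s c 0 * unit_mat n s (s + 1) - unit_mat n s (s + 1) * chain_map n s c 0 =
      (unit_mat n c (s + 1) :: complex mat)"
    unfolding chain_map_unit[OF s(1) s1]
    using unit_chain_map[OF s(1) s1, of s 0 c, where 'a = complex] s(1) c' by (auto simp: minus_zero_mat)
  finally have E: "unit_mat n c (s + 1) \<in> tang" .
  have "chain_map n c (s + 1) ?h * unit_mat n c (s + 1) - unit_mat n c (s + 1) * chain_map n c (s + 1) ?h \<in> tang"
  proof (rule tangent_bracket_chain_map[OF E])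
    show "c + a \<in> B'" if "0 < a" "a \<le> ?h" for a
      using chain_len_link[OF that] short_disjoint[OF c that(2), of 1] len_s_pos[OF B s] by simp
    show "c + ?h + 1 \<notin> B'" using chain_len_end[OF fin, of c] by simp
    show "s + 1 \<notin> B'" by simp
    show "s + 1 + a \<in> B'" if "0 < a" "a \<le> ?h" for a
      using chain_len_link[of "Suc a" B s] that c'(3) by simp
    fix a assume a: "a \<le> ?h"
    show "\<not> (c \<le> s + 1 + a \<and> s + 1 + a \<le> c + ?h)"
    proof
      assume "c \<le> s + 1 + a \<and> s + 1 + a \<le> c + ?h"
      then have "c + (s + 1 + a - c) = s + (1 + a)" "s + 1 + a - c \<le> ?h" by linarith+
      then show False using short_disjoint[OF c, of "s + 1 + a - c" "1 + a"] a c'(3) by simp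
    qed
  qed
  also have "chain_map n c (s + 1) ?h * unit_mat n c (s + 1) - unit_mat n c (s + 1) * chain_map n c (s + 1) ?h =
      (unit_mat n (s + 1) (s + 1) - unit_mat n c c :: complex mat)"
    unfolding chain_map_unit[OF c'(1) s1] unit_chain_map[OF c'(1) s1 h] by simp
  finally show ?thesis .
qed

text \<open>Bracket of the unit at \<open>(top_s, s)\<close> with the map from the final segment of
  the long chain onto the chain of \<open>c\<close>, which takes \<open>top_s\<close> to the end of
  the latter.\<close>

lemma short_top_start_tangent:
  assumes c: "c \<in> short"
  shows "unit_mat n (chain_top c) s \<in> tang"
proof -
  note c' = shorter_start[OF B s c]
  have fin: "finite B" using B finite_subset by blast
  have zn: "top_s < n" by (rule top_s_less[OF B s])
  let ?h = "chain_len B c"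
  let ?u = "top_s - ?h"
  have u: "?u = s + (chain_len B s - ?h)" "?u + ?h = top_s" using c'(3) by linarith+
  have "chain_map n ?u c ?h * unit_mat n top_s s - unit_mat n top_s s * chain_map n ?u c ?h \<in> tang"
  proof (rule tangent_bracket_chain_map[OF top_start_tangent])
    show "?u + a \<in> B'" if "0 < a" "a \<le> ?h" for a
      using chain_len_link[of "chain_len B s - ?h + a" B s] that c'(3) u by (simp add: add.assoc)
    show "?u + ?h + 1 \<notin> B'" using chain_len_end[OF fin, of s] u by simp
    show "c \<notin> B'" using c' by simp
    show "c + a \<in> B'" if "0 < a" "a \<le> ?h" for a
      using chain_len_link[OF that] short_disjoint[OF c that(2), of 1] len_s_pos[OF B s] by simp
    fix a assume a: "a \<le> ?h"
    show "\<not> (?u \<le> c + a \<and> c + a \<le> ?u + ?h)"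
    proof
      assume "?u \<le> c + a \<and> c + a \<le> ?u + ?h"
      then have "c + a = s + (c + a - s)" "c + a - s \<le> chain_len B s" using u by linarith+
      then show False using short_disjoint[OF c a] by metis
    qed
  qed
  also have "chain_map n ?u c ?h * unit_mat n top_s s - unit_mat n top_s s * chain_map n ?u c ?h =
      (unit_mat n (chain_top c) s :: complex mat)"
  proof -
    have "chain_map n ?u c ?h * unit_mat n top_s s = (unit_mat n (chain_top c) s :: complex mat)"
      unfolding chain_map_unit[OF zn s(1)] using u by (simp add: add.commute)
    moreover have "\<not> (c \<le> s \<and> s \<le> c + ?h)"
    proof
      assume "c \<le> s \<and> s \<le> c + ?h"
      then have "c + (s - c) = s + 0" "s - c \<le> ?h" by linarith+
      then show False using short_disjoint[OF c] by blast
    qed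
    then have "unit_mat n top_s s * chain_map n ?u c ?h = (0\<^sub>m n n :: complex mat)"
      using unit_chain_map[OF zn s(1), of ?u ?h c, where 'a = complex] u(2) zn by (simp only: if_False)
    ultimately show ?thesis by (simp add: minus_zero_mat)
  qed
  finally show ?thesis .
qed

text \<open>The end of the chain of \<open>c\<close> is a quotient of dimension one and
  \<open>s\<close> is now an isolated chain, so the map between them commutes with the cut matrix.
  Its bracket with the unit at \<open>(top_s, s)\<close> is the wanted unit up to sign.\<close>

lemma top_short_top_tangent:
  assumes c: "c \<in> short"
  shows "unit_mat n top_s (chain_top c) \<in> tang"
proof -
  note c' = shorter_start[OF B s c]
  have fin: "finite B" using B finite_subset by blast
  have zn: "top_s < n" by (rule top_s_less[OF B s])
  have tn: "chain_top c < n" using chain_len_less[OF B c'(1)] .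
  have ts: "chain_top c \<noteq> s" by (rule top_shorter_neq_s[OF B s c])
  have tz: "chain_top c \<noteq> top_s" using short_disjoint[OF c, of "chain_len B c" "chain_len B s"] by simp
  let ?D = "chain_map n (chain_top c) s 0 * unit_mat n top_s s - unit_mat n top_s s * chain_map n (chain_top c) s 0 :: complex mat"
  have D: "?D \<in> tang"
    by (rule tangent_bracket_chain_map[OF top_start_tangent])
      (use s ts chain_len_end[OF fin, of c] in auto)
  have e: "chain_map n (chain_top c) s 0 * unit_mat n top_s s = (0\<^sub>m n n :: complex mat)"
    unfolding chain_map_unit[OF zn s(1)] using tz by auto
  have "unit_mat n top_s s * chain_map n (chain_top c) s 0 = (unit_mat n top_s (chain_top c) :: complex mat)"
    using unit_chain_map[OF zn s(1), of "chain_top c" 0 s, where 'a = complex] tn by simp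
  then have D': "?D = 0\<^sub>m n n - unit_mat n top_s (chain_top c)" unfolding e by simp
  have "(- 1) \<cdot>\<^sub>m ?D + 0 \<cdot>\<^sub>m ?D = unit_mat n top_s (chain_top c)"
    unfolding D' by (intro eq_matI) auto
  then show ?thesis using tangent_lincomb[OF D D, of "- 1" 0] by simp
qed


text \<open>The hypothesis is the coupling of two levels, tested on the matrix unit at
  \<open>(r, c)\<close>. Units whose commutator with the cut matrix vanishes leave a relation on
  level k + 1 alone, which gives the first three claims. The fourth one uses a sum of units, namely
  the map from the chain of \<open>c\<close> to the chain starting at \<open>s + 1\<close>.\<close>

lemma cone_functional_relations:
  fixes L :: "nat \<Rightarrow> nat \<Rightarrow> nat \<Rightarrow> complex"
  assumes rel: "\<And>r c. r < n \<Longrightarrow> c < n \<Longrightarrow> (if c + 1 \<in> B' then L k r (c + 1) else 0) - (if r \<in> B' then L k (r - 1) c else 0) +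
      ((if c = s then L (k + 1) r (s + 1) else 0) - (if r = s + 1 then L (k + 1) s c else 0)) = 0"
  shows "L (k + 1) s (s + 1) = 0" "L (k + 1) (s + 1) (s + 1) = L (k + 1) s s"
    and "c \<in> short \<Longrightarrow> L (k + 1) c (s + 1) = 0" "c \<in> short \<Longrightarrow> L (k + 1) s c = 0"
proof -
  have s1: "s + 1 < n" using s B by auto
  show "L (k + 1) s (s + 1) = 0" using rel[OF s(1) s(1)] s by simp
  show "L (k + 1) (s + 1) (s + 1) = L (k + 1) s s" using rel[OF s1 s(1)] by simp
  show "L (k + 1) c (s + 1) = 0" if "c \<in> short"
    using rel[OF _ s(1), of c] shorter_start[OF B s that] by simp
  show "L (k + 1) s c = 0" if c: "c \<in> short"
  proof -
    note c' = shorter_start[OF B s c]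
    have fin: "finite B" using B finite_subset by blast
    have link: "c + a \<in> B'" if "0 < a" "a \<le> chain_len B c" for a
      using chain_len_link[OF that] short_disjoint[OF c that(2), of 1] len_s_pos[OF B s] by simp
    \<comment> \<open>The relations at \<open>(s + 1 + a, c + a)\<close> form a telescope along the
      chain of \<open>c\<close>; at its end the left side is 0.\<close>
    have "(if c + a + 1 \<in> B' then L k (s + 1 + a) (c + a + 1) else 0) = L (k + 1) s c"
      if "a \<le> chain_len B c" for a
      using that
    proof (induction a)
      case 0
      show ?case using rel[OF s1 c'(1)] c' by (simp split: if_splits)
    next
      case (Suc a)
      have "c + Suc a \<in> B'" by (rule link) (use Suc.prems in auto)
      then have "L k (s + 1 + a) (c + Suc a) = L (k + 1) s c" using Suc by simp
      moreover have sa: "s + 1 + Suc a \<in> B"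
        using chain_len_link[of "a + 2" B s] Suc.prems c'(3) by simp
      moreover have "c + Suc a \<noteq> s" using short_disjoint[OF c Suc.prems, of 0] by simp
      moreover have "s + 1 + Suc a < n" "c + Suc a < n"
        using sa \<open>c + Suc a \<in> B'\<close> B by auto
      ultimately show ?case using rel[of "s + 1 + Suc a" "c + Suc a"] by simp
    qed
    from this[OF order_refl] show ?thesis using chain_len_end[OF fin, of c] by simp
  qed
qed

text \<open>Descending induction on the level. Once the level above is zero, a level kills all
  commutators with the cut matrix, so \<open>commutator_form_zero\<close> reduces to the positions
  in \<open>reps\<close>. These are killed by assumption at level 0; at positive levels the
  couplings take care of \<open>tangent_cone_reps\<close>, and at level \<open>m\<close> the tangent
  vectors take care of the rest of \<open>tangent_reps\<close>.\<close>

lemma cone_functional_zero: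
  fixes L :: "nat \<Rightarrow> nat \<Rightarrow> nat \<Rightarrow> complex"
  assumes c0: "c0 \<in> short" and m: "m \<ge> 1"
    and rel: "\<And>k r c. r < n \<Longrightarrow> c < n \<Longrightarrow> (if c + 1 \<in> B' then L k r (c + 1) else 0) - (if r \<in> B' then L k (r - 1) c else 0) +
      ((if c = s then L (k + 1) r (s + 1) else 0) - (if r = s + 1 then L (k + 1) s c else 0)) = 0"
    and high: "\<And>k r c. m < k \<Longrightarrow> L k r c = 0"
    and bottom: "\<And>r c. (r, c) \<in> reps n B' \<Longrightarrow> L 0 r c = 0"
    and middle: "\<And>k r c. 0 < k \<Longrightarrow> k < m \<Longrightarrow> (r, c) \<in> reps n B' - tangent_cone_reps n B s \<Longrightarrow> L k r c = 0"
    and top_level: "\<And>r c. (r, c) \<in> reps n B' - tangent_reps n B s c0 \<Longrightarrow> L m r c = 0"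
    and tangent_zs: "L m top_s s = 0" and tangent_diag: "L m (s + 1) (s + 1) = L m c0 c0"
    and tangent_ts: "\<And>c. c \<in> short \<Longrightarrow> L m (chain_top c) s = 0"
    and tangent_zt: "\<And>c. c \<in> short \<Longrightarrow> L m top_s (chain_top c) = 0"
    and "r < n" "c < n"
  shows "L k r c = 0"
proof (cases "k \<le> m")
  case True
  have fin: "finite B" using B finite_subset by blast
  have sB': "s \<notin> B'" using s by simp
  note defs = tangent_cone_reps_def[OF B s] tangent_reps_def[OF B s]
  \<comment> \<open>The coupling only equates the entries at \<open>(s + 1, s + 1)\<close> and
    \<open>(s, s)\<close>; the latter must therefore stay among the positions where vanishing is
    assumed, at level \<open>m\<close> too.\<close>
  have ss: "(s, s) \<in> reps n B' - tangent_reps n B s c0"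
  proof -
    have "chain_top c \<noteq> s" if "c \<in> short" for c using top_shorter_neq_s[OF B s that] .
    then show ?thesis
      using s len_s_pos[OF B s] shorter_start(4)[OF B s] c0 by (auto simp: reps_def defs)
  qed
  have cone: "L k r c = 0" if k: "0 < k" "k \<le> m" and rc: "(r, c) \<in> tangent_cone_reps n B s" for k r c
  proof -
    have "(s, s) \<in> reps n B' - tangent_cone_reps n B s" using ss by (auto simp: defs)
    then have "L k s s = 0" using middle[OF k(1), of s s] top_level[OF ss] k by (cases "k = m") auto
    then show ?thesis
      using cone_functional_relations[of L "k - 1", OF rel] k rc by (auto simp: defs)
  qed
  have "\<forall>r<n. \<forall>c<n. L k r c = 0" using True
  proof (induction k rule: inc_induct)
    case base
    have form: "(if r \<in> B' then L m (r - 1) c else 0) = (if c + 1 \<in> B' then L m r (c + 1) else 0)"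
      if "r < n" "c < n" for r c using rel[OF that, of m] high[of "m + 1"] by (simp split: if_splits)
    have "L m r c = 0" if rc: "(r, c) \<in> reps n B'" for r c
    proof (cases "(r, c) \<in> tangent_reps n B s c0")
      case True
      have bb: "L m (s + 1) (s + 1) = 0" by (rule cone) (use m in \<open>auto simp: defs\<close>)
      \<comment> \<open>The tangent vector tests the lower end of the diagonal string that starts at
        this position, and the form is constant along the string.\<close>
      have "L m (top_s - chain_len B c) c = 0" if c: "c \<in> short" for c
      proof -
        note c' = shorter_start[OF B s c]
        have "L m (top_s - chain_len B c + chain_len B c) (c + chain_len B c) = L m (top_s - chain_len B c) c"
          by (rule commutator_form_string[OF removed_link_subset[OF B s] form c'(1)])
            (use chain_len_top_minus[OF B s c] chain_len_other[OF B s c'(4)] in simp_all)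
        then show ?thesis using tangent_zt[OF c] c'(3) by simp
      qed
      then show ?thesis
        using True cone[of m r c] m tangent_zs tangent_diag tangent_ts bb
        unfolding tangent_reps_def[OF B s] by auto
    qed (use rc top_level in simp)
    then show ?case using commutator_form_zero[OF removed_link_subset[OF B s] form] by blast
  next
    case (step k)
    have s1: "s + 1 < n" using s B by auto
    have form: "(if r \<in> B' then L k (r - 1) c else 0) = (if c + 1 \<in> B' then L k r (c + 1) else 0)"
      if "r < n" "c < n" for r c using rel[OF that, of k] step.IH that s(1) s1 by (simp split: if_splits)
    have "L k r c = 0" if rc: "(r, c) \<in> reps n B'" for r c
      using bottom[of r c] middle[of k r c] cone[of k r c] rc step.hyps
      by (cases "k = 0") auto
    then show ?case using commutator_form_zero[OF removed_link_subset[OF B s] form] by blast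
  qed
  then show ?thesis using assms by blast
qed (use high in simp)

end

text \<open>The number of links is the rank. Concretely, fewer links in \<open>A\<close> than in
  \<open>B\<close> give a vector supported on \<open>B\<close> killed by the rows of
  \<open>Q\<close> in \<open>A\<close>; the intertwining relation shifts it to a nonzero vector
  killed by all rows of \<open>Q\<close>, although \<open>Q\<close> is invertible.\<close>

lemma chain_mat_not_similar:
  assumes B: "B \<subseteq> {1..<n}" and A: "A \<subset> B"
  shows "\<not> similar_mat (chain_mat n B) (chain_mat n A :: complex mat)"
proof
  assume "similar_mat (chain_mat n B) (chain_mat n A :: complex mat)"
  then obtain P Q where w: "similar_mat_wit (chain_mat n B) (chain_mat n A :: complex mat) P Q"
    by (auto simp: similar_mat_def)
  note w' = similar_mat_witD2[OF chain_mat_carrier w]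
  have PQ: "P \<in> carrier_mat n n" "Q \<in> carrier_mat n n" "P * Q = 1\<^sub>m n" "Q * P = 1\<^sub>m n"
    using w' by auto
  have "Q * chain_mat n B = Q * (P * (chain_mat n A * Q))"
    using w' PQ by (simp add: assoc_mult_mat[of _ n n _ n _ n])
  also have "\<dots> = chain_mat n A * Q"
    using assoc_mult_mat[OF PQ(2,1) mult_carrier_mat[OF chain_mat_carrier[of n A] PQ(2)]] PQ(4)
      left_mult_one_mat[OF mult_carrier_mat[OF chain_mat_carrier[of n A] PQ(2)]] by simp
  finally have QA: "Q * chain_mat n B = chain_mat n A * Q" .
  have fin: "finite B" using B finite_subset by blast
  have "card A < card B" by (rule psubset_card_mono[OF fin A])
  then obtain x where x: "\<exists>j\<in>B. x j \<noteq> 0" "\<forall>e\<in>A. (\<Sum>j\<in>B. Q $$ (e, j) * x j) = 0"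
    using homogeneous_system_nontrivial[OF finite_subset[OF psubset_imp_subset[OF A] fin] fin, of "\<lambda>e j. Q $$ (e, j)"]
    by blast
  obtain j0 where j0: "j0 \<in> B" "x j0 \<noteq> 0" using x by blast
  have jn: "j < n \<and> j - 1 < n \<and> 0 < j" if "j \<in> B" for j
  proof -
    have "1 \<le> j" "j < n" using that B by auto
    then show ?thesis by linarith
  qed
  have An: "A \<subseteq> {1..<n}" using A B by auto
  have row: "(\<Sum>j\<in>B. Q $$ (i, j - 1) * x j) = 0" if i: "i < n" for i
  proof -
    have "Q $$ (i, j - 1) = (if i + 1 \<in> A then Q $$ (i + 1, j) else 0)" if j: "j \<in> B" for j
      using arg_cong[OF QA, of "\<lambda>M. M $$ (i, j)"] j jn[OF j]
      unfolding chain_mat_mult_right[OF B PQ(2) i jn[OF j, THEN conjunct1]]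
        chain_mat_mult_left[OF An PQ(2) i jn[OF j, THEN conjunct1]] by simp
    then have "(\<Sum>j\<in>B. Q $$ (i, j - 1) * x j) = (\<Sum>j\<in>B. (if i + 1 \<in> A then Q $$ (i + 1, j) else 0) * x j)"
      by (intro sum.cong) auto
    also have "\<dots> = 0" using x(2) by (cases "i + 1 \<in> A") auto
    finally show ?thesis .
  qed
  have "x j0 = (\<Sum>j\<in>B. (if j = j0 then x j else 0))" using j0 fin by simp
  also have "\<dots> = (\<Sum>j\<in>B. (P * Q) $$ (j0 - 1, j - 1) * x j)"
  proof (rule sum.cong[OF refl])
    fix j assume "j \<in> B"
    then have "j - 1 < n" "j0 - 1 < n" "j - 1 = j0 - 1 \<longleftrightarrow> j = j0" using jn[of j] jn[OF j0(1)] by auto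
    then show "(if j = j0 then x j else 0) = (P * Q) $$ (j0 - 1, j - 1) * x j" unfolding PQ(3) by auto
  qed
  also have "\<dots> = (\<Sum>j\<in>B. \<Sum>i<n. P $$ (j0 - 1, i) * (Q $$ (i, j - 1) * x j))"
  proof (rule sum.cong[OF refl])
    fix j assume "j \<in> B"
    then show "(P * Q) $$ (j0 - 1, j - 1) * x j = (\<Sum>i<n. P $$ (j0 - 1, i) * (Q $$ (i, j - 1) * x j))"
      using mult_mat_index[OF PQ(1,2), of "j0 - 1" "j - 1"] jn j0(1)
      by (simp add: sum_distrib_right mult.assoc)
  qed
  also have "\<dots> = (\<Sum>i<n. \<Sum>j\<in>B. P $$ (j0 - 1, i) * (Q $$ (i, j - 1) * x j))"
    by (rule sum.swap)
  also have "\<dots> = 0" unfolding sum_distrib_left[symmetric] using row by simp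
  finally show False using j0 by simp
qed

text \<open>Restoring the cut link with weight \<open>t\<close>, conjugated to \<open>X\<close>,
  gives a line in the larger orbit that tends to \<open>X\<close> for \<open>t\<close> tending to 0.
  The orbits differ because a link is lost.\<close>

lemma smaller_orbit_subset_closure:
  assumes B: "B \<subseteq> {1..<n}" and s: "s < n" "s \<notin> B" "s + 1 \<in> B"
  shows "chain_orbit n (B - {s + 1}) \<subseteq> orbit_closure n (chain_orbit n B) - chain_orbit n B"
proof
  fix X assume X: "X \<in> chain_orbit n (B - {s + 1})"
  have Xc: "X \<in> carrier_mat n n" using X chain_orbit_carrier by blast
  obtain P Q where w: "similar_mat_wit X (chain_mat n (B - {s + 1})) P Q"
    using X by (auto simp: similar_mat_def)
  note w' = similar_mat_witD2[OF Xc w]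
  have PQ: "P \<in> carrier_mat n n" "Q \<in> carrier_mat n n" "P * Q = 1\<^sub>m n" using w' by auto
  let ?Y = "unit_mat n s (s + 1) :: complex mat"
  have PY: "P * ?Y \<in> carrier_mat n n" using PQ by simp
  have "X + t \<cdot>\<^sub>m (P * ?Y * Q) \<in> chain_orbit n B" if "t \<noteq> 0" for t
  proof -
    have "P * (chain_mat n (B - {s + 1}) + t \<cdot>\<^sub>m ?Y) * Q = X + t \<cdot>\<^sub>m (P * ?Y * Q)"
      using w' PQ smult_mult_right_mat[OF PQ(1) unit_mat_carrier, of t s "s + 1"]
        smult_mult_left_mat[OF PY PQ(2), of t]
        add_mult_distrib_mat[OF mult_carrier_mat[OF PQ(1) chain_mat_carrier] smult_carrier_mat[OF PY] PQ(2)]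
      by (simp add: mult_add_distrib_mat[OF PQ(1) chain_mat_carrier smult_carrier_mat[OF unit_mat_carrier]])
    then show ?thesis
      using chain_orbit_conjugate[OF removed_link_add[OF B s that] PQ] by simp
  qed
  then have "F (\<lambda>i. X $$ i + 0 * (P * ?Y * Q) $$ i) = 0" if "F \<in> vanishing_fun n (chain_orbit n B)" for F
    using vanishing_fun_line[OF Xc mult_carrier_mat[OF PY PQ(2)] _ that] by blast
  then have "X \<in> orbit_closure n (chain_orbit n B)"
    using Xc by (simp add: mem_orbit_closure)
  moreover have "X \<notin> chain_orbit n B"
  proof
    assume "X \<in> chain_orbit n B"
    then have "similar_mat (chain_mat n B) (chain_mat n (B - {s + 1}) :: complex mat)"
      using X similar_mat_trans similar_mat_sym by blast
    moreover have "B - {s + 1} \<subset> B" using s by auto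
    ultimately show False using chain_mat_not_similar[OF B] by blast
  qed
  ultimately show "X \<in> orbit_closure n (chain_orbit n B) - chain_orbit n B" by blast
qed

lemma mat_pair_zero: "mat_pair n L (0\<^sub>m n n) = 0"
  unfolding mat_pair_def by (rule sum.neutral) (auto simp: mat_coords_def)

text \<open>The cut creates at most 2 u + 2 additional classes in each level. Middle levels recover
  all of them, level 0 recovers none, and level \<open>m\<close> recovers twice as many, so the
  total balances.\<close>

lemma smaller_orbit_jet_preimage_dim_ge:
  assumes B: "B \<subseteq> {1..<n}" and s: "s < n" "s \<notin> B" "s + 1 \<in> B"
    and c0: "c0 \<in> shorter n B s" and m: "m \<ge> 1"
  shows "ereal (real ((n * n - card (reps n B)) * (m + 1))) \<le>
    jet_preimage_dim n m (chain_orbit n B) (chain_orbit n (B - {s + 1}))"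
proof -
  let ?B = "B - {s + 1}" and ?S = "shorter n B s" and ?z = "s + chain_len B s"
  let ?top = "\<lambda>c. c + chain_len B c" and ?y = "chain_mat n (B - {s + 1}) :: complex mat"
  let ?T = "tangent n (chain_orbit n B) ?y"
  let ?R = "reps n ?B" and ?Rc = "reps n ?B - tangent_cone_reps n B s" and ?Rt = "reps n ?B - tangent_reps n B s c0"
  have B': "?B \<subseteq> {1..<n}" using B by auto
  have s1: "s + 1 < n" and z: "?z < n" using s B top_s_less[OF B s] by auto
  note c0' = shorter_start[OF B s c0]
  have topn: "?top c < n" if "c \<in> ?S" for c
    using chain_len_less[OF B] shorter_start[OF B s that] by blast
  define Tset :: "complex mat set" where "Tset = insert (unit_mat n ?z s)
    (insert (unit_mat n (s + 1) (s + 1) - unit_mat n c0 c0)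
      ((\<lambda>c. unit_mat n (?top c) s) ` ?S \<union> (\<lambda>c. unit_mat n ?z (?top c)) ` ?S))"
  have "Tset \<subseteq> ?T"
    unfolding Tset_def using top_start_tangent[OF B s] short_diag_tangent[OF B s c0]
      short_top_start_tangent[OF B s] top_short_top_tangent[OF B s] by auto
  moreover have "finite Tset" using finite_shorter[OF B s] by (simp add: Tset_def)
  ultimately obtain Ts where Ts: "set Ts = Tset" "set Ts \<subseteq> ?T" using finite_list by blast
  \<comment> \<open>The coordinates on which a functional has to be assumed zero: every class at
    level 0, and at later levels those not reached by couplings or tangent vectors.\<close>
  define W where "W = ?R \<times> {0} \<union> ?Rc \<times> {1..<m} \<union> ?Rt \<times> {m}"
  have Rn: "?R \<subseteq> mat_coords n" by (auto simp: reps_def mat_coords_def)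
  have finR: "finite ?R" by (rule finite_reps)
  have "card W \<le> card (reps n B) * (m + 1)"
  proof -
    let ?u = "card ?S" and ?r = "card (reps n B)"
    have 1: "card ?R \<le> ?r + 2 * ?u + 2" by (rule card_reps_removed[OF B s])
    have 2: "card ?Rc = card ?R - (2 * ?u + 2)"
      using card_Diff_subset[OF finite_subset[OF tangent_cone_reps_subset[OF B s] finR] tangent_cone_reps_subset[OF B s]]
        card_tangent_cone_reps[OF B s] by simp
    have 3: "card ?Rt = card ?R - (4 * ?u + 4)"
      using card_Diff_subset[OF finite_subset[OF tangent_reps_subset[OF B s c0] finR] tangent_reps_subset[OF B s c0]]
        card_tangent_reps[OF B s c0] by simp
    \<comment> \<open>Guards against truncation in the subtraction of \<open>3\<close>, which has to
      be exact for the balance.\<close>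
    have 4: "4 * ?u + 4 \<le> card ?R"
      using card_mono[OF finR tangent_reps_subset[OF B s c0]] card_tangent_reps[OF B s c0] by simp
    have "card W \<le> card (?R \<times> {0 :: nat}) + card (?Rc \<times> {1..<m}) + card (?Rt \<times> {m})"
      unfolding W_def by (meson add_right_mono card_Un_le order_trans)
    also have "\<dots> = card ?R + card ?Rc * (m - 1) + card ?Rt"
      by (simp add: card_cartesian_product)
    also have "\<dots> \<le> card ?R + ?r * (m - 1) + card ?Rt"
    proof -
      have "card ?Rc \<le> ?r" using 1 2 by linarith
      then show ?thesis by simp
    qed
    also have "\<dots> \<le> ?r * (m - 1) + 2 * ?r" using 1 3 4 by linarith
    also have "\<dots> = ?r * (m + 1)" using m by (cases m) (simp_all add: algebra_simps)
    finally show ?thesis .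
  qed
  then have "real ((n * n - card (reps n B)) * (m + 1)) \<le> real (n * n * (m + 1) - card W)"
    by (simp only: diff_mult_distrib of_nat_le_iff diff_le_mono2)
  moreover have "ereal (real (n * n * (m + 1) - card W)) \<le>
      jet_preimage_dim n m (chain_orbit n B) (chain_orbit n ?B)"
  proof (rule jet_preimage_dim_ge[OF _ chain_mat_carrier unit_mat_carrier removed_link_add[OF B s] Ts(2) _ m])
    show "n \<ge> 1" using s by simp
    show "P * ?y * adj_mat P \<in> chain_orbit n ?B" if "P \<in> carrier_mat n n" "det P \<noteq> 0" for P
      by (rule chain_orbit_adj[OF _ that]) (simp add: similar_mat_refl[OF chain_mat_carrier])
    show "W \<subseteq> mat_coords n \<times> {..m}" using Rn m by (auto simp: W_def)
    fix L :: "nat \<Rightarrow> nat \<times> nat \<Rightarrow> complex" and k ij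
    assume high: "\<And>k ij. m < k \<Longrightarrow> L k ij = 0" and W: "\<And>k ij. (ij, k) \<in> W \<Longrightarrow> L k ij = 0"
      and comm: "\<And>k G. G \<in> carrier_mat n n \<Longrightarrow> mat_pair n (L k) (G * ?y - ?y * G) +
        mat_pair n (L (k + 1)) (G * unit_mat n s (s + 1) - unit_mat n s (s + 1) * G) = 0"
      and tang: "\<And>Y. Y \<in> set Ts \<Longrightarrow> mat_pair n (L m) Y = 0" and ij: "ij \<in> mat_coords n"
    obtain r c where rc: "ij = (r, c)" "r < n" "c < n" using ij by (auto simp: mat_coords_def)
    note TsD = tang[unfolded Ts(1) Tset_def]
    show "L k ij = 0"
      unfolding rc(1)
    proof (rule cone_functional_zero[where L = "\<lambda>k r c. L k (r, c)" and k = k, OF B s c0 m _ _ _ _ _ _ _ _ _ rc(2,3)])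
      fix k r c assume rc: "r < n" "c < n"
      let ?G = "unit_mat n r c :: complex mat"
      have G: "?G * ?y \<in> carrier_mat n n" "?y * ?G \<in> carrier_mat n n"
        "?G * unit_mat n s (s + 1) \<in> carrier_mat n n" "unit_mat n s (s + 1) * ?G \<in> carrier_mat n n"
        by (auto intro!: mult_carrier_mat[OF unit_mat_carrier] mult_carrier_mat[OF chain_mat_carrier])
      have "c + 1 < n" if "c + 1 \<in> ?B" using that B' by auto
      then have pairs:
        "mat_pair n M (if c + 1 \<in> ?B then unit_mat n r (c + 1) else 0\<^sub>m n n) = (if c + 1 \<in> ?B then M (r, c + 1) else 0)"
        "mat_pair n M (if r \<in> ?B then unit_mat n (r - 1) c else 0\<^sub>m n n) = (if r \<in> ?B then M (r - 1, c) else 0)"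
        "mat_pair n M (if c = s then unit_mat n r (s + 1) else 0\<^sub>m n n) = (if c = s then M (r, s + 1) else 0)"
        "mat_pair n M (if s + 1 = r then unit_mat n s c else 0\<^sub>m n n) = (if s + 1 = r then M (s, c) else 0)" for M
        using rc s(1) s1 by (simp_all add: mat_pair_unit_mat mat_pair_zero)
      show "(if c + 1 \<in> ?B then L k (r, c + 1) else 0) - (if r \<in> ?B then L k (r - 1, c) else 0) +
          ((if c = s then L (k + 1) (r, s + 1) else 0) - (if r = s + 1 then L (k + 1) (s, c) else 0)) = 0"
        using comm[OF unit_mat_carrier, of k r c, unfolded mat_pair_diff[OF G(1,2)] mat_pair_diff[OF G(3,4)]]
        unfolding unit_mat_chain_mat[OF B' rc] unit_mat_mult_unit_mat[OF rc s(1) s1]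
          unit_mat_mult_unit_mat[OF s(1) s1 rc]
          pairs
        by (simp only: eq_commute[of "s + 1" r])
    next
      show "L m (?z, s) = 0" using TsD[of "unit_mat n ?z s"] by (simp add: mat_pair_unit_mat[OF z s(1)])
      show "L m (s + 1, s + 1) = L m (c0, c0)"
        using TsD[of "unit_mat n (s + 1) (s + 1) - unit_mat n c0 c0"]
        by (simp add: mat_pair_diff mat_pair_unit_mat s1[simplified] c0'(1))
      show "L m (?top c, s) = 0" if "c \<in> ?S" for c
        using TsD[of "unit_mat n (?top c) s"] that by (simp add: mat_pair_unit_mat topn s(1))
      show "L m (?z, ?top c) = 0" if "c \<in> ?S" for c
        using TsD[of "unit_mat n ?z (?top c)"] that by (simp add: mat_pair_unit_mat topn z)
    qed (use high W in \<open>auto simp: W_def\<close>)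
  qed
  ultimately show ?thesis by (meson ereal_less_eq(3) order_trans)
qed

theorem theorem3:
  fixes n m :: nat and Ob :: "complex mat set" and p :: "nat multiset"
  assumes "n \<ge> 1"
    and "nilpotent_orbit n Ob"
    and "partition_of n p"
    and "orbit_partition Ob p"
    and "\<not> rectangular p"
    and "m \<ge> 1"
  shows "RC2 n m Ob"
proof -
  obtain A where A: "A \<in> sl_mat n" "Ob = {X. similar_mat X A}"
    using assms(2) by (auto simp: nilpotent_orbit_def)
  have "A \<in> Ob" using A similar_mat_refl[of A n] by (simp add: sl_mat_def)
  then obtain ks where ks: "mset ks = p" "jordan_nf A (map (\<lambda>k. (k, 0)) ks)"
    using assms(4) by (auto simp: orbit_partition_def)
  have ks0: "0 \<notin> set ks" and ksn: "sum_list ks = n"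
    using assms(3) ks(1) by (auto simp: partition_of_def sum_mset_sum_list)
  obtain B where B: "B \<subseteq> {1..<n}" and jordan: "jordan_matrix (map (\<lambda>k. (k, 0)) ks) = (chain_mat n B :: complex mat)"
    and starts: "\<forall>k\<in>set ks. \<exists>c<n. c \<notin> B \<and> chain_len B c = k - 1"
    using jordan_matrix_chain[OF ks0] ksn by auto
  have "similar_mat A (chain_mat n B)" using ks(2) jordan by (simp add: jordan_nf_def)
  then have Ob: "Ob = chain_orbit n B"
    using A(2) similar_mat_trans similar_mat_sym by blast
  obtain a b where ab: "a \<in> set ks" "b \<in> set ks" "a < b"
    using assms(5) ks(1) by (metis linorder_neqE_nat rectangular_def set_mset_mset)
  have "a > 0" using ab(1) ks0 gr0I by metis
  obtain s where s: "s < n" "s \<notin> B" "chain_len B s = b - 1" using starts ab by blast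
  obtain c0 where c0: "c0 < n" "c0 \<notin> B" "chain_len B c0 = a - 1" using starts ab by blast
  \<comment> \<open>Since 0 < a < b, the block at \<open>s\<close> has at least two elements, so
    there is a first link to cut.\<close>
  have s1: "s + 1 \<in> B" using chain_len_link[of 1 B s] s ab \<open>a > 0\<close> by simp
  have short: "c0 \<in> shorter n B s"
    using c0 s ab \<open>a > 0\<close> by (auto simp: shorter_def[OF B s(1,2) s1])
  let ?B = "B - {s + 1}"
  have B': "?B \<subseteq> {1..<n}" using B by auto
  have "nilpotent_orbit n (chain_orbit n ?B)"
    unfolding nilpotent_orbit_def using chain_mat_sl chain_mat_nilpotent[OF B'] by blast
  moreover have "jet_preimage_dim n m Ob Ob \<le> jet_preimage_dim n m Ob (chain_orbit n ?B)"
    unfolding Ob using jet_preimage_dim_le[OF B, of m] smaller_orbit_jet_preimage_dim_ge[OF B s(1,2) s1 short assms(6)]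
    by (rule order_trans)
  ultimately show ?thesis
    unfolding RC2_def Ob using smaller_orbit_subset_closure[OF B s(1,2) s1] by blast
qed

end
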